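(* Let $\mathcal U\subset\mathbb R^3$ be an exterior region, and let $v\in L^\infty(\mathbb R^3)$ (complex-valued) with $\operatorname{supp}v\subset\mathbb R^3\setminus\overline{\mathcal U}$. Let $\kappa>0$ be fixed, suppose that the unique solvability property (US) holds for $v$ and $\kappa$, and let $R_v^+(x,y,\kappa)$ be the outgoing Green function for the equation $-\Delta\psi+v\psi=\kappa^2\psi+\delta(x-y)$. Let $\mathcal B$ be an open bounded domain in $\mathbb R^3$ whose boundary $Y=\partial\mathcal B$ is real-analytic and connected, such that $\overline{\mathcal B}=\mathcal B\cup Y\subset\mathcal U$ and $\kappa$ is not a Dirichlet eigenvalue for $\mathcal B$. Let $\mathcal D$ be an arbitrary non-empty open domain of $Y$. Then $v$ is uniquely determined by $\operatorname{Im}R_v^+(\cdot,\cdot,\kappa)$ on $\mathcal D\times\mathcal D$. That is, if $v_1,v_2\in L^\infty(\mathbb R^3)$ (complex-valued) satisfy $\operatorname{supp}v_j\subset\mathbb R^3\setminus\overline{\mathcal U}$ and property (US) holds for $v_j$ and $\kappa$, for $j=1,2$ (with the same $\mathcal U,\kappa,\mathcal B,\mathcal D$), and $\operatorname{Im}R_{v_1}^+(\cdot,\cdot,\kappa)=\operatorname{Im}R_{v_2}^+(\cdot,\cdot,\kappa)$ on $\mathcal D\times\mathcal D$, then $v_1=v_2$ (almost everywhere).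
   Context: An exterior region $\mathcal U$ in $\mathbb R^3$ is an open unbounded connected set consisting of all points in the exterior of a closed bounded regular surface $S$; $\overline{\mathcal U}$ is its closure. Put $G^+(x,\kappa)=-\dfrac{e^{i\kappa|x|}}{4\pi|x|}$, $x\in\mathbb R^3$. Let $\Omega$ be an open bounded connected domain in $\mathbb R^3$ with $\operatorname{supp}v\subset\Omega$. The outgoing Green function $R_v^+(x,y,\kappa)$ is, for each fixed $y\in\mathbb R^3$, the solution $\psi=R_v^+(\cdot,y,\kappa)$ of $-\Delta\psi(x)+v(x)\psi(x)=\kappa^2\psi(x)+\delta(x-y)$, $x\in\mathbb R^3$ ($\delta$ the Dirac delta), satisfying the Sommerfeld radiation condition $|x|\left(\frac{\partial}{\partial|x|}-i\kappa\right)\psi(x)\to0$ as $|x|\to+\infty$, uniformly in $x/|x|$. It satisfies the integral equation $$R_v^+(x,y,\kappa)=-G^+(x-y,\kappa)+\int_\Omega G^+(x-z,\kappa)v(z)R_v^+(z,y,\kappa)\,dz,\qquad x,y\in\mathbb R^3.$$ Property (US) for $v,\kappa$: for the given $\kappa>0$ this integral equation is uniquely solvable for $R_v^+(\cdot,y,\kappa)\in L^2(\Omega)$. "$\kappa$ is not a Dirichlet eigenvalue for $\mathcal B$" means that the only solution of $-\Delta u=\kappa^2u$ in $\mathcal B$ with $u=0$ on $\partial\mathcal B$ is $u=0$ (i.e. $\kappa^2$ is not an eigenvalue of the Dirichlet Laplacian $-\Delta$ in $\mathcal B$). On the diagonal $x=y$ outside $\operatorname{supp}v$, $\operatorname{Im}R_v^+(x,y,\kappa)$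 is understood by continuous extension. "Open domain of $Y$" means open in the relative topology of $Y$. *)

theory Defs
  imports "HOL-Analysis.Analysis"
begin

section \<open>Regularity of functions and surfaces\<close>

text \<open>Intended for open \<open>S\<close> only: the derivatives are taken at interior points.\<close>

fun Ck_on :: "nat \<Rightarrow> 'a::euclidean_space set \<Rightarrow> ('a \<Rightarrow> 'b::real_normed_vector) \<Rightarrow> bool" where
  "Ck_on 0 S f \<longleftrightarrow> continuous_on S f"
| "Ck_on (Suc k) S f \<longleftrightarrow>
     f differentiable_on S \<and> (\<forall>h. Ck_on k S (\<lambda>x. frechet_derivative f (at x) h))"

definition laplacian :: "('a::euclidean_space \<Rightarrow> 'b::real_normed_vector) \<Rightarrow> 'a \<Rightarrow> 'b" where
  "laplacian f x =
     (\<Sum>b\<in>Basis. frechet_derivative (\<lambda>z. frechet_derivative f (at z) b) (at x) b)"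

text \<open>The index \<open>\<alpha>\<close> ranges over all multi-indices, and \<open>has_sum\<close> is unconditional
  convergence of the power series around \<open>p\<close>.\<close>

definition real_analytic_on ::
    "(real^'n) set \<Rightarrow> (real^'n \<Rightarrow> 'b::real_normed_vector) \<Rightarrow> bool" where
  "real_analytic_on S f \<longleftrightarrow>
     (\<forall>p\<in>S. \<exists>r>0. \<exists>c :: ('n \<Rightarrow> nat) \<Rightarrow> 'b. \<forall>x\<in>ball p r.
        ((\<lambda>\<alpha>. (\<Prod>i\<in>UNIV. (x $ i - p $ i) ^ \<alpha> i) *\<^sub>R c \<alpha>) has_sum f x) UNIV)"

text \<open>Embedded surface without boundary, given by local parametrizations \<open>X\<close> of regularity
  \<open>reg\<close> that are immersions and homeomorphisms onto relatively open pieces of \<open>S\<close>.\<close>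

definition embedded_surface ::
    "((real^2) set \<Rightarrow> (real^2 \<Rightarrow> real^3) \<Rightarrow> bool) \<Rightarrow> (real^3) set \<Rightarrow> bool" where
  "embedded_surface reg S \<longleftrightarrow>
     (\<forall>p\<in>S. \<exists>V W X Z. open V \<and> p \<in> V \<and> open W \<and> homeomorphism W (S \<inter> V) X Z \<and>
        reg W X \<and> (\<forall>u\<in>W. X differentiable (at u) \<and> inj (frechet_derivative X (at u))))"

abbreviation regular_surface :: "(real^3) set \<Rightarrow> bool" where
  "regular_surface \<equiv> embedded_surface (Ck_on 1)"

abbreviation real_analytic_surface :: "(real^3) set \<Rightarrow> bool" where
  "real_analytic_surface \<equiv> embedded_surface real_analytic_on"

text \<open>\<open>outside S\<close> is the union of the unbounded components of the complement of \<open>S\<close>. For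
  compact \<open>S\<close> in space it is open, unbounded and connected.\<close>

definition exterior_region :: "(real^3) set \<Rightarrow> bool" where
  "exterior_region U \<longleftrightarrow>
     (\<exists>S. S \<noteq> {} \<and> compact S \<and> regular_surface S \<and> U = outside S)"


section \<open>Potentials and function spaces\<close>

definition Linfty :: "(real^3 \<Rightarrow> complex) \<Rightarrow> bool" where
  "Linfty v \<longleftrightarrow> v \<in> borel_measurable lebesgue \<and> (\<exists>M. AE x in lebesgue. norm (v x) \<le> M)"

definition L2_on :: "(real^3) set \<Rightarrow> (real^3 \<Rightarrow> complex) \<Rightarrow> bool" where
  "L2_on \<Omega> f \<longleftrightarrow> f \<in> borel_measurable (lebesgue_on \<Omega>) \<and>
     integrable (lebesgue_on \<Omega>) (\<lambda>x. (norm (f x))\<^sup>2)"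

text \<open>Essential support: invariant under changing \<open>v\<close> on a null set.\<close>

definition ess_support :: "(real^3 \<Rightarrow> complex) \<Rightarrow> (real^3) set" where
  "ess_support v = - \<Union>{W. open W \<and> (AE x in lebesgue. x \<in> W \<longrightarrow> v x = 0)}"

definition test_function :: "(real^3 \<Rightarrow> complex) \<Rightarrow> bool" where
  "test_function \<phi> \<longleftrightarrow> (\<forall>k. Ck_on k UNIV \<phi>) \<and> compact (closure {x. \<phi> x \<noteq> 0})"


section \<open>Outgoing Green function\<close>

text \<open>The value at \<open>x = 0\<close> is the irrelevant one given by division by zero.\<close>

definition Gplus :: "real^3 \<Rightarrow> real \<Rightarrow> complex" where
  "Gplus x \<kappa> = - exp (\<i> * of_real \<kappa> * of_real (norm x)) / of_real (4 * pi * norm x)"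

text \<open>A limit along \<open>at_infinity\<close> is uniform in the direction \<open>sgn x = x /\<^sub>R norm x\<close>.\<close>

definition sommerfeld :: "real \<Rightarrow> (real^3 \<Rightarrow> complex) \<Rightarrow> bool" where
  "sommerfeld \<kappa> \<psi> \<longleftrightarrow>
     (\<forall>\<^sub>F x in at_infinity. (\<lambda>r. \<psi> (r *\<^sub>R sgn x)) differentiable (at (norm x))) \<and>
     ((\<lambda>x. of_real (norm x) *
        (vector_derivative (\<lambda>r. \<psi> (r *\<^sub>R sgn x)) (at (norm x)) - \<i> * of_real \<kappa> * \<psi> x))
      \<longlongrightarrow> 0) at_infinity"

text \<open>The equation \<open>- \<Delta>\<psi> + v \<psi> = \<kappa>\<^sup>2 \<psi> + \<delta>(\<cdot> - y)\<close> in the sense of distributions.\<close>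

definition distributional_green_solution ::
    "(real^3 \<Rightarrow> complex) \<Rightarrow> real \<Rightarrow> real^3 \<Rightarrow> (real^3 \<Rightarrow> complex) \<Rightarrow> bool" where
  "distributional_green_solution v \<kappa> y \<psi> \<longleftrightarrow>
     (\<forall>K. compact K \<longrightarrow> \<psi> absolutely_integrable_on K) \<and>
     (\<forall>\<phi>. test_function \<phi> \<longrightarrow>
        (LINT x|lebesgue. \<psi> x * (- laplacian \<phi> x + v x * \<phi> x - of_real (\<kappa>\<^sup>2) * \<phi> x)) = \<phi> y)"

text \<open>Continuity off the singularity selects the representative whose pointwise values are
  meant. The values \<open>R y y\<close> are left unconstrained.\<close>

definition outgoing_green_function ::
    "(real^3 \<Rightarrow> complex) \<Rightarrow> real \<Rightarrow> (real^3 \<Rightarrow> real^3 \<Rightarrow> complex) \<Rightarrow> bool" where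
  "outgoing_green_function v \<kappa> R \<longleftrightarrow>
     (\<forall>y. distributional_green_solution v \<kappa> y (\<lambda>x. R x y) \<and>
          continuous_on (- {y}) (\<lambda>x. R x y) \<and>
          sommerfeld \<kappa> (\<lambda>x. R x y))"

text \<open>The imaginary part of the Green function, continuously extended to the diagonal as a
  function of both points.\<close>

definition Im_green :: "(real^3 \<Rightarrow> real^3 \<Rightarrow> complex) \<Rightarrow> real^3 \<Rightarrow> real^3 \<Rightarrow> real" where
  "Im_green R x y =
     (if x \<noteq> y then Im (R x y)
      else Lim (at (x, y) within {(a, b). a \<noteq> b}) (\<lambda>(a, b). Im (R a b)))"


section \<open>Unique solvability and Dirichlet eigenvalues\<close>

definition green_integral_equation ::
    "(real^3) set \<Rightarrow> (real^3 \<Rightarrow> complex) \<Rightarrow> real \<Rightarrow> real^3 \<Rightarrow> (real^3 \<Rightarrow> complex) \<Rightarrow> bool" where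
  "green_integral_equation \<Omega> v \<kappa> y \<psi> \<longleftrightarrow>
     (AE x in lebesgue_on \<Omega>.
        \<psi> x = - Gplus (x - y) \<kappa> + (LINT z|lebesgue_on \<Omega>. Gplus (x - z) \<kappa> * v z * \<psi> z))"

definition unique_solvability :: "(real^3) set \<Rightarrow> (real^3 \<Rightarrow> complex) \<Rightarrow> real \<Rightarrow> bool" where
  "unique_solvability \<Omega> v \<kappa> \<longleftrightarrow>
     (\<forall>y. (\<exists>\<psi>. L2_on \<Omega> \<psi> \<and> green_integral_equation \<Omega> v \<kappa> y \<psi>) \<and>
          (\<forall>\<psi>1 \<psi>2. L2_on \<Omega> \<psi>1 \<and> green_integral_equation \<Omega> v \<kappa> y \<psi>1 \<and>
                    L2_on \<Omega> \<psi>2 \<and> green_integral_equation \<Omega> v \<kappa> y \<psi>2 \<longrightarrow>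
             (AE x in lebesgue_on \<Omega>. \<psi>1 x = \<psi>2 x)))"

text \<open>The spectral parameter of the Dirichlet Laplacian is \<open>\<kappa>\<^sup>2\<close>, not \<open>\<kappa>\<close>.\<close>

definition dirichlet_eigenvalue :: "real \<Rightarrow> (real^3) set \<Rightarrow> bool" where
  "dirichlet_eigenvalue \<kappa> B \<longleftrightarrow>
     (\<exists>u :: real^3 \<Rightarrow> complex. continuous_on (closure B) u \<and> Ck_on 2 B u \<and>
        (\<forall>x\<in>B. - laplacian u x = of_real (\<kappa>\<^sup>2) * u x) \<and>
        (\<forall>x\<in>frontier B. u x = 0) \<and> (\<exists>x\<in>B. u x \<noteq> 0))"

end

theory Submission
  imports Defs "HOL-Complex_Analysis.Complex_Analysis"
begin

text \<open>Off the diagonal the Green functions solve the Lippmann--Schwinger equation, because an entire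
  solution of the Helmholtz equation satisfying the radiation condition vanishes. So for \<open>y\<close> in \<open>D\<close> the
  difference \<open>W = R\<^sub>1(\<cdot>,y) - R\<^sub>2(\<cdot>,y)\<close> is a volume potential. Its imaginary part vanishes on \<open>D\<close>, by
  analyticity on the whole surface, hence inside (no Dirichlet eigenvalue), hence on \<open>U\<close>; and an
  outgoing field that is real near infinity vanishes there, so \<open>W = 0\<close> on \<open>U\<close>. With the Fredholm
  alternative this gives \<open>\<integral> (v\<^sub>1 - v\<^sub>2) u\<^sub>1 u\<^sub>2 = 0\<close> for all solutions \<open>u\<^sub>j\<close> near the supports, and complex
  geometrical optics solutions, obtained from Fourier series over a shifted lattice, show that all
  Fourier coefficients of \<open>v\<^sub>1 - v\<^sub>2\<close> vanish.\<close>

section \<open>Calculus of smooth functions\<close>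

text \<open>Everything is phrased with bounded Borel densities of bounded support and their
  potentials \<open>pot \<kappa> f\<close>, so that neither Sobolev spaces nor a calculus of
  distributions is involved. A function counts as a solution of the Schroedinger equation if its
  pairings with all potentials that vanish outside a fixed ball are the right ones
  (\<open>adjoint_solution\<close>); the orthogonality relation tests with exactly these, and a
  Neumann series produces such solutions directly. Conjugating the Helmholtz operator with exp (i
  \<zeta> . x), where \<zeta> . \<zeta> = \<kappa>^2, and inverting it gives a Fourier multiplier
  with denominators \<alpha> . \<alpha> + 2 \<zeta> . \<alpha>. On an unshifted lattice the
  frequency \<alpha> = 0 is a zero of this symbol. The half-integer shift makes the imaginary part 2
  w . \<alpha>, with w = Im \<zeta>, an odd multiple of a fixed number, as large as desired; and in
  dimension three the squared reciprocals of the denominators are summable, so all iterates are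
  bounded functions given by absolutely convergent series.\<close>

lemmas bint_cong = Bochner_Integration.integral_cong
  and bint_add = Bochner_Integration.integral_add
  and bint_diff = Bochner_Integration.integral_diff
  and bintegrable_bound = Bochner_Integration.integrable_bound
  and bintegrable_diff = Bochner_Integration.integrable_diff

abbreviation (input) pd :: "('a::euclidean_space => 'b::real_normed_vector) => 'a => 'a => 'b" where
  "pd f h \<equiv> \<lambda>x. frechet_derivative f (at x) h"

lemma Ck_on_SucD:
  assumes "open S" "Ck_on (Suc k) S f"
  shows "x \<in> S \<Longrightarrow> (f has_derivative frechet_derivative f (at x)) (at x)"
    and "Ck_on k S (\<lambda>x. pd f h x)"
  using assms by (auto simp: differentiable_on_eq_differentiable_at frechet_derivative_works[symmetric])

lemma Ck_on_imp_continuous_on: "Ck_on k S f \<Longrightarrow> continuous_on S f"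
  by (cases k) (auto intro: differentiable_imp_continuous_on)

lemma Ck_on_Suc_imp: "open S \<Longrightarrow> Ck_on (Suc k) S f \<Longrightarrow> Ck_on k S f"
  by (induction k arbitrary: f) (auto intro: differentiable_imp_continuous_on)

lemma Ck_on_mono: "open S \<Longrightarrow> Ck_on n S f \<Longrightarrow> k \<le> n \<Longrightarrow> Ck_on k S f"
proof (induction n)
  case (Suc n)
  show ?case
  proof (cases "k = Suc n")
    case False
    with Suc.prems(3) have "k \<le> n" by simp
    then show ?thesis using Suc.IH[OF Suc.prems(1) Ck_on_Suc_imp[OF Suc.prems(1,2)]] by blast
  qed (use Suc.prems in simp)
qed simp

lemma frechet_derivative_cong_open:
  assumes "open S" "x \<in> S" "\<And>x. x \<in> S \<Longrightarrow> f x = g x"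
  shows "frechet_derivative f (at x) = frechet_derivative g (at x)"
proof -
  have "(f has_derivative D) (at x) \<longleftrightarrow> (g has_derivative D) (at x)" for D
    using has_derivative_transform_within_open[of f D x UNIV S g, OF _ assms(1,2)]
      has_derivative_transform_within_open[of g D x UNIV S f, OF _ assms(1,2)] assms(3) by fastforce
  then show ?thesis by (simp add: frechet_derivative_def)
qed

lemma Ck_on_cong_imp:
  "open S \<Longrightarrow> (\<And>x. x \<in> S \<Longrightarrow> f x = g x) \<Longrightarrow> Ck_on k S f \<Longrightarrow> Ck_on k S g"
proof (induction k arbitrary: f g)
  case 0
  then have "continuous_on S f" by simp
  from continuous_on_eq[OF this] 0 show ?case by simp
next
  case (Suc k)
  have "f differentiable_on S" using Suc.prems(3) by simp
  then have "g differentiable_on S"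
    unfolding differentiable_on_def using Suc.prems(2)
    by (intro ballI differentiable_transform_within[of f _ S 1 g]) auto
  moreover have "Ck_on k S (\<lambda>x. pd g h x)" for h
  proof (rule Suc.IH[OF Suc.prems(1)])
    show "Ck_on k S (\<lambda>x. pd f h x)" using Suc.prems(3) by simp
    show "pd f h x = pd g h x" if "x \<in> S" for x
      using frechet_derivative_cong_open[of S x f g] Suc.prems(1,2) that by metis
  qed
  ultimately show ?case by simp
qed

lemma Ck_on_cong:
  "open S \<Longrightarrow> (\<And>x. x \<in> S \<Longrightarrow> f x = g x) \<Longrightarrow> Ck_on k S f \<longleftrightarrow> Ck_on k S g"
  using Ck_on_cong_imp[of S f g k] Ck_on_cong_imp[of S g f k] by auto

lemma Ck_on_subset: "open T \<Longrightarrow> T \<subseteq> S \<Longrightarrow> Ck_on k S f \<Longrightarrow> Ck_on k T f"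
  by (induction k arbitrary: f) (auto intro: continuous_on_subset differentiable_on_subset)

lemma Ck_on_Un:
  assumes "open S" "open T" "Ck_on k S f" "Ck_on k T f" shows "Ck_on k (S \<union> T) f"
  using assms
  by (induction k arbitrary: f)
     (auto intro: continuous_on_open_Un simp: differentiable_on_eq_differentiable_at open_Un)

lemma Ck_on_SucI:
  assumes "open S" "\<And>x. x \<in> S \<Longrightarrow> (f has_derivative f' x) (at x)" "\<And>h. Ck_on k S (\<lambda>x. f' x h)"
  shows "Ck_on (Suc k) S f"
proof -
  have "frechet_derivative f (at x) = f' x" if "x \<in> S" for x
    using assms(2)[OF that] frechet_derivative_at by fastforce
  then have "Ck_on k S (\<lambda>x. pd f h x)" for h
    using assms(3)[of h] by (subst Ck_on_cong[OF assms(1)]) auto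
  then show ?thesis
    using assms(1,2) by (auto simp: differentiable_on_def differentiable_def intro: has_derivative_at_withinI)
qed

lemma Ck_on_const [simp]: "open S \<Longrightarrow> Ck_on k S (\<lambda>x. c)"
proof (induction k arbitrary: c)
  case (Suc k)
  show ?case by (rule Ck_on_SucI[where f' = "\<lambda>_ _. 0"]) (use Suc in auto)
qed auto

lemma Ck_on_bounded_linear: "bounded_linear L \<Longrightarrow> open S \<Longrightarrow> Ck_on k S L"
proof (cases k)
  case 0 then show "bounded_linear L \<Longrightarrow> open S \<Longrightarrow> Ck_on k S L"
    by (simp add: linear_continuous_on)
next
  case (Suc n)
  assume "bounded_linear L" "open S"
  then show "Ck_on k S L" unfolding Suc
    by (intro Ck_on_SucI[where f' = "\<lambda>_. L"]) (auto intro: bounded_linear_imp_has_derivative)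
qed

lemma Ck_on_bounded_linear_compose:
  assumes L: "bounded_linear L" and S: "open S"
  shows "Ck_on k S f \<Longrightarrow> Ck_on k S (\<lambda>x. L (f x))"
proof (induction k arbitrary: f)
  case 0 then show ?case by (simp add: bounded_linear.continuous_on[OF L])
next
  case (Suc k)
  note D = Ck_on_SucD[OF S Suc.prems]
  show ?case
    by (rule Ck_on_SucI[where f' = "\<lambda>x h. L (pd f h x)"])
       (use S Suc.IH D in \<open>auto intro: bounded_linear.has_derivative[OF L]\<close>)
qed

lemma Ck_on_add:
  assumes S: "open S"
  shows "Ck_on k S f \<Longrightarrow> Ck_on k S g \<Longrightarrow> Ck_on k S (\<lambda>x. f x + g x)"
proof (induction k arbitrary: f g)
  case 0 then show ?case by (simp add: continuous_on_add)
next
  case (Suc k)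
  note D = Ck_on_SucD[OF S Suc.prems(1)] Ck_on_SucD[OF S Suc.prems(2)]
  show ?case
    by (rule Ck_on_SucI[where f' = "\<lambda>x h. pd f h x + pd g h x"])
       (use S Suc.IH D in \<open>auto intro: has_derivative_add\<close>)
qed

lemma Ck_on_minus: "open S \<Longrightarrow> Ck_on k S f \<Longrightarrow> Ck_on k S (\<lambda>x. - f x)"
  by (rule Ck_on_bounded_linear_compose[OF bounded_linear_minus[OF bounded_linear_ident]])

lemma Ck_on_diff: "open S \<Longrightarrow> Ck_on k S f \<Longrightarrow> Ck_on k S g \<Longrightarrow> Ck_on k S (\<lambda>x. f x - g x)"
  using Ck_on_add[of S k f "\<lambda>x. - g x"] Ck_on_minus[of S k g] by simp

lemma Ck_on_sum:
  "open S \<Longrightarrow> (\<And>i. i \<in> I \<Longrightarrow> Ck_on k S (f i)) \<Longrightarrow> Ck_on k S (\<lambda>x. \<Sum>i\<in>I. f i x)"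
  by (induction I rule: infinite_finite_induct) (auto intro: Ck_on_add)

lemma Ck_on_bilinear:
  assumes B: "bounded_bilinear B" and S: "open S"
  shows "Ck_on k S f \<Longrightarrow> Ck_on k S g \<Longrightarrow> Ck_on k S (\<lambda>x. B (f x) (g x))"
proof (induction k arbitrary: f g)
  case 0 then show ?case by (simp add: bounded_bilinear.continuous_on[OF B])
next
  case (Suc k)
  note D = Ck_on_SucD[OF S Suc.prems(1)] Ck_on_SucD[OF S Suc.prems(2)]
  note C = Ck_on_Suc_imp[OF S Suc.prems(1)] Ck_on_Suc_imp[OF S Suc.prems(2)]
  show ?case
    by (rule Ck_on_SucI[where f' = "\<lambda>x h. B (f x) (pd g h x) + B (pd f h x) (g x)"])
       (use S Suc.IH D C in \<open>auto intro!: Ck_on_add bounded_bilinear.FDERIV[OF B]\<close>)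
qed

lemmas Ck_on_mult = Ck_on_bilinear[OF bounded_bilinear_mult]
lemmas Ck_on_scaleR = Ck_on_bilinear[OF bounded_bilinear_scaleR]
lemmas Ck_on_inner = Ck_on_bilinear[OF bounded_bilinear_inner]

text \<open>A real-valued inner function turns the derivative of the composite into the product of
  \<open>pd f h\<close> with the derivative of \<open>g\<close> in direction 1, composed with
  \<open>f\<close>. The induction thus needs only the product rule and itself.\<close>

lemma Ck_on_compose_real:
  fixes f :: "'a::euclidean_space => real" and g :: "real => 'b::real_normed_vector"
  assumes S: "open S" and T: "open T" and fS: "f ` S \<subseteq> T"
  shows "Ck_on k S f \<Longrightarrow> Ck_on k T g \<Longrightarrow> Ck_on k S (\<lambda>x. g (f x))"
proof (induction k arbitrary: g)
  case 0 then show ?case using fS by (auto intro: continuous_on_compose2)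
next
  case (Suc k)
  note D = Ck_on_SucD[OF S Suc.prems(1)] Ck_on_SucD[OF T Suc.prems(2)]
  note C = Ck_on_Suc_imp[OF S Suc.prems(1)]
  have eq: "pd g s t = s *\<^sub>R frechet_derivative g (at t) 1" if "t \<in> T" for t s
    using linear_scale[OF has_derivative_linear[OF D(3)[OF that]], of s 1] by simp
  show ?case
  proof (rule Ck_on_SucI[where f' = "\<lambda>x h. pd f h x *\<^sub>R frechet_derivative g (at (f x)) 1"])
    fix x assume x: "x \<in> S"
    with fS have fx: "f x \<in> T" by auto
    show "((\<lambda>x. g (f x)) has_derivative (\<lambda>h. pd f h x *\<^sub>R frechet_derivative g (at (f x)) 1)) (at x)"
      using has_derivative_compose[OF D(1)[OF x] D(3)[OF fx]] by (subst eq[OF fx, symmetric])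
  next
    fix h show "Ck_on k S (\<lambda>x. pd f h x *\<^sub>R frechet_derivative g (at (f x)) 1)"
      by (intro Ck_on_scaleR S D(2) Suc.IH C D(4))
  qed fact
qed

lemma Ck_on_compose_affine:
  fixes L :: "'c::euclidean_space => 'a::euclidean_space"
  assumes L: "bounded_linear L" and S: "open S"
  shows "Ck_on k S f \<Longrightarrow> Ck_on k {x. c + L x \<in> S} (\<lambda>x. f (c + L x))"
proof (induction k arbitrary: f)
  case 0
  have "continuous_on {x. c + L x \<in> S} (\<lambda>x. c + L x)"
    by (intro continuous_intros linear_continuous_on L)
  then show ?case using 0 continuous_on_compose2[of S f] by auto
next
  case (Suc k)
  have o: "open {x. c + L x \<in> S}"
    using open_vimage[OF S, of "\<lambda>x. c + L x"] continuous_on_add[OF continuous_on_const linear_continuous_on[OF L]]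
    by (simp add: vimage_def)
  note D = Ck_on_SucD[OF S Suc.prems]
  show ?case
  proof (rule Ck_on_SucI[OF o, where f' = "\<lambda>x h. pd f (L h) (c + L x)"])
    fix x assume x: "x \<in> {x. c + L x \<in> S}"
    have "((\<lambda>x. c + L x) has_derivative L) (at x)"
      using has_derivative_add[OF has_derivative_const bounded_linear_imp_has_derivative[OF L], of c] by simp
    from has_derivative_compose[OF this D(1)] x
    show "((\<lambda>x. f (c + L x)) has_derivative (\<lambda>h. pd f (L h) (c + L x))) (at x)"
      by auto
  qed (use Suc.IH[OF D(2)] in auto)
qed

lemma Ck_on_reflect: "Ck_on k UNIV f \<Longrightarrow> Ck_on k UNIV (\<lambda>x. f (z - x))"
  using Ck_on_compose_affine[OF bounded_linear_minus[OF bounded_linear_ident], of UNIV k f z] by simp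

text \<open>Smoothness from an explicit list of derivatives. It serves \<open>flat\<close> and
  restrictions of holomorphic functions to the real axis, whose successive derivatives are all
  known.\<close>

lemma Ck_on_real_sequence:
  fixes G :: "nat => real => 'b::real_normed_vector"
  assumes S: "open S" and G: "\<And>n t. t \<in> S \<Longrightarrow> (G n has_vector_derivative G (Suc n) t) (at t)"
  shows "Ck_on k S (G n)"
proof (induction k arbitrary: n)
  case 0
  show ?case using G
    by (auto intro!: continuous_at_imp_continuous_on has_vector_derivative_continuous)
next
  case (Suc k)
  show ?case
    by (rule Ck_on_SucI[where f' = "\<lambda>t h. h *\<^sub>R G (Suc n) t"])
       (use S G Suc in \<open>auto simp: has_vector_derivative_def intro!: Ck_on_scaleR\<close>)
qed

text \<open>The derivatives of \<open>exp (-1/t)\<close> are of the form \<open>poly p (1/t) * exp (-1/t)\<close>.\<close>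

definition flat :: "real poly => real => real" where
  "flat p t = (if t > 0 then poly p (1/t) * exp (-(1/t)) else 0)"

lemma flat_tendsto_0: "((\<lambda>t. poly p (1/t) * exp (-(1/t))) \<longlongrightarrow> 0) (at_right (0::real))"
proof -
  have "((\<lambda>s. poly p s / exp s) \<longlongrightarrow> 0) at_top"
  proof -
    have eq: "(\<lambda>s. poly p s / exp s) = (\<lambda>s. \<Sum>i\<le>degree p. coeff p i * (s ^ i / exp s))"
      by (auto simp: poly_altdef sum_divide_distrib)
    show ?thesis unfolding eq
      by (intro tendsto_null_sum tendsto_mult_right_zero tendsto_power_div_exp_0)
  qed
  then have "((\<lambda>t. poly p (inverse t) / exp (inverse t)) \<longlongrightarrow> 0) (at_right (0::real))"
    by (rule filterlim_compose) (rule filterlim_inverse_at_top_right)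
  then show ?thesis by (simp add: exp_minus divide_inverse)
qed

text \<open>In the variable s = 1/t differentiation acts on the polynomial as p -> s^2 (p - p'),
  whence the factor \<open>[:0,0,1:]\<close>; the class is closed under it.\<close>

lemma flat_has_derivative:
  "(flat p has_vector_derivative flat ([:0,0,1:] * (p - pderiv p)) t) (at t)"
proof -
  consider "t > 0" | "t < 0" | "t = 0" by linarith
  then show ?thesis
  proof cases
    case 1
    have "((\<lambda>t. poly p (1/t) * exp (-(1/t))) has_real_derivative
        poly ([:0,0,1:] * (p - pderiv p)) (1/t) * exp (-(1/t))) (at t)"
      using 1 by (auto intro!: derivative_eq_intros DERIV_chain2[OF poly_DERIV] simp: field_simps power2_eq_square)
    then have "((\<lambda>t. poly p (1/t) * exp (-(1/t))) has_vector_derivative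
        flat ([:0,0,1:] * (p - pderiv p)) t) (at t)"
      using 1 by (simp add: flat_def has_real_derivative_iff_has_vector_derivative)
    then show ?thesis
      by (rule has_vector_derivative_transform_within_open[of _ _ _ "{0<..}"]) (use 1 in \<open>auto simp: flat_def\<close>)
  next
    case 2
    have "((\<lambda>t. 0) has_vector_derivative 0) (at t)" by simp
    then have "(flat p has_vector_derivative 0) (at t)"
      by (rule has_vector_derivative_transform_within_open[of _ _ _ "{..<0}"]) (use 2 in \<open>auto simp: flat_def\<close>)
    then show ?thesis using 2 by (simp add: flat_def)
  next
    case 3
    have "((\<lambda>y. (flat p y - flat p 0) / (y - 0)) \<longlongrightarrow> 0) (at (0::real))"
    proof (rule filterlim_split_at)
      show "((\<lambda>y. (flat p y - flat p 0) / (y - 0)) \<longlongrightarrow> 0) (at_left (0::real))"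
        by (rule tendsto_eventually) (auto simp: flat_def eventually_at_left_field intro!: exI[of _ "-1"])
      \<comment> \<open>Division by \<open>y\<close> multiplies the polynomial in 1/y by its
        variable, so the difference quotient at 0 is itself covered by
        \<open>flat_tendsto_0\<close>.\<close>
      have "((\<lambda>t. poly (pCons 0 p) (1/t) * exp (-(1/t))) \<longlongrightarrow> 0) (at_right (0::real))"
        by (rule flat_tendsto_0)
      then show "((\<lambda>y. (flat p y - flat p 0) / (y - 0)) \<longlongrightarrow> 0) (at_right (0::real))"
        by (rule Lim_transform_eventually)
           (auto simp: flat_def eventually_at_right_field field_simps intro!: exI[of _ 1])
    qed
    then have "(flat p has_real_derivative 0) (at 0)"
      by (simp add: has_field_derivative_iff)
    then show ?thesis using 3 by (simp add: flat_def has_real_derivative_iff_has_vector_derivative)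
  qed
qed

lemma Ck_on_flat: "Ck_on k UNIV (flat p)"
proof -
  define G where "G n = flat (((\<lambda>p. [:0,0,1:] * (p - pderiv p)) ^^ n) p)" for n
  have "Ck_on k UNIV (G 0)"
    by (rule Ck_on_real_sequence) (simp_all only: G_def flat_has_derivative funpow.simps o_apply open_UNIV)
  then show ?thesis by (simp add: G_def)
qed

section \<open>Cut-off functions and convolution\<close>

definition bump01 :: "real => real" where
  "bump01 t = flat 1 t * flat 1 (1 - t)"

lemma Ck_on_bump01: "Ck_on k UNIV bump01"
  unfolding bump01_def by (intro Ck_on_mult Ck_on_flat Ck_on_reflect) auto

lemma flat_1_pos: "flat 1 t > 0 \<longleftrightarrow> t > 0" "flat 1 t \<ge> 0" "t \<le> 0 \<Longrightarrow> flat 1 t = 0"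
  by (auto simp: flat_def)

lemma bump01_nonneg: "bump01 t \<ge> 0"
  and bump01_pos: "0 < t \<Longrightarrow> t < 1 \<Longrightarrow> bump01 t > 0"
  and bump01_eq_0: "t \<le> 0 \<or> t \<ge> 1 \<Longrightarrow> bump01 t = 0"
  by (auto simp: bump01_def flat_1_pos intro!: mult_pos_pos)

text \<open>The normalised antiderivative of \<open>bump01\<close>. Its derivative is carried along
  with strict positivity on (0, 1), since it will serve as a weight on shells that must be bounded
  below.\<close>

lemma smooth_step_exists:
  "\<exists>F b. (\<forall>k. Ck_on k UNIV F) \<and> (\<forall>k. Ck_on k UNIV b) \<and> (\<forall>t::real. (F has_real_derivative b t) (at t)) \<and>
     (\<forall>t. b t \<ge> 0) \<and> (\<forall>t. 0 < t \<longrightarrow> t < 1 \<longrightarrow> b t > (0::real)) \<and> (\<forall>t. t \<le> 0 \<longrightarrow> F t = 0) \<and> (\<forall>t. t \<ge> 1 \<longrightarrow> F t = (1::real))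
     \<and> (\<forall>t. 0 \<le> F t \<and> F t \<le> 1)"
proof -
  have "continuous_on UNIV bump01" using Ck_on_bump01[of 0] by simp
  then obtain F0 where F0: "\<And>x. (F0 has_vector_derivative bump01 x) (at x)"
    using einterval_antiderivative[of "-\<infinity>" "\<infinity>" bump01] by (auto simp: continuous_on_eq_continuous_at)
  then have F0': "(F0 has_real_derivative bump01 x) (at x)" for x
    by (simp add: has_real_derivative_iff_has_vector_derivative)
  have mono: "x \<le> y \<Longrightarrow> F0 x \<le> F0 y" for x y
    using DERIV_nonneg_imp_nondecreasing[of x y F0] F0' bump01_nonneg by blast
  have c0: "F0 t = F0 0" if "t \<le> 0" for t
  proof (cases "t = 0")
    case False
    then have "\<exists>z>t. z < 0 \<and> F0 0 - F0 t = (0 - t) * bump01 z"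
      using that F0' by (intro MVT2) auto
    then show ?thesis by (auto simp: bump01_eq_0)
  qed simp
  have c1: "F0 t = F0 1" if "t \<ge> 1" for t
  proof (cases "t = 1")
    case False
    then have "\<exists>z>1. z < t \<and> F0 t - F0 1 = (t - 1) * bump01 z"
      using that F0' by (intro MVT2) auto
    then show ?thesis by (auto simp: bump01_eq_0)
  qed simp
  obtain z where z: "z > 0" "z < 1" "F0 1 - F0 0 = (1 - 0) * bump01 z"
    using MVT2[of 0 1 F0 bump01] F0' by auto
  define C where "C = F0 1 - F0 0"
  have C: "C > 0" using z bump01_pos[of z] by (simp add: C_def)
  define F where "F t = (F0 t - F0 0) / C" for t
  define b where "b t = inverse C * bump01 t" for t
  have Fb: "(F has_real_derivative b t) (at t)" for t
    unfolding F_def b_def using C by (auto intro!: derivative_eq_intros F0' simp: divide_inverse)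
  have bk: "Ck_on k UNIV b" for k
    unfolding b_def by (intro Ck_on_mult Ck_on_bump01 Ck_on_const) auto
  have "Ck_on (Suc k) UNIV F" for k
  proof (rule Ck_on_SucI[where f' = "\<lambda>t h. h * b t"])
    show "(F has_derivative (\<lambda>h. h * b x)) (at x)" for x
    proof -
      have "(*) (b x) = (\<lambda>h. h * b x)" by (auto simp: mult.commute)
      then show ?thesis using Fb[of x] by (simp add: has_field_derivative_def)
    qed
  qed (auto intro!: Ck_on_mult bk)
  then have "Ck_on k UNIV F" for k using Ck_on_Suc_imp[of UNIV k F] by auto
  moreover have "0 \<le> F t \<and> F t \<le> 1" for t
  proof -
    have "F0 0 \<le> F0 t" using mono[of 0 t] c0[of t] by linarith
    moreover have "F0 t \<le> F0 1" using mono[of t 1] c1[of t] by linarith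
    ultimately show ?thesis using C by (simp add: F_def C_def)
  qed
  moreover have "b t \<ge> 0" "0 < t \<Longrightarrow> t < 1 \<Longrightarrow> b t > 0" for t
    using bump01_nonneg[of t] bump01_pos[of t] C by (simp_all add: b_def)
  moreover have "t \<le> 0 \<Longrightarrow> F t = 0" "t \<ge> 1 \<Longrightarrow> F t = 1" for t
    using c0[of t] c1[of t] C by (simp_all add: F_def C_def)
  ultimately show ?thesis
    using bk Fb by blast
qed

definition sstep :: "real => real" where
  "sstep = (SOME F. \<exists>b. (\<forall>k. Ck_on k UNIV F) \<and> (\<forall>k. Ck_on k UNIV b) \<and> (\<forall>t::real. (F has_real_derivative b t) (at t)) \<and>
     (\<forall>t. b t \<ge> 0) \<and> (\<forall>t. 0 < t \<longrightarrow> t < 1 \<longrightarrow> b t > (0::real)) \<and> (\<forall>t. t \<le> 0 \<longrightarrow> F t = 0) \<and> (\<forall>t. t \<ge> 1 \<longrightarrow> F t = (1::real))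
     \<and> (\<forall>t. 0 \<le> F t \<and> F t \<le> 1))"

lemma sstep_ex: "\<exists>b. (\<forall>k. Ck_on k UNIV sstep) \<and> (\<forall>k. Ck_on k UNIV b) \<and> (\<forall>t::real. (sstep has_real_derivative b t) (at t)) \<and>
     (\<forall>t. b t \<ge> 0) \<and> (\<forall>t. 0 < t \<longrightarrow> t < 1 \<longrightarrow> b t > (0::real)) \<and> (\<forall>t. t \<le> 0 \<longrightarrow> sstep t = 0) \<and> (\<forall>t. t \<ge> 1 \<longrightarrow> sstep t = (1::real))
     \<and> (\<forall>t. 0 \<le> sstep t \<and> sstep t \<le> 1)"
  unfolding sstep_def by (rule someI_ex[OF smooth_step_exists])

definition sbump :: "real => real" where "sbump t = deriv sstep t"

lemma sstep_deriv: "(sstep has_real_derivative sbump t) (at t)"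
  and Ck_on_sstep: "Ck_on k UNIV sstep"
  and Ck_on_sbump: "Ck_on k UNIV sbump"
  and sbump_nonneg: "sbump t \<ge> 0"
  and sbump_pos: "0 < t \<Longrightarrow> t < 1 \<Longrightarrow> sbump t > 0"
  and sstep_eq_0: "t \<le> 0 \<Longrightarrow> sstep t = 0"
  and sstep_eq_1: "t \<ge> 1 \<Longrightarrow> sstep t = 1"
  and sstep_bounds: "0 \<le> sstep t" "sstep t \<le> 1"
proof -
  obtain b where b: "(\<forall>k. Ck_on k UNIV sstep)" "(\<forall>k. Ck_on k UNIV b)" "(\<forall>t::real. (sstep has_real_derivative b t) (at t))"
     "(\<forall>t. b t \<ge> 0)" "(\<forall>t. 0 < t \<longrightarrow> t < 1 \<longrightarrow> b t > (0::real))" "(\<forall>t. t \<le> 0 \<longrightarrow> sstep t = 0)" "(\<forall>t. t \<ge> 1 \<longrightarrow> sstep t = (1::real))"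
     "(\<forall>t. 0 \<le> sstep t \<and> sstep t \<le> 1)"
    using sstep_ex by blast
  then have [simp]: "sbump = b" by (auto simp: sbump_def DERIV_imp_deriv)
  show "(sstep has_real_derivative sbump t) (at t)" "Ck_on k UNIV sstep"  "Ck_on k UNIV sbump" "sbump t \<ge> 0"
    "0 < t \<Longrightarrow> t < 1 \<Longrightarrow> sbump t > 0" "t \<le> 0 \<Longrightarrow> sstep t = 0" "t \<ge> 1 \<Longrightarrow> sstep t = 1" "0 \<le> sstep t" "sstep t \<le> 1"
    using b by auto
qed

section \<open>Affine changes of variables, functions of bounded support, convolution\<close>

lemma lborel_integral_affine:
  fixes f :: "'a::euclidean_space => 'b::{banach, second_countable_topology}"
  assumes c: "c \<noteq> 0" and [measurable]: "f \<in> borel_measurable borel"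
  shows "(LBINT x. f x) = \<bar>c\<bar> ^ DIM('a) *\<^sub>R (LBINT x. f (t + c *\<^sub>R x))"
    and "integrable lborel f \<longleftrightarrow> integrable lborel (\<lambda>x. f (t + c *\<^sub>R x))"
proof -
  have T[measurable]: "(\<lambda>x. t + c *\<^sub>R x) \<in> measurable lborel borel" by simp
  show "(LBINT x. f x) = \<bar>c\<bar> ^ DIM('a) *\<^sub>R (LBINT x. f (t + c *\<^sub>R x))"
    by (subst lborel_affine[OF c, of t], subst integral_density) (auto simp: integral_distr)
  have "integrable lborel f \<longleftrightarrow> integrable lborel (\<lambda>x. \<bar>c\<bar> ^ DIM('a) *\<^sub>R f (t + c *\<^sub>R x))"
    by (subst lborel_affine[OF c, of t], subst integrable_density) (auto simp: integrable_distr_eq)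
  also have "\<dots> \<longleftrightarrow> integrable lborel (\<lambda>x. f (t + c *\<^sub>R x))"
    using c integrable_scaleR_right[of "inverse (\<bar>c\<bar> ^ DIM('a))" lborel "\<lambda>x. \<bar>c\<bar> ^ DIM('a) *\<^sub>R f (t + c *\<^sub>R x)"] by auto
  finally show "integrable lborel f \<longleftrightarrow> integrable lborel (\<lambda>x. f (t + c *\<^sub>R x))" .
qed

lemma lborel_integral_translate:
  fixes f :: "'a::euclidean_space => 'b::{banach, second_countable_topology}"
  assumes "f \<in> borel_measurable borel"
  shows "(LBINT x. f (x - t)) = (LBINT x. f x)"
    and "integrable lborel (\<lambda>x. f (x - t)) \<longleftrightarrow> integrable lborel f"
  using lborel_integral_affine[of 1 f "-t"] assms by simp_all

lemma lborel_integral_reflect: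
  fixes f :: "'a::euclidean_space => 'b::{banach, second_countable_topology}"
  assumes "f \<in> borel_measurable borel"
  shows "(LBINT x. f (t - x)) = (LBINT x. f x)"
    and "integrable lborel (\<lambda>x. f (t - x)) \<longleftrightarrow> integrable lborel f"
  using lborel_integral_affine[of "-1" f t] assms by simp_all

text \<open>Equivalent to compactness of the support (\<open>bsupp_compact_closure\<close>), but
  immediately stable under sums, products, derivatives and reflections.\<close>

definition bsupp :: "('a::real_normed_vector => 'b::zero) => bool" where
  "bsupp f \<longleftrightarrow> (\<exists>R. \<forall>x. norm x > R \<longrightarrow> f x = 0)"

lemma bsuppE: "bsupp f \<Longrightarrow> (\<And>R. R > 0 \<Longrightarrow> (\<And>x. norm x > R \<Longrightarrow> f x = 0) \<Longrightarrow> P) \<Longrightarrow> P"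
  unfolding bsupp_def by (metis dual_order.strict_trans2 gt_ex linorder_le_cases max.strict_boundedE less_max_iff_disj)

lemma bsupp_mult_left: "bsupp f \<Longrightarrow> bsupp (\<lambda>x. f x * (g x :: 'b::mult_zero))"
  and bsupp_mult_right: "bsupp f \<Longrightarrow> bsupp (\<lambda>x. (g x :: 'b::mult_zero) * f x)"
  unfolding bsupp_def by (metis mult_zero_left) (metis mult_zero_right)

lemma bsupp_frechet_derivative:
  fixes f :: "'a::euclidean_space => 'b::real_normed_vector"
  assumes "bsupp f" shows "bsupp (\<lambda>x. pd f h x)"
proof -
  obtain R where R: "\<And>x. norm x > R \<Longrightarrow> f x = 0" using assms by (auto simp: bsupp_def)
  have "pd f h x = 0" if "norm x > R" for x
  proof -
    have "open {x::'a. norm x > R}" by (intro open_Collect_less continuous_intros)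
    then have "frechet_derivative f (at x) = frechet_derivative (\<lambda>x. 0) (at x)"
      by (rule frechet_derivative_cong_open) (use that R in auto)
    then show ?thesis by simp
  qed
  then show ?thesis by (auto simp: bsupp_def)
qed

lemma bsupp_add:
  fixes f g :: "'a::real_normed_vector => 'b::monoid_add"
  assumes "bsupp f" "bsupp g" shows "bsupp (\<lambda>x. f x + g x)"
proof -
  obtain R S where "\<And>x. norm x > R \<Longrightarrow> f x = 0" "\<And>x. norm x > S \<Longrightarrow> g x = 0" using assms by (auto simp: bsupp_def)
  then show ?thesis unfolding bsupp_def by (intro exI[of _ "max R S"]) auto
qed

lemma bsupp_sum:
  fixes f :: "'i => 'a::real_normed_vector => 'b::comm_monoid_add"
  shows "(\<And>i. i \<in> I \<Longrightarrow> bsupp (f i)) \<Longrightarrow> bsupp (\<lambda>x. \<Sum>i\<in>I. f i x)"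
proof (induction I rule: infinite_finite_induct)
  case (insert i I) then show ?case by (simp add: bsupp_add)
qed (auto simp: bsupp_def)

lemma bsupp_reflect:
  fixes f :: "'a::real_normed_vector => 'b::zero"
  assumes "bsupp f" shows "bsupp (\<lambda>x. f (t - x))" "bsupp (\<lambda>x. f (x - t))"
proof -
  obtain R where R: "\<And>x. norm x > R \<Longrightarrow> f x = 0" using assms by (auto simp: bsupp_def)
  have "norm (t - x) > R" "norm (x - t) > R" if "norm x > R + norm t" for x
    using that norm_triangle_ineq2[of x t] by (auto simp: norm_minus_commute)
  then show "bsupp (\<lambda>x. f (t - x))" "bsupp (\<lambda>x. f (x - t))"
    using R unfolding bsupp_def by blast+
qed

lemma bsupp_compact_closure:
  fixes f :: "'a::euclidean_space => 'b::zero"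
  shows "bsupp f \<longleftrightarrow> compact (closure {x. f x \<noteq> 0})"
proof
  assume "bsupp f"
  then obtain R where "\<And>x. norm x > R \<Longrightarrow> f x = 0" by (auto simp: bsupp_def)
  then have "{x. f x \<noteq> 0} \<subseteq> cball 0 R" by (auto simp: not_less[symmetric])
  then show "compact (closure {x. f x \<noteq> 0})" using bounded_subset bounded_cball by (auto simp: compact_closure)
next
  assume "compact (closure {x. f x \<noteq> 0})"
  then have "bounded {x. f x \<noteq> 0}" by (simp add: compact_closure)
  then obtain R where "\<And>x. f x \<noteq> 0 \<Longrightarrow> norm x \<le> R" by (auto simp: bounded_iff)
  then show "bsupp f" unfolding bsupp_def by (metis not_less)
qed

lemma test_function_iff: "test_function \<phi> \<longleftrightarrow> (\<forall>k. Ck_on k UNIV \<phi>) \<and> bsupp \<phi>"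
  by (simp add: test_function_def bsupp_compact_closure)

lemma continuous_bsupp_integrable:
  fixes f :: "'a::euclidean_space => 'b::euclidean_space"
  assumes "continuous_on UNIV f" "bsupp f"
  shows "integrable lborel f"
proof -
  obtain R where R: "\<And>x. norm x > R \<Longrightarrow> f x = 0" using assms by (auto simp: bsupp_def)
  have "integrable lborel (\<lambda>x. indicator (cball 0 R) x *\<^sub>R f x)"
    by (rule borel_integrable_compact) (use assms continuous_on_subset in auto)
  moreover have "(\<lambda>x. indicator (cball 0 R) x *\<^sub>R f x) = f"
    using R by (auto simp: indicator_def fun_eq_iff)
  ultimately show ?thesis by simp
qed

lemma continuous_bsupp_bounded:
  fixes f :: "'a::euclidean_space => 'b::real_normed_vector"
  assumes "continuous_on UNIV f" "bsupp f"
  obtains B where "B > 0" "\<And>x. norm (f x) \<le> B"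
proof -
  obtain R where R: "\<And>x. norm x > R \<Longrightarrow> f x = 0" using assms by (auto simp: bsupp_def)
  have "bounded (f ` cball 0 R)"
    by (intro compact_imp_bounded compact_continuous_image) (use assms continuous_on_subset in auto)
  then obtain B where "B > 0" and B: "\<And>x. x \<in> cball 0 R \<Longrightarrow> norm (f x) \<le> B" by (auto simp: bounded_pos)
  have "norm (f x) \<le> B" for x using R[of x] B[of x] \<open>B > 0\<close> by (cases "norm x > R") auto
  then show ?thesis using that \<open>B > 0\<close> by blast
qed

lemma continuous_bounded_cball:
  fixes f :: "'a::euclidean_space => 'b::real_normed_vector"
  assumes "continuous_on UNIV f"
  obtains B where "B > 0" "\<And>x. norm x \<le> R \<Longrightarrow> norm (f x) \<le> B"
proof -
  have "bounded (f ` cball 0 R)"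
    by (intro compact_imp_bounded compact_continuous_image) (use assms continuous_on_subset in auto)
  then obtain B where "B > 0" and B: "\<And>x. x \<in> cball 0 R \<Longrightarrow> norm (f x) \<le> B" by (auto simp: bounded_pos)
  then show ?thesis using that by auto
qed

lemma Ck1_lipschitz_cball:
  fixes h :: "'a::euclidean_space => 'b::real_normed_vector"
  assumes "Ck_on 1 UNIV h"
  obtains B where "B > 0" "\<And>x y. norm x \<le> R \<Longrightarrow> norm y \<le> R \<Longrightarrow> norm (h x - h y) \<le> B * norm (x - y)"
    "\<And>x v. norm x \<le> R \<Longrightarrow> norm (pd h v x) \<le> B * norm v"
proof -
  have D: "(h has_derivative frechet_derivative h (at x)) (at x)"
    and C: "continuous_on UNIV (\<lambda>x. pd h v x)" for x v
    using Ck_on_SucD[of UNIV 0 h] assms by auto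
  have "\<forall>b::'a. \<exists>B>0. \<forall>x. norm x \<le> R \<longrightarrow> norm (pd h b x) \<le> B"
    using continuous_bounded_cball[OF C, of R] by metis
  then obtain Bf where Bf: "\<And>b. Bf b > 0" "\<And>b x. norm x \<le> R \<Longrightarrow> norm (pd h (b::'a) x) \<le> Bf b"
    by metis
  define B where "B = (\<Sum>b\<in>Basis. Bf (b::'a))"
  have dB: "norm (pd h v x) \<le> B * norm v" if "norm x \<le> R" for x v
  proof -
    interpret L: bounded_linear "frechet_derivative h (at x)" using D has_derivative_bounded_linear by blast
    have "pd h v x = frechet_derivative h (at x) (\<Sum>b\<in>Basis. (v \<bullet> b) *\<^sub>R b)"
      by (simp add: euclidean_representation)
    also have "\<dots> = (\<Sum>b\<in>Basis. (v \<bullet> b) *\<^sub>R pd h b x)"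
      by (simp add: L.sum L.scaleR)
    also have "norm \<dots> \<le> (\<Sum>b\<in>Basis. norm v * Bf b)"
      by (rule sum_norm_le) (auto intro!: mult_mono Basis_le_norm Bf that)
    finally show ?thesis by (simp add: B_def sum_distrib_left mult.commute)
  qed
  have on: "onorm (frechet_derivative h (at x)) \<le> B" if "norm x \<le> R" for x
    by (intro onorm_le dB that)
  have "B > 0" unfolding B_def by (rule sum_pos) (use Bf in auto)
  moreover have "norm (h x - h y) \<le> B * norm (x - y)" if "norm x \<le> R" "norm y \<le> R" for x y
    by (rule differentiable_bound[of "cball 0 R" h "\<lambda>x. frechet_derivative h (at x)"])
       (use that on D in \<open>auto intro: has_derivative_at_withinI\<close>)
  ultimately show ?thesis using that dB by blast
qed

lemma integrable_mult_bounded: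
  fixes f g :: "'a => complex"
  assumes "integrable M f" "g \<in> borel_measurable M" "\<And>x. f x \<noteq> 0 \<Longrightarrow> norm (g x) \<le> B"
  shows "integrable M (\<lambda>x. g x * f x)" "integrable M (\<lambda>x. f x * g x)"
proof -
  have "integrable M (\<lambda>x. norm (f x) * B)" using assms by simp
  then show *: "integrable M (\<lambda>x. g x * f x)"
  proof (rule bintegrable_bound)
    show "(\<lambda>x. g x * f x) \<in> borel_measurable M" using assms by measurable
    show "AE x in M. norm (g x * f x) \<le> norm (norm (f x) * B)"
    proof (rule AE_I2)
      fix x show "norm (g x * f x) \<le> norm (norm (f x) * B)"
        using assms(3)[of x] mult_left_mono[of "norm (g x)" "\<bar>B\<bar>" "norm (f x)"]
        by (cases "f x = 0") (auto simp: norm_mult abs_mult mult.commute)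
    qed
  qed
  then show "integrable M (\<lambda>x. f x * g x)" by (simp add: mult.commute)
qed

lemma conv_integrable:
  fixes h f :: "'a::euclidean_space => complex"
  assumes "continuous_on UNIV h" "integrable lborel f" "bsupp f"
  shows "integrable lborel (\<lambda>z. h (x - z) * f z)"
proof -
  obtain R where R: "\<And>x. norm x > R \<Longrightarrow> f x = 0" using assms by (auto simp: bsupp_def)
  obtain B where B: "\<And>y. norm y \<le> norm x + R \<Longrightarrow> norm (h y) \<le> B" using continuous_bounded_cball[OF assms(1)] by metis
  have "continuous_on UNIV (\<lambda>z. h (x - z))"
    by (intro continuous_on_compose2[OF assms(1)] continuous_intros) auto
  then have "(\<lambda>z. h (x - z)) \<in> borel_measurable lborel" by (simp add: borel_measurable_continuous_onI)
  moreover have "norm (h (x - z)) \<le> B" if "f z \<noteq> 0" for z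
    using R[of z] that norm_triangle_ineq4[of x z] by (intro B) force
  ultimately show ?thesis using assms by (intro integrable_mult_bounded)
qed

lemma conv_continuous:
  fixes h f :: "'a::euclidean_space => complex"
  assumes h: "continuous_on UNIV h" and f: "integrable lborel f" "bsupp f"
  shows "continuous_on UNIV (\<lambda>x. LBINT z. h (x - z) * f z)"
proof -
  obtain R where R: "\<And>x. norm x > R \<Longrightarrow> f x = 0" using f by (auto simp: bsupp_def)
  show ?thesis
    unfolding continuous_on_sequentially
  proof (intro ballI allI impI, unfold comp_def)
    fix s :: "nat => 'a" and x assume "x \<in> UNIV" "(\<forall>n. s n \<in> UNIV) \<and> s \<longlonglongrightarrow> x"
    then have s: "s \<longlonglongrightarrow> x" by auto
    then obtain S where S: "\<And>n. norm (s n) \<le> S"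
      using convergent_imp_Bseq[of s] by (auto simp: convergent_def Bseq_def)
    obtain B where B: "\<And>y. norm y \<le> S + R \<Longrightarrow> norm (h y) \<le> B" using continuous_bounded_cball[OF h] by metis
    show "(\<lambda>n. LBINT z. h (s n - z) * f z) \<longlonglongrightarrow> (LBINT z. h (x - z) * f z)"
    proof (rule integral_dominated_convergence[where w = "\<lambda>z. B * norm (f z)"])
      show "(\<lambda>z. h (x - z) * f z) \<in> borel_measurable lborel" "(\<lambda>z. h (s n - z) * f z) \<in> borel_measurable lborel" for n
        using conv_integrable[OF h f] borel_measurable_integrable by blast+
      show "integrable lborel (\<lambda>z. B * norm (f z))" using f by simp
      have "(\<lambda>n. h (s n - z)) \<longlonglongrightarrow> h (x - z)" for z
        using continuous_on_tendsto_compose[OF h, of "\<lambda>n. s n - z" "x - z" sequentially] tendsto_diff[OF s tendsto_const, of z] by simp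
      then show "AE z in lborel. (\<lambda>n. h (s n - z) * f z) \<longlonglongrightarrow> h (x - z) * f z"
        by (intro AE_I2 tendsto_mult tendsto_const)
      show "AE z in lborel. norm (h (s n - z) * f z) \<le> B * norm (f z)" for n
      proof (rule AE_I2)
        fix z show "norm (h (s n - z) * f z) \<le> B * norm (f z)"
        proof (cases "f z = 0")
          case False
          then have "norm z \<le> R" using R[of z] by force
          then have "norm (s n - z) \<le> S + R" using S[of n] norm_triangle_ineq4[of "s n" z] by linarith
          from B[OF this] show ?thesis by (simp add: norm_mult mult_right_mono)
        qed simp
      qed
    qed
  qed
qed

text \<open>All derivatives fall on the smooth kernel \<open>h\<close>. Differentiation under the
  integral is dominated convergence: the local Lipschitz constant of \<open>h\<close> bounds the
  difference quotients by \<open>2 * B * norm (f z)\<close>.\<close>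

lemma conv_has_derivative:
  fixes h f :: "'a::euclidean_space => complex"
  assumes h: "Ck_on 1 UNIV h" and f: "integrable lborel f" "bsupp f"
  shows "((\<lambda>x. LBINT z. h (x - z) * f z) has_derivative
      (\<lambda>v. LBINT z. pd h v (x - z) * f z)) (at x)"
proof -
  obtain R where R: "\<And>x. norm x > R \<Longrightarrow> f x = 0" using f by (auto simp: bsupp_def)
  have D: "(h has_derivative frechet_derivative h (at x)) (at x)"
    and C: "continuous_on UNIV (\<lambda>x. pd h v x)" for x v
    using Ck_on_SucD[of UNIV 0 h] h by auto
  have hc: "continuous_on UNIV h" using h by (rule Ck_on_imp_continuous_on)
  obtain B where B: "B > 0" "\<And>u v. norm u \<le> norm x + 1 + R \<Longrightarrow> norm v \<le> norm x + 1 + R \<Longrightarrow> norm (h u - h v) \<le> B * norm (u - v)"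
    "\<And>u v. norm u \<le> norm x + 1 + R \<Longrightarrow> norm (pd h v u) \<le> B * norm v"
    using Ck1_lipschitz_cball[OF h] by metis
  note iD = conv_integrable[OF C f] and ih = conv_integrable[OF hc f]
  define L where "L v = (LBINT z. pd h v (x - z) * f z)" for v
  have lin: "linear (frechet_derivative h (at w))" for w
    using D has_derivative_linear by blast
  have "linear L"
  proof
    show "L (u + v) = L u + L v" for u v
      unfolding L_def by (subst bint_add[symmetric]) (use iD in \<open>auto simp: linear_add[OF lin] distrib_right\<close>)
    show "L (r *\<^sub>R u) = r *\<^sub>R L u" for r u
      unfolding L_def by (subst integral_scaleR_right[symmetric]) (auto simp: linear_scale[OF lin])
  qed
  then have bl: "bounded_linear L" by (simp add: linear_conv_bounded_linear)
  define q where "q z v = (h (x + v - z) - h (x - z) - pd h v (x - z)) * f z / of_real (norm v)" for z v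
  have iq: "integrable lborel (\<lambda>z. q z v)" for v
    unfolding q_def left_diff_distrib
    by (intro integrable_divide bintegrable_diff ih iD)
  have "((\<lambda>v. LBINT z. q z v) \<longlongrightarrow> 0) (at 0)"
    unfolding tendsto_at_iff_sequentially
  proof (intro allI impI, unfold comp_def)
    fix s :: "nat => 'a" assume s0: "\<forall>i. s i \<in> UNIV - {0}" and s: "s \<longlonglongrightarrow> 0"
    have qn: "norm (q z v) = norm (h (x + v - z) - h (x - z) - pd h v (x - z)) / norm v * norm (f z)" for z v
      by (simp add: q_def norm_mult norm_divide)
    have ev: "\<forall>\<^sub>F n in sequentially. norm (s n) < 1"
      using order_tendstoD(2)[OF tendsto_norm_zero[OF s], of 1] by simp
    then obtain N where N: "\<And>n. n \<ge> N \<Longrightarrow> norm (s n) < 1" by (auto simp: eventually_sequentially)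
    \<comment> \<open>Domination holds for increments of norm below 1, hence the index shift by
      \<open>N\<close>, which \<open>LIMSEQ_offset\<close> removes afterwards.\<close>
    have "(\<lambda>n. LBINT z. q z (s (n + N))) \<longlonglongrightarrow> (LBINT (z::'a). 0)"
    proof (rule integral_dominated_convergence[of "\<lambda>z. 0" lborel "\<lambda>n z. q z (s (n + N))" "\<lambda>z. 2 * B * norm (f z)"])
      show "(\<lambda>z. q z (s (n + N))) \<in> borel_measurable lborel" for n using iq borel_measurable_integrable by blast
      show "integrable lborel (\<lambda>z. 2 * B * norm (f z))" using f by simp
      show "AE z in lborel. norm (q z (s (n + N))) \<le> 2 * B * norm (f z)" for n
      proof (rule AE_I2)
        fix z
        define v where "v = s (n + N)"
        have v: "v \<noteq> 0" "norm v < 1" using s0 N by (auto simp: v_def)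
        show "norm (q z (s (n + N))) \<le> 2 * B * norm (f z)"
        proof (cases "f z = 0")
          case False
          then have z: "norm z \<le> R" using R[of z] by force
          have n1: "norm (x - z) \<le> norm x + 1 + R" using z norm_triangle_ineq4[of x z] by linarith
          have n2: "norm (x + v - z) \<le> norm x + 1 + R"
            using z v norm_triangle_ineq4[of "x + v" z] norm_triangle_ineq[of x v] by linarith
          have "norm (h (x + v - z) - h (x - z) - pd h v (x - z)) \<le> B * norm v + B * norm v"
            using norm_triangle_ineq4[of "h (x + v - z) - h (x - z)" "pd h v (x - z)"]
              B(2)[OF n2 n1] B(3)[OF n1, of v] by simp
          then have "norm (h (x + v - z) - h (x - z) - pd h v (x - z)) / norm v \<le> 2 * B"
            using v by (simp add: field_simps)
          then show ?thesis unfolding v_def[symmetric] qn by (intro mult_right_mono) auto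
        qed (simp add: q_def)
      qed
      show "AE z in lborel. (\<lambda>n. q z (s (n + N))) \<longlonglongrightarrow> 0"
      proof (rule AE_I2)
        fix z
        have "((\<lambda>v. norm (h (x - z + v) - h (x - z) - pd h v (x - z)) / norm v) \<longlongrightarrow> 0) (at 0)"
          using D[of "x - z"] by (simp add: has_derivative_at)
        then have "(\<lambda>n. norm (h (x - z + s n) - h (x - z) - pd h (s n) (x - z)) / norm (s n)) \<longlonglongrightarrow> 0"
          using s0 s unfolding tendsto_at_iff_sequentially comp_def by blast
        then have "(\<lambda>n. norm (q z (s n))) \<longlonglongrightarrow> 0"
          unfolding qn by (intro tendsto_mult_left_zero) (simp add: algebra_simps)
        then show "(\<lambda>n. q z (s (n + N))) \<longlonglongrightarrow> 0"
          using LIMSEQ_ignore_initial_segment[of "\<lambda>n. q z (s n)" 0 N] by (simp add: tendsto_norm_zero_iff)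
      qed
    qed auto
    then show "(\<lambda>n. LBINT z. q z (s n)) \<longlonglongrightarrow> 0"
      by (simp add: LIMSEQ_offset)
  qed
  moreover have "(LBINT z. q z v) = ((LBINT z. h (x + v - z) * f z) - (LBINT z. h (x - z) * f z) - L v) / of_real (norm v)" for v
    unfolding q_def L_def left_diff_distrib by (simp add: ih iD)
  ultimately have "((\<lambda>v. norm ((LBINT z. h (x + v - z) * f z) - (LBINT z. h (x - z) * f z) - L v) / norm v) \<longlongrightarrow> 0) (at 0)"
    using tendsto_norm_zero by (fastforce simp: norm_divide)
  then show ?thesis
    using bl unfolding L_def[symmetric] has_derivative_at by simp
qed

lemma Ck_on_conv:
  fixes h f :: "'a::euclidean_space => complex"
  assumes f: "integrable lborel f" "bsupp f"
  shows "Ck_on k UNIV h \<Longrightarrow> Ck_on k UNIV (\<lambda>x. LBINT z. h (x - z) * f z)"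
proof (induction k arbitrary: h)
  case 0
  then show ?case using conv_continuous[OF _ f] by simp
next
  case (Suc k)
  have h1: "Ck_on 1 UNIV h" using Ck_on_mono[OF _ Suc.prems, of 1] by simp
  show ?case
  proof (rule Ck_on_SucI[OF _ conv_has_derivative[OF h1 f]])
    show "Ck_on k UNIV (\<lambda>x. LBINT z. pd h v (x - z) * f z)" for v
      by (rule Suc.IH) (use Suc.prems in simp)
  qed simp
qed

lemma frechet_derivative_conv:
  fixes h f :: "'a::euclidean_space => complex"
  assumes "Ck_on 1 UNIV h" "integrable lborel f" "bsupp f"
  shows "frechet_derivative (\<lambda>x. LBINT z. h (x - z) * f z) (at x) =
      (\<lambda>v. LBINT z. pd h v (x - z) * f z)"
  using frechet_derivative_at[OF conv_has_derivative[OF assms]] by simp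

text \<open>In place of iterated integration: the convolution of \<phi> with the indicator of a
  large ball is constant near 0, because small translates of \<phi> do not leave the ball. Its
  derivative at 0 therefore vanishes, and \<open>conv_has_derivative\<close> identifies that
  derivative with the integral.\<close>

lemma integral_frechet_derivative_eq_0:
  fixes \<phi> :: "'a::euclidean_space => complex"
  assumes h: "Ck_on 1 UNIV \<phi>" and b: "bsupp \<phi>"
  shows "(LBINT x. pd \<phi> v x) = 0"
proof -
  obtain R where R: "\<And>x. norm x > R \<Longrightarrow> \<phi> x = 0" using b by (auto simp: bsupp_def)
  define f :: "'a => complex" where "f = indicator (cball 0 (R + 1))"
  have f: "integrable lborel f" "bsupp f"
  proof -
    have "integrable lborel (\<lambda>x. indicator (cball (0::'a) (R + 1)) x *\<^sub>R (1::complex))"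
      by (intro integrable_indicator) (use emeasure_bounded_finite[of "cball (0::'a) (R + 1)"] in \<open>auto simp: less_top\<close>)
    moreover have "(\<lambda>x. indicator (cball (0::'a) (R + 1)) x *\<^sub>R (1::complex)) = f"
      by (auto simp: f_def indicator_def)
    ultimately show "integrable lborel f" by simp
    show "bsupp f" by (auto simp: f_def bsupp_def indicator_def intro!: exI[of _ "R + 1"])
  qed
  have C: "continuous_on UNIV \<phi>" "continuous_on UNIV (\<lambda>x. pd \<phi> v x)" for v
    using Ck_on_SucD[of UNIV 0 \<phi>] h Ck_on_imp_continuous_on[OF h] by auto
  note bm = borel_measurable_continuous_onI[OF C(1)] borel_measurable_continuous_onI[OF C(2)]
  have R': "pd \<phi> v x = 0" if "norm x > R" for x
  proof -
    have "open {x::'a. norm x > R}" by (intro open_Collect_less continuous_intros)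
    then have "frechet_derivative \<phi> (at x) = frechet_derivative (\<lambda>x. 0) (at x)"
      by (rule frechet_derivative_cong_open) (use that R in auto)
    then show ?thesis by simp
  qed
  have "((\<lambda>x. LBINT z. \<phi> (x - z) * f z) has_derivative (\<lambda>v. 0)) (at 0)"
  proof (rule has_derivative_transform_within_open[of "\<lambda>x. LBINT z. \<phi> z" _ _ _ "ball 0 1"])
    fix x :: 'a assume x: "x \<in> ball 0 1"
    have "(\<lambda>z. \<phi> (x - z) * f z) = (\<lambda>z. \<phi> (x - z))"
    proof
      fix z show "\<phi> (x - z) * f z = \<phi> (x - z)"
        using x R[of "x - z"] norm_triangle_ineq2[of z x] by (auto simp: f_def indicator_def norm_minus_commute)
    qed
    then show "(LBINT z. \<phi> z) = (LBINT z. \<phi> (x - z) * f z)"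
      using lborel_integral_reflect(1)[OF bm(1), of x] by simp
  qed auto
  from fun_cong[OF has_derivative_unique[OF this conv_has_derivative[OF h f, of 0]], of v]
  have "(LBINT z. pd \<phi> v (0 - z) * f z) = 0" by simp
  also have "(LBINT z. pd \<phi> v (0 - z) * f z) = (LBINT z. pd \<phi> v (0 - z))"
    by (rule bint_cong) (use R' in \<open>auto simp: f_def indicator_def\<close>)
  also have "\<dots> = (LBINT x. pd \<phi> v x)"
    by (rule lborel_integral_reflect(1)[OF bm(2)])
  finally show ?thesis .
qed

section \<open>Second derivatives, the Laplacian and radial functions\<close>

lemma Ck_on_2D:
  assumes "open S" "Ck_on 2 S f"
  shows "x \<in> S \<Longrightarrow> (f has_derivative frechet_derivative f (at x)) (at x)"
    and "Ck_on 1 S (pd f h)"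
    and "x \<in> S \<Longrightarrow> (pd f h has_derivative frechet_derivative (pd f h) (at x)) (at x)"
    and "continuous_on S (pd (pd f h) k)" and "Ck_on 1 S f" and "continuous_on S f" and "continuous_on S (pd f h)"
proof -
  show *: "x \<in> S \<Longrightarrow> (f has_derivative frechet_derivative f (at x)) (at x)" "Ck_on 1 S (pd f h)"
    using Ck_on_SucD[of S 1 f] assms by (auto simp: numeral_2_eq_2 simp del: Ck_on.simps)
  show "x \<in> S \<Longrightarrow> (pd f h has_derivative frechet_derivative (pd f h) (at x)) (at x)" "continuous_on S (pd (pd f h) k)"
    using Ck_on_SucD[of S 0 "pd f h"] assms *(2) by auto
  show "Ck_on 1 S f" using assms Ck_on_mono[of S 2 f 1] by simp
  show "continuous_on S f" using assms Ck_on_imp_continuous_on by blast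
  show "continuous_on S (pd f h)" using *(2) Ck_on_imp_continuous_on by blast
qed

lemma laplacian_cong_open:
  assumes "open S" "x \<in> S" "\<And>x. x \<in> S \<Longrightarrow> f x = g x"
  shows "laplacian f x = laplacian g x"
proof -
  have "frechet_derivative f (at z) = frechet_derivative g (at z)" if "z \<in> S" for z
    by (rule frechet_derivative_cong_open) (use assms that in auto)
  then have "frechet_derivative (pd f b) (at x) = frechet_derivative (pd g b) (at x)" for b
    by (intro frechet_derivative_cong_open[OF assms(1,2)]) auto
  then show ?thesis by (simp add: laplacian_def)
qed

lemma continuous_on_laplacian: "open S \<Longrightarrow> Ck_on 2 S f \<Longrightarrow> continuous_on S (laplacian f)"
  unfolding laplacian_def[abs_def] by (intro continuous_on_sum Ck_on_2D(4)) auto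

lemma Ck_on_laplacian:
  assumes "open S" "\<And>k. Ck_on k S f" shows "Ck_on k S (laplacian f)"
  unfolding laplacian_def[abs_def]
  by (intro Ck_on_sum assms Ck_on_SucD(2)[OF assms(1), of _ "pd f _"] Ck_on_SucD(2)[OF assms(1), of _ f])

lemma bsupp_laplacian: "bsupp f \<Longrightarrow> bsupp (laplacian f)"
  unfolding laplacian_def[abs_def] by (intro bsupp_sum bsupp_frechet_derivative)

lemma frechet_derivative_eqI: "(f has_derivative D) (at x) \<Longrightarrow> frechet_derivative f (at x) = D"
  using frechet_derivative_at by metis

lemma laplacian_eqI:
  assumes "open S" "x \<in> S" "\<And>y. y \<in> S \<Longrightarrow> (f has_derivative f' y) (at y)"
    "\<And>b. b \<in> Basis \<Longrightarrow> ((\<lambda>y. f' y b) has_derivative f'' b) (at x)"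
  shows "laplacian f x = (\<Sum>b\<in>Basis. f'' b b)"
proof -
  have *: "pd f b y = f' y b" if "y \<in> S" for b y
    using frechet_derivative_eqI[OF assms(3)[OF that]] by simp
  have "frechet_derivative (pd f b) (at x) = frechet_derivative (\<lambda>y. f' y b) (at x)" for b
    by (rule frechet_derivative_cong_open[OF assms(1,2) *])
  then show ?thesis unfolding laplacian_def using frechet_derivative_eqI[OF assms(4)] by simp
qed

lemma laplacian_mult:
  fixes f g :: "'a::euclidean_space => complex"
  assumes S: "open S" "x \<in> S" and f: "Ck_on 2 S f" and g: "Ck_on 2 S g"
  shows "laplacian (\<lambda>x. f x * g x) x =
    f x * laplacian g x + 2 * (\<Sum>b\<in>Basis. pd f b x * pd g b x) + laplacian f x * g x"
proof -
  note F = Ck_on_2D[OF S(1) f] and G = Ck_on_2D[OF S(1) g]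
  have "laplacian (\<lambda>x. f x * g x) x = (\<Sum>b\<in>Basis. (f x * pd (pd g b) b x + pd f b x * pd g b x) + (pd f b x * pd g b x + pd (pd f b) b x * g x))"
    by (rule laplacian_eqI[OF S, where f' = "\<lambda>x h. f x * pd g h x + pd f h x * g x"
        and f'' = "\<lambda>b h. (f x * pd (pd g b) h x + pd f h x * pd g b x) + (pd f b x * pd g h x + pd (pd f b) h x * g x)"])
       (intro has_derivative_add has_derivative_mult F G S; assumption)+
  then show ?thesis
    by (simp add: laplacian_def sum.distrib sum_distrib_left sum_distrib_right algebra_simps)
qed

lemma laplacian_bounded_linear:
  assumes L: "bounded_linear L" and S: "open S" "x \<in> S" and f: "Ck_on 2 S f"
  shows "laplacian (\<lambda>x. L (f x)) x = L (laplacian f x)"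
proof -
  note F = Ck_on_2D[OF S(1) f]
  interpret bounded_linear L by fact
  have "laplacian (\<lambda>x. L (f x)) x = (\<Sum>b\<in>Basis. L (pd (pd f b) b x))"
    by (rule laplacian_eqI[OF S, where f' = "\<lambda>x h. L (pd f h x)" and f'' = "\<lambda>b h. L (pd (pd f b) h x)"])
       (intro bounded_linear.has_derivative[OF L] F S; assumption)+
  then show ?thesis by (simp add: laplacian_def sum)
qed

lemma laplacian_add:
  assumes S: "open S" "x \<in> S" and f: "Ck_on 2 S f" and g: "Ck_on 2 S g"
  shows "laplacian (\<lambda>x. f x + g x) x = laplacian f x + laplacian g x"
proof -
  note F = Ck_on_2D[OF S(1) f] and G = Ck_on_2D[OF S(1) g]
  have "laplacian (\<lambda>x. f x + g x) x = (\<Sum>b\<in>Basis. pd (pd f b) b x + pd (pd g b) b x)"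
    by (rule laplacian_eqI[OF S, where f' = "\<lambda>x h. pd f h x + pd g h x"
        and f'' = "\<lambda>b h. pd (pd f b) h x + pd (pd g b) h x"])
       (intro has_derivative_add F G S; assumption)+
  then show ?thesis by (simp add: laplacian_def sum.distrib)
qed

lemma laplacian_affine:
  fixes f :: "'a::euclidean_space => 'b::real_normed_vector"
  assumes f: "Ck_on 2 UNIV f"
  shows "laplacian (\<lambda>x. f (t + c *\<^sub>R x)) x = c\<^sup>2 *\<^sub>R laplacian f (t + c *\<^sub>R x)"
proof -
  note F = Ck_on_2D[OF open_UNIV f]
  have A: "((\<lambda>x. t + c *\<^sub>R x) has_derivative (\<lambda>h. c *\<^sub>R h)) (at x)" for x :: 'a
    by (auto intro!: derivative_eq_intros)
  have lin: "linear (frechet_derivative f (at y))" "linear (frechet_derivative (pd f b) (at y))" for y b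
    using F(1,3) has_derivative_linear by blast+
  have "laplacian (\<lambda>x. f (t + c *\<^sub>R x)) x = (\<Sum>b\<in>Basis. c *\<^sub>R pd (pd f b) (c *\<^sub>R b) (t + c *\<^sub>R x))"
  proof (rule laplacian_eqI[OF open_UNIV, where f' = "\<lambda>x h. c *\<^sub>R pd f h (t + c *\<^sub>R x)"
        and f'' = "\<lambda>b h. c *\<^sub>R pd (pd f b) (c *\<^sub>R h) (t + c *\<^sub>R x)"])
    show "((\<lambda>x. f (t + c *\<^sub>R x)) has_derivative (\<lambda>h. c *\<^sub>R pd f h (t + c *\<^sub>R y))) (at y)" for y
      using has_derivative_compose[OF A F(1)] by (simp add: linear_scale[OF lin(1)])
    show "((\<lambda>y. c *\<^sub>R pd f b (t + c *\<^sub>R y)) has_derivative (\<lambda>h. c *\<^sub>R pd (pd f b) (c *\<^sub>R h) (t + c *\<^sub>R x))) (at x)" for b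
      by (intro has_derivative_scaleR_right has_derivative_compose[OF A F(3)]) simp
  qed auto
  also have "\<dots> = (\<Sum>b\<in>Basis. c\<^sup>2 *\<^sub>R pd (pd f b) b (t + c *\<^sub>R x))"
    by (simp add: linear_scale[OF lin(2)] power2_eq_square)
  finally show ?thesis by (simp add: laplacian_def scaleR_sum_right)
qed

lemma laplacian_reflect:
  assumes "Ck_on 2 UNIV f" shows "laplacian (\<lambda>x. f (t - x)) x = laplacian f (t - x)"
    and "laplacian (\<lambda>x. f (x - t)) x = laplacian f (x - t)"
  using laplacian_affine[OF assms, of t "-1" x] laplacian_affine[OF assms, of "-t" 1 x] by simp_all

lemma laplacian_conv:
  fixes h f :: "'a::euclidean_space => complex"
  assumes h: "Ck_on 2 UNIV h" and f: "integrable lborel f" "bsupp f"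
  shows "laplacian (\<lambda>x. LBINT z. h (x - z) * f z) x = (LBINT z. laplacian h (x - z) * f z)"
proof -
  note F = Ck_on_2D[OF open_UNIV h]
  have "laplacian (\<lambda>x. LBINT z. h (x - z) * f z) x = (\<Sum>b\<in>Basis. LBINT z. pd (pd h b) b (x - z) * f z)"
    by (rule laplacian_eqI[OF open_UNIV, where f' = "\<lambda>x v. LBINT z. pd h v (x - z) * f z"
        and f'' = "\<lambda>b v. LBINT z. pd (pd h b) v (x - z) * f z"])
       (auto intro!: conv_has_derivative F f simp del: Ck_on.simps One_nat_def)
  also have "\<dots> = (LBINT z. laplacian h (x - z) * f z)"
    unfolding laplacian_def sum_distrib_right
    by (rule Bochner_Integration.integral_sum[symmetric]) (intro conv_integrable F f)
  finally show ?thesis .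
qed

text \<open>The difference of the integrands is the divergence of the field u grad \<phi> - \<phi>
  grad u, whose components \<open>w b\<close> have bounded support.\<close>

lemma green_identity:
  fixes u \<phi> :: "'a::euclidean_space => complex"
  assumes u: "Ck_on 2 UNIV u" and \<phi>: "Ck_on 2 UNIV \<phi>" "bsupp \<phi>"
  shows "(LBINT x. u x * laplacian \<phi> x) = (LBINT x. laplacian u x * \<phi> x)"
proof -
  note U = Ck_on_2D[OF open_UNIV u] and F = Ck_on_2D[OF open_UNIV \<phi>(1)]
  define w where "w b x = u x * pd \<phi> b x - \<phi> x * pd u b x" for b x
  have w1: "Ck_on 1 UNIV (w b)" for b
    unfolding w_def by (intro Ck_on_diff Ck_on_mult U F) auto
  have ws: "bsupp (w b)" for b
    unfolding w_def diff_conv_add_uminus mult_minus_right[symmetric]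
    by (intro bsupp_add bsupp_mult_right bsupp_mult_left bsupp_frechet_derivative \<phi>)
  have wd: "pd (w b) b x = u x * pd (pd \<phi> b) b x - pd (pd u b) b x * \<phi> x" for b x
  proof -
    have "(w b has_derivative (\<lambda>h. (u x * pd (pd \<phi> b) h x + pd u h x * pd \<phi> b x) - (\<phi> x * pd (pd u b) h x + pd \<phi> h x * pd u b x))) (at x)"
      unfolding w_def by (intro has_derivative_diff has_derivative_mult U F UNIV_I)
    from frechet_derivative_eqI[OF this] show ?thesis by (simp add: algebra_simps)
  qed
  have wi: "integrable lborel (pd (w b) b)" for b
    using Ck_on_SucD(2)[of UNIV 0 "w b"] w1 ws
    by (intro continuous_bsupp_integrable bsupp_frechet_derivative) auto
  have "(LBINT x. (\<Sum>b\<in>Basis. pd (w b) b x)) = 0"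
    by (subst Bochner_Integration.integral_sum) (auto simp: integral_frechet_derivative_eq_0[OF w1 ws] wi)
  moreover have "(\<Sum>b\<in>Basis. pd (w b) b x) = u x * laplacian \<phi> x - laplacian u x * \<phi> x" for x
    unfolding wd laplacian_def by (simp add: sum_subtractf sum_distrib_left sum_distrib_right)
  moreover have "integrable lborel (\<lambda>x. u x * laplacian \<phi> x)" "integrable lborel (\<lambda>x. laplacian u x * \<phi> x)"
    by (intro continuous_bsupp_integrable continuous_on_mult U continuous_on_laplacian bsupp_mult_right
        bsupp_laplacian u \<phi> F open_UNIV)+
  ultimately show ?thesis by simp
qed

text \<open>The variable is the squared norm, a polynomial and hence smooth at the origin. Apart
  from the shift \<open>c\<close>, the Laplacian becomes 4 s g'' + 2 n g' in the variable s = |x|^2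
  and dimension n.\<close>

lemma laplacian_radial:
  fixes g :: "real => complex" and x :: "'a::euclidean_space"
  assumes S: "open S" "x \<in> S" "\<And>y. y \<in> S \<Longrightarrow> y \<bullet> y + c \<in> T"
    and g: "\<And>s. s \<in> T \<Longrightarrow> (g has_vector_derivative g1 s) (at s)"
    and g1: "\<And>s. s \<in> T \<Longrightarrow> (g1 has_vector_derivative g2 s) (at s)"
  shows "laplacian (\<lambda>x. g (x \<bullet> x + c)) x = of_real (4 * (x \<bullet> x)) * g2 (x \<bullet> x + c) + of_real (2 * real DIM('a)) * g1 (x \<bullet> x + c)"
    and "pd (\<lambda>x. g (x \<bullet> x + c)) h x = of_real (2 * (x \<bullet> h)) * g1 (x \<bullet> x + c)"
proof -
  have q: "((\<lambda>y. y \<bullet> y + c) has_derivative (\<lambda>h. 2 * (y \<bullet> h))) (at y)" for y :: 'a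
    by (auto intro!: derivative_eq_intros simp: inner_commute)
  have d1: "((\<lambda>x. g (x \<bullet> x + c)) has_derivative (\<lambda>h. (2 * (y \<bullet> h)) *\<^sub>R g1 (y \<bullet> y + c))) (at y)" if "y \<in> S" for y
    using has_derivative_compose[OF q g[unfolded has_vector_derivative_def]] S(3)[OF that] by auto
  have "laplacian (\<lambda>x. g (x \<bullet> x + c)) x = (\<Sum>b\<in>Basis. (2 * (x \<bullet> b)) *\<^sub>R (2 * (x \<bullet> b)) *\<^sub>R g2 (x \<bullet> x + c) + (2 * (b \<bullet> b)) *\<^sub>R g1 (x \<bullet> x + c))"
  proof (rule laplacian_eqI[OF S(1,2) d1, where f'' = "\<lambda>b h. (2 * (x \<bullet> b)) *\<^sub>R (2 * (x \<bullet> h)) *\<^sub>R g2 (x \<bullet> x + c) + (2 * (h \<bullet> b)) *\<^sub>R g1 (x \<bullet> x + c)"])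
    fix b :: 'a
    have "((\<lambda>x. g1 (x \<bullet> x + c)) has_derivative (\<lambda>h. (2 * (x \<bullet> h)) *\<^sub>R g2 (x \<bullet> x + c))) (at x)"
      using has_derivative_compose[OF q g1[unfolded has_vector_derivative_def]] S by auto
    then show "((\<lambda>y. (2 * (y \<bullet> b)) *\<^sub>R g1 (y \<bullet> y + c)) has_derivative
      (\<lambda>h. (2 * (x \<bullet> b)) *\<^sub>R (2 * (x \<bullet> h)) *\<^sub>R g2 (x \<bullet> x + c) + (2 * (h \<bullet> b)) *\<^sub>R g1 (x \<bullet> x + c))) (at x)"
      by (intro has_derivative_scaleR) (auto intro!: derivative_eq_intros)
  qed
  also have "\<dots> = of_real (4 * (\<Sum>b\<in>Basis. (x \<bullet> b)\<^sup>2)) * g2 (x \<bullet> x + c) + of_real (2 * real DIM('a)) * g1 (x \<bullet> x + c)"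
    by (simp add: sum.distrib scaleR_conv_of_real sum_distrib_left sum_distrib_right power2_eq_square algebra_simps inner_Basis)
  also have "(\<Sum>b\<in>Basis. (x \<bullet> b)\<^sup>2) = x \<bullet> x"
    by (simp add: euclidean_inner[of x x] power2_eq_square)
  finally show "laplacian (\<lambda>x. g (x \<bullet> x + c)) x = of_real (4 * (x \<bullet> x)) * g2 (x \<bullet> x + c) + of_real (2 * real DIM('a)) * g1 (x \<bullet> x + c)" .
  show "pd (\<lambda>x. g (x \<bullet> x + c)) h x = of_real (2 * (x \<bullet> h)) * g1 (x \<bullet> x + c)"
    using frechet_derivative_eqI[OF d1[OF S(2)]] by (simp add: scaleR_conv_of_real)
qed

text \<open>Polar coordinates for radial integrands: both measures give the half-line up to r >= 0
  the volume 4/3 pi r^3 of a ball, and half-lines generate the Borel sets.\<close>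

lemma distr_lborel_norm:
  "distr lborel borel (norm :: real^3 => real) = density lborel (\<lambda>r. ennreal (if r \<ge> 0 then 4 * pi * r\<^sup>2 else 0))"
    (is "?M = ?N")
proof (rule measure_eqI_generator_eq[where E = "range atMost" and \<Omega> = UNIV and A = "\<lambda>n. {..real n}"])
  have em: "emeasure ?M {..r} = emeasure ?N {..r} \<and> emeasure ?M {..r} \<noteq> \<infinity>" for r
  proof -
    have "norm -` {..r} = cball (0::real^3) r" by auto
    then have M: "emeasure ?M {..r} = emeasure lborel (cball (0::real^3) r)"
      by (subst emeasure_distr) auto
    have N: "emeasure ?N {..r} = (\<integral>\<^sup>+x. ennreal (4 * pi * x\<^sup>2) * indicator {0..r} x \<partial>lborel)"
      by (subst emeasure_density) (auto intro!: nn_integral_cong simp: indicator_def)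
    show ?thesis
    proof (cases "r < 0")
      case True
      then show ?thesis unfolding M N by simp
    next
      case False
      have "(\<integral>\<^sup>+x. ennreal (4 * pi * x\<^sup>2) * indicator {0..r} x \<partial>lborel) = ennreal (4 / 3 * pi * r ^ 3 - 4 / 3 * pi * 0 ^ 3)"
        by (rule nn_integral_FTC_Icc)
           (use False in \<open>auto intro!: derivative_eq_intros simp: power2_eq_square has_real_derivative_iff_has_vector_derivative[symmetric]\<close>)
      moreover have "emeasure lborel (cball (0::real^3) r) = ennreal (4 / 3 * pi * r ^ 3)"
        using False by (simp add: emeasure_cball unit_ball_vol_3 ennreal_mult'')
      ultimately show ?thesis unfolding M N by simp
    qed
  qed
  show "emeasure ?M X = emeasure ?N X" if "X \<in> range atMost" for X using em that by auto
  show "emeasure ?M {..real i} \<noteq> \<infinity>" for i :: nat using em[of "real i"] by metis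
  show "Int_stable (range atMost :: real set set)" by (auto simp: Int_stable_def)
  show "sets ?M = sigma_sets UNIV (range atMost)" "sets ?N = sigma_sets UNIV (range atMost)"
    by (simp_all add: borel_eq_atMost)
  show "(\<Union>i. {..real i}) = UNIV"
    by (auto simp: real_arch_simple)
qed auto

lemma lborel_radial:
  fixes f :: "real => 'b::{banach, second_countable_topology}"
  assumes [measurable]: "f \<in> borel_measurable borel"
  shows "(LBINT x. f (norm (x::real^3))) = (LBINT r. (if r \<ge> 0 then 4 * pi * r\<^sup>2 else 0) *\<^sub>R f r)"
    and "integrable lborel (\<lambda>x::real^3. f (norm x)) \<longleftrightarrow> integrable lborel (\<lambda>r. (if r \<ge> 0 then 4 * pi * r\<^sup>2 else 0) *\<^sub>R f r)"
  using integral_distr[of "norm :: real^3 => real" lborel borel f] integrable_distr_eq[of "norm :: real^3 => real" lborel borel f]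
  unfolding distr_lborel_norm by (simp_all add: integral_density integrable_density)

section \<open>The outgoing fundamental solution\<close>

text \<open>The factor r^2 of polar coordinates cancels both singularities. The squared one is what
  allows the kernel to be paired with functions that are merely in L^2.\<close>

lemma integrable_inverse_norm:
  "integrable lborel (\<lambda>x::real^3. indicator (cball 0 R) x / norm x)"
  "integrable lborel (\<lambda>x::real^3. indicator (cball 0 R) x / (norm x)\<^sup>2)"
proof -
  have "integrable lborel (\<lambda>x::real^3. (\<lambda>r. indicator {0..R} r / r ^ k) (norm x))" if "k = 1 \<or> k = 2" for k :: nat
  proof (subst lborel_radial(2))
    show "integrable lborel (\<lambda>r. (if 0 \<le> r then 4 * pi * r\<^sup>2 else 0) *\<^sub>R (indicator {0..R} r / r ^ k))"
    proof (rule bintegrable_bound)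
      show "integrable lborel (\<lambda>r. indicator {0..R} r *\<^sub>R (4 * pi * (1 + \<bar>R\<bar>)))"
        by (intro integrable_scaleR_left integrable_real_indicator) (auto simp: emeasure_lborel_Icc_eq)
      show "AE r in lborel. norm ((if 0 \<le> r then 4 * pi * r\<^sup>2 else 0) *\<^sub>R (indicator {0..R} r / r ^ k)) \<le> norm (indicator {0..R} r *\<^sub>R (4 * pi * (1 + \<bar>R\<bar>)))"
        using that by (intro AE_I2) (auto simp: indicator_def power2_eq_square)
    qed measurable
  qed measurable
  from this[of 1] this[of 2]
  show "integrable lborel (\<lambda>x::real^3. indicator (cball 0 R) x / norm x)"
    "integrable lborel (\<lambda>x::real^3. indicator (cball 0 R) x / (norm x)\<^sup>2)"
    by (simp_all add: indicator_def cong: if_cong)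
qed

text \<open>The kernel in the variable s = |x|^2 of \<open>laplacian_radial\<close>;
  \<open>Gr1\<close> and \<open>Gr2\<close> are its first two derivatives in s
  (\<open>Gr_deriv\<close>).\<close>

definition Gr :: "real => real => complex" where
  "Gr \<kappa> s = - exp (\<i> * of_real \<kappa> * of_real (sqrt s)) / of_real (4 * pi * sqrt s)"

definition Gr1 :: "real => real => complex" where
  "Gr1 \<kappa> s = - exp (\<i> * of_real \<kappa> * of_real (sqrt s)) / of_real (8 * pi) *
     (\<i> * of_real \<kappa> / of_real (sqrt s) ^ 2 - 1 / of_real (sqrt s) ^ 3)"

definition Gr2 :: "real => real => complex" where
  "Gr2 \<kappa> s = - exp (\<i> * of_real \<kappa> * of_real (sqrt s)) / of_real (16 * pi) *
     (3 / of_real (sqrt s) ^ 5 - 3 * \<i> * of_real \<kappa> / of_real (sqrt s) ^ 4 - of_real \<kappa> ^ 2 / of_real (sqrt s) ^ 3)"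

lemma Gplus_Gr: "Gplus x \<kappa> = Gr \<kappa> (x \<bullet> x)"
  by (simp add: Gplus_def Gr_def norm_eq_sqrt_inner)

lemma of_real_sqrt_deriv:
  "s > 0 \<Longrightarrow> ((\<lambda>s. complex_of_real (sqrt s)) has_vector_derivative 1 / (2 * of_real (sqrt s))) (at s)"
proof -
  assume "s > 0"
  then have "(sqrt has_real_derivative 1 / (2 * sqrt s)) (at s)"
    by (auto intro!: derivative_eq_intros simp: divide_simps)
  from has_vector_derivative_of_real[OF this, where 'a = complex] show ?thesis by simp
qed

lemma Gr_sqrt_chain:
  assumes "s > 0" "(f has_field_derivative f') (at (complex_of_real (sqrt s)))"
  shows "((\<lambda>s. f (complex_of_real (sqrt s))) has_vector_derivative f' / (2 * of_real (sqrt s))) (at s)"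
  using field_vector_diff_chain_at[OF of_real_sqrt_deriv[OF assms(1)] assms(2)] by (simp add: o_def)

lemma Gr_deriv:
  assumes s: "s > 0"
  shows "(Gr \<kappa> has_vector_derivative Gr1 \<kappa> s) (at s)"
    and "(Gr1 \<kappa> has_vector_derivative Gr2 \<kappa> s) (at s)"
proof -
  define \<rho> where "\<rho> = complex_of_real (sqrt s)"
  have \<rho>: "\<rho> \<noteq> 0" using s by (simp add: \<rho>_def)
  define E where "E = exp (\<i> * of_real \<kappa> * \<rho>)"
  have dE: "((\<lambda>z. exp (\<i> * of_real \<kappa> * z)) has_field_derivative \<i> * of_real \<kappa> * E) (at \<rho>)"
    by (auto intro!: derivative_eq_intros simp: E_def)
  have 1: "((\<lambda>z. - exp (\<i> * of_real \<kappa> * z) / (4 * pi * z)) has_field_derivative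
     - E / (4 * pi) * (\<i> * of_real \<kappa> / \<rho> - 1 / \<rho>\<^sup>2)) (at \<rho>)"
  proof -
    have "((\<lambda>z. - exp (\<i> * of_real \<kappa> * z) / (4 * pi * z)) has_field_derivative
       ((- (\<i> * of_real \<kappa> * E)) * (4 * pi * \<rho>) - (- exp (\<i> * of_real \<kappa> * \<rho>)) * (4 * pi)) / ((4 * pi * \<rho>) * (4 * pi * \<rho>))) (at \<rho>)"
      by (intro DERIV_divide DERIV_minus dE) (use \<rho> in \<open>auto intro!: derivative_eq_intros\<close>)
    then show ?thesis unfolding E_def[symmetric]
      by (rule DERIV_cong) (use \<rho> in \<open>simp add: field_simps power2_eq_square\<close>)
  qed
  have "((\<lambda>s. - exp (\<i> * of_real \<kappa> * of_real (sqrt s)) / (4 * pi * of_real (sqrt s))) has_vector_derivative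
     (- E / (4 * pi) * (\<i> * of_real \<kappa> / \<rho> - 1 / \<rho>\<^sup>2)) / (2 * \<rho>)) (at s)"
    using Gr_sqrt_chain[OF s 1[unfolded \<rho>_def]] by (simp add: \<rho>_def)
  moreover have "(- E / (4 * pi) * (\<i> * of_real \<kappa> / \<rho> - 1 / \<rho>\<^sup>2)) / (2 * \<rho>) = Gr1 \<kappa> s"
    unfolding Gr1_def \<rho>_def[symmetric] E_def[symmetric] using \<rho> by (simp add: field_simps eval_nat_numeral)
  ultimately show "(Gr \<kappa> has_vector_derivative Gr1 \<kappa> s) (at s)"
    unfolding Gr_def[abs_def] by simp
  have 2: "((\<lambda>z. - exp (\<i> * of_real \<kappa> * z) / of_real (8 * pi) * (\<i> * of_real \<kappa> / z ^ 2 - 1 / z ^ 3)) has_field_derivative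
     - E / (8 * pi) * (3 / \<rho> ^ 4 - 3 * \<i> * of_real \<kappa> / \<rho> ^ 3 - of_real \<kappa> ^ 2 / \<rho> ^ 2)) (at \<rho>)"
  proof -
    have "((\<lambda>z. \<i> * of_real \<kappa> / z ^ 2 - 1 / z ^ 3) has_field_derivative (3 / \<rho> ^ 4 - 2 * \<i> * of_real \<kappa> / \<rho> ^ 3)) (at \<rho>)"
    proof -
      have "((\<lambda>z. \<i> * of_real \<kappa> / z ^ 2 - 1 / z ^ 3) has_field_derivative
         (0 * \<rho>\<^sup>2 - \<i> * of_real \<kappa> * (2 * \<rho>)) / (\<rho>\<^sup>2 * \<rho>\<^sup>2) - (0 * \<rho> ^ 3 - 1 * (3 * \<rho>\<^sup>2)) / (\<rho> ^ 3 * \<rho> ^ 3)) (at \<rho>)"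
        by (intro DERIV_diff DERIV_divide) (use \<rho> in \<open>auto intro!: derivative_eq_intros\<close>)
      then show ?thesis
        by (rule DERIV_cong) (use \<rho> in \<open>simp add: divide_simps eval_nat_numeral\<close>)
    qed
    moreover have "((\<lambda>z. - exp (\<i> * of_real \<kappa> * z) / of_real (8 * pi)) has_field_derivative - (\<i> * of_real \<kappa> * E) / of_real (8 * pi)) (at \<rho>)"
      by (intro DERIV_cdivide DERIV_minus dE)
    ultimately have "((\<lambda>z. - exp (\<i> * of_real \<kappa> * z) / of_real (8 * pi) * (\<i> * of_real \<kappa> / z ^ 2 - 1 / z ^ 3)) has_field_derivative
       - (\<i> * of_real \<kappa> * E) / of_real (8 * pi) * (\<i> * of_real \<kappa> / \<rho> ^ 2 - 1 / \<rho> ^ 3) +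
       (3 / \<rho> ^ 4 - 2 * \<i> * of_real \<kappa> / \<rho> ^ 3) * (- E / of_real (8 * pi))) (at \<rho>)"
      unfolding E_def by (rule DERIV_mult[rotated])
    then show ?thesis
      by (rule DERIV_cong) (use \<rho> in \<open>simp add: divide_simps eval_nat_numeral, simp add: algebra_simps\<close>)
  qed
  have "((\<lambda>s. - exp (\<i> * of_real \<kappa> * of_real (sqrt s)) / of_real (8 * pi) * (\<i> * of_real \<kappa> / of_real (sqrt s) ^ 2 - 1 / of_real (sqrt s) ^ 3)) has_vector_derivative
     (- E / (8 * pi) * (3 / \<rho> ^ 4 - 3 * \<i> * of_real \<kappa> / \<rho> ^ 3 - of_real \<kappa> ^ 2 / \<rho> ^ 2)) / (2 * \<rho>)) (at s)"
    using Gr_sqrt_chain[OF s 2[unfolded \<rho>_def]] by (simp add: \<rho>_def)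
  moreover have "(- E / (8 * pi) * (3 / \<rho> ^ 4 - 3 * \<i> * of_real \<kappa> / \<rho> ^ 3 - of_real \<kappa> ^ 2 / \<rho> ^ 2)) / (2 * \<rho>) = Gr2 \<kappa> s"
    unfolding Gr2_def \<rho>_def[symmetric] E_def[symmetric] using \<rho> by (simp add: field_simps eval_nat_numeral)
  ultimately show "(Gr1 \<kappa> has_vector_derivative Gr2 \<kappa> s) (at s)"
    unfolding Gr1_def[abs_def] by simp
qed

text \<open>The radial Helmholtz equation of dimension 3 in the variable s.\<close>

lemma Gr_ode:
  assumes "s > 0" shows "of_real (4 * s) * Gr2 \<kappa> s + 6 * Gr1 \<kappa> s + of_real (\<kappa>\<^sup>2) * Gr \<kappa> s = 0"
proof -
  define \<rho> where "\<rho> = complex_of_real (sqrt s)"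
  have \<rho>: "\<rho> \<noteq> 0" "of_real s = \<rho> * \<rho>" using assms by (auto simp: \<rho>_def simp flip: of_real_mult)
  show ?thesis
    unfolding Gr2_def Gr1_def Gr_def \<rho>_def[symmetric] of_real_mult \<rho>(2) of_real_power
    using \<rho>(1) by (simp add: divide_simps eval_nat_numeral) (simp add: algebra_simps)
qed

text \<open>On the positive half-line \<open>Gr\<close> is the restriction of a function holomorphic
  off the nonpositive reals, so its derivatives of all orders are restricted complex derivatives and
  need no formulas.\<close>

lemma Ck_on_Gr: "Ck_on k {0<..} (Gr \<kappa>)"
proof -
  define F where "F z = - exp (\<i> * of_real \<kappa> * csqrt z) / (4 * pi * csqrt z)" for z
  define S where "S = - (\<real>\<^sub>\<le>\<^sub>0 :: complex set)"
  have S: "open S" by (simp add: S_def open_Compl)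
  have F: "F holomorphic_on S"
    unfolding F_def S_def by (intro holomorphic_intros) auto
  define G where "G n t = (deriv ^^ n) F (complex_of_real t)" for n t
  have "Ck_on k {0<..} (G 0)"
  proof (rule Ck_on_real_sequence)
    fix n and t :: real assume t: "t \<in> {0<..}"
    then have tS: "complex_of_real t \<in> S" by (auto simp: S_def complex_nonpos_Reals_iff)
    have "((deriv ^^ n) F has_field_derivative (deriv ^^ Suc n) F (complex_of_real t)) (at (complex_of_real t))"
      using holomorphic_derivI[OF holomorphic_higher_deriv[OF F S, of n] S tS] by simp
    then show "(G n has_vector_derivative G (Suc n) t) (at t)"
      unfolding G_def by (rule has_vector_derivative_real_field)
  qed simp
  moreover have "G 0 t = Gr \<kappa> t" if "t \<in> {0<..}" for t
    using that by (simp add: G_def F_def Gr_def)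
  ultimately show ?thesis using Ck_on_cong[of "{0<..}" "G 0" "Gr \<kappa>" k] by auto
qed

lemma norm_Gplus: "norm (Gplus x \<kappa>) = 1 / (4 * pi * norm x)"
  by (simp add: Gplus_def norm_divide norm_mult)

lemma Gplus_measurable [measurable]: "(\<lambda>x. Gplus x \<kappa>) \<in> borel_measurable borel"
  unfolding Gplus_def by measurable

lemma open_minus_zero: "open (- {0::real^3})" by auto

lemma Ck_on_inner_self: "open S \<Longrightarrow> Ck_on k S (\<lambda>x::real^3. x \<bullet> x + c)"
  by (intro Ck_on_add Ck_on_inner Ck_on_const Ck_on_bounded_linear bounded_linear_ident)

lemma Ck_on_Gplus: "Ck_on k (- {0}) (\<lambda>x. Gplus x \<kappa>)"
  unfolding Gplus_Gr
  using Ck_on_compose_real[of "- {0}" "{0<..}" "\<lambda>x::real^3. x \<bullet> x + 0" k "Gr \<kappa>"]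
    Ck_on_Gr Ck_on_inner_self[of "- {0}" k 0] by (simp add: open_Compl image_subset_iff)

lemma helmholtz_Gplus:
  assumes "x \<noteq> 0" shows "laplacian (\<lambda>x. Gplus x \<kappa>) x + of_real (\<kappa>\<^sup>2) * Gplus x \<kappa> = 0"
proof -
  have p: "x \<bullet> x > 0" using assms by simp
  have "laplacian (\<lambda>x. Gr \<kappa> (x \<bullet> x + 0)) x = of_real (4 * (x \<bullet> x)) * Gr2 \<kappa> (x \<bullet> x + 0) + of_real (2 * real DIM(real^3)) * Gr1 \<kappa> (x \<bullet> x + 0)"
    by (rule laplacian_radial(1)[of "- {0}" _ _ "{0<..}"]) (use assms Gr_deriv in auto)
  then show ?thesis using Gr_ode[OF p, of \<kappa>] unfolding Gplus_Gr by (simp add: algebra_simps)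
qed

lemma pd_Gplus:
  assumes "x \<noteq> 0" shows "pd (\<lambda>x. Gplus x \<kappa>) h x = of_real (2 * (x \<bullet> h)) * Gr1 \<kappa> (x \<bullet> x)"
  using laplacian_radial(2)[of "- {0}" x 0 "{0<..}" "Gr \<kappa>" "Gr1 \<kappa>" "Gr2 \<kappa>" h] assms Gr_deriv
  by (auto simp: Gplus_Gr)

lemma integrable_Gplus_bounded:
  assumes [measurable]: "g \<in> borel_measurable borel" and B: "\<And>x. norm (g x) \<le> B"
    and R: "\<And>x. norm x > R \<Longrightarrow> g x = 0"
  shows "integrable lborel (\<lambda>x. Gplus x \<kappa> * g x)"
    and "(LBINT x. norm (Gplus x \<kappa> * g x)) \<le> B * (\<integral>x. indicator (cball 0 R) x / norm x \<partial>(lborel :: (real^3) measure))"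
proof -
  have B0: "B \<ge> 0" using B[of 0] norm_ge_zero order_trans by blast
  have bd: "norm (Gplus x \<kappa> * g x) \<le> B * (indicator (cball 0 R) x / norm x)" for x
  proof (cases "norm x > R")
    case False
    have p: "4 * pi \<ge> 1" using pi_gt3 by linarith
    have "norm (Gplus x \<kappa> * g x) = norm (g x) / (4 * pi * norm x)" by (simp add: norm_mult norm_Gplus)
    also have "\<dots> \<le> B / (4 * pi * norm x)" using B by (intro divide_right_mono) auto
    also have "\<dots> = B / norm x / (4 * pi)" by simp
    also have "\<dots> \<le> B / norm x / 1" using B0 p by (intro divide_left_mono) auto
    finally show ?thesis using False by (simp add: indicator_def)
  qed (use R B0 in \<open>auto simp: indicator_def\<close>)
  note i = integrable_mult_right[OF integrable_inverse_norm(1)[of R], of B]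
  show I: "integrable lborel (\<lambda>x. Gplus x \<kappa> * g x)"
    by (rule bintegrable_bound[OF i])
       (use order_trans[OF bd abs_ge_self] in \<open>auto simp del: abs_mult abs_divide\<close>)
  have "(LBINT x. norm (Gplus x \<kappa> * g x)) \<le> (\<integral>x. B * (indicator (cball 0 R) x / norm x) \<partial>(lborel :: (real^3) measure))"
    by (rule integral_mono) (use I bd i in auto)
  then show "(LBINT x. norm (Gplus x \<kappa> * g x)) \<le> B * (\<integral>x. indicator (cball 0 R) x / norm x \<partial>(lborel :: (real^3) measure))"
    by (simp only: integral_mult_right_zero)
qed

text \<open>The positive and the negative part are densities of two measures that agree on boxes, an
  intersection-stable generator of the Borel sets. So the two parts agree almost everywhere, and at
  each point at most one of them is non-zero.\<close>

lemma AE_zero_if_box_integrals_zero_real: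
  fixes g :: "'a::euclidean_space => real"
  assumes g: "integrable lborel g" and z: "\<And>a b. (LBINT x. indicator (box a b) x *\<^sub>R g x) = 0"
  shows "AE x in lborel. g x = 0"
proof -
  have [measurable]: "g \<in> borel_measurable borel" using g by auto
  let ?M = "\<lambda>h. density lborel (\<lambda>x. ennreal (h x))" and ?p = "\<lambda>x. max 0 (g x)" and ?n = "\<lambda>x. max 0 (- g x)"
  let ?E = "range (\<lambda>(a, b). box a b :: 'a set)"
  have e: "emeasure (?M h) (box a b) = ennreal (LBINT x. indicator (box a b) x *\<^sub>R h x)" "integrable lborel (\<lambda>x. indicator (box a b) x *\<^sub>R h x)"
    if "integrable lborel h" "\<And>x. h x \<ge> 0" for h and a b :: 'a
  proof -
    show i: "integrable lborel (\<lambda>x. indicator (box a b) x *\<^sub>R h x)" using integrable_mult_indicator[OF _ that(1)] by simp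
    have [measurable]: "h \<in> borel_measurable borel" using that(1) by auto
    have "emeasure (?M h) (box a b) = (\<integral>\<^sup>+x. ennreal (indicator (box a b) x *\<^sub>R h x) \<partial>lborel)"
      by (subst emeasure_density) (auto intro!: nn_integral_cong simp: indicator_def)
    then show "emeasure (?M h) (box a b) = ennreal (LBINT x. indicator (box a b) x *\<^sub>R h x)"
      using nn_integral_eq_integral[OF i] that(2) by simp
  qed
  note P = e[of ?p, OF integrable_max[OF integrable_zero g] max.cobounded1] and N = e[of ?n, OF integrable_max[OF integrable_zero integrable_minus[OF g]] max.cobounded1]
  have "?M ?p = ?M ?n"
  proof (rule measure_eqI_generator_eq[of ?E UNIV _ _ "\<lambda>n::nat. box (- (real n *\<^sub>R One)) (real n *\<^sub>R One)"])
    show "Int_stable ?E" by (auto simp: Int_stable_def box_Int_box)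
    show "emeasure (?M ?p) X = emeasure (?M ?n) X" if X': "X \<in> ?E" for X
    proof -
      obtain a b where X: "X = box a b" using X' by auto
      have "(LBINT x. indicator X x *\<^sub>R ?p x) - (LBINT x. indicator X x *\<^sub>R ?n x) = (LBINT x. indicator X x *\<^sub>R g x)"
        unfolding X by (subst bint_diff[OF P(2) N(2), symmetric]) (auto intro!: bint_cong simp: max_def)
      then show ?thesis using z unfolding X by (simp add: P N)
    qed
    show "emeasure (?M ?p) (box (- (real n *\<^sub>R One)) (real n *\<^sub>R One)) \<noteq> \<infinity>" for n by (simp add: P)
  qed (auto simp: borel_eq_box UN_box_eq_UNIV)
  then have "AE x in lborel. ennreal (?p x) = ennreal (?n x)"
    using sigma_finite_measure.density_unique_iff[OF lborel.sigma_finite_measure_axioms, of "\<lambda>x. ennreal (?p x)" "\<lambda>x. ennreal (?n x)"] by simp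
  then show ?thesis by eventually_elim (auto simp: max_def split: if_splits)
qed

lemma AE_zero_if_box_integrals_zero:
  fixes f :: "'a::euclidean_space => complex"
  assumes f: "integrable lborel f" and z: "\<And>a b. (LBINT x. indicator (box a b) x *\<^sub>R f x) = 0"
  shows "AE x in lborel. f x = 0"
proof -
  have i: "integrable lborel (\<lambda>x. indicator (box a b) x *\<^sub>R f x)" for a b using integrable_mult_indicator[OF _ f] by simp
  have "AE x in lborel. Re (f x) = 0" "AE x in lborel. Im (f x) = 0"
    using integral_Re[OF i] integral_Im[OF i] f z by (auto intro!: AE_zero_if_box_integrals_zero_real)
  then show ?thesis by eventually_elim (auto simp: complex_eq_iff)
qed

definition loc_integrable :: "('a::euclidean_space => complex) => bool" where
  "loc_integrable f \<longleftrightarrow> (\<forall>R. integrable lborel (\<lambda>x. indicator (cball 0 R) x *\<^sub>R f x))"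

lemma loc_integrable_bsupp_mult:
  assumes f: "loc_integrable f" and g: "continuous_on UNIV g" "bsupp g"
  shows "integrable lborel (\<lambda>x. f x * g x)"
proof -
  obtain R where R: "\<And>x. norm x > R \<Longrightarrow> g x = 0" using g by (auto simp: bsupp_def)
  obtain B where B: "\<And>x. norm (g x) \<le> B" using continuous_bsupp_bounded[OF g] by metis
  have "integrable lborel (\<lambda>x. (indicator (cball 0 R) x *\<^sub>R f x) * g x)"
    using f B g(1) unfolding loc_integrable_def
    by (intro integrable_mult_bounded(2)[where B = B]) (auto intro: borel_measurable_continuous_onI)
  moreover have "(indicator (cball 0 R) x *\<^sub>R f x) * g x = f x * g x" for x
    using R[of x] by (cases "norm x > R") (auto simp: indicator_def)
  ultimately show ?thesis by simp
qed

lemma continuous_off_point_borel: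
  fixes \<psi> :: "real^3 => complex"
  shows "continuous_on (- {y}) \<psi> \<Longrightarrow> \<psi> \<in> borel_measurable borel"
  by (rule borel_measurable_continuous_countable_exceptions[of "{y}"]) auto

abbreviation (input) helm :: "real => ('a::euclidean_space => complex) => 'a => complex" where
  "helm \<kappa> f x \<equiv> laplacian f x + of_real (\<kappa>\<^sup>2) * f x"

section \<open>Cut-offs and a smooth parametrix of the Helmholtz operator\<close>

lemma Ck_on_Union:
  "(\<And>S. S \<in> F \<Longrightarrow> open S \<and> Ck_on k S f) \<Longrightarrow> Ck_on k (\<Union>F) f"
proof (induction k arbitrary: f)
  case 0 then show ?case by (auto intro: continuous_on_open_Union)
next
  case (Suc k)
  have "f differentiable at x" if "x \<in> S" "S \<in> F" for x S
    using Suc.prems[OF that(2)] that(1) by (auto simp: differentiable_on_eq_differentiable_at)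
  then have "f differentiable_on \<Union>F"
    using Suc.prems by (auto simp: differentiable_on_eq_differentiable_at open_Union)
  moreover have "Ck_on k (\<Union>F) (pd f h)" for h by (rule Suc.IH) (use Suc.prems in auto)
  ultimately show ?case by simp
qed

lemma Ck_on_UNIV_balls:
  assumes "\<And>R. R > 0 \<Longrightarrow> Ck_on k (ball 0 R) f" shows "Ck_on k UNIV f"
proof -
  have "Ck_on k (\<Union>{ball 0 R |R. R > 0}) f" by (rule Ck_on_Union) (use assms in auto)
  moreover have "(\<Union>{ball 0 R |R. R > 0}) = (UNIV :: 'a set)"
  proof -
    have "x \<in> \<Union>{ball 0 R |R. R > 0}" for x :: 'a
    proof -
      have "x \<in> ball 0 (norm x + 1)" "norm x + 1 > 0" by (auto simp: add_nonneg_pos)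
      then show ?thesis by blast
    qed
    then show ?thesis by auto
  qed
  ultimately show ?thesis by simp
qed

text \<open>A function of |x|^2 and hence smooth at 0. The transition takes place for R^2 \<le>
  |x|^2 \<le> 2 R^2, strictly inside the ball of radius 2 R.\<close>

definition cutoff :: "real => real^3 => complex" where
  "cutoff R x = of_real (sstep (2 - (x \<bullet> x) / R\<^sup>2))"

lemma Ck_on_quadratic: "open S \<Longrightarrow> Ck_on k S (\<lambda>x::real^3. c - (x \<bullet> x) * d)"
  by (intro Ck_on_diff Ck_on_mult Ck_on_inner Ck_on_const Ck_on_bounded_linear bounded_linear_ident)

lemma Ck_on_cutoff: "Ck_on k UNIV (cutoff R)"
  unfolding cutoff_def divide_inverse
  by (intro Ck_on_bounded_linear_compose[OF bounded_linear_of_real] Ck_on_compose_real[OF _ _ subset_UNIV _ Ck_on_sstep] Ck_on_quadratic open_UNIV)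

lemma cutoff_1: "R > 0 \<Longrightarrow> norm x \<le> R \<Longrightarrow> cutoff R x = 1"
proof -
  assume "R > 0" "norm x \<le> R"
  then have "(x \<bullet> x) / R\<^sup>2 \<le> 1" by (simp add: power2_norm_eq_inner[symmetric] power_mono)
  then show ?thesis by (simp add: cutoff_def sstep_eq_1)
qed

lemma cutoff_0: "R > 0 \<Longrightarrow> norm x \<ge> 2 * R \<Longrightarrow> cutoff R x = 0"
proof -
  assume R: "R > 0" "norm x \<ge> 2 * R"
  then have "(2 * R)\<^sup>2 \<le> (norm x)\<^sup>2" by (intro power_mono) auto
  then have "x \<bullet> x \<ge> 2 * R\<^sup>2" by (simp add: power2_norm_eq_inner power_mult_distrib) (smt (verit) zero_le_power2)
  then have "(x \<bullet> x) / R\<^sup>2 \<ge> 2" using R by (simp add: pos_le_divide_eq)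
  then show ?thesis by (simp add: cutoff_def sstep_eq_0)
qed

lemma bsupp_cutoff: "R > 0 \<Longrightarrow> bsupp (cutoff R)"
  unfolding bsupp_def using cutoff_0[of R] by (intro exI[of _ "2 * R"]) auto

lemma norm_cutoff: "norm (cutoff R x) \<le> 1"
  using sstep_bounds by (simp add: cutoff_def)

lemma cutoff_measurable [measurable]: "cutoff R \<in> borel_measurable borel"
  using Ck_on_imp_continuous_on[OF Ck_on_cutoff] by (rule borel_measurable_continuous_onI)

text \<open>A smooth parametrix of the Helmholtz operator and its error term.\<close>

definition Gam :: "real => real => real^3 => complex" where
  "Gam \<kappa> \<delta> x = (1 - cutoff \<delta> x) * Gplus x \<kappa>"

definition Hker :: "real => real => real^3 => complex" where
  "Hker \<kappa> \<delta> x = - (helm \<kappa> (Gam \<kappa> \<delta>) x)"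

lemma Gam_eq: "\<delta> > 0 \<Longrightarrow> norm x \<ge> 2 * \<delta> \<Longrightarrow> Gam \<kappa> \<delta> x = Gplus x \<kappa>"
  by (simp add: Gam_def cutoff_0)

lemma Ck_on_Gam:
  assumes "\<delta> > 0" shows "Ck_on k UNIV (Gam \<kappa> \<delta>)"
proof -
  have "Ck_on k (- {0}) (Gam \<kappa> \<delta>)"
    unfolding Gam_def
    by (intro Ck_on_mult Ck_on_diff Ck_on_const Ck_on_Gplus Ck_on_subset[OF _ subset_UNIV Ck_on_cutoff]) auto
  moreover have "Ck_on k (ball 0 \<delta>) (Gam \<kappa> \<delta>)"
    using Ck_on_cong[of "ball 0 \<delta>" "Gam \<kappa> \<delta>" "\<lambda>x. 0" k] assms by (simp add: Gam_def cutoff_1)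
  ultimately have "Ck_on k (- {0} \<union> ball 0 \<delta>) (Gam \<kappa> \<delta>)" by (intro Ck_on_Un) auto
  moreover have "- {0} \<union> ball (0::real^3) \<delta> = UNIV" using assms by auto
  ultimately show ?thesis by simp
qed

lemma Ck_on_Hker: "\<delta> > 0 \<Longrightarrow> Ck_on k UNIV (Hker \<kappa> \<delta>)"
  unfolding Hker_def by (intro Ck_on_minus Ck_on_add Ck_on_mult Ck_on_const Ck_on_laplacian Ck_on_Gam open_UNIV)

lemma Hker_0:
  assumes "\<delta> > 0" "norm x > 2 * \<delta>" shows "Hker \<kappa> \<delta> x = 0"
proof -
  have "open {x::real^3. norm x > 2 * \<delta>}" by (intro open_Collect_less continuous_intros)
  then have "laplacian (Gam \<kappa> \<delta>) x = laplacian (\<lambda>x. Gplus x \<kappa>) x"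
    by (rule laplacian_cong_open) (use assms in \<open>auto simp: Gam_eq\<close>)
  moreover have "x \<noteq> 0" using assms by auto
  ultimately show ?thesis using assms helmholtz_Gplus[of x \<kappa>] by (simp add: Hker_def Gam_eq)
qed

lemma bsupp_Hker: "\<delta> > 0 \<Longrightarrow> bsupp (Hker \<kappa> \<delta>)"
  unfolding bsupp_def using Hker_0 by (intro exI[of _ "2 * \<delta>"]) auto

lemma helmholtz_continuous:
  fixes \<phi> :: "'a::euclidean_space => complex"
  shows "Ck_on 2 UNIV \<phi> \<Longrightarrow> continuous_on UNIV (\<lambda>x. laplacian \<phi> x + c * \<phi> x)"
  by (intro continuous_intros continuous_on_laplacian Ck_on_imp_continuous_on[of 2] open_UNIV)

lemma helmholtz_bsupp:
  fixes \<phi> :: "'a::euclidean_space => complex"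
  shows "bsupp \<phi> \<Longrightarrow> bsupp (\<lambda>x. laplacian \<phi> x + c * \<phi> x)"
  by (intro bsupp_add bsupp_laplacian bsupp_mult_right)

lemma helmholtz_symmetric:
  fixes u \<phi> :: "'a::euclidean_space => complex"
  assumes u: "Ck_on 2 UNIV u" and \<phi>: "Ck_on 2 UNIV \<phi>" "bsupp \<phi>"
  shows "(LBINT x. u x * (laplacian \<phi> x + c * \<phi> x)) = (LBINT x. (laplacian u x + c * u x) * \<phi> x)"
proof -
  note C = Ck_on_imp_continuous_on[OF u] Ck_on_imp_continuous_on[OF \<phi>(1)]
  have I: "integrable lborel (\<lambda>x. u x * laplacian \<phi> x)" "integrable lborel (\<lambda>x. u x * (c * \<phi> x))"
    "integrable lborel (\<lambda>x. laplacian u x * \<phi> x)"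
    by (intro continuous_bsupp_integrable continuous_intros C continuous_on_laplacian u \<phi> bsupp_mult_right bsupp_laplacian open_UNIV)+
  have "(LBINT x. u x * (laplacian \<phi> x + c * \<phi> x)) = (LBINT x. u x * laplacian \<phi> x) + (LBINT x. u x * (c * \<phi> x))"
    unfolding distrib_left using I by (subst bint_add) auto
  also have "\<dots> = (LBINT x. laplacian u x * \<phi> x + u x * (c * \<phi> x))"
    using I green_identity[OF u \<phi>] by (subst bint_add) auto
  finally show ?thesis by (simp add: algebra_simps)
qed

lemma sbump_eq_0: "t < 0 \<or> t > 1 \<Longrightarrow> sbump t = 0"
proof -
  have "(sstep has_real_derivative 0) (at t)" if "t < 0"
    by (rule has_field_derivative_transform_within_open[where S = "{..<0}" and f = "\<lambda>x. 0"]) (use that in \<open>auto simp: sstep_eq_0\<close>)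
  moreover have "(sstep has_real_derivative 0) (at t)" if "t > 1"
    by (rule has_field_derivative_transform_within_open[where S = "{1<..}" and f = "\<lambda>x. 1"]) (use that in \<open>auto simp: sstep_eq_1\<close>)
  ultimately show "t < 0 \<or> t > 1 \<Longrightarrow> sbump t = 0" using sstep_deriv[of t] DERIV_unique by blast
qed

text \<open>The two-parameter profile behind \<open>cutoff\<close>. Its gradient is radial with
  weight \<open>sbump (a - (x \<bullet> x) * b)\<close>, so \<open>a\<close> and \<open>b\<close>
  place a weight on a prescribed shell; \<open>energy_flux_zero\<close> exploits this
  freedom.\<close>

definition qcut :: "real => real => real^3 => complex" where
  "qcut a b x = of_real (sstep (a - (x \<bullet> x) * b))"

lemma Ck_on_qcut: "Ck_on k UNIV (qcut a b)"
  unfolding qcut_def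
  by (intro Ck_on_bounded_linear_compose[OF bounded_linear_of_real] Ck_on_compose_real[OF _ _ subset_UNIV _ Ck_on_sstep] Ck_on_quadratic open_UNIV)

lemma cutoff_qcut: "cutoff R = qcut 2 (1 / R\<^sup>2)"
  by (simp add: fun_eq_iff cutoff_def qcut_def)

lemma pd_qcut: "pd (qcut a b) h x = - of_real (2 * b * (x \<bullet> h) * sbump (a - (x \<bullet> x) * b))"
proof -
  have "((\<lambda>y. a - (y \<bullet> y) * b) has_derivative (\<lambda>h. - (2 * (x \<bullet> h) * b))) (at x)"
    by (auto intro!: derivative_eq_intros simp: inner_commute algebra_simps)
  from has_derivative_compose[OF this sstep_deriv[unfolded has_field_derivative_def]]
  have "((\<lambda>y. sstep (a - (y \<bullet> y) * b)) has_derivative (\<lambda>h. sbump (a - (x \<bullet> x) * b) * - (2 * (x \<bullet> h) * b))) (at x)" .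
  from bounded_linear.has_derivative[OF bounded_linear_of_real this]
  have "(qcut a b has_derivative (\<lambda>h. of_real (sbump (a - (x \<bullet> x) * b) * - (2 * (x \<bullet> h) * b)))) (at x)"
    unfolding qcut_def .
  from frechet_derivative_eqI[OF this] show ?thesis by (simp add: mult_ac)
qed

lemma bsupp_qcut: "b > 0 \<Longrightarrow> bsupp (qcut a b)"
proof -
  assume b: "b > 0"
  have "qcut a b x = 0" if "norm x > 1 + \<bar>a\<bar> / b" for x
  proof -
    have "1 * (1 + \<bar>a\<bar> / b) \<le> norm x * norm x" using that b by (intro mult_mono) (auto intro: order_trans[OF _ less_imp_le[OF that]])
    then have "x \<bullet> x \<ge> \<bar>a\<bar> / b" by (simp add: power2_norm_eq_inner[symmetric] power2_eq_square)
    then have "x \<bullet> x * b \<ge> a" using b by (simp add: divide_le_eq)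
    then show ?thesis by (simp add: qcut_def sstep_eq_0)
  qed
  then show ?thesis by (auto simp: bsupp_def)
qed

lemma pd_expand:
  assumes "(f has_derivative frechet_derivative f (at x)) (at x)"
  shows "(\<Sum>b\<in>Basis. (y \<bullet> b) *\<^sub>R pd f b x) = pd f y x"
proof -
  interpret L: bounded_linear "frechet_derivative f (at x)" using assms has_derivative_bounded_linear by blast
  have "pd f y x = frechet_derivative f (at x) (\<Sum>b\<in>Basis. (y \<bullet> b) *\<^sub>R b)"
    by (simp add: euclidean_representation)
  then show ?thesis by (simp add: L.sum L.scaleR)
qed

lemma grad_qcut:
  fixes f :: "real^3 => complex"
  assumes "(f has_derivative frechet_derivative f (at x)) (at x)"
  shows "(\<Sum>c\<in>Basis. pd (qcut a b) c x * pd f c x) = - of_real (2 * b * sbump (a - (x \<bullet> x) * b)) * pd f x x"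
proof -
  have "(\<Sum>c\<in>Basis. pd (qcut a b) c x * pd f c x) = - of_real (2 * b * sbump (a - (x \<bullet> x) * b)) * (\<Sum>c\<in>Basis. (x \<bullet> c) *\<^sub>R pd f c x)"
    unfolding pd_qcut sum_distrib_left by (intro sum.cong) (auto simp: scaleR_conv_of_real)
  then show ?thesis unfolding pd_expand[OF assms] .
qed

text \<open>The commutator of the Helmholtz operator with the cut-off. As the gradient of the
  cut-off is radial, only x . grad f survives, the quantity that the radiation condition
  controls.\<close>

lemma helmholtz_qcut_mult:
  fixes f :: "real^3 => complex"
  assumes S: "open S" "x \<in> S" and f: "Ck_on 2 S f" and h: "laplacian f x + c * f x = 0"
  shows "laplacian (\<lambda>x. qcut a b x * f x) x + c * (qcut a b x * f x) =
    laplacian (qcut a b) x * f x - of_real (4 * b * sbump (a - (x \<bullet> x) * b)) * pd f x x"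
proof -
  have lf: "laplacian f x = - (c * f x)" using h by (simp add: eq_neg_iff_add_eq_0)
  show ?thesis
    unfolding laplacian_mult[OF S Ck_on_subset[OF S(1) subset_UNIV Ck_on_qcut] f] grad_qcut[OF Ck_on_2D(1)[OF S(1) f S(2)]] lf
    by (simp add: algebra_simps)
qed

lemma sbump_bounded: obtains M where "M > 0" "\<And>t. \<bar>sbump t\<bar> \<le> M"
proof (rule continuous_bsupp_bounded[of sbump])
  show "continuous_on UNIV sbump" using Ck_on_sbump[of 0] by simp
  show "bsupp sbump" unfolding bsupp_def by (intro exI[of _ 1]) (auto simp: abs_if intro!: sbump_eq_0 split: if_splits)
qed (use that in auto)

lemma laplacian_cutoff_bounded:
  obtains M where "M > 0" "\<And>R x. R > 0 \<Longrightarrow> norm (laplacian (cutoff R) x) \<le> M / R\<^sup>2"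
proof -
  obtain M where M: "M > 0" "\<And>x. norm (laplacian (cutoff 1) x) \<le> M"
    by (rule continuous_bsupp_bounded[of "laplacian (cutoff 1)"])
       (auto intro!: continuous_on_laplacian Ck_on_cutoff bsupp_laplacian bsupp_cutoff)
  have "norm (laplacian (cutoff R) x) \<le> M / R\<^sup>2" for R x
  proof -
    have "cutoff R = (\<lambda>x. cutoff 1 (0 + (1 / R) *\<^sub>R x))" by (auto simp: cutoff_def power2_eq_square)
    then have "laplacian (cutoff R) x = (1 / R)\<^sup>2 *\<^sub>R laplacian (cutoff 1) (0 + (1 / R) *\<^sub>R x)"
      using laplacian_affine[OF Ck_on_cutoff, of 1 0 "1 / R" x] by simp
    then show ?thesis using M(2) by (simp add: power_divide divide_right_mono)
  qed
  with M(1) show ?thesis by (rule that)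
qed

text \<open>Where the cut-off varies, its Laplacian has order \<delta>^-2 and the kernel order
  \<delta>^-1; the gradient term is \<delta>^-2 times x . grad of the kernel, again of order
  \<delta>^-1. The total power 3 is what the volume of the support compensates.\<close>

lemma norm_Hker_le:
  assumes \<kappa>: "\<kappa> > 0"
  obtains C where "C > 0" "\<And>\<delta> x. 0 < \<delta> \<Longrightarrow> \<delta> \<le> 1 \<Longrightarrow> norm (Hker \<kappa> \<delta> x) \<le> C / \<delta> ^ 3"
proof -
  obtain M where M: "M > 0" "\<And>t. \<bar>sbump t\<bar> \<le> M" using sbump_bounded by blast
  obtain M3 where M3: "M3 > 0" "\<And>R x. R > 0 \<Longrightarrow> norm (laplacian (cutoff R) x) \<le> M3 / R\<^sup>2" using laplacian_cutoff_bounded by blast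
  define C where "C = M3 + 4 * M * (\<kappa> + 1)"
  have C: "C > 0" using M M3 \<kappa> by (auto simp: C_def intro!: add_pos_nonneg)
  have "norm (Hker \<kappa> \<delta> x) \<le> C / \<delta> ^ 3" if \<delta>: "0 < \<delta>" "\<delta> \<le> 1" for \<delta> x
  proof (cases "norm x < \<delta>")
    case True
    then have "laplacian (Gam \<kappa> \<delta>) x = laplacian (\<lambda>x. 0) x"
      by (intro laplacian_cong_open[of "ball 0 \<delta>"]) (auto simp: Gam_def cutoff_1 \<delta>)
    then have "Hker \<kappa> \<delta> x = 0" using True \<delta> by (simp add: Hker_def laplacian_def Gam_def cutoff_1)
    then show ?thesis using C \<delta> by simp
  next
    case False
    define \<rho> where "\<rho> = norm x"
    have \<rho>: "\<delta> \<le> \<rho>" "\<rho> > 0" using False \<delta> by (auto simp: \<rho>_def)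
    have x0: "open (- {0::real^3})" "x \<in> - {0}" using \<rho> by (auto simp: \<rho>_def)
    let ?G = "\<lambda>x. Gplus x \<kappa>"
    note G = Ck_on_Gplus[of 2 \<kappa>]
    have \<chi>G: "Ck_on 2 (- {0}) (\<lambda>x. cutoff \<delta> x * ?G x)" by (intro Ck_on_mult G Ck_on_subset[OF _ subset_UNIV Ck_on_cutoff] x0)
    have "laplacian (Gam \<kappa> \<delta>) x = laplacian (\<lambda>x. ?G x + - (cutoff \<delta> x * ?G x)) x" by (simp add: Gam_def[abs_def] algebra_simps)
    also have "\<dots> = laplacian ?G x + - laplacian (\<lambda>x. cutoff \<delta> x * ?G x) x"
      using laplacian_add[OF x0 G Ck_on_minus[OF x0(1) \<chi>G]] laplacian_bounded_linear[OF bounded_linear_minus[OF bounded_linear_ident] x0 \<chi>G] by simp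
    finally have "Hker \<kappa> \<delta> x = (laplacian (\<lambda>x. cutoff \<delta> x * ?G x) x + of_real (\<kappa>\<^sup>2) * (cutoff \<delta> x * ?G x)) - (laplacian ?G x + of_real (\<kappa>\<^sup>2) * ?G x)"
      unfolding Hker_def Gam_def by (simp only: ring_distribs mult_1_left mult.assoc mult.left_commute[of "of_real (\<kappa>\<^sup>2)"]) simp
    also have "\<dots> = laplacian (cutoff \<delta>) x * ?G x - of_real (4 * (1 / \<delta>\<^sup>2) * sbump (2 - (x \<bullet> x) * (1 / \<delta>\<^sup>2))) * pd ?G x x"
      using helmholtz_qcut_mult[OF x0 G helmholtz_Gplus] helmholtz_Gplus[of x] x0 unfolding cutoff_qcut by simp
    finally have "norm (Hker \<kappa> \<delta> x) \<le> norm (laplacian (cutoff \<delta>) x * ?G x) + norm (of_real (4 * (1 / \<delta>\<^sup>2) * sbump (2 - (x \<bullet> x) * (1 / \<delta>\<^sup>2))) * pd ?G x x)"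
      by (simp only: norm_triangle_ineq4)
    also have "norm (laplacian (cutoff \<delta>) x * ?G x) \<le> M3 / \<delta>\<^sup>2 * (1 / \<delta>)"
    proof -
      have "1 * \<delta> \<le> 4 * pi * norm x" using \<rho> \<delta> pi_gt3 by (intro mult_mono) (auto simp: \<rho>_def)
      then have "1 / (4 * pi * norm x) \<le> 1 / \<delta>" using \<delta> by (intro frac_le) auto
      then show ?thesis unfolding norm_mult norm_Gplus using M3(2)[OF \<delta>(1)] M3(1) \<delta> by (intro mult_mono) auto
    qed
    also have "norm (of_real (4 * (1 / \<delta>\<^sup>2) * sbump (2 - (x \<bullet> x) * (1 / \<delta>\<^sup>2))) * pd ?G x x) \<le> (4 * (1 / \<delta>\<^sup>2) * M) * (\<kappa> + 1 / \<delta>)"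
      unfolding norm_mult norm_of_real
    proof (intro mult_mono)
      show "\<bar>4 * (1 / \<delta>\<^sup>2) * sbump (2 - (x \<bullet> x) * (1 / \<delta>\<^sup>2))\<bar> \<le> 4 * (1 / \<delta>\<^sup>2) * M"
        unfolding abs_mult using M(2) by (intro mult_mono) auto
      have n: "norm (\<i> * of_real \<kappa> / of_real \<rho> ^ 2 - 1 / of_real \<rho> ^ 3 :: complex) \<le> \<kappa> / \<rho> ^ 2 + 1 / \<rho> ^ 3"
        using norm_triangle_ineq4[of "\<i> * of_real \<kappa> / of_real \<rho> ^ 2" "1 / of_real \<rho> ^ 3 :: complex"] \<kappa> \<rho> by (simp add: norm_mult norm_divide norm_power)
      have "norm (pd ?G x x) = 2 * \<rho>\<^sup>2 * (1 / (8 * pi) * norm (\<i> * of_real \<kappa> / of_real \<rho> ^ 2 - 1 / of_real \<rho> ^ 3 :: complex))"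
        using x0 pd_Gplus[of x \<kappa> x] unfolding Gr1_def norm_eq_sqrt_inner[symmetric] \<rho>_def[symmetric]
        by (simp add: norm_mult norm_divide \<rho>_def power2_norm_eq_inner)
      also have "\<dots> \<le> 2 * \<rho>\<^sup>2 * (1 / (8 * pi) * (\<kappa> / \<rho> ^ 2 + 1 / \<rho> ^ 3))" using n by (intro mult_left_mono) auto
      also have "\<dots> = (1 / (4 * pi)) * (\<kappa> + 1 / \<rho>)" using \<rho>(2) by (simp add: field_simps eval_nat_numeral)
      also have "\<dots> \<le> 1 * (\<kappa> + 1 / \<delta>)" using \<rho> \<kappa> \<delta> pi_gt3 by (intro mult_mono add_left_mono frac_le) auto
      finally show "norm (pd ?G x x) \<le> \<kappa> + 1 / \<delta>" by simp
    qed (use M \<delta> in auto)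
    also have "M3 / \<delta>\<^sup>2 * (1 / \<delta>) + (4 * (1 / \<delta>\<^sup>2) * M) * (\<kappa> + 1 / \<delta>) = (M3 + 4 * M * (\<kappa> * \<delta> + 1)) / \<delta> ^ 3"
      using \<delta> by (simp add: field_simps eval_nat_numeral)
    also have "\<dots> \<le> C / \<delta> ^ 3" unfolding C_def using \<delta> \<kappa> M by (intro divide_right_mono add_mono mult_left_mono) auto
    finally show ?thesis by simp
  qed
  with C show ?thesis by (rule that)
qed

text \<open>This fixes the constant in the fundamental solution on one radial function, to which the
  general case is reduced by subtraction. In polar coordinates the integrand is a total
  derivative.\<close>

lemma Gplus_cutoff_integral:
  "(LBINT x. Gplus x \<kappa> * helm \<kappa> (cutoff 1) x) = 1"
proof -
  define b' where "b' = deriv sbump"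
  have sb: "(sbump has_real_derivative b' t) (at t)" for t
    using Ck_on_SucD(1)[OF open_UNIV Ck_on_sbump[of "Suc 0"], of t] unfolding b'_def
    by (intro DERIV_deriv_iff_real_differentiable[THEN iffD2]) (auto simp: differentiable_def)
  have b'c: "continuous_on UNIV b'"
  proof -
    have "b' = (\<lambda>t. pd sbump 1 t)"
      using frechet_derivative_eqI[OF sb[unfolded has_field_derivative_def]] by simp
    then show ?thesis using Ck_on_SucD(2)[OF open_UNIV Ck_on_sbump[of "Suc 0"], of 1] by simp
  qed
  have b'0: "b' t = 0" if "t < 0" for t
  proof -
    have "(sbump has_real_derivative 0) (at t)"
      by (rule has_field_derivative_transform_within_open[where S = "{..<0}" and f = "\<lambda>x. 0"]) (use that in \<open>auto simp: sbump_eq_0\<close>)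
    then show ?thesis using sb DERIV_unique by blast
  qed
  define g where "g s = complex_of_real (sstep (2 - s))" for s
  define g1 where "g1 s = complex_of_real (- sbump (2 - s))" for s
  define g2 where "g2 s = complex_of_real (b' (2 - s))" for s
  have d1: "(g has_vector_derivative g1 s) (at s)" and d2: "(g1 has_vector_derivative g2 s) (at s)" for s
  proof -
    have m: "((\<lambda>s::real. 2 - s) has_real_derivative - 1) (at s)" by (auto intro!: derivative_eq_intros)
    show "(g has_vector_derivative g1 s) (at s)" "(g1 has_vector_derivative g2 s) (at s)"
      unfolding g_def g1_def g2_def
      using has_vector_derivative_of_real[OF DERIV_chain2[OF sstep_deriv m]]
        has_vector_derivative_of_real[OF DERIV_minus[OF DERIV_chain2[OF sb m]]] by simp_all
  qed
  define f where "f r = Gr \<kappa> (r\<^sup>2) * (of_real (4 * r\<^sup>2) * g2 (r\<^sup>2) + 6 * g1 (r\<^sup>2) + of_real (\<kappa>\<^sup>2) * g (r\<^sup>2))" for r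
  define e where "e r = exp (\<i> * of_real (\<kappa> * r))" for r
  \<comment> \<open>With \<Phi>(r) = r g(r^2) this is - e^(i \<kappa> r) (\<Phi>' - i \<kappa>
    \<Phi>), whose derivative is - e^(i \<kappa> r) (\<Phi>'' + \<kappa>^2 \<Phi>). Only the
    boundary term at 0, where g = 1, survives.\<close>
  define F where "F r = - e r * ((g (r\<^sup>2) + of_real (2 * r\<^sup>2) * g1 (r\<^sup>2)) - \<i> * of_real (\<kappa> * r) * g (r\<^sup>2))" for r
  define F' where "F' r = - e r * of_real r * (of_real (4 * r\<^sup>2) * g2 (r\<^sup>2) + 6 * g1 (r\<^sup>2) + of_real (\<kappa>\<^sup>2) * g (r\<^sup>2))" for r
  have gc: "continuous_on UNIV g" "continuous_on UNIV g1" "continuous_on UNIV g2"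
  proof -
    show "continuous_on UNIV g" "continuous_on UNIV g1"
      using has_vector_derivative_continuous[OF d1] has_vector_derivative_continuous[OF d2] by (auto intro!: continuous_at_imp_continuous_on)
    have "continuous_on UNIV (\<lambda>s. b' (2 - s))" by (rule continuous_on_compose2[OF b'c]) (auto intro!: continuous_intros)
    then show "continuous_on UNIV g2" unfolding g2_def by (rule continuous_on_of_real)
  qed
  note [measurable] = gc[THEN borel_measurable_continuous_onI]
  have m: "f \<in> borel_measurable borel" unfolding f_def Gr_def by measurable
  have "Gplus x \<kappa> * helm \<kappa> (cutoff 1) x = f (norm x)" for x
  proof -
    have "laplacian (\<lambda>x. g (x \<bullet> x + 0)) x = of_real (4 * (x \<bullet> x)) * g2 (x \<bullet> x + 0) + of_real (2 * real DIM(real^3)) * g1 (x \<bullet> x + 0)"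
      by (rule laplacian_radial(1)[of UNIV _ _ UNIV]) (use d1 d2 in auto)
    moreover have "cutoff 1 = (\<lambda>x. g (x \<bullet> x + 0))" by (simp add: fun_eq_iff cutoff_def g_def)
    ultimately show ?thesis by (simp add: f_def Gplus_Gr power2_norm_eq_inner)
  qed
  then have "(LBINT x. Gplus x \<kappa> * helm \<kappa> (cutoff 1) x) = (LBINT r. (if r \<ge> 0 then 4 * pi * r\<^sup>2 else 0) *\<^sub>R f r)"
    by (simp only: lborel_radial(1)[OF m])
  also have "\<dots> = (LBINT r. indicator {0..2} r *\<^sub>R F' r)"
  proof (rule bint_cong[OF refl])
    fix r :: real
    consider "r < 0" | "r = 0" | "0 < r" "r \<le> 2" | "r > 2" by linarith
    then show "(if r \<ge> 0 then 4 * pi * r\<^sup>2 else 0) *\<^sub>R f r = indicator {0..2} r *\<^sub>R F' r"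
    proof cases
      case 3
      then show ?thesis by (simp add: f_def F'_def Gr_def e_def scaleR_conv_of_real power2_eq_square field_simps)
    next
      case 4
      then have "2 < r\<^sup>2" using power_strict_mono[of 2 r 2] by simp
      then have "g (r\<^sup>2) = 0" "g1 (r\<^sup>2) = 0" "g2 (r\<^sup>2) = 0" by (auto simp: g_def g1_def g2_def sstep_eq_0 sbump_eq_0 b'0)
      then show ?thesis using 4 by (simp add: f_def)
    qed (auto simp: F'_def)
  qed
  also have "\<dots> = F 2 - F 0"
  proof (rule integral_FTC_atLeastAtMost)
    fix r :: real
    have sq: "((\<lambda>r. r\<^sup>2) has_vector_derivative 2 * r) (at r)" by (auto intro!: derivative_eq_intros simp: has_real_derivative_iff_has_vector_derivative[symmetric])
    have c: "((\<lambda>r. G (r\<^sup>2)) has_vector_derivative of_real (2 * r) * G' (r\<^sup>2)) (at r)" if "\<And>s. (G has_vector_derivative G' s) (at s)" for G G' :: "real => complex"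
      using vector_diff_chain_at[OF sq that] by (simp add: o_def scaleR_conv_of_real)
    have ed: "(e has_vector_derivative \<i> * of_real \<kappa> * e r) (at r)" unfolding e_def
      by (rule has_vector_derivative_real_field[where f = "\<lambda>z. exp (\<i> * (of_real \<kappa> * z))", simplified of_real_mult[symmetric]])
         (auto intro!: derivative_eq_intros)
    have re: "((\<lambda>r. complex_of_real (2 * r\<^sup>2)) has_vector_derivative of_real (4 * r)) (at r)"
      "((\<lambda>r. complex_of_real (\<kappa> * r)) has_vector_derivative of_real \<kappa>) (at r)"
      by (intro has_vector_derivative_of_real; auto intro!: derivative_eq_intros)+
    have A: "((\<lambda>r. g (r\<^sup>2) + of_real (2 * r\<^sup>2) * g1 (r\<^sup>2)) has_vector_derivative
        of_real (2 * r) * g1 (r\<^sup>2) + (of_real (2 * r\<^sup>2) * (of_real (2 * r) * g2 (r\<^sup>2)) + of_real (4 * r) * g1 (r\<^sup>2))) (at r)"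
      by (intro has_vector_derivative_add has_vector_derivative_mult re c d1 d2)
    have B: "((\<lambda>r. \<i> * of_real (\<kappa> * r) * g (r\<^sup>2)) has_vector_derivative
        \<i> * of_real (\<kappa> * r) * (of_real (2 * r) * g1 (r\<^sup>2)) + (\<i> * of_real \<kappa> + 0 * of_real (\<kappa> * r)) * g (r\<^sup>2)) (at r)"
      by (intro has_vector_derivative_mult re c d1 has_vector_derivative_const)
    have "(F has_vector_derivative F' r) (at r)"
      unfolding F_def
      by (rule has_vector_derivative_eq_rhs[OF has_vector_derivative_mult[OF has_vector_derivative_minus[OF ed] has_vector_derivative_diff[OF A B]]])
         (simp add: F'_def algebra_simps power2_eq_square)
    then show "(F has_vector_derivative F' r) (at r within {0..2})" by (rule has_vector_derivative_at_within)
  next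
    show "continuous_on {0..2} F'" unfolding F'_def e_def
      by (intro continuous_intros continuous_on_compose2[OF gc(1)] continuous_on_compose2[OF gc(2)] continuous_on_compose2[OF gc(3)]) auto
  qed simp
  also have "\<dots> = 1" by (simp add: F_def g_def g1_def e_def sstep_eq_0 sstep_eq_1 sbump_eq_0)
  finally show ?thesis .
qed

lemma measure_cball_3: "r \<ge> 0 \<Longrightarrow> measure lborel (cball (0::real^3) r) = 4 / 3 * pi * r ^ 3"
  by (simp add: measure_def emeasure_cball unit_ball_vol_3 ennreal_mult'')

lemma integrable_indicator_cball: "integrable lborel (\<lambda>x. c * indicator (cball (0::'a::euclidean_space) r) x :: real)"
  by (intro integrable_mult_right integrable_real_indicator) (use emeasure_bounded_finite[of "cball (0::'a) r"] in \<open>auto simp: less_top\<close>)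

text \<open>Subtracting a multiple of \<open>cutoff 1\<close> leaves a function \<theta> with
  \<theta>(0) = 0. Moving the operator onto the smoothed kernel \<open>Gam\<close> gives an integral
  over |x| \<le> 2 \<delta> of a product of sizes \<delta>^-3 and \<delta>, hence O(\<delta>);
  dominated convergence identifies its limit.\<close>

theorem fundamental_solution:
  fixes \<phi> :: "real^3 => complex"
  assumes \<phi>: "Ck_on 2 UNIV \<phi>" "bsupp \<phi>" and \<kappa>: "\<kappa> > 0"
  shows "(LBINT x. Gplus x \<kappa> * helm \<kappa> \<phi> x) = \<phi> 0"
proof -
  define L where "L \<psi> x = helm \<kappa> \<psi> x" for \<psi> :: "real^3 => complex" and x
  define \<theta> where "\<theta> x = \<phi> x + (- \<phi> 0) * cutoff 1 x" for x
  define \<delta> where "\<delta> n = 1 / real (Suc n)" for n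
  have \<delta>: "\<delta> n > 0" "\<delta> n \<le> 1" for n by (auto simp: \<delta>_def)
  have \<delta>0: "\<delta> \<longlonglongrightarrow> 0" unfolding \<delta>_def using LIMSEQ_inverse_real_of_nat by (simp add: inverse_eq_divide)
  note c = Ck_on_cutoff[of 2 1] bsupp_cutoff[OF zero_less_one]
  have c\<phi>: "Ck_on 2 UNIV (\<lambda>x. - \<phi> 0 * cutoff 1 x)" by (intro Ck_on_mult Ck_on_const c open_UNIV)
  have \<theta>: "Ck_on 2 UNIV \<theta>" "bsupp \<theta>" "\<theta> 0 = 0"
    unfolding \<theta>_def[abs_def] by (intro Ck_on_add bsupp_add bsupp_mult_right c \<phi> c\<phi> open_UNIV)+ (simp add: cutoff_1)
  have L\<theta>: "L \<theta> x = L \<phi> x - \<phi> 0 * L (cutoff 1) x" for x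
    using laplacian_add[OF open_UNIV UNIV_I \<phi>(1) c\<phi>, of x]
      laplacian_bounded_linear[OF bounded_linear_mult_right[of "- \<phi> 0"] open_UNIV UNIV_I c(1), of x]
    by (simp add: L_def \<theta>_def[abs_def] algebra_simps)
  have Lc: "continuous_on UNIV (L \<psi>)" "bsupp (L \<psi>)" if "Ck_on 2 UNIV \<psi>" "bsupp \<psi>" for \<psi>
    unfolding L_def[abs_def] by (intro helmholtz_continuous helmholtz_bsupp that)+
  have GL: "integrable lborel (\<lambda>x. Gplus x \<kappa> * L \<psi> x)" if "Ck_on 2 UNIV \<psi>" "bsupp \<psi>" for \<psi>
  proof -
    note l = Lc(1)[OF that] Lc(2)[OF that]
    obtain B where B: "\<And>x. norm (L \<psi> x) \<le> B" using continuous_bsupp_bounded[OF l] by metis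
    obtain R where R: "\<And>x. norm x > R \<Longrightarrow> L \<psi> x = 0" using l(2) by (auto simp: bsupp_def)
    show ?thesis by (rule integrable_Gplus_bounded[OF borel_measurable_continuous_onI[OF l(1)] B R])
  qed
  obtain B where B: "B > 0" "\<And>x. norm x \<le> 2 \<Longrightarrow> norm (\<theta> x) \<le> B * norm x"
  proof (rule Ck1_lipschitz_cball[OF Ck_on_mono[OF open_UNIV \<theta>(1), of 1], of 2])
    fix B assume "B > 0" and B: "\<And>x y. norm x \<le> 2 \<Longrightarrow> norm y \<le> 2 \<Longrightarrow> norm (\<theta> x - \<theta> y) \<le> B * norm (x - y)"
    then show thesis using that B[of _ 0] \<theta>(3) by simp
  qed simp_all
  obtain C where C: "C > 0" "\<And>\<delta> x. 0 < \<delta> \<Longrightarrow> \<delta> \<le> 1 \<Longrightarrow> norm (Hker \<kappa> \<delta> x) \<le> C / \<delta> ^ 3" using norm_Hker_le[OF \<kappa>] by blast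
  define I where "I n = (LBINT x. Gam \<kappa> (\<delta> n) x * L \<theta> x)" for n
  \<comment> \<open>The constant is C \<delta>^-3 times the bound 2 B \<delta> for \<theta> times
    the volume 4/3 pi (2 \<delta>)^3.\<close>
  have "norm (I n) \<le> (64 / 3 * pi * B * C) * \<delta> n" for n
  proof -
    let ?d = "\<delta> n"
    have "I n = - (LBINT x. Hker \<kappa> ?d x * \<theta> x)"
      unfolding I_def L_def Hker_def helmholtz_symmetric[OF Ck_on_Gam[OF \<delta>(1)] \<theta>(1,2)]
      by (simp only: mult_minus_left integral_minus minus_minus)
    then have "norm (I n) \<le> (LBINT x. norm (Hker \<kappa> ?d x * \<theta> x))" by simp
    also have "\<dots> \<le> (LBINT x. C / ?d ^ 3 * (B * (2 * ?d)) * indicator (cball (0::real^3) (2 * ?d)) x)"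
    proof (rule integral_mono[OF _ integrable_indicator_cball])
      show "integrable lborel (\<lambda>x. norm (Hker \<kappa> ?d x * \<theta> x))"
        by (intro integrable_norm continuous_bsupp_integrable continuous_intros bsupp_mult_right \<theta> Ck_on_imp_continuous_on[OF \<theta>(1)]
            Ck_on_imp_continuous_on[OF Ck_on_Hker[OF \<delta>(1), of 0]])
      fix x :: "real^3"
      show "norm (Hker \<kappa> ?d x * \<theta> x) \<le> C / ?d ^ 3 * (B * (2 * ?d)) * indicator (cball 0 (2 * ?d)) x"
      proof (cases "norm x \<le> 2 * ?d")
        case True
        then have "norm (\<theta> x) \<le> B * (2 * ?d)" using B(1) \<delta>(2)[of n] by (intro order_trans[OF B(2)] mult_left_mono) auto
        then have "norm (Hker \<kappa> ?d x * \<theta> x) \<le> C / ?d ^ 3 * (B * (2 * ?d))" unfolding norm_mult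
          using C \<delta>[of n] by (intro mult_mono) auto
        then show ?thesis using True by simp
      qed (simp add: Hker_0 \<delta>)
    qed
    also have "\<dots> = (64 / 3 * pi * B * C) * ?d"
      using \<delta>(1)[of n] by (simp add: measure_cball_3 field_simps eval_nat_numeral)
    finally show ?thesis .
  qed
  then have "I \<longlonglongrightarrow> 0"
    by (intro Lim_null_comparison[OF _ tendsto_mult_right_zero[OF \<delta>0]] always_eventually allI)
  moreover have "I \<longlonglongrightarrow> (LBINT x. Gplus x \<kappa> * L \<theta> x)"
    unfolding I_def
  proof (rule integral_dominated_convergence)
    note [measurable] = borel_measurable_continuous_onI[OF Lc(1)[OF \<theta>(1,2)]]
    show "(\<lambda>x. Gplus x \<kappa> * L \<theta> x) \<in> borel_measurable lborel" "(\<lambda>x. Gam \<kappa> (\<delta> n) x * L \<theta> x) \<in> borel_measurable lborel" for n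
      unfolding Gam_def by measurable
    show "integrable lborel (\<lambda>x. 2 * norm (Gplus x \<kappa> * L \<theta> x))" by (intro integrable_mult_right integrable_norm GL \<theta>)
    have "(\<lambda>n. Gam \<kappa> (\<delta> n) x) \<longlonglongrightarrow> Gplus x \<kappa>" for x
    proof (cases "x = 0")
      case False
      then have "eventually (\<lambda>n. \<delta> n < norm x / 2) sequentially" by (intro order_tendstoD[OF \<delta>0]) auto
      then show ?thesis by (intro tendsto_eventually) (auto elim!: eventually_mono simp: Gam_eq \<delta>)
    qed (simp add: Gam_def Gplus_def)
    then show "AE x in lborel. (\<lambda>n. Gam \<kappa> (\<delta> n) x * L \<theta> x) \<longlonglongrightarrow> Gplus x \<kappa> * L \<theta> x" by (intro AE_I2 tendsto_intros)
    have "norm (Gam \<kappa> (\<delta> n) x * L \<theta> x) \<le> 2 * norm (Gplus x \<kappa> * L \<theta> x)" for n x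
    proof -
      have "norm (1 - cutoff (\<delta> n) x) \<le> 2" using norm_triangle_ineq4[of 1 "cutoff (\<delta> n) x"] norm_cutoff[of "\<delta> n" x] by simp
      then show ?thesis unfolding Gam_def norm_mult mult.assoc by (intro mult_right_mono) auto
    qed
    then show "AE x in lborel. norm (Gam \<kappa> (\<delta> n) x * L \<theta> x) \<le> 2 * norm (Gplus x \<kappa> * L \<theta> x)" for n by simp
  qed
  ultimately have "(LBINT x. Gplus x \<kappa> * L \<theta> x) = 0" by (metis LIMSEQ_unique)
  moreover have "(LBINT x. Gplus x \<kappa> * L \<theta> x) = (LBINT x. Gplus x \<kappa> * L \<phi> x) - \<phi> 0 * (LBINT x. Gplus x \<kappa> * L (cutoff 1) x)"
    unfolding L\<theta> right_diff_distrib mult.left_commute[of "Gplus _ _" "\<phi> 0"] using GL[OF \<phi>] GL[OF c] by simp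
  ultimately show ?thesis using Gplus_cutoff_integral[of \<kappa>] by (simp add: L_def)
qed

text \<open>Tested form of the identity: (\<Delta> + \<kappa>^2) applied to the truncated kernel is
  the delta at 0 plus \<open>Hker\<close>. So the truncated kernel is a compactly supported
  parametrix with smooth error.\<close>

lemma cut_fundamental:
  fixes \<phi> :: "real^3 => complex"
  assumes \<phi>: "Ck_on 2 UNIV \<phi>" "bsupp \<phi>" and \<kappa>: "\<kappa> > 0" and \<delta>: "\<delta> > 0"
  shows "(LBINT z. (cutoff \<delta> z * Gplus z \<kappa>) * helm \<kappa> \<phi> z) = \<phi> 0 + (LBINT z. Hker \<kappa> \<delta> z * \<phi> z)"
proof -
  define g where "g x = helm \<kappa> \<phi> x" for x
  have g: "continuous_on UNIV g" "bsupp g" unfolding g_def by (intro helmholtz_continuous helmholtz_bsupp \<phi>)+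
  obtain B where B: "\<And>x. norm (g x) \<le> B" using continuous_bsupp_bounded[OF g] by metis
  obtain R where R: "\<And>x. norm x > R \<Longrightarrow> g x = 0" using g(2) by (auto simp: bsupp_def)
  have I1: "integrable lborel (\<lambda>x. Gplus x \<kappa> * g x)"
    by (rule integrable_Gplus_bounded[OF _ B R]) (use g(1) in \<open>simp add: borel_measurable_continuous_onI\<close>)
  have I2: "integrable lborel (\<lambda>x. Gam \<kappa> \<delta> x * g x)"
    by (intro continuous_bsupp_integrable continuous_intros g bsupp_mult_right Ck_on_imp_continuous_on[OF Ck_on_Gam[OF \<delta>, of 0]])
  have "(LBINT z. (cutoff \<delta> z * Gplus z \<kappa>) * g z) = (LBINT z. Gplus z \<kappa> * g z - Gam \<kappa> \<delta> z * g z)"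
    by (intro bint_cong) (auto simp: Gam_def algebra_simps)
  also have "\<dots> = \<phi> 0 - (LBINT z. Gam \<kappa> \<delta> z * g z)"
    using I1 I2 fundamental_solution[OF \<phi> \<kappa>] by (simp add: g_def)
  also have "(LBINT z. Gam \<kappa> \<delta> z * g z) = - (LBINT z. Hker \<kappa> \<delta> z * \<phi> z)"
    unfolding g_def Hker_def helmholtz_symmetric[OF Ck_on_Gam[OF \<delta>] \<phi>]
    by (simp only: mult_minus_left integral_minus minus_minus)
  finally show ?thesis by (simp add: g_def)
qed

section \<open>Weyl's lemma for the Helmholtz equation\<close>

lemma fubini_conv:
  fixes h f \<phi> :: "real^3 => complex"
  assumes h: "continuous_on UNIV h" and f: "integrable lborel f" "bsupp f" and g: "continuous_on UNIV g" "bsupp g"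
  shows "(LBINT x. f x * (LBINT y. h (x - y) * g y)) = (LBINT y. g y * (LBINT x. h (x - y) * f x))"
proof -
  obtain R where R: "\<And>x. norm x > R \<Longrightarrow> f x = 0" using f by (auto simp: bsupp_def)
  obtain S where S: "\<And>x. norm x > S \<Longrightarrow> g x = 0" using g by (auto simp: bsupp_def)
  obtain B where B: "B > 0" "\<And>y. norm y \<le> R + S \<Longrightarrow> norm (h y) \<le> B" using continuous_bounded_cball[OF h] by metis
  have [measurable]: "h \<in> borel_measurable borel" "f \<in> borel_measurable borel" "g \<in> borel_measurable borel"
    using h g f by (auto intro: borel_measurable_continuous_onI)
  have gi: "integrable lborel g" by (rule continuous_bsupp_integrable[OF g])
  have "integrable (lborel \<Otimes>\<^sub>M lborel) (\<lambda>(x, y). f x * g y)"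
    by (rule lborel_pair.Fubini_integrable) (use f gi in \<open>auto simp: norm_mult\<close>)
  then have I: "integrable (lborel \<Otimes>\<^sub>M lborel) (\<lambda>(x, y). f x * (h (x - y) * g y))"
  proof -
    assume i: "integrable (lborel \<Otimes>\<^sub>M lborel) (\<lambda>(x, y). f x * g y)"
    have "integrable (lborel \<Otimes>\<^sub>M lborel) (\<lambda>p. h (fst p - snd p) * (f (fst p) * g (snd p)))"
    proof (rule integrable_mult_bounded(1)[where B = B])
      show "integrable (lborel \<Otimes>\<^sub>M lborel) (\<lambda>p. f (fst p) * g (snd p))" using i by (simp add: case_prod_unfold)
      show "norm (h (fst p - snd p)) \<le> B" if "f (fst p) * g (snd p) \<noteq> 0" for p
      proof -
        have "norm (fst p) \<le> R" "norm (snd p) \<le> S" using that R[of "fst p"] S[of "snd p"] by force+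
        then show ?thesis using norm_triangle_ineq4[of "fst p" "snd p"] by (intro B) linarith
      qed
    qed measurable
    then show ?thesis by (simp add: case_prod_unfold mult_ac)
  qed
  have "(LBINT x. f x * (LBINT y. h (x - y) * g y)) = (LBINT x. (LBINT y. f x * (h (x - y) * g y)))"
    by simp
  also have "\<dots> = (LBINT y. (LBINT x. f x * (h (x - y) * g y)))"
    using lborel_pair.Fubini_integral[OF I] by simp
  also have "\<dots> = (LBINT y. g y * (LBINT x. h (x - y) * f x))"
    by (simp add: mult_ac flip: integral_mult_right_zero)
  finally show ?thesis .
qed

text \<open>The test function is the conjugate of f(y) times a cut-off at \<open>y\<close>: the real
  part of the integrand is then nonnegative, and positive near \<open>y\<close>.\<close>

lemma continuous_zero_if_test_integrals_zero:
  fixes f :: "real^3 => complex"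
  assumes f: "continuous_on S f" "open S" "y \<in> S" and l: "loc_integrable f"
    and z: "\<And>\<phi>. test_function \<phi> \<Longrightarrow> (LBINT x. f x * \<phi> x) = 0"
  shows "f y = 0"
proof (rule ccontr)
  assume "f y \<noteq> 0"
  define g where "g x = Re (f x * cnj (f y))" for x
  have gc: "continuous_on S g" unfolding g_def by (intro continuous_intros f)
  have "g y > 0" using \<open>f y \<noteq> 0\<close> by (simp add: g_def complex_eq_iff sum_power2_gt_zero_iff flip: power2_eq_square)
  moreover have "open (S \<inter> g -` {0<..})" by (rule continuous_open_preimage[OF gc f(2)]) simp
  ultimately obtain e where e': "e > 0" "ball y e \<subseteq> S \<inter> g -` {0<..}" using f(3) by (auto elim: openE)
  then have e: "e > 0" "\<And>x. norm (y - x) < e \<Longrightarrow> g x > 0" by (auto simp: subset_iff dist_norm)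
  define \<beta> where "\<beta> x = sstep (2 - ((y - x) \<bullet> (y - x)) / (e / 2)\<^sup>2)" for x
  have cu: "cutoff (e / 2) (y - x) = of_real (\<beta> x)" for x by (simp add: cutoff_def \<beta>_def)
  have b0: "\<beta> x = 0" if "e \<le> norm (y - x)" for x using cutoff_0[of "e / 2" "y - x"] e(1) that by (simp add: cu)
  define \<phi> where "\<phi> x = cnj (f y) * cutoff (e / 2) (y - x)" for x
  have "Ck_on k UNIV \<phi>" for k
    unfolding \<phi>_def[abs_def] by (rule Ck_on_mult[OF open_UNIV Ck_on_const Ck_on_reflect[OF Ck_on_cutoff]]) simp
  moreover have "bsupp \<phi>" unfolding \<phi>_def[abs_def] using e(1) by (intro bsupp_mult_right bsupp_reflect(1)[OF bsupp_cutoff]) simp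
  ultimately have t: "test_function \<phi>" by (simp add: test_function_iff)
  have r: "Re (f x * \<phi> x) = \<beta> x * g x" for x
  proof -
    have "f x * \<phi> x = \<beta> x *\<^sub>R (f x * cnj (f y))" by (simp only: \<phi>_def cu scaleR_conv_of_real mult_ac)
    then show ?thesis by (simp only: scaleR_complex.sel(1) g_def)
  qed
  have i: "integrable lborel (\<lambda>x. f x * \<phi> x)"
    using t by (intro loc_integrable_bsupp_mult l) (auto simp: test_function_iff intro: Ck_on_imp_continuous_on)
  have nn: "0 \<le> \<beta> x * g x" for x using e(2)[of x] b0[of x] sstep_bounds by (cases "norm (y - x) < e") (auto simp: \<beta>_def)
  have "integrable lborel (\<lambda>x. \<beta> x * g x)" "(LBINT x. \<beta> x * g x) = 0"
    unfolding r[symmetric] using integrable_Re[OF i] integral_Re[OF i] z[OF t] by (simp_all only: zero_complex.sel)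
  then have "AE x in lborel. \<beta> x * g x = 0" using integral_nonneg_eq_0_iff_AE nn by blast
  then have "AE x in lborel. x \<notin> ball y (e / 2)"
  proof (rule eventually_mono)
    fix x assume *: "\<beta> x * g x = 0"
    show "x \<notin> ball y (e / 2)"
    proof
      assume "x \<in> ball y (e / 2)"
      then have "norm (y - x) < e" "\<beta> x = 1" using e(1) cutoff_1[of "e / 2" "y - x"] by (auto simp: dist_norm cu)
      then show False using e(2)[of x] * by simp
    qed
  qed
  then have "ball y (e / 2) \<in> null_sets lborel" by (subst AE_iff_null_sets) (simp, assumption)
  then have "negligible (ball y (e / 2))" by (simp add: negligible_iff_null_sets null_sets_completionI)
  then show False using e(1) open_not_negligible[of "ball y (e / 2)"] by simp
qed

text \<open>With the parametrix \<open>E\<close>, the convolution \<psi> of \<phi> with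
  \<open>E\<close> is a test function, and (\<Delta> + \<kappa>^2) \<psi> is \<phi> plus the
  convolution of \<phi> with \<open>h\<close>. The weak equation for \<psi> and Fubini give d =
  \<open>D\<close> off \<open>y\<close>, where \<open>D\<close> integrates \<open>d\<close> against
  the smooth kernel \<open>h\<close>. The singularity at \<open>y\<close> is removed on the
  way.\<close>

theorem weyl_helmholtz:
  fixes d :: "real^3 => complex"
  assumes d: "loc_integrable d" and dc: "continuous_on (- {y}) d" and \<kappa>: "\<kappa> > 0"
    and weak: "\<And>\<phi>. test_function \<phi> \<Longrightarrow> (LBINT x. d x * helm \<kappa> \<phi> x) = 0"
  obtains D where "\<And>k. Ck_on k UNIV D" "\<And>x. x \<noteq> y \<Longrightarrow> d x = D x"
    "\<And>x. helm \<kappa> D x = 0"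
proof -
  define h where "h = Hker \<kappa> 1"
  define D where "D y = - (LBINT x. h (x - y) * d x)" for y
  define E where "E z = cutoff 1 z * Gplus z \<kappa>" for z
  have [measurable]: "d \<in> borel_measurable borel" by (rule continuous_off_point_borel[OF dc])
  have hC: "Ck_on k UNIV h" "bsupp h" for k by (auto simp: h_def Ck_on_Hker bsupp_Hker)
  have hc: "continuous_on UNIV h" using hC(1)[of 0] by simp
  have h0: "h x = 0" if "norm x > 2" for x using Hker_0[of 1 x] that by (simp add: h_def)
  have E: "integrable lborel E" "bsupp E"
  proof -
    show "bsupp E" unfolding E_def by (intro bsupp_mult_left bsupp_cutoff) simp
    have "integrable lborel (\<lambda>x. Gplus x \<kappa> * cutoff 1 x)"
      by (rule integrable_Gplus_bounded[where B = 1 and R = 2]) (auto simp: norm_cutoff cutoff_0)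
    then show "integrable lborel E" unfolding E_def[abs_def] by (simp add: mult.commute)
  qed
  let ?d = "\<lambda>R x. indicator (cball 0 R) x *\<^sub>R d x"
  have dR: "integrable lborel (?d R)" "bsupp (?d R)" for R
    using d by (auto simp: loc_integrable_def bsupp_def indicator_def intro!: exI[of _ R])
  \<comment> \<open>As \<open>h\<close> vanishes beyond radius 2, only values of \<open>d\<close>
    within \<open>R + 2\<close> enter, so that \<open>D\<close> is locally a convolution with an
    integrable function of bounded support.\<close>
  have DR: "D y = - (LBINT x. h (x - y) * ?d (R + 2) x)" if "norm y \<le> R" for y R
    unfolding D_def
  proof (intro arg_cong[where f = uminus] bint_cong refl)
    fix x show "h (x - y) * d x = h (x - y) * ?d (R + 2) x"
      using h0[of "x - y"] norm_triangle_ineq2[of x y] that by (cases "norm x > R + 2") (auto simp: indicator_def)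
  qed
  have hr: "Ck_on k UNIV (\<lambda>w. h (- w))" for k using Ck_on_reflect[OF hC(1), of k 0] by simp
  have DC: "Ck_on k UNIV D" for k
  proof (rule Ck_on_UNIV_balls)
    fix R :: real assume "R > 0"
    have "Ck_on k UNIV (\<lambda>y. - (LBINT x. h (- (y - x)) * ?d (R + 2) x))"
      by (intro Ck_on_minus Ck_on_conv[OF dR hr] open_UNIV)
    then have "Ck_on k (ball 0 R) (\<lambda>y. - (LBINT x. h (- (y - x)) * ?d (R + 2) x))"
      by (rule Ck_on_subset[rotated 2]) auto
    then show "Ck_on k (ball 0 R) D" by (rule Ck_on_cong_imp[rotated 2]) (auto simp: DR[of _ R])
  qed
  have Dc: "continuous_on UNIV D" using DC[of 0] by simp
  have di: "loc_integrable (\<lambda>x. d x - D x)"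
  proof -
    have "integrable lborel (?d R)" "integrable lborel (\<lambda>x. indicator (cball 0 R) x *\<^sub>R D x)" for R
      using d Dc by (auto simp: loc_integrable_def intro!: borel_integrable_compact continuous_on_subset[OF Dc])
    then show ?thesis unfolding loc_integrable_def by (simp add: scaleR_diff_right)
  qed
  have dD: "d x = D x" if "x \<noteq> y" for x
  proof -
    have "d x - D x = 0"
    proof (rule continuous_zero_if_test_integrals_zero[where f = "\<lambda>x. d x - D x" and S = "- {y}", OF _ _ _ di])
      show "continuous_on (- {y}) (\<lambda>x. d x - D x)" by (intro continuous_intros dc continuous_on_subset[OF Dc]) auto
    fix \<phi> assume t: "test_function \<phi>"
    then have \<phi>: "Ck_on k UNIV \<phi>" "bsupp \<phi>" for k by (auto simp: test_function_iff)
    have \<phi>c: "continuous_on UNIV \<phi>" using \<phi>(1)[of 0] by simp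
    define \<psi> where "\<psi> x = (LBINT z. \<phi> (x - z) * E z)" for x
    obtain R where R: "R > 0" "\<And>x. norm x > R \<Longrightarrow> \<phi> x = 0" using \<phi>(2) by (auto elim: bsuppE)
    have "\<psi> x = 0" if "norm x > R + 2" for x
    proof -
      have "\<phi> (x - z) * E z = 0" for z
        using R(2)[of "x - z"] norm_triangle_ineq2[of x z] that by (cases "norm z > 2") (auto simp: E_def cutoff_0)
      then show ?thesis unfolding \<psi>_def by (simp only: Bochner_Integration.integral_zero)
    qed
    then have \<psi>b: "bsupp \<psi>" by (auto simp: bsupp_def)
    have \<psi>C: "Ck_on k UNIV \<psi>" for k unfolding \<psi>_def by (intro Ck_on_conv E \<phi>)
    have L: "helm \<kappa> \<psi> x = \<phi> x + (LBINT y. h (x - y) * \<phi> y)" for x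
    proof -
      define \<phi>x where "\<phi>x z = \<phi> (x - z)" for z
      have \<phi>xC: "Ck_on 2 UNIV \<phi>x" "bsupp \<phi>x" unfolding \<phi>x_def by (intro Ck_on_reflect bsupp_reflect \<phi>)+
      have lx: "laplacian \<phi>x z = laplacian \<phi> (x - z)" for z
        unfolding \<phi>x_def by (rule laplacian_reflect(1)[OF \<phi>(1)])
      have i: "integrable lborel (\<lambda>z. laplacian \<phi> (x - z) * E z)" "integrable lborel (\<lambda>z. \<phi> (x - z) * E z)"
        by (intro conv_integrable E \<phi>c continuous_on_laplacian \<phi> open_UNIV)+
      have "helm \<kappa> \<psi> x = (LBINT z. laplacian \<phi> (x - z) * E z) + (LBINT z. of_real (\<kappa>\<^sup>2) * (\<phi> (x - z) * E z))"
        unfolding \<psi>_def laplacian_conv[OF \<phi>(1) E] by simp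
      also have "\<dots> = (LBINT z. E z * helm \<kappa> \<phi>x z)"
      proof -
        have "E z * helm \<kappa> \<phi>x z = laplacian \<phi> (x - z) * E z + of_real (\<kappa>\<^sup>2) * (\<phi> (x - z) * E z)" for z
          by (simp add: lx \<phi>x_def algebra_simps)
        then show ?thesis using i(1) integrable_mult_right[OF i(2), of "of_real (\<kappa>\<^sup>2)"]
          by (simp only: bint_add)
      qed
      also have "\<dots> = \<phi> x + (LBINT z. h z * \<phi> (x - z))"
        using cut_fundamental[OF \<phi>xC \<kappa>, of 1] by (simp add: E_def h_def \<phi>x_def)
      also have "(LBINT z. h z * \<phi> (x - z)) = (LBINT y. h (x - y) * \<phi> y)"
      proof -
        have [measurable]: "h \<in> borel_measurable borel" "\<phi> \<in> borel_measurable borel"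
          using hc \<phi>c by (auto intro: borel_measurable_continuous_onI)
        have "(\<lambda>z. h z * \<phi> (x - z)) \<in> borel_measurable borel" by measurable
        from lborel_integral_reflect(1)[OF this, of x] show ?thesis by simp
      qed
      finally show ?thesis .
    qed
    let ?h = "\<lambda>x. LBINT y. h (x - y) * \<phi> y"
    have hphi: "continuous_on UNIV ?h"
      by (intro conv_continuous hc continuous_bsupp_integrable \<phi> \<phi>c)
    have hphi0: "?h x = 0" if "norm x > R + 2" for x
    proof -
      have "h (x - z) * \<phi> z = 0" for z
        using h0[of "x - z"] norm_triangle_ineq2[of x z] that R(2)[of z] by (cases "norm z > R") auto
      then show ?thesis by (simp only: Bochner_Integration.integral_zero)
    qed
    have "0 = (LBINT x. d x * (\<phi> x + ?h x))"
      using weak[of \<psi>, unfolded L] \<psi>C \<psi>b by (simp add: test_function_iff)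
    also have "\<dots> = (LBINT x. d x * \<phi> x) + (LBINT x. d x * ?h x)"
      unfolding distrib_left
      by (intro bint_add loc_integrable_bsupp_mult[OF d] hphi \<phi> \<phi>c)
         (use hphi0 in \<open>auto simp: bsupp_def\<close>)
    also have "(LBINT x. d x * ?h x) = (LBINT x. ?d (R + 2) x * ?h x)"
    proof (rule bint_cong[OF refl])
      fix x show "d x * ?h x = ?d (R + 2) x * ?h x"
        using hphi0[of x] by (cases "norm x > R + 2") (auto simp: indicator_def)
    qed
    also have "\<dots> = (LBINT y. \<phi> y * (LBINT x. h (x - y) * ?d (R + 2) x))"
      by (rule fubini_conv[OF hc dR \<phi>c \<phi>(2)])
    also have "\<dots> = - (LBINT y. D y * \<phi> y)"
    proof -
      have "\<phi> y * (LBINT x. h (x - y) * ?d (R + 2) x) = - (D y * \<phi> y)" for y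
        using R(2)[of y] DR[of y R] by (cases "norm y > R") auto
      then show ?thesis by simp
    qed
    finally have "(LBINT x. d x * \<phi> x) = (LBINT y. D y * \<phi> y)" by simp
    moreover have "integrable lborel (\<lambda>x. d x * \<phi> x)" "integrable lborel (\<lambda>x. D x * \<phi> x)"
      by (intro loc_integrable_bsupp_mult d \<phi> \<phi>c continuous_bsupp_integrable continuous_intros Dc bsupp_mult_right)+
    ultimately show "(LBINT x. (d x - D x) * \<phi> x) = 0" by (simp add: left_diff_distrib)
    qed (use that in auto)
    then show ?thesis by simp
  qed
  define H where "H x = helm \<kappa> D x" for x
  have Hc: "continuous_on UNIV H" unfolding H_def by (rule helmholtz_continuous[OF DC])
  have "H x = 0" for x
  proof (rule continuous_zero_if_test_integrals_zero[OF Hc open_UNIV UNIV_I])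
    show "loc_integrable H" unfolding loc_integrable_def
      by (intro allI borel_integrable_compact continuous_on_subset[OF Hc]) auto
    fix \<phi> assume t: "test_function \<phi>"
    then have \<phi>: "Ck_on k UNIV \<phi>" "bsupp \<phi>" for k by (auto simp: test_function_iff)
    have [measurable]: "D \<in> borel_measurable borel" "(\<lambda>x. helm \<kappa> \<phi> x) \<in> borel_measurable borel"
      by (intro borel_measurable_continuous_onI helmholtz_continuous \<phi> Dc)+
    have "(LBINT x. H x * \<phi> x) = (LBINT x. D x * helm \<kappa> \<phi> x)"
      unfolding H_def by (rule helmholtz_symmetric[OF DC \<phi>, symmetric])
    also have "\<dots> = (LBINT x. d x * helm \<kappa> \<phi> x)"
      by (rule integral_cong_AE) (measurable, use AE_lborel_singleton[of y] dD in \<open>auto elim!: eventually_mono\<close>)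
    also have "\<dots> = 0" using weak t by simp
    finally show "(LBINT x. H x * \<phi> x) = 0" .
  qed
  then show ?thesis using that DC dD unfolding H_def by blast
qed

section \<open>Radiating solutions\<close>

text \<open>Testing the equation with the cut-off conjugate of \<open>D\<close>: apart from the
  radial flux, the integrand is real. Hence the flux, averaged with the weight of the shell,
  vanishes.\<close>

lemma energy_flux_zero:
  fixes D :: "real^3 => complex"
  assumes D: "Ck_on 2 UNIV D" and h: "\<And>x. helm \<kappa> D x = 0" and b: "b > 0"
  shows "(LBINT x. sbump (a - (x \<bullet> x) * b) * Im (D x * cnj (pd D x x))) = 0"
proof -
  define C where "C x = cnj (D x)" for x
  have CC: "Ck_on 2 UNIV C" unfolding C_def by (rule Ck_on_bounded_linear_compose[OF bounded_linear_cnj open_UNIV D])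
  have hC: "helm \<kappa> C x = 0" for x
  proof -
    have "laplacian C x = cnj (laplacian D x)"
      unfolding C_def by (rule laplacian_bounded_linear[OF bounded_linear_cnj open_UNIV UNIV_I D])
    then show ?thesis using arg_cong[OF h[of x], of cnj] by (simp add: C_def)
  qed
  have pC: "pd C v x = cnj (pd D v x)" for v x
    using frechet_derivative_eqI[OF bounded_linear.has_derivative[OF bounded_linear_cnj Ck_on_2D(1)[OF open_UNIV D UNIV_I]]]
    by (simp add: C_def[abs_def])
  define \<phi> where "\<phi> x = qcut a b x * C x" for x
  have \<phi>: "Ck_on 2 UNIV \<phi>" "bsupp \<phi>"
    unfolding \<phi>_def by (intro Ck_on_mult Ck_on_qcut CC bsupp_mult_left bsupp_qcut b open_UNIV)+
  let ?\<beta> = "\<lambda>x::real^3. sbump (a - (x \<bullet> x) * b)"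
  have sc: "continuous_on UNIV sbump" using Ck_on_sbump[of 0] by simp
  have Cx: "continuous_on UNIV (\<lambda>x. pd D x x)"
    by (subst pd_expand[OF Ck_on_2D(1)[OF open_UNIV D UNIV_I], symmetric])
       (intro continuous_on_sum continuous_intros Ck_on_2D(7)[OF open_UNIV D])
  have i2: "integrable lborel (\<lambda>x. D x * helm \<kappa> \<phi> x)"
    by (intro continuous_bsupp_integrable continuous_intros helmholtz_continuous helmholtz_bsupp \<phi> bsupp_mult_right Ck_on_2D(6)[OF _ D] open_UNIV)
  have "0 = (LBINT x. D x * helm \<kappa> \<phi> x)"
    unfolding helmholtz_symmetric[OF D \<phi>] h by simp
  then have "0 = (LBINT x. Im (D x * helm \<kappa> \<phi> x))"
    using i2 by (subst integral_Im) auto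
  also have "(\<lambda>x. Im (D x * helm \<kappa> \<phi> x)) = (\<lambda>x. - (4 * b) * (?\<beta> x * Im (D x * cnj (pd D x x))))"
  proof
    fix x
    have "laplacian (qcut a b) x = of_real (laplacian (\<lambda>x. sstep (a - (x \<bullet> x) * b)) x)"
      unfolding qcut_def
      by (rule laplacian_bounded_linear[OF bounded_linear_of_real open_UNIV UNIV_I])
         (intro Ck_on_compose_real[OF _ _ subset_UNIV _ Ck_on_sstep] Ck_on_quadratic open_UNIV)
    then have "Im (D x * (laplacian (qcut a b) x * C x)) = 0" by (simp add: C_def)
    moreover have "helm \<kappa> \<phi> x = laplacian (qcut a b) x * C x - of_real (4 * b * ?\<beta> x) * cnj (pd D x x)"
      unfolding \<phi>_def using helmholtz_qcut_mult[OF open_UNIV UNIV_I CC hC] by (simp only: pC)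
    ultimately show "Im (D x * helm \<kappa> \<phi> x) = - (4 * b) * (?\<beta> x * Im (D x * cnj (pd D x x)))"
      by (simp add: right_diff_distrib)
  qed
  finally show ?thesis using b by simp
qed

text \<open>Averages over shells of radius about R replace surface integrals. By the radiation
  condition the flux is nearly - \<kappa> |x| |D|^2, so its vanishing average bounds the integral of
  |D|^2 over a shell by O(\<epsilon>^2 R). The fundamental solution applied to
  \<open>cutoff R\<close> times \<open>D\<close> expresses \<open>D x0\<close> through values on
  such a shell and yields the bound \<open>K * \<epsilon>\<close>.\<close>

theorem radiating_entire_solution_zero:
  fixes D :: "real^3 => complex"
  assumes D: "Ck_on 2 UNIV D" and h: "\<And>x. helm \<kappa> D x = 0" and \<kappa>: "\<kappa> > 0"
    and rad: "((\<lambda>x. pd D x x - \<i> * of_real \<kappa> * of_real (norm x) * D x) \<longlongrightarrow> 0) at_infinity"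
  shows "D x0 = 0"
proof -
  define p where "p x = pd D x x" for x
  define S where "S x = p x - \<i> * of_real \<kappa> * of_real (norm x) * D x" for x
  have Dc: "continuous_on UNIV D" by (rule Ck_on_2D(6)[OF open_UNIV D])
  have pc: "continuous_on UNIV p"
    unfolding p_def by (subst pd_expand[OF Ck_on_2D(1)[OF open_UNIV D UNIV_I], symmetric])
       (intro continuous_on_sum continuous_intros Ck_on_2D(7)[OF open_UNIV D])
  have Sc: "continuous_on UNIV S" unfolding S_def by (intro continuous_intros pc Dc)
  have sc: "continuous_on UNIV sbump" using Ck_on_sbump[of 0] by simp
  obtain M1 where M1: "M1 > 0" "\<And>t. \<bar>sbump t\<bar> \<le> M1" using sbump_bounded by blast
  obtain M3 where M3: "M3 > 0" "\<And>R x. R > 0 \<Longrightarrow> norm (laplacian (cutoff R) x) \<le> M3 / R\<^sup>2" using laplacian_cutoff_bounded by blast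
  have "compact {2/5..4/5::real}" by simp
  then obtain t0 where t0: "t0 \<in> {2/5..4/5}" "\<And>t. t \<in> {2/5..4/5} \<Longrightarrow> sbump t0 \<le> sbump t"
    using continuous_attains_inf[of "{2/5..4/5}" sbump] continuous_on_subset[OF sc] by auto
  define c0 where "c0 = sbump t0"
  have c0: "c0 > 0" unfolding c0_def by (rule sbump_pos) (use t0 in auto)
  define C2 where "C2 = M3 + 4 * M1"
  define V where "V = 4 / 3 * pi * 8"
  define K where "K = C2 * ((2 + 2 * \<kappa>) * (4 * M1 * V / (c0 * \<kappa>\<^sup>2) + V))"
  have V0: "V > 0" by (simp add: V_def)
  have C2: "C2 > 0" using M1 M3 by (simp add: C2_def)
  have main: "norm (D x0) \<le> K * \<epsilon>" if \<epsilon>: "\<epsilon> > 0" for \<epsilon>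
  proof -
    obtain R0 where R0: "\<And>x. norm x \<ge> R0 \<Longrightarrow> norm (S x) \<le> \<epsilon>"
      using rad \<epsilon> unfolding Lim_at_infinity S_def[symmetric] p_def[symmetric] dist_norm by (metis diff_zero less_imp_le)
    \<comment> \<open>The weight \<beta> lives where |x| \<ge> R/2, so R \<ge> 2 R0 puts it where
      the radiation error is below \<epsilon>; R \<ge> 2 |x0| keeps \<open>x0\<close> at distance
      R/2 from the shell on which \<open>cutoff R\<close> varies.\<close>
    define R where "R = max 1 (max (2 * norm x0) (2 * \<bar>R0\<bar>))"
    have R: "R \<ge> 1" "R \<ge> 2 * norm x0" "R \<ge> 2 * R0" "R > 0" by (auto simp: R_def)
    \<comment> \<open>The numbers 6/5 and 2/(5 R^2) send the shell R^2 \<le> |x|^2 \<le> 2 R^2,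
      where \<open>cutoff R\<close> varies, onto [2/5, 4/5], a compact part of (0, 1) on which
      \<open>sbump\<close> is at least \<open>c0\<close>.\<close>
    define \<beta> where "\<beta> x = sbump (6/5 - (x \<bullet> x) * (2 / (5 * R\<^sup>2)))" for x :: "real^3"
    have \<beta>c: "continuous_on UNIV \<beta>"
      unfolding \<beta>_def by (intro continuous_on_compose2[OF sc] continuous_intros) auto
    have \<beta>n: "\<beta> x \<ge> 0" "\<beta> x \<le> M1" for x using sbump_nonneg M1(2)[of "6/5 - (x \<bullet> x) * (2 / (5 * R\<^sup>2))"] by (auto simp: \<beta>_def)
    have \<beta>s: "R / 2 \<le> norm x \<and> norm x \<le> 2 * R" if "\<beta> x \<noteq> 0" for x
    proof -
      have a: "0 \<le> 6/5 - (x \<bullet> x) * (2 / (5 * R\<^sup>2))" "6/5 - (x \<bullet> x) * (2 / (5 * R\<^sup>2)) \<le> 1"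
        using that sbump_eq_0 unfolding \<beta>_def by (meson not_less)+
      have "x \<bullet> x \<le> 3 * R\<^sup>2" "R\<^sup>2 \<le> 2 * (x \<bullet> x)" using a R by (simp_all add: field_simps)
      then have "(norm x)\<^sup>2 \<le> (2 * R)\<^sup>2" "(R / 2)\<^sup>2 \<le> (norm x)\<^sup>2"
        using zero_le_power2[of R] by (auto simp: power2_norm_eq_inner power_mult_distrib power_divide)
      then show ?thesis using R power2_le_imp_le[of "norm x" "2 * R"] power2_le_imp_le[of "R / 2" "norm x"] by simp
    qed
    have \<beta>b: "bsupp \<beta>" unfolding bsupp_def using \<beta>s by (metis not_less)
    \<comment> \<open>Pointwise form of the flux argument: Im (D conj p) = Im (D conj S) - \<kappa>
      |x| |D|^2 with the radiation error \<open>S\<close>, and Young's inequality absorbs the mixed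
      term into half of the quadratic one.\<close>
    have key: "\<beta> x * Im (D x * cnj (p x)) + \<kappa> * R / 4 * (\<beta> x * (norm (D x))\<^sup>2) \<le> M1 * \<epsilon>\<^sup>2 / (\<kappa> * R) * indicator (cball 0 (2 * R)) x" for x
    proof (cases "\<beta> x = 0")
      case False
      let ?d = "norm (D x)"
      note r = \<beta>s[OF False]
      have "norm (S x) \<le> \<epsilon>" using r R by (intro R0) auto
      have "D x * cnj (p x) = D x * cnj (S x) - \<i> * of_real (\<kappa> * norm x) * (D x * cnj (D x))"
        by (simp add: S_def algebra_simps)
      then have "Im (D x * cnj (p x)) = Im (D x * cnj (S x)) - \<kappa> * norm x * ?d\<^sup>2"
        by (simp add: complex_norm_square[symmetric] flip: of_real_power of_real_mult)
      also have "\<dots> \<le> ?d * \<epsilon> - \<kappa> * (R / 2) * ?d\<^sup>2"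
        using abs_Im_le_cmod[of "D x * cnj (S x)"] mult_left_mono[OF \<open>norm (S x) \<le> \<epsilon>\<close>, of ?d] r \<kappa>
        by (intro diff_mono mult_right_mono mult_left_mono) (auto simp: norm_mult)
      also have "?d * \<epsilon> \<le> \<kappa> * R / 4 * ?d\<^sup>2 + \<epsilon>\<^sup>2 / (\<kappa> * R)"
      proof -
        have "0 \<le> (\<kappa> * R / 2 * ?d - \<epsilon>)\<^sup>2 / (\<kappa> * R)" using \<kappa> R by simp
        also have "\<dots> = \<kappa> * R / 4 * ?d\<^sup>2 + \<epsilon>\<^sup>2 / (\<kappa> * R) - ?d * \<epsilon>"
          using \<kappa> R by (simp add: power2_eq_square field_simps)
        finally show ?thesis by simp
      qed
      finally have "Im (D x * cnj (p x)) + \<kappa> * R / 4 * ?d\<^sup>2 \<le> \<epsilon>\<^sup>2 / (\<kappa> * R)" by (simp add: algebra_simps)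
      then have "\<beta> x * (Im (D x * cnj (p x)) + \<kappa> * R / 4 * ?d\<^sup>2) \<le> M1 * (\<epsilon>\<^sup>2 / (\<kappa> * R))"
        using \<beta>n[of x] \<kappa> R by (intro order_trans[OF mult_left_mono mult_right_mono]) auto
      then show ?thesis using r by (simp add: distrib_left mult_ac)
    qed (use M1 R \<kappa> in simp)
    have bi: "integrable lborel (\<lambda>x. \<beta> x * (norm (D x))\<^sup>2)" "integrable lborel (\<lambda>x. \<beta> x * Im (D x * cnj (p x)))"
      by (intro continuous_bsupp_integrable continuous_intros \<beta>c Dc pc bsupp_mult_left \<beta>b)+
    have flux: "(LBINT x. \<beta> x * Im (D x * cnj (p x))) = 0"
      unfolding \<beta>_def p_def by (rule energy_flux_zero[OF D h]) (use R in simp)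
    have "\<kappa> * R / 4 * (LBINT x. \<beta> x * (norm (D x))\<^sup>2) = (LBINT x. \<beta> x * Im (D x * cnj (p x)) + \<kappa> * R / 4 * (\<beta> x * (norm (D x))\<^sup>2))"
      using bi flux by simp
    also have "\<dots> \<le> (LBINT x. M1 * \<epsilon>\<^sup>2 / (\<kappa> * R) * indicator (cball (0::real^3) (2 * R)) x)"
      by (rule integral_mono[OF _ integrable_indicator_cball key]) (use bi in simp)
    also have "\<dots> = M1 * \<epsilon>\<^sup>2 / (\<kappa> * R) * (V * R ^ 3)"
      using R by (simp add: measure_cball_3 V_def power_mult_distrib)
    finally have E1: "(LBINT x. \<beta> x * (norm (D x))\<^sup>2) \<le> 4 * M1 * V * \<epsilon>\<^sup>2 * R / \<kappa>\<^sup>2"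
      using \<kappa> R by (simp add: field_simps eval_nat_numeral)
    define sh where "sh = {x::real^3. R\<^sup>2 \<le> x \<bullet> x \<and> x \<bullet> x \<le> 2 * R\<^sup>2}"
    have shr: "R \<le> norm x" "norm x \<le> 2 * R" if "x \<in> sh" for x
    proof -
      have "R\<^sup>2 \<le> (norm x)\<^sup>2" "(norm x)\<^sup>2 \<le> (2 * R)\<^sup>2"
        using that zero_le_power2[of R] by (auto simp: sh_def power2_norm_eq_inner power_mult_distrib)
      then show "R \<le> norm x" "norm x \<le> 2 * R"
        using R power2_le_imp_le[of "norm x" "2 * R"] power2_le_imp_le[of R "norm x"] by simp_all
    qed
    have sh\<beta>: "c0 \<le> \<beta> x" if "x \<in> sh" for x
    proof -
      have "6/5 - (x \<bullet> x) * (2 / (5 * R\<^sup>2)) \<in> {2/5..4/5}"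
        using that R by (auto simp: sh_def field_simps)
      from t0(2)[OF this] show ?thesis by (simp add: \<beta>_def c0_def)
    qed
    define \<phi> where "\<phi> x = cutoff R x * D x" for x
    have \<phi>: "Ck_on 2 UNIV \<phi>" "bsupp \<phi>"
      unfolding \<phi>_def by (intro Ck_on_mult Ck_on_cutoff D bsupp_mult_left bsupp_cutoff R open_UNIV)+
    define g where "g x = helm \<kappa> \<phi> x" for x
    have gb: "norm (g x) \<le> C2 / R\<^sup>2 * (norm (D x) + norm (p x))" for x
    proof -
      have "norm (of_real (4 * (1 / R\<^sup>2) * sbump (2 - (x \<bullet> x) * (1 / R\<^sup>2))) :: complex) \<le> 4 * M1 / R\<^sup>2"
        using M1(2)[of "2 - (x \<bullet> x) * (1 / R\<^sup>2)"] R unfolding norm_of_real by (simp add: abs_mult divide_right_mono)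
      moreover have "norm (g x) \<le> norm (laplacian (cutoff R) x) * norm (D x) + norm (of_real (4 * (1 / R\<^sup>2) * sbump (2 - (x \<bullet> x) * (1 / R\<^sup>2))) :: complex) * norm (p x)"
        unfolding g_def \<phi>_def cutoff_qcut helmholtz_qcut_mult[OF open_UNIV UNIV_I D h] p_def norm_mult[symmetric] by (rule norm_triangle_ineq4)
      ultimately have "norm (g x) \<le> M3 / R\<^sup>2 * norm (D x) + 4 * M1 / R\<^sup>2 * norm (p x)"
        using M3(2)[OF R(4), of x] by (elim order_trans) (intro add_mono mult_right_mono, auto)
      also have "\<dots> \<le> C2 / R\<^sup>2 * norm (D x) + C2 / R\<^sup>2 * norm (p x)"
        using M1 M3 by (intro add_mono mult_right_mono divide_right_mono) (auto simp: C2_def)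
      finally show ?thesis by (simp add: distrib_left)
    qed
    have gs: "g x = 0" if "x \<notin> sh" for x
    proof -
      have "x \<bullet> x < R\<^sup>2 \<or> x \<bullet> x > 2 * R\<^sup>2" using that by (auto simp: sh_def)
      then consider "x \<bullet> x < R\<^sup>2" | "x \<bullet> x > 2 * R\<^sup>2" by blast
      then show ?thesis
      proof cases
        case 1
        have "open {x::real^3. x \<bullet> x < R\<^sup>2}" by (intro open_Collect_less continuous_intros)
        then have "laplacian \<phi> x = laplacian D x"
          by (rule laplacian_cong_open) (use 1 R in \<open>auto simp: \<phi>_def cutoff_def intro!: sstep_eq_1\<close>)
        moreover have "\<phi> x = D x" using 1 R by (auto simp: \<phi>_def cutoff_def intro!: sstep_eq_1)
        ultimately show ?thesis using h by (simp add: g_def)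
      next
        case 2
        have z: "\<phi> x = 0" if "x \<bullet> x > 2 * R\<^sup>2" for x
          using that R by (auto simp: \<phi>_def cutoff_def divide_simps intro!: sstep_eq_0)
        have "open {x::real^3. x \<bullet> x > 2 * R\<^sup>2}" by (intro open_Collect_less continuous_intros)
        then have "laplacian \<phi> x = laplacian (\<lambda>x. 0) x"
          by (rule laplacian_cong_open) (use 2 z in auto)
        also have "\<dots> = 0" by (simp add: laplacian_def)
        finally show ?thesis using z[OF 2] by (simp add: g_def)
      qed
    qed
    define \<phi>x where "\<phi>x z = \<phi> (x0 - z)" for z
    have \<phi>x: "Ck_on 2 UNIV \<phi>x" "bsupp \<phi>x" unfolding \<phi>x_def by (intro Ck_on_reflect bsupp_reflect \<phi>)+
    have gc: "continuous_on UNIV g" "bsupp g" unfolding g_def by (intro helmholtz_continuous helmholtz_bsupp \<phi>)+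
    have gm: "(\<lambda>x. norm (g x)) \<in> borel_measurable borel"
      by (intro borel_measurable_continuous_onI continuous_intros gc)
    let ?W = "\<lambda>z. C2 / R\<^sup>2 * ((2 + 2 * \<kappa>) * (R\<^sup>2 / (\<epsilon> * c0) * (\<beta> z * (norm (D z))\<^sup>2) + \<epsilon> * indicator (cball (0::real^3) (2 * R)) z))"
    have gi: "integrable lborel (\<lambda>x. norm (g x))" by (intro integrable_norm continuous_bsupp_integrable gc)
    have "\<phi> x0 = (LBINT z. Gplus z \<kappa> * g (x0 - z))"
      using fundamental_solution[OF \<phi>x \<kappa>] laplacian_reflect(1)[OF \<phi>(1), of x0] by (simp add: \<phi>x_def[abs_def] g_def)
    then have "norm (\<phi> x0) \<le> (LBINT z. norm (Gplus z \<kappa> * g (x0 - z)))" by simp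
    also have "\<dots> \<le> (LBINT z. 1 / R * norm (g (x0 - z)))"
    proof (rule integral_mono)
      show "integrable lborel (\<lambda>z. norm (Gplus z \<kappa> * g (x0 - z)))"
      proof (rule integrable_norm)
        have "bsupp (\<lambda>z. g (x0 - z))" by (rule bsupp_reflect(1)[OF gc(2)])
        then obtain Q where Q: "\<And>z. norm z > Q \<Longrightarrow> g (x0 - z) = 0" by (auto simp: bsupp_def)
        obtain B where B: "\<And>z. norm (g z) \<le> B" using continuous_bsupp_bounded[OF gc] by metis
        have "continuous_on UNIV (\<lambda>z. g (x0 - z))" by (intro continuous_on_compose2[OF gc(1)] continuous_intros) auto
        then have "(\<lambda>z. g (x0 - z)) \<in> borel_measurable borel" by (rule borel_measurable_continuous_onI)
        from integrable_Gplus_bounded(1)[OF this B Q] show "integrable lborel (\<lambda>z. Gplus z \<kappa> * g (x0 - z))" .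
      qed
      show "integrable lborel (\<lambda>z. 1 / R * norm (g (x0 - z)))"
        using gi lborel_integral_reflect(2)[OF gm, of x0] by simp
      fix z
      show "norm (Gplus z \<kappa> * g (x0 - z)) \<le> 1 / R * norm (g (x0 - z))"
      proof (cases "x0 - z \<in> sh")
        case True
        have "R \<le> norm (x0 - z)" by (rule shr[OF True])
        then have "norm z \<ge> R / 2" using R norm_triangle_ineq4[of x0 z] by linarith
        moreover have "2 \<le> 4 * pi" using pi_gt3 by linarith
        ultimately have "2 * (R / 2) \<le> 4 * pi * norm z" using R by (intro mult_mono) auto
        then have "1 / (4 * pi * norm z) \<le> 1 / R" using R by (intro frac_le) auto
        then show ?thesis unfolding norm_mult norm_Gplus by (intro mult_right_mono) auto
      qed (simp add: gs)
    qed
    also have "\<dots> = 1 / R * (LBINT z. norm (g z))"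
      using lborel_integral_reflect(1)[OF gm, of x0] by simp
    \<comment> \<open>Young's inequality with weight R^2/\<epsilon> converts the L^2 bound
      \<open>E1\<close> into an L^1 bound; both of its terms are O(\<epsilon> R^3) before the factor
      R^-2 of the commutator.\<close>
    also have "(LBINT z. norm (g z)) \<le> (LBINT z. ?W z)"
    proof (rule integral_mono[OF gi])
      show "integrable lborel (\<lambda>z. ?W z)"
        by (intro integrable_mult_right Bochner_Integration.integrable_add bi integrable_indicator_cball)
      fix z
      show "norm (g z) \<le> ?W z"
      proof (cases "z \<in> sh")
        case False
        then show ?thesis using gs C2 \<kappa> R \<epsilon> c0 \<beta>n by (simp add: gs)
      next
        case True
        note r = shr[OF True]
        let ?d = "norm (D z)" and ?w = "R\<^sup>2 / (\<epsilon> * c0) * (\<beta> z * (norm (D z))\<^sup>2) + \<epsilon>"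
        have "0 \<le> (R * ?d - \<epsilon>)\<^sup>2 / \<epsilon>" using \<epsilon> by simp
        also have "\<dots> = R\<^sup>2 / \<epsilon> * ?d\<^sup>2 + \<epsilon> - 2 * (R * ?d)" using \<epsilon> by (simp add: power2_eq_square field_simps)
        finally have "2 * (R * ?d) \<le> R\<^sup>2 / \<epsilon> * ?d\<^sup>2 + \<epsilon>" by simp
        moreover have "0 \<le> R * ?d" using R by (intro mult_nonneg_nonneg) auto
        ultimately have "R * ?d \<le> R\<^sup>2 / \<epsilon> * ?d\<^sup>2 + \<epsilon>" by linarith
        also have "R\<^sup>2 / \<epsilon> * ?d\<^sup>2 = R\<^sup>2 / (\<epsilon> * c0) * (c0 * ?d\<^sup>2)" using c0 by simp
        also have "\<dots> \<le> R\<^sup>2 / (\<epsilon> * c0) * (\<beta> z * ?d\<^sup>2)"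
          using sh\<beta>[OF True] \<epsilon> c0 by (intro mult_left_mono mult_right_mono) auto
        finally have w: "R * ?d \<le> ?w" by simp
        have w\<epsilon>: "\<epsilon> \<le> ?w" using \<epsilon> c0 \<beta>n by simp
        have "norm (S z) \<le> \<epsilon>" using r R by (intro R0) auto
        then have "norm (p z) \<le> \<kappa> * norm z * ?d + \<epsilon>"
          using norm_triangle_ineq[of "S z" "\<i> * of_real \<kappa> * of_real (norm z) * D z"] \<kappa> by (simp add: S_def norm_mult)
        also have "\<kappa> * norm z * ?d \<le> \<kappa> * (2 * R) * ?d" using r \<kappa> by (intro mult_right_mono mult_left_mono) auto
        also have "\<dots> \<le> 2 * \<kappa> * ?w" using w \<kappa> by simp
        finally have "?d + norm (p z) \<le> ?w + (2 * \<kappa> * ?w + ?w)"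
          using w w\<epsilon> mult_right_mono[OF R(1), of ?d, simplified] by linarith
        also have "\<dots> = (2 + 2 * \<kappa>) * ?w" by (simp only: distrib_right mult_2 add_ac)
        finally have "C2 / R\<^sup>2 * (?d + norm (p z)) \<le> C2 / R\<^sup>2 * ((2 + 2 * \<kappa>) * ?w)"
          using C2 by (intro mult_left_mono) auto
        then show ?thesis using gb[of z] r by simp
      qed
    qed
    also have "\<dots> = C2 / R\<^sup>2 * ((2 + 2 * \<kappa>) * (R\<^sup>2 / (\<epsilon> * c0) * (LBINT z. \<beta> z * (norm (D z))\<^sup>2) + \<epsilon> * (V * R ^ 3)))"
      using R by (subst integral_mult_right_zero integral_mult_right_zero bint_add[OF integrable_mult_right[OF bi(1)] integrable_indicator_cball])+
         (simp add: measure_cball_3 V_def power_mult_distrib)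
    also have "\<dots> \<le> C2 / R\<^sup>2 * ((2 + 2 * \<kappa>) * (R\<^sup>2 / (\<epsilon> * c0) * (4 * M1 * V * \<epsilon>\<^sup>2 * R / \<kappa>\<^sup>2) + \<epsilon> * (V * R ^ 3)))"
      using E1 C2 \<kappa> R \<epsilon> c0 V0 by (intro mult_left_mono add_mono) auto
    also have "\<dots> = R * (K * \<epsilon>)"
      using R \<epsilon> c0 \<kappa> by (simp add: K_def field_simps eval_nat_numeral)
    finally have "norm (\<phi> x0) \<le> 1 / R * (R * (K * \<epsilon>))" using R by (simp add: divide_right_mono)
    moreover have "\<phi> x0 = D x0" using cutoff_1[of R x0] R norm_ge_zero[of x0] by (simp add: \<phi>_def)
    ultimately show ?thesis using R by simp
  qed
  have K0: "K \<ge> 0" unfolding K_def using C2 V0 c0 M1 \<kappa> by (intro mult_nonneg_nonneg add_nonneg_nonneg divide_nonneg_nonneg) auto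
  have "norm (D x0) \<le> e" if "e > 0" for e
  proof -
    have "norm (D x0) \<le> K * (e / (K + 1))" using that K0 by (intro main) auto
    also have "\<dots> \<le> e" using that K0 by (simp add: field_simps)
    finally show ?thesis .
  qed
  then have "norm (D x0) \<le> 0" by (rule field_le_epsilon[of _ 0, simplified])
  then show ?thesis by simp
qed

section \<open>Volume potentials\<close>

text \<open>With the sign of \<open>Gplus\<close>, (\<Delta> + \<kappa>^2) applied to
  \<open>pot \<kappa> f\<close> gives f itself; \<open>pot_weak\<close> is the tested form.\<close>

definition pot :: "real => (real^3 => complex) => real^3 => complex" where
  "pot \<kappa> f x = (LBINT z. Gplus (x - z) \<kappa> * f z)"

definition invnorm :: "real => real" where
  "invnorm R = (LBINT x. indicator (cball (0::real^3) R) x / norm x)"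

text \<open>The quadratic decay is what makes the contribution near the diagonal small, uniformly in
  the density.\<close>

lemma invnorm_scale:
  assumes "r > 0" shows "invnorm r = r\<^sup>2 * invnorm 1"
proof -
  have m: "(\<lambda>x::real^3. indicator (cball 0 r) x / norm x :: real) \<in> borel_measurable borel"
    by (intro borel_measurable_divide borel_measurable_indicator) auto
  have "invnorm r = \<bar>r\<bar> ^ DIM(real^3) *\<^sub>R (LBINT x. indicator (cball (0::real^3) r) (0 + r *\<^sub>R x) / norm (0 + r *\<^sub>R x))"
    unfolding invnorm_def using lborel_integral_affine(1)[OF _ m, of r 0] assms by simp
  also have "(\<lambda>x::real^3. indicator (cball 0 r) (0 + r *\<^sub>R x) / norm (0 + r *\<^sub>R x)) = (\<lambda>x. (1 / r) * (indicator (cball 0 1) x / norm x))"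
    using assms by (auto simp: indicator_def fun_eq_iff)
  also have "\<bar>r\<bar> ^ DIM(real^3) *\<^sub>R (LBINT x. (1 / r) * (indicator (cball (0::real^3) 1) x / norm x)) = r\<^sup>2 * invnorm 1"
    unfolding invnorm_def integral_mult_right_zero using assms by (simp add: field_simps eval_nat_numeral)
  finally show ?thesis .
qed

lemma invnorm_nonneg: "invnorm R \<ge> 0"
  unfolding invnorm_def by (rule Bochner_Integration.integral_nonneg) (auto simp: indicator_def)

text \<open>Bound and radius are explicit parameters because the compactness argument needs
  estimates that are uniform over a family of densities.\<close>

definition dens :: "real => real => (real^3 => complex) => bool" where
  "dens B A f \<longleftrightarrow> f \<in> borel_measurable borel \<and> (\<forall>x. norm (f x) \<le> B) \<and> (\<forall>x. norm x > A \<longrightarrow> f x = 0)"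

lemma densD:
  assumes "dens B A f"
  shows "f \<in> borel_measurable borel" "norm (f x) \<le> B" "norm x > A \<Longrightarrow> f x = 0" "f x \<noteq> 0 \<Longrightarrow> norm x \<le> A" "B \<ge> 0"
proof -
  show "f \<in> borel_measurable borel" "norm (f x) \<le> B" "norm x > A \<Longrightarrow> f x = 0" "f x \<noteq> 0 \<Longrightarrow> norm x \<le> A"
    using assms by (auto simp: dens_def not_less[symmetric])
  have "norm (f 0) \<le> B" using assms by (simp add: dens_def)
  then show "B \<ge> 0" using norm_ge_zero order_trans by blast
qed

lemma dens_integrable:
  assumes f: "dens B A f"
  shows "integrable lborel f" "bsupp f" "(LBINT x. norm (f x)) \<le> B * measure lborel (cball (0::real^3) A)"
proof -
  have b: "norm (f x) \<le> B * indicator (cball 0 A) x" for x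
    using densD(2,3)[OF f, of x] by (cases "norm x > A") (auto simp: indicator_def)
  show I: "integrable lborel f"
    by (rule bintegrable_bound[OF integrable_indicator_cball[of B A]])
       (use order_trans[OF b abs_ge_self] densD(1)[OF f] in auto)
  have "(LBINT x. norm (f x)) \<le> (LBINT x. B * indicator (cball (0::real^3) A) x)"
    by (rule integral_mono[OF integrable_norm[OF I] integrable_indicator_cball b])
  then show "(LBINT x. norm (f x)) \<le> B * measure lborel (cball (0::real^3) A)" by simp
  show "bsupp f" using densD(3)[OF f] by (auto simp: bsupp_def)
qed

lemma pot_integrable:
  assumes f: "dens B A f"
  shows "integrable lborel (\<lambda>z. Gplus (x - z) \<kappa> * f z)"
    and "(LBINT z. norm (Gplus (x - z) \<kappa> * f z)) \<le> B * invnorm (norm x + A)"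
    and "norm (pot \<kappa> f x) \<le> B * invnorm (norm x + A)"
proof -
  note [measurable] = densD(1)[OF f]
  have m: "(\<lambda>w. f (x - w)) \<in> borel_measurable borel" "(\<lambda>w. Gplus w \<kappa> * f (x - w)) \<in> borel_measurable borel"
    "(\<lambda>w. norm (Gplus w \<kappa> * f (x - w))) \<in> borel_measurable borel" by measurable
  have z: "f (x - w) = 0" if "norm w > norm x + A" for w
    using that norm_triangle_ineq2[of w x] by (intro densD(3)[OF f]) (simp add: norm_minus_commute)
  note g = integrable_Gplus_bounded[where \<kappa> = \<kappa>, OF m(1) densD(2)[OF f] z]
  show "integrable lborel (\<lambda>z. Gplus (x - z) \<kappa> * f z)"
    using g(1) lborel_integral_reflect(2)[OF m(2), of x] by simp
  show n: "(LBINT z. norm (Gplus (x - z) \<kappa> * f z)) \<le> B * invnorm (norm x + A)"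
    using g(2) lborel_integral_reflect(1)[OF m(3), of x] by (simp add: invnorm_def)
  show "norm (pot \<kappa> f x) \<le> B * invnorm (norm x + A)" unfolding pot_def using integral_norm_bound n by (rule order_trans)
qed

text \<open>The kernel splits into the Lipschitz part \<open>Gam\<close> and a part near the
  diagonal, whose potential is at most \<open>B * invnorm (2 * \<delta>)\<close>. That \<eta> does
  not depend on the density is the equicontinuity required by Arzela-Ascoli.\<close>

lemma pot_equicontinuous:
  assumes B: "B \<ge> 0" and \<epsilon>: "\<epsilon> > 0"
  obtains \<eta> where "\<eta> > 0" "\<And>f x y. \<lbrakk>dens B A f; norm x \<le> S; norm y \<le> S; norm (x - y) < \<eta>\<rbrakk> \<Longrightarrow> norm (pot \<kappa> f x - pot \<kappa> f y) < \<epsilon>"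
proof -
  \<comment> \<open>Chosen so that B \<open>invnorm\<close> (2 \<delta>), which is 4 \<delta>^2 B
    \<open>invnorm 1\<close>, stays below \<epsilon>/4; the added ones prevent division by
    0.\<close>
  define \<delta> where "\<delta> = sqrt (\<epsilon> / (16 * (B + 1) * (invnorm 1 + 1)))"
  have i1: "invnorm 1 \<ge> 0" by (rule invnorm_nonneg)
  have \<delta>: "\<delta> > 0" using B \<epsilon> i1 by (simp add: \<delta>_def)
  have \<delta>2: "B * invnorm (2 * \<delta>) \<le> \<epsilon> / 4"
  proof -
    have "B * invnorm (2 * \<delta>) = B * (4 * \<delta>\<^sup>2 * invnorm 1)" using \<delta> by (subst invnorm_scale) (auto simp: power_mult_distrib)
    also have "\<dots> \<le> (B + 1) * (4 * \<delta>\<^sup>2 * (invnorm 1 + 1))" using B i1 by (intro mult_mono mult_left_mono) auto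
    also have "\<delta>\<^sup>2 = \<epsilon> / (16 * (B + 1) * (invnorm 1 + 1))" using B \<epsilon> i1 by (simp add: \<delta>_def)
    also have "(B + 1) * (4 * (\<epsilon> / (16 * (B + 1) * (invnorm 1 + 1))) * (invnorm 1 + 1)) = \<epsilon> / 4"
      using B i1 by (simp add: divide_simps add_nonneg_eq_0_iff)
    finally show ?thesis .
  qed
  obtain L where L: "L > 0" "\<And>u v. norm u \<le> \<bar>S\<bar> + \<bar>A\<bar> \<Longrightarrow> norm v \<le> \<bar>S\<bar> + \<bar>A\<bar> \<Longrightarrow> norm (Gam \<kappa> \<delta> u - Gam \<kappa> \<delta> v) \<le> L * norm (u - v)"
    using Ck1_lipschitz_cball[OF Ck_on_Gam[OF \<delta>, of 1 \<kappa>]] by metis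
  define V where "V = measure lborel (cball (0::real^3) A)"
  define \<eta> where "\<eta> = \<epsilon> / (4 * (L * (B * V) + 1))"
  have V: "V \<ge> 0" by (simp add: V_def)
  have LB: "L * (B * V) \<ge> 0" using L B V by (intro mult_nonneg_nonneg) auto
  show ?thesis
  proof
    show \<eta>: "\<eta> > 0" using LB \<epsilon> by (auto simp: \<eta>_def intro!: divide_pos_pos add_nonneg_pos)
    fix f :: "real^3 => complex" and x y :: "real^3"
    assume f: "dens B A f" and x: "norm x \<le> S" and y: "norm y \<le> S" and xy: "norm (x - y) < \<eta>"
    note fi = dens_integrable[OF f] and [measurable] = densD(1)[OF f]
    have Gc: "continuous_on UNIV (Gam \<kappa> \<delta>)" using Ck_on_Gam[OF \<delta>, of 0] by simp
    have gi: "integrable lborel (\<lambda>z. Gam \<kappa> \<delta> (x - z) * f z)" for x by (intro conv_integrable Gc fi(1,2))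
    define q where "q x = (LBINT z. Gam \<kappa> \<delta> (x - z) * f z)" for x
    have near: "norm (pot \<kappa> f x - q x) \<le> \<epsilon> / 4" for x
    proof -
      have "pot \<kappa> f x - q x = (LBINT z. Gplus (x - z) \<kappa> * f z - Gam \<kappa> \<delta> (x - z) * f z)"
        unfolding pot_def q_def by (rule bint_diff[OF pot_integrable(1)[OF f] gi, symmetric])
      also have "\<dots> = (LBINT z. Gplus (x - z) \<kappa> * (cutoff \<delta> (x - z) * f z))"
        by (intro bint_cong) (auto simp: Gam_def algebra_simps)
      also have "\<dots> = (LBINT w. Gplus w \<kappa> * (cutoff \<delta> w * f (x - w)))"
      proof -
        have "(\<lambda>w. Gplus w \<kappa> * (cutoff \<delta> w * f (x - w))) \<in> borel_measurable borel" by measurable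
        from lborel_integral_reflect(1)[OF this, of x] show ?thesis by simp
      qed
      also have "norm \<dots> \<le> (LBINT w. norm (Gplus w \<kappa> * (cutoff \<delta> w * f (x - w))))" by simp
      also have "\<dots> \<le> B * invnorm (2 * \<delta>)"
        unfolding invnorm_def
      proof (rule integrable_Gplus_bounded(2))
        show "norm (cutoff \<delta> w * f (x - w)) \<le> B" for w
          using mult_mono[OF norm_cutoff[of \<delta> w] densD(2)[OF f, of "x - w"]] by (simp add: norm_mult)
        show "cutoff \<delta> w * f (x - w) = 0" if "norm w > 2 * \<delta>" for w using cutoff_0[OF \<delta>, of w] that by simp
      qed measurable
      also have "\<dots> \<le> \<epsilon> / 4" by (rule \<delta>2)
      finally show ?thesis .
    qed
    have "q x - q y = (LBINT z. Gam \<kappa> \<delta> (x - z) * f z - Gam \<kappa> \<delta> (y - z) * f z)"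
      unfolding q_def by (rule bint_diff[OF gi gi, symmetric])
    also have "norm \<dots> \<le> (LBINT z. norm (Gam \<kappa> \<delta> (x - z) * f z - Gam \<kappa> \<delta> (y - z) * f z))" by simp
    also have "\<dots> \<le> (LBINT z. L * norm (x - y) * norm (f z))"
    proof (rule integral_mono)
      show "integrable lborel (\<lambda>z. norm (Gam \<kappa> \<delta> (x - z) * f z - Gam \<kappa> \<delta> (y - z) * f z))"
        by (intro integrable_norm bintegrable_diff gi)
      show "integrable lborel (\<lambda>z. L * norm (x - y) * norm (f z))" by (intro integrable_mult_right integrable_norm fi(1))
      fix z
      show "norm (Gam \<kappa> \<delta> (x - z) * f z - Gam \<kappa> \<delta> (y - z) * f z) \<le> L * norm (x - y) * norm (f z)"
      proof (cases "norm z > A")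
        case False
        have "norm (Gam \<kappa> \<delta> (x - z) - Gam \<kappa> \<delta> (y - z)) \<le> L * norm ((x - z) - (y - z))"
          using False x y norm_triangle_ineq4[of x z] norm_triangle_ineq4[of y z] by (intro L(2)) auto
        then show ?thesis unfolding left_diff_distrib[symmetric] norm_mult by (intro mult_right_mono) auto
      qed (simp add: densD(3)[OF f])
    qed
    also have "\<dots> = L * norm (x - y) * (LBINT z. norm (f z))" by simp
    also have "\<dots> \<le> L * norm (x - y) * (B * V)"
      unfolding V_def using L fi(3) by (intro mult_left_mono) auto
    also have "\<dots> = L * (B * V) * norm (x - y)" by simp
    also have "\<dots> \<le> L * (B * V) * \<eta>" using xy LB by (intro mult_left_mono) auto
    also have "\<dots> \<le> \<epsilon> / 4"
    proof -
      have "L * (B * V) / (L * (B * V) + 1) \<le> 1" using LB by simp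
      then have "\<epsilon> / 4 * (L * (B * V) / (L * (B * V) + 1)) \<le> \<epsilon> / 4 * 1" using \<epsilon> by (intro mult_left_mono) auto
      then show ?thesis by (simp add: \<eta>_def mult_ac)
    qed
    finally have qq: "norm (q x - q y) \<le> \<epsilon> / 4" .
    have "pot \<kappa> f x - pot \<kappa> f y = (pot \<kappa> f x - q x) + (q x - q y) - (pot \<kappa> f y - q y)" by simp
    also have "norm \<dots> \<le> \<epsilon> / 4 + \<epsilon> / 4 + \<epsilon> / 4"
      by (intro order_trans[OF norm_triangle_ineq4] add_mono order_trans[OF norm_triangle_ineq] near qq)
    finally show "norm (pot \<kappa> f x - pot \<kappa> f y) < \<epsilon>" using \<epsilon> by linarith
  qed
qed

lemma pot_continuous:
  assumes f: "dens B A f"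
  shows "continuous_on UNIV (pot \<kappa> f)"
proof (subst continuous_on_eq_continuous_at[OF open_UNIV], intro ballI)
  fix x :: "real^3"
  show "isCont (pot \<kappa> f) x"
    unfolding continuous_at_eps_delta
  proof (intro allI impI)
    fix e :: real assume e: "e > 0"
    obtain \<eta> where \<eta>: "\<eta> > 0" "\<And>f u v. \<lbrakk>dens B A f; norm u \<le> norm x + 1; norm v \<le> norm x + 1; norm (u - v) < \<eta>\<rbrakk> \<Longrightarrow> norm (pot \<kappa> f u - pot \<kappa> f v) < e"
      using pot_equicontinuous[OF densD(5)[OF f] e, of A "norm x + 1" \<kappa>] by metis
    have "dist (pot \<kappa> f y) (pot \<kappa> f x) < e" if "dist y x < min \<eta> 1" for y
    proof -
      have "norm y \<le> norm x + 1" using that norm_triangle_ineq2[of y x] by (simp add: dist_norm)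
      then show ?thesis unfolding dist_norm using that f by (intro \<eta>(2)) (auto simp: dist_norm)
    qed
    then show "\<exists>d>0. \<forall>x'. dist x' x < d \<longrightarrow> dist (pot \<kappa> f x') (pot \<kappa> f x) < e"
      using \<eta>(1) by (intro exI[of _ "min \<eta> 1"]) auto
  qed
qed

lemma pot_symmetric:
  assumes f: "dens B A f" and g: "dens Bg Q g"
  shows "(LBINT x. pot \<kappa> f x * g x) = (LBINT z. f z * pot \<kappa> g z)"
proof -
  let ?G = "\<lambda>x z. Gplus (x - z) \<kappa> * f z" and ?R = "invnorm (\<bar>Q\<bar> + \<bar>A\<bar>)"
  note [measurable] = densD(1)[OF f] densD(1)[OF g]
  have sym: "Gplus (x - z) \<kappa> = Gplus (z - x) \<kappa>" for x z by (simp add: Gplus_def norm_minus_commute)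
  have I: "integrable (lborel \<Otimes>\<^sub>M lborel) (\<lambda>(x, z). g x * ?G x z)"
  proof (rule lborel_pair.Fubini_integrable)
    show "(\<lambda>(x, z). g x * ?G x z) \<in> borel_measurable (lborel \<Otimes>\<^sub>M lborel)" by measurable
    have pf: "integrable lborel (\<lambda>z. ?G x z)" for x by (rule pot_integrable(1)[OF f])
    show "AE x in lborel. integrable lborel (\<lambda>y. case (x, y) of (x, z) => g x * ?G x z)"
      using pf by simp
    have "integrable lborel (\<lambda>x. norm (g x) * (LBINT z. norm (?G x z)))"
    proof (rule bintegrable_bound[OF integrable_indicator_cball[of "Bg * (B * ?R)" Q]])
      show "(\<lambda>x. norm (g x) * (LBINT z. norm (?G x z))) \<in> borel_measurable lborel" by measurable
      show "AE x in lborel. norm (norm (g x) * (LBINT z. norm (?G x z))) \<le> norm (Bg * (B * ?R) * indicator (cball 0 Q) x)"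
      proof (rule AE_I2)
        fix x :: "real^3"
        note Bp = densD(5)[OF g] densD(5)[OF f]
        show "norm (norm (g x) * (LBINT z. norm (?G x z))) \<le> norm (Bg * (B * ?R) * indicator (cball 0 Q) x)"
        proof (cases "norm x > Q")
          case False
          have "invnorm (norm x + A) \<le> ?R"
            unfolding invnorm_def
          proof (rule integral_mono[OF integrable_inverse_norm(1) integrable_inverse_norm(1)])
            show "indicator (cball 0 (norm x + A)) z / norm z \<le> (indicator (cball 0 (\<bar>Q\<bar> + \<bar>A\<bar>)) z / norm z :: real)" for z :: "real^3"
              using False by (auto simp: indicator_def)
          qed
          then have "(LBINT z. norm (?G x z)) \<le> B * ?R"
            using pot_integrable(2)[OF f, of x \<kappa>] Bp by (meson mult_left_mono order_trans)
          then have "norm (g x) * (LBINT z. norm (?G x z)) \<le> Bg * (B * ?R)"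
            using densD(2)[OF g, of x] Bp by (intro mult_mono) auto
          then show ?thesis using False Bp invnorm_nonneg[of "\<bar>Q\<bar> + \<bar>A\<bar>"] by (simp add: abs_mult)
        qed (simp add: densD(3)[OF g])
      qed
    qed
    then show "integrable lborel (\<lambda>x. LBINT y. norm (case (x, y) of (x, z) => g x * ?G x z))"
      by (simp add: norm_mult)
  qed
  have "(LBINT x. pot \<kappa> f x * g x) = (LBINT x. (LBINT z. g x * ?G x z))"
    by (simp add: pot_def mult.commute)
  also have "\<dots> = (LBINT z. (LBINT x. g x * ?G x z))"
    using lborel_pair.Fubini_integral[OF I] by simp
  also have "\<dots> = (LBINT z. f z * pot \<kappa> g z)"
  proof (rule bint_cong[OF refl])
    fix z
    have "(LBINT x. g x * ?G x z) = (LBINT x. f z * (Gplus (z - x) \<kappa> * g x))"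
      unfolding sym[of _ z] by (simp add: mult_ac)
    then show "(LBINT x. g x * ?G x z) = f z * pot \<kappa> g z" by (simp add: pot_def)
  qed
  finally show ?thesis .
qed

text \<open>The second claim is the fundamental solution translated to \<open>z\<close>; the first
  follows from it by the symmetry of the kernel.\<close>

lemma pot_weak:
  assumes f: "dens B A f"
    and \<phi>: "Ck_on 2 UNIV \<phi>" "bsupp \<phi>" and \<kappa>: "\<kappa> > 0"
  shows "(LBINT x. pot \<kappa> f x * helm \<kappa> \<phi> x) = (LBINT z. f z * \<phi> z)"
    and "pot \<kappa> (\<lambda>x. helm \<kappa> \<phi> x) z = \<phi> z"
proof -
  define g where "g x = helm \<kappa> \<phi> x" for x
  have gc: "continuous_on UNIV g" "bsupp g" unfolding g_def by (intro helmholtz_continuous helmholtz_bsupp \<phi>)+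
  have [measurable]: "g \<in> borel_measurable borel" using gc by (auto intro: borel_measurable_continuous_onI)
  obtain Bg where Bg: "\<And>x. norm (g x) \<le> Bg" using continuous_bsupp_bounded[OF gc] by metis
  obtain Q where Q: "\<And>x. norm x > Q \<Longrightarrow> g x = 0" using gc(2) by (auto simp: bsupp_def)
  have gp: "pot \<kappa> g z = \<phi> z" for z
  proof -
    define \<phi>x where "\<phi>x w = \<phi> (z - w)" for w
    have \<phi>x: "Ck_on 2 UNIV \<phi>x" "bsupp \<phi>x" unfolding \<phi>x_def by (intro Ck_on_reflect bsupp_reflect \<phi>)+
    have "\<phi> z = (LBINT w. Gplus w \<kappa> * g (z - w))"
      using fundamental_solution[OF \<phi>x \<kappa>] laplacian_reflect(1)[OF \<phi>(1), of z] by (simp add: \<phi>x_def[abs_def] g_def)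
    also have "\<dots> = pot \<kappa> g z"
    proof -
      have "(\<lambda>w. Gplus w \<kappa> * g (z - w)) \<in> borel_measurable borel" by measurable
      from lborel_integral_reflect(1)[OF this, of z] show ?thesis by (simp add: pot_def)
    qed
    finally show ?thesis by simp
  qed
  show "pot \<kappa> (\<lambda>x. helm \<kappa> \<phi> x) z = \<phi> z" by (rule gp[unfolded g_def[abs_def]])
  have "(LBINT x. pot \<kappa> f x * g x) = (LBINT z. f z * pot \<kappa> g z)"
    by (rule pot_symmetric[OF f, of Bg Q]) (use Bg Q in \<open>auto simp: dens_def\<close>)
  then show "(LBINT x. pot \<kappa> f x * helm \<kappa> \<phi> x) = (LBINT z. f z * \<phi> z)"
    unfolding gp by (simp only: g_def)
qed

lemma pd_Gam:
  assumes "\<delta> > 0" "norm w > 2 * \<delta>" shows "pd (Gam \<kappa> \<delta>) h w = pd (\<lambda>x. Gplus x \<kappa>) h w"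
proof -
  have "open {x::real^3. norm x > 2 * \<delta>}" by (intro open_Collect_less continuous_intros)
  then have "frechet_derivative (Gam \<kappa> \<delta>) (at w) = frechet_derivative (\<lambda>x. Gplus x \<kappa>) (at w)"
    by (rule frechet_derivative_cong_open) (use assms in \<open>auto simp: Gam_eq\<close>)
  then show ?thesis by simp
qed

lemmas pot_dens = pot_integrable(1,3) pot_continuous pot_weak(1)

text \<open>The factor 2 matches \<open>Gam_eq\<close>: at such distances \<open>Gam\<close>
  coincides with \<open>Gplus\<close>, and the potential is a convolution with a smooth
  kernel.\<close>

definition separated :: "real => (real^3) set => (real^3 => complex) => bool" where
  "separated \<delta> S f \<longleftrightarrow> (\<forall>x\<in>S. \<forall>z. f z \<noteq> 0 \<longrightarrow> norm (x - z) > 2 * \<delta>)"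

lemma pot_separated:
  assumes f: "integrable lborel f" "bsupp f" and S: "open S" and \<delta>: "\<delta> > 0" and sep: "separated \<delta> S f"
  shows "Ck_on k S (pot \<kappa> f)"
    and "x \<in> S \<Longrightarrow> helm \<kappa> (pot \<kappa> f) x = 0"
    and "x \<in> S \<Longrightarrow> pd (pot \<kappa> f) h x = (LBINT z. pd (\<lambda>x. Gplus x \<kappa>) h (x - z) * f z)"
    and "x \<in> S \<Longrightarrow> integrable lborel (\<lambda>z. pd (\<lambda>x. Gplus x \<kappa>) h (x - z) * f z)"
    and "x \<in> S \<Longrightarrow> integrable lborel (\<lambda>z. Gplus (x - z) \<kappa> * f z)"
proof -
  have s: "norm (x - z) > 2 * \<delta>" if "x \<in> S" "f z \<noteq> 0" for x z using sep that by (simp add: separated_def)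
  define q where "q x = (LBINT z. Gam \<kappa> \<delta> (x - z) * f z)" for x
  have e: "Gplus (x - z) \<kappa> * f z = Gam \<kappa> \<delta> (x - z) * f z" if "x \<in> S" for x z
    using s[OF that, of z] Gam_eq[OF \<delta>, of "x - z" \<kappa>] by (cases "f z = 0") auto
  have q: "pot \<kappa> f x = q x" if "x \<in> S" for x unfolding pot_def q_def by (simp only: e[OF that])
  have qC: "Ck_on k UNIV q" for k unfolding q_def by (intro Ck_on_conv f Ck_on_Gam \<delta>)
  note Gc = Ck_on_imp_continuous_on[OF Ck_on_Gam[OF \<delta>, of 0]]
  note Gc1 = Ck_on_2D(7)[OF open_UNIV Ck_on_Gam[OF \<delta>]]
  show "Ck_on k S (pot \<kappa> f)"
    by (rule Ck_on_cong_imp[OF S _ Ck_on_subset[OF S subset_UNIV qC]]) (simp add: q)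
  assume x: "x \<in> S"
  have "laplacian (pot \<kappa> f) x = laplacian q x" by (rule laplacian_cong_open[OF S x q])
  also have "\<dots> = (LBINT z. laplacian (Gam \<kappa> \<delta>) (x - z) * f z)"
    unfolding q_def by (rule laplacian_conv[OF Ck_on_Gam[OF \<delta>] f])
  also have "\<dots> = (LBINT z. - of_real (\<kappa>\<^sup>2) * (Gam \<kappa> \<delta> (x - z) * f z))"
  proof (rule bint_cong[OF refl])
    fix z show "laplacian (Gam \<kappa> \<delta>) (x - z) * f z = - of_real (\<kappa>\<^sup>2) * (Gam \<kappa> \<delta> (x - z) * f z)"
    proof (cases "f z = 0")
      case False
      have "Hker \<kappa> \<delta> (x - z) = 0" by (rule Hker_0[OF \<delta> s[OF x False]])
      then have "laplacian (Gam \<kappa> \<delta>) (x - z) = - (of_real (\<kappa>\<^sup>2) * Gam \<kappa> \<delta> (x - z))"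
        unfolding Hker_def neg_equal_0_iff_equal by (simp only: eq_neg_iff_add_eq_0)
      then show ?thesis by simp
    qed simp
  qed
  also have "\<dots> = - of_real (\<kappa>\<^sup>2) * q x" unfolding q_def by (simp only: integral_mult_right_zero)
  finally show "helm \<kappa> (pot \<kappa> f) x = 0" using q[OF x] by simp
  have ee: "pd (\<lambda>x. Gplus x \<kappa>) h (x - z) * f z = pd (Gam \<kappa> \<delta>) h (x - z) * f z" for z
    using pd_Gam[OF \<delta> s[OF x, of z]] by (cases "f z = 0") auto
  have "frechet_derivative (pot \<kappa> f) (at x) = frechet_derivative q (at x)"
    by (rule frechet_derivative_cong_open[OF S x q])
  then show "pd (pot \<kappa> f) h x = (LBINT z. pd (\<lambda>x. Gplus x \<kappa>) h (x - z) * f z)"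
    unfolding ee using frechet_derivative_conv[OF Ck_on_Gam[OF \<delta>] f] by (simp add: q_def[abs_def])
  show "integrable lborel (\<lambda>z. pd (\<lambda>x. Gplus x \<kappa>) h (x - z) * f z)"
    unfolding ee by (intro conv_integrable Gc1 f)
  show "integrable lborel (\<lambda>z. Gplus (x - z) \<kappa> * f z)"
    unfolding e[OF x] by (intro conv_integrable Gc f)
qed

text \<open>Both errors are one order smaller than the kernel. For w = x - z, the component of w
  along x differs from |w| by at most 2 A, and differentiating the amplitude 1/|w| gains another
  1/|w|. Uniformity in \<open>z\<close> carries the bound over to potentials.\<close>

lemma Gplus_radiation:
  assumes A: "norm z \<le> A" "norm x > 2 * A" and \<kappa>: "\<kappa> > 0"
  shows "norm (pd (\<lambda>x. Gplus x \<kappa>) (sgn x) (x - z) - \<i> * of_real \<kappa> * Gplus (x - z) \<kappa>) \<le> (2 * A * \<kappa> + 1) / (norm x)\<^sup>2"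
proof -
  define w where "w = x - z"
  define \<rho> where "\<rho> = norm w"
  have A0: "A \<ge> 0" using A norm_ge_zero order_trans by blast
  have x: "norm x > 0" using A A0 by linarith
  have \<rho>: "\<rho> \<ge> norm x - A" "\<rho> \<le> norm x + A"
    using A norm_triangle_ineq2[of x z] norm_triangle_ineq4[of x z] by (auto simp: \<rho>_def w_def)
  have \<rho>2: "\<rho> > 0" "\<rho> \<ge> norm x / 2" using \<rho> A A0 x by linarith+
  have w0: "w \<noteq> 0" using \<rho>2 by (auto simp: \<rho>_def)
  define c where "c = w \<bullet> sgn x"
  have "x \<bullet> sgn x = norm x" using x by (simp add: sgn_div_norm power2_norm_eq_inner[symmetric] power2_eq_square divide_simps)
  moreover have "\<bar>z \<bullet> sgn x\<bar> \<le> A" using Cauchy_Schwarz_ineq2[of z "sgn x"] A x by (simp add: norm_sgn)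
  ultimately have c1: "c \<ge> norm x - A" by (simp add: c_def w_def inner_diff_left)
  have c2: "c \<le> \<rho>" using Cauchy_Schwarz_ineq2[of w "sgn x"] x by (simp add: norm_sgn c_def \<rho>_def)
  have c3: "\<bar>c\<bar> \<le> \<rho>" using Cauchy_Schwarz_ineq2[of w "sgn x"] x by (simp add: norm_sgn c_def \<rho>_def)
  have sq: "sqrt (w \<bullet> w) = \<rho>" by (simp add: \<rho>_def norm_eq_sqrt_inner)
  have "pd (\<lambda>x. Gplus x \<kappa>) (sgn x) w - \<i> * of_real \<kappa> * Gplus w \<kappa> =
    of_real (2 * c) * Gr1 \<kappa> (w \<bullet> w) - \<i> * of_real \<kappa> * Gr \<kappa> (w \<bullet> w)"
    using pd_Gplus[OF w0, of \<kappa> "sgn x"] by (simp add: c_def Gplus_Gr)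
  also have "\<dots> = - exp (\<i> * of_real \<kappa> * of_real \<rho>) / of_real (4 * pi * \<rho>) * (\<i> * of_real \<kappa> * (of_real (c / \<rho>) - 1) - of_real (c / \<rho>\<^sup>2))"
    unfolding Gr1_def Gr_def sq using \<rho>2 by (simp add: divide_simps eval_nat_numeral, simp add: right_diff_distrib left_diff_distrib mult_ac)
  finally have eq: "norm (pd (\<lambda>x. Gplus x \<kappa>) (sgn x) w - \<i> * of_real \<kappa> * Gplus w \<kappa>) =
     1 / (4 * pi * \<rho>) * norm (\<i> * of_real \<kappa> * (of_real (c / \<rho>) - 1) - of_real (c / \<rho>\<^sup>2))"
    using \<rho>2 by (simp add: norm_mult norm_divide)
  have "norm (\<i> * of_real \<kappa> * (of_real (c / \<rho>) - 1) - of_real (c / \<rho>\<^sup>2) :: complex) \<le> norm (\<i> * of_real \<kappa> * (of_real (c / \<rho>) - 1 :: complex)) + norm (of_real (c / \<rho>\<^sup>2) :: complex)"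
    by (rule norm_triangle_ineq4)
  also have "norm (\<i> * of_real \<kappa> * (of_real (c / \<rho>) - 1 :: complex)) = \<kappa> * \<bar>c / \<rho> - 1\<bar>"
  proof -
    have "(of_real (c / \<rho>) - 1 :: complex) = of_real (c / \<rho> - 1)" by simp
    then show ?thesis using \<kappa> unfolding norm_mult by (simp only: norm_of_real norm_ii)
  qed
  also have "\<bar>c / \<rho> - 1\<bar> = (\<rho> - c) / \<rho>" using c2 \<rho>2 by (simp add: field_simps abs_if)
  also have "\<kappa> * ((\<rho> - c) / \<rho>) \<le> \<kappa> * (2 * A / \<rho>)"
    using c1 \<rho> \<kappa> \<rho>2 by (intro mult_left_mono divide_right_mono) auto
  also have "norm (of_real (c / \<rho>\<^sup>2) :: complex) \<le> 1 / \<rho>"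
    unfolding norm_of_real using c3 \<rho>2 by (simp add: abs_divide power2_eq_square divide_simps)
  finally have "norm (\<i> * of_real \<kappa> * (of_real (c / \<rho>) - 1) - of_real (c / \<rho>\<^sup>2) :: complex) \<le> \<kappa> * (2 * A / \<rho>) + 1 / \<rho>"
    by simp
  moreover have "\<kappa> * (2 * A / \<rho>) + 1 / \<rho> = (2 * A * \<kappa> + 1) / \<rho>" by (simp add: add_divide_distrib)
  ultimately have b: "norm (\<i> * of_real \<kappa> * (of_real (c / \<rho>) - 1) - of_real (c / \<rho>\<^sup>2) :: complex) \<le> (2 * A * \<kappa> + 1) / \<rho>"
    by (simp only:)
  have "norm (pd (\<lambda>x. Gplus x \<kappa>) (sgn x) w - \<i> * of_real \<kappa> * Gplus w \<kappa>) \<le> 1 / (4 * pi * \<rho>) * ((2 * A * \<kappa> + 1) / \<rho>)"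
    unfolding eq using b \<rho>2 by (intro mult_left_mono) auto
  also have "\<dots> = (2 * A * \<kappa> + 1) / (4 * pi * \<rho>\<^sup>2)" by (simp add: power2_eq_square)
  also have "\<dots> \<le> (2 * A * \<kappa> + 1) / (norm x)\<^sup>2"
  proof (intro divide_left_mono)
    have "(norm x)\<^sup>2 \<le> (2 * \<rho>)\<^sup>2" using \<rho>2 by (intro power_mono) auto
    also have "\<dots> \<le> 4 * pi * \<rho>\<^sup>2" using pi_gt3 by (simp add: power_mult_distrib mult_right_mono)
    finally show "(norm x)\<^sup>2 \<le> 4 * pi * \<rho>\<^sup>2" .
    show "0 < 4 * pi * \<rho>\<^sup>2 * (norm x)\<^sup>2" using \<rho>2(1) x by (intro mult_pos_pos) auto
  qed (use A0 \<kappa> in auto)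
  finally show ?thesis by (simp add: w_def)
qed

lemma pot_helmholtz_test:
  "\<lbrakk>Ck_on 2 UNIV \<phi>; bsupp \<phi>; \<kappa> > 0\<rbrakk> \<Longrightarrow> pot \<kappa> (\<lambda>x. helm \<kappa> \<phi> x) z = \<phi> z"
  by (rule pot_weak(2)[of 0 0 "\<lambda>x. 0"]) (auto simp: dens_def)

section \<open>Borel representatives, and the passage from the distributional to the integral
  equation\<close>

lemma closed_ess_support: "closed (ess_support v)"
  unfolding ess_support_def closed_def by (auto intro: open_Union)

text \<open>The union that defines the support is uncountable; the Lindelof property reduces it to
  countably many null sets.\<close>

lemma AE_zero_off_ess_support: "AE x in lebesgue. x \<notin> ess_support v \<longrightarrow> v x = 0"
proof -
  define F where "F = {W. open W \<and> (AE x in lebesgue. x \<in> W \<longrightarrow> v x = 0)}"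
  obtain F' where F': "F' \<subseteq> F" "countable F'" "\<Union>F' = \<Union>F"
    using Lindelof[of F] by (auto simp: F_def)
  have "AE x in lebesgue. \<forall>W\<in>F'. x \<in> W \<longrightarrow> v x = 0"
    using F' by (subst AE_ball_countable) (auto simp: F_def)
  then show ?thesis
  proof eventually_elim
    case (elim x)
    have "- ess_support v = \<Union>F'" by (simp add: ess_support_def F_def F'(3))
    then show ?case using elim by auto
  qed
qed

text \<open>A Borel function with bound and zeros valid everywhere, so that translates, products and
  Fubini over \<open>lborel\<close> apply without exceptional sets.\<close>

lemma Linfty_borel_version:
  assumes v: "Linfty v"
  obtains v' M where "v' \<in> borel_measurable borel" "M > 0" "\<And>x. norm (v' x) \<le> M"
    "\<And>x. x \<notin> ess_support v \<Longrightarrow> v' x = 0" "AE x in lebesgue. v x = v' x"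
proof -
  obtain M where M: "AE x in lebesgue. norm (v x) \<le> M" using v by (auto simp: Linfty_def)
  have vm: "v \<in> borel_measurable lebesgue" using v by (auto simp: Linfty_def)
  have "(\<lambda>x. Re (v x)) \<in> borel_measurable (completion lborel)" using vm by measurable
  from completion_ex_borel_measurable_real[OF this]
  obtain a where a: "a \<in> borel_measurable lborel" "AE x in lborel. Re (v x) = a x" by blast
  have "(\<lambda>x. Im (v x)) \<in> borel_measurable (completion lborel)" using vm by measurable
  from completion_ex_borel_measurable_real[OF this]
  obtain b where b: "b \<in> borel_measurable lborel" "AE x in lborel. Im (v x) = b x" by blast
  note ab = a(1) b(1) a(2) b(2)
  define K where "K = ess_support v"
  define w where "w x = Complex (a x) (b x)" for x
  define v' where "v' x = indicator (K \<inter> {x. norm (w x) \<le> \<bar>M\<bar> + 1}) x *\<^sub>R w x" for x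
  have wm[measurable]: "w \<in> borel_measurable borel"
  proof -
    have "w = (\<lambda>x. of_real (a x) + \<i> * of_real (b x))" by (auto simp: w_def complex_eq_iff)
    moreover have "(\<lambda>x. of_real (a x) + \<i> * of_real (b x) :: complex) \<in> borel_measurable borel" using ab by measurable
    ultimately show ?thesis by simp
  qed
  have Kb: "K \<in> sets borel" unfolding K_def using closed_ess_support by (rule borel_closed)
  have set: "K \<inter> {x. norm (w x) \<le> \<bar>M\<bar> + 1} \<in> sets borel"
  proof (intro sets.Int Kb)
    have "{x \<in> space borel. norm (w x) \<le> \<bar>M\<bar> + 1} \<in> sets borel" by measurable
    then show "{x. norm (w x) \<le> \<bar>M\<bar> + 1} \<in> sets borel" by simp
  qed
  show ?thesis
  proof
    show "v' \<in> borel_measurable borel" unfolding v'_def using set by (intro borel_measurable_scaleR borel_measurable_indicator) auto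
    show "\<bar>M\<bar> + 1 > 0" by simp
    show "norm (v' x) \<le> \<bar>M\<bar> + 1" for x by (auto simp: v'_def indicator_def)
    show "v' x = 0" if "x \<notin> ess_support v" for x using that by (auto simp: v'_def K_def)
    have "AE x in lebesgue. v x = w x"
      using AE_completion[OF ab(3)] AE_completion[OF ab(4)] by eventually_elim (auto simp: w_def complex_eq_iff)
    then show "AE x in lebesgue. v x = v' x"
      using M AE_zero_off_ess_support[of v]
    proof eventually_elim
      case (elim x)
      show ?case using elim by (cases "x \<in> K") (auto simp: v'_def K_def)
    qed
  qed
qed

abbreviation (input) schroed :: "(real^3 => complex) => real => (real^3 => complex) => real^3 => complex" where
  "schroed v \<kappa> \<phi> x \<equiv> - laplacian \<phi> x + v x * \<phi> x - of_real (\<kappa>\<^sup>2) * \<phi> x"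

lemma green_solution_lborel:
  fixes \<psi> v v' :: "real^3 => complex"
  assumes g: "distributional_green_solution v \<kappa> y \<psi>" and c: "continuous_on (- {y}) \<psi>"
    and v: "v \<in> borel_measurable lebesgue" "v' \<in> borel_measurable borel" "AE x in lebesgue. v x = v' x"
  shows "loc_integrable \<psi>"
    and "\<And>\<phi>. test_function \<phi> \<Longrightarrow> (LBINT x. \<psi> x * schroed v' \<kappa> \<phi> x) = \<phi> y"
proof -
  have [measurable]: "\<psi> \<in> borel_measurable borel" by (rule continuous_off_point_borel[OF c])
  show "loc_integrable \<psi>"
    unfolding loc_integrable_def
  proof
    fix R :: real
    have "\<psi> absolutely_integrable_on (cball 0 R)"
      using g by (simp add: distributional_green_solution_def)
    then have "integrable lebesgue (\<lambda>x. indicator (cball 0 R) x *\<^sub>R \<psi> x)" by (simp add: set_integrable_def)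
    moreover have "(\<lambda>x. indicator (cball 0 R) x *\<^sub>R \<psi> x) \<in> borel_measurable lborel"
      using borel_measurable_indicator[of "cball (0::real^3) R" borel] by (intro borel_measurable_scaleR) auto
    ultimately show "integrable lborel (\<lambda>x. indicator (cball 0 R) x *\<^sub>R \<psi> x)"
      by (simp add: integrable_completion)
  qed
  fix \<phi> :: "real^3 => complex" assume t: "test_function \<phi>"
  then have \<phi>: "Ck_on k UNIV \<phi>" for k by (auto simp: test_function_iff)
  have [measurable]: "\<phi> \<in> borel_measurable borel" "laplacian \<phi> \<in> borel_measurable borel"
    using \<phi>[of 0] continuous_on_laplacian[OF open_UNIV \<phi>] by (auto intro: borel_measurable_continuous_onI)
  note [measurable] = v(2)
  have m: "(\<lambda>x. \<psi> x * schroed v' \<kappa> \<phi> x) \<in> borel_measurable lborel" by measurable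
  have [measurable]: "\<psi> \<in> borel_measurable lebesgue" "\<phi> \<in> borel_measurable lebesgue" "laplacian \<phi> \<in> borel_measurable lebesgue"
    by (auto intro: measurable_completion)
  note [measurable] = v(1)
  have "\<phi> y = (LINT x|lebesgue. \<psi> x * schroed v \<kappa> \<phi> x)"
    using g t by (simp add: distributional_green_solution_def)
  also have "\<dots> = (LINT x|lebesgue. \<psi> x * schroed v' \<kappa> \<phi> x)"
  proof (rule integral_cong_AE)
    show "(\<lambda>x. \<psi> x * schroed v \<kappa> \<phi> x) \<in> borel_measurable lebesgue" by measurable
    show "(\<lambda>x. \<psi> x * schroed v' \<kappa> \<phi> x) \<in> borel_measurable lebesgue"
      using m by (rule measurable_completion)
    show "AE x in lebesgue. \<psi> x * schroed v \<kappa> \<phi> x = \<psi> x * schroed v' \<kappa> \<phi> x"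
      using v(3) by eventually_elim simp
  qed
  also have "\<dots> = (LBINT x. \<psi> x * schroed v' \<kappa> \<phi> x)"
    by (rule integral_completion[OF m])
  finally show "(LBINT x. \<psi> x * schroed v' \<kappa> \<phi> x) = \<phi> y" by simp
qed

lemma pot_radiation:
  assumes f: "dens B A f" and A: "A > 0" and \<kappa>: "\<kappa> > 0"
    and x: "norm x > 2 * A"
  shows "norm (pd (pot \<kappa> f) (sgn x) x - \<i> * of_real \<kappa> * pot \<kappa> f x) \<le> (2 * A * \<kappa> + 1) / (norm x)\<^sup>2 * (LBINT z. norm (f z))"
    and "(pot \<kappa> f has_derivative frechet_derivative (pot \<kappa> f) (at x)) (at x)"
proof -
  define S where "S = {x::real^3. norm x > 2 * A}"
  have S: "open S" unfolding S_def by (intro open_Collect_less continuous_intros)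
  have sep: "separated (A / 2) S f"
    unfolding separated_def
  proof (intro ballI allI impI)
    fix x z assume "x \<in> S" "f z \<noteq> 0"
    then show "norm (x - z) > 2 * (A / 2)"
      using densD(4)[OF f, of z] norm_triangle_ineq2[of x z] by (simp add: S_def)
  qed
  note fi = dens_integrable[OF f]
  have A2: "A / 2 > 0" using A by simp
  note P = pot_separated[OF fi(1,2) S A2 sep]
  have xS: "x \<in> S" using x by (simp add: S_def)
  let ?d = "\<lambda>z. pd (\<lambda>x. Gplus x \<kappa>) (sgn x) (x - z) - \<i> * of_real \<kappa> * Gplus (x - z) \<kappa>"
  show "(pot \<kappa> f has_derivative frechet_derivative (pot \<kappa> f) (at x)) (at x)"
    by (rule Ck_on_SucD(1)[OF S P(1)[of "Suc 0"] xS])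
  have "pd (pot \<kappa> f) (sgn x) x - \<i> * of_real \<kappa> * pot \<kappa> f x =
     (LBINT z. pd (\<lambda>x. Gplus x \<kappa>) (sgn x) (x - z) * f z) - (LBINT z. \<i> * of_real \<kappa> * (Gplus (x - z) \<kappa> * f z))"
    using P(3)[OF xS] by (simp add: pot_def)
  also have "\<dots> = (LBINT z. pd (\<lambda>x. Gplus x \<kappa>) (sgn x) (x - z) * f z - \<i> * of_real \<kappa> * (Gplus (x - z) \<kappa> * f z))"
    by (rule bint_diff[symmetric]) (intro P(4,5) xS integrable_mult_right)+
  also have "\<dots> = (LBINT z. ?d z * f z)"
    by (simp add: algebra_simps)
  also have "norm \<dots> \<le> (LBINT z. norm (?d z * f z))"
    by simp
  also have "\<dots> \<le> (LBINT z. (2 * A * \<kappa> + 1) / (norm x)\<^sup>2 * norm (f z))"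
  proof (rule integral_mono)
    show "integrable lborel (\<lambda>z. norm (?d z * f z))"
      unfolding left_diff_distrib mult.assoc
      by (intro integrable_norm bintegrable_diff P(4,5) xS integrable_mult_right)
    show "integrable lborel (\<lambda>z. (2 * A * \<kappa> + 1) / (norm x)\<^sup>2 * norm (f z))" by (intro integrable_mult_right integrable_norm fi)
    fix z
    show "norm (?d z * f z) \<le> (2 * A * \<kappa> + 1) / (norm x)\<^sup>2 * norm (f z)"
    proof (cases "norm z > A")
      case False
      then show ?thesis unfolding norm_mult using x \<kappa> by (intro mult_right_mono Gplus_radiation) auto
    qed (simp add: densD(3)[OF f])
  qed
  also have "\<dots> = (2 * A * \<kappa> + 1) / (norm x)\<^sup>2 * (LBINT z. norm (f z))" by simp
  finally show "norm (pd (pot \<kappa> f) (sgn x) x - \<i> * of_real \<kappa> * pot \<kappa> f x) \<le> (2 * A * \<kappa> + 1) / (norm x)\<^sup>2 * (LBINT z. norm (f z))" .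
qed

lemma tendsto_norm_div_square:
  assumes "\<forall>\<^sub>F x in at_infinity. norm (F x) \<le> C / (norm x)\<^sup>2"
  shows "((\<lambda>x::real^3. of_real (norm x) * (F x :: complex)) \<longlongrightarrow> 0) at_infinity"
proof (rule Lim_null_comparison)
  show "\<forall>\<^sub>F x in at_infinity. norm (of_real (norm x) * F x) \<le> C * inverse (norm x)"
    using assms eventually_not_equal_at_infinity[of 0]
  proof eventually_elim
    case (elim x)
    have "norm (of_real (norm x) * F x) \<le> norm x * (C / (norm x)\<^sup>2)"
      unfolding norm_mult norm_of_real using elim by (intro mult_mono) auto
    also have "norm x * (C / (norm x)\<^sup>2) = C * inverse (norm x)" using elim by (simp add: power2_eq_square field_simps)
    finally show ?case .
  qed
  have "((\<lambda>x::real^3. C * inverse (norm x)) \<longlongrightarrow> C * 0) at_infinity"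
    by (intro tendsto_mult tendsto_const tendsto_inverse_0_at_top filterlim_norm_at_top)
  then show "((\<lambda>x::real^3. C * inverse (norm x)) \<longlongrightarrow> 0) at_infinity" by simp
qed

text \<open>The Green function may be singular at \<open>y\<close>, but \<open>y\<close> lies off
  the compact set that carries \<open>v\<close>.\<close>

lemma dens_mult_off_point:
  assumes v: "dens M A v" "\<And>x. x \<notin> K \<Longrightarrow> v x = 0" and K: "compact K" "y \<notin> K" and \<psi>: "continuous_on (- {y}) \<psi>"
  obtains B where "dens B A (\<lambda>x. v x * \<psi> x)"
proof -
  have "compact (\<psi> ` K)" using K by (intro compact_continuous_image continuous_on_subset[OF \<psi>]) auto
  then obtain C where C: "\<forall>x\<in>K. norm (\<psi> x) \<le> C" by (auto dest!: compact_imp_bounded simp: bounded_iff)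
  have "norm (v x * \<psi> x) \<le> M * \<bar>C\<bar>" for x
  proof (cases "x \<in> K")
    case True
    then have "norm (\<psi> x) \<le> \<bar>C\<bar>" using C by fastforce
    then show ?thesis unfolding norm_mult using densD(2,5)[OF v(1)] by (intro mult_mono) auto
  qed (use v(2) densD(5)[OF v(1)] in simp)
  then have "dens (M * \<bar>C\<bar>) A (\<lambda>x. v x * \<psi> x)"
    using densD(1,3)[OF v(1)] continuous_off_point_borel[OF \<psi>] by (auto simp: dens_def)
  then show ?thesis by (rule that)
qed

text \<open>The difference \<open>d\<close> of the two sides is a weak solution of the Helmholtz
  equation, which Weyl's lemma replaces by an entire one. The radiation conditions of \<psi>, of the
  point source and of the potential add up to that of the entire solution.\<close>

theorem lippmann_schwinger:
  fixes \<psi> v :: "real^3 => complex"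
  assumes v: "v \<in> borel_measurable borel" "\<And>x. norm (v x) \<le> M" "\<And>x. x \<notin> K \<Longrightarrow> v x = 0" and K: "compact K" "y \<notin> K"
    and \<kappa>: "\<kappa> > 0" and \<psi>: "continuous_on (- {y}) \<psi>" "loc_integrable \<psi>"
    and weak: "\<And>\<phi>. test_function \<phi> \<Longrightarrow> (LBINT x. \<psi> x * schroed v \<kappa> \<phi> x) = \<phi> y"
    and rad: "sommerfeld \<kappa> \<psi>" and x: "x \<noteq> y"
  shows "\<psi> x = - Gplus (x - y) \<kappa> + pot \<kappa> (\<lambda>z. v z * \<psi> z) x"
proof -
  have [measurable]: "\<psi> \<in> borel_measurable borel" by (rule continuous_off_point_borel[OF \<psi>(1)])
  define f where "f z = v z * \<psi> z" for z
  obtain A0 where A0: "\<And>z. z \<in> K \<Longrightarrow> norm z \<le> A0" using compact_imp_bounded[OF K(1)] by (auto simp: bounded_iff)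
  define A where "A = \<bar>A0\<bar> + norm y + 1"
  have A: "A > 0" "norm y \<le> A" "\<And>z. z \<in> K \<Longrightarrow> norm z \<le> A" using A0
  proof -
    show "A > 0" by (simp add: A_def add_nonneg_pos)
    show "norm y \<le> A" by (simp add: A_def)
    show "norm z \<le> A" if "z \<in> K" for z using A0[OF that] norm_ge_zero[of y] unfolding A_def by linarith
  qed
  have "dens M A v" unfolding dens_def using v A(3) by (auto simp: not_less[symmetric])
  from dens_mult_off_point[OF this v(3) K \<psi>(1)] obtain Bf where fp: "dens Bf A f" unfolding f_def[abs_def] .
  note fi = dens_integrable[OF fp]
  have pc: "continuous_on UNIV (pot \<kappa> f)" by (rule pot_dens(3)[OF fp])
  define d where "d x = \<psi> x + Gplus (x - y) \<kappa> - pot \<kappa> f x" for x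
  have Gli: "loc_integrable (\<lambda>x. Gplus (x - y) \<kappa>)"
    unfolding loc_integrable_def
  proof
    fix R :: real
    have "dens 1 R (indicator (cball 0 R))" unfolding dens_def by (intro conjI borel_measurable_indicator) (auto simp: indicator_def)
    note pot_dens(1)[OF this, of y \<kappa>]
    moreover have "Gplus (y - x) \<kappa> * indicator (cball 0 R) x = indicator (cball 0 R) x *\<^sub>R Gplus (x - y) \<kappa>" for x
      by (simp add: indicator_def Gplus_def norm_minus_commute)
    ultimately show "integrable lborel (\<lambda>x. indicator (cball 0 R) x *\<^sub>R Gplus (x - y) \<kappa>)" by (simp only:)
  qed
  have pli: "loc_integrable (pot \<kappa> f)"
    unfolding loc_integrable_def by (intro allI borel_integrable_compact continuous_on_subset[OF pc]) auto
  have dli: "loc_integrable d"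
    using \<psi>(2) Gli pli unfolding loc_integrable_def d_def by (simp add: scaleR_add_right scaleR_diff_right)
  have dw: "(LBINT x. d x * helm \<kappa> \<phi> x) = 0" if t: "test_function \<phi>" for \<phi>
  proof -
    have \<phi>: "Ck_on k UNIV \<phi>" "bsupp \<phi>" for k using t by (auto simp: test_function_iff)
    define g where "g x = helm \<kappa> \<phi> x" for x
    have gc: "continuous_on UNIV g" "bsupp g" unfolding g_def by (intro helmholtz_continuous helmholtz_bsupp \<phi>)+
    have \<phi>c: "continuous_on UNIV \<phi>" using \<phi>(1)[of 0] by simp
    have gi: "integrable lborel (\<lambda>x. \<psi> x * g x)" "integrable lborel (\<lambda>x. Gplus (x - y) \<kappa> * g x)" "integrable lborel (\<lambda>x. pot \<kappa> f x * g x)"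
      by (intro loc_integrable_bsupp_mult \<psi> Gli pli gc)+
    have fi\<phi>: "integrable lborel (\<lambda>x. f x * \<phi> x)"
    proof -
      obtain B where "\<And>x. norm (\<phi> x) \<le> B" using continuous_bsupp_bounded[OF \<phi>c \<phi>(2)] by metis
      then show ?thesis
        by (intro integrable_mult_bounded(2)[OF fi(1)]) (use borel_measurable_continuous_onI[OF \<phi>c] in auto)
    qed
    have "\<phi> y = (LBINT x. f x * \<phi> x - \<psi> x * g x)"
      using weak[OF t] by (simp add: f_def g_def algebra_simps)
    then have 1: "(LBINT x. \<psi> x * g x) = (LBINT x. f x * \<phi> x) - \<phi> y"
      using gi(1) fi\<phi> by simp
    have 2: "(LBINT x. Gplus (x - y) \<kappa> * g x) = \<phi> y"
    proof -
      have "(LBINT x. Gplus (x - y) \<kappa> * g x) = pot \<kappa> g y"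
        by (simp add: pot_def Gplus_def norm_minus_commute)
      also have "\<dots> = \<phi> y" unfolding g_def by (rule pot_helmholtz_test[OF \<phi> \<kappa>])
      finally show ?thesis .
    qed
    have 3: "(LBINT x. pot \<kappa> f x * g x) = (LBINT x. f x * \<phi> x)"
      unfolding g_def by (rule pot_dens(4)[OF fp \<phi> \<kappa>])
    have "(LBINT x. d x * g x) = (LBINT x. \<psi> x * g x + Gplus (x - y) \<kappa> * g x - pot \<kappa> f x * g x)"
      by (simp add: d_def algebra_simps)
    also have "\<dots> = 0" using gi 1 2 3 by simp
    finally show ?thesis by (simp add: g_def)
  qed
  have Gy: "Ck_on k (- {y}) (\<lambda>x. Gplus (x - y) \<kappa>)" for k
    using Ck_on_compose_affine[OF bounded_linear_ident open_minus_zero Ck_on_Gplus[of k \<kappa>], where c = "-y"]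
    by (simp add: Compl_eq)
  have dc: "continuous_on (- {y}) d" unfolding d_def
    by (intro continuous_intros \<psi> Ck_on_imp_continuous_on[OF Gy] continuous_on_subset[OF pc]) auto
  obtain D where D: "\<And>k. Ck_on k UNIV D" "\<And>x. x \<noteq> y \<Longrightarrow> d x = D x" "\<And>x. helm \<kappa> D x = 0"
    using weyl_helmholtz[OF dli dc \<kappa> dw] by metis
  have "((\<lambda>x. pd D x x - \<i> * of_real \<kappa> * of_real (norm x) * D x) \<longlongrightarrow> 0) at_infinity"
  proof -
    define P where "P x = vector_derivative (\<lambda>r. \<psi> (r *\<^sub>R sgn x)) (at (norm x)) - \<i> * of_real \<kappa> * \<psi> x" for x
    define Q where "Q x = pd (\<lambda>x. Gplus x \<kappa>) (sgn x) (x - y) - \<i> * of_real \<kappa> * Gplus (x - y) \<kappa>" for x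
    define S where "S x = pd (pot \<kappa> f) (sgn x) x - \<i> * of_real \<kappa> * pot \<kappa> f x" for x
    have big: "\<forall>\<^sub>F x::real^3 in at_infinity. norm x > 2 * A"
      unfolding eventually_at_infinity by (intro exI[of _ "2 * A + 1"]) auto
    have "((\<lambda>x. of_real (norm x) * P x) \<longlongrightarrow> 0) at_infinity" using rad by (simp add: sommerfeld_def P_def)
    moreover have "((\<lambda>x. of_real (norm x) * Q x) \<longlongrightarrow> 0) at_infinity"
      by (rule tendsto_norm_div_square[where C = "2 * A * \<kappa> + 1"])
         (use big Gplus_radiation[OF A(2) _ \<kappa>] in \<open>auto simp: Q_def elim!: eventually_mono\<close>)
    moreover have "((\<lambda>x. of_real (norm x) * S x) \<longlongrightarrow> 0) at_infinity"
      by (rule tendsto_norm_div_square[where C = "(2 * A * \<kappa> + 1) * (LBINT z. norm (f z))"])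
         (use big pot_radiation(1)[OF fp A(1) \<kappa>] in \<open>auto simp: S_def elim!: eventually_mono\<close>)
    ultimately have "((\<lambda>x. of_real (norm x) * P x + of_real (norm x) * Q x - of_real (norm x) * S x) \<longlongrightarrow> 0 + 0 - 0) at_infinity"
      by (intro tendsto_intros)
    then have lim: "((\<lambda>x. of_real (norm x) * P x + of_real (norm x) * Q x - of_real (norm x) * S x) \<longlongrightarrow> 0) at_infinity" by simp
    have "\<forall>\<^sub>F x in at_infinity. of_real (norm x) * P x + of_real (norm x) * Q x - of_real (norm x) * S x = pd D x x - \<i> * of_real \<kappa> * of_real (norm x) * D x"
      using big
    proof eventually_elim
      case (elim x)
      have x0: "norm x > 0" using elim A by linarith
      then have xs: "norm x *\<^sub>R sgn x = x" by (simp add: sgn_div_norm)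
      have xy: "x \<noteq> y" using elim A(1,2) by force
      have hG: "((\<lambda>x. Gplus (x - y) \<kappa>) has_derivative (\<lambda>h. pd (\<lambda>x. Gplus x \<kappa>) h (x - y))) (at x)"
      proof (rule has_derivative_compose[of "\<lambda>x. x - y" "\<lambda>h. h" x UNIV "\<lambda>x. Gplus x \<kappa>"])
        show "((\<lambda>x. Gplus x \<kappa>) has_derivative (\<lambda>h. pd (\<lambda>x. Gplus x \<kappa>) h (x - y))) (at (x - y))"
          by (rule Ck_on_SucD(1)[OF _ Ck_on_Gplus[of "Suc 0"]]) (use xy in auto)
      qed (auto intro!: derivative_eq_intros)
      \<comment> \<open>\<open>sommerfeld\<close> speaks of a one-dimensional derivative along the
        ray. Far out, \<psi> is a combination of smooth functions, so this is its Frechet derivative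
        in direction \<open>sgn x\<close>.\<close>
      let ?d = "\<lambda>h. pd D h x - pd (\<lambda>x. Gplus x \<kappa>) h (x - y) + pd (pot \<kappa> f) h x"
      have "((\<lambda>x. D x - Gplus (x - y) \<kappa> + pot \<kappa> f x) has_derivative ?d) (at x)"
        by (intro has_derivative_add has_derivative_diff hG Ck_on_2D(1)[OF open_UNIV D(1) UNIV_I] pot_radiation(2)[OF fp A(1) \<kappa> elim])
      then have d\<psi>: "(\<psi> has_derivative ?d) (at x)"
      proof (rule has_derivative_transform_within_open[of _ _ _ _ "- {y}"])
        show "D x - Gplus (x - y) \<kappa> + pot \<kappa> f x = \<psi> x" if "x \<in> - {y}" for x using D(2)[of x, symmetric] that by (simp add: d_def)
      qed (use xy in auto)
      interpret L: linear ?d using d\<psi> by (rule has_derivative_linear)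
      have "((\<lambda>r. \<psi> (r *\<^sub>R sgn x)) has_derivative (\<lambda>s. ?d (s *\<^sub>R sgn x))) (at (norm x))"
        by (rule has_derivative_compose[where f = "\<lambda>r. r *\<^sub>R sgn x"]) (use d\<psi> xs in \<open>auto intro!: derivative_eq_intros\<close>)
      then have "((\<lambda>r. \<psi> (r *\<^sub>R sgn x)) has_vector_derivative ?d (sgn x)) (at (norm x))"
        unfolding has_vector_derivative_def L.scaleR .
      then have pD: "pd D (sgn x) x = vector_derivative (\<lambda>r. \<psi> (r *\<^sub>R sgn x)) (at (norm x)) + pd (\<lambda>x. Gplus x \<kappa>) (sgn x) (x - y) - pd (pot \<kappa> f) (sgn x) x"
        by (simp add: vector_derivative_at)
      have "pd D x x = of_real (norm x) * pd D (sgn x) x"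
      proof -
        have "linear (frechet_derivative D (at x))" using Ck_on_2D(1)[OF open_UNIV D(1) UNIV_I] has_derivative_linear by blast
        from linear_scale[OF this, of "norm x" "sgn x"] show ?thesis unfolding xs by (simp only: scaleR_conv_of_real)
      qed
      moreover have "D x = \<psi> x + Gplus (x - y) \<kappa> - pot \<kappa> f x" using D(2)[OF xy] by (simp add: d_def)
      moreover have "n * (vp - k * p) + n * (vg - k * g) - n * (vt - k * t) = n * (vp + vg - vt) - k * n * (p + g - t)"
        for n vp k p vg g vt t :: complex by (simp add: algebra_simps)
      ultimately show ?case unfolding P_def Q_def S_def pD by simp
    qed
    from Lim_transform_eventually[OF lim this] show ?thesis .
  qed
  from radiating_entire_solution_zero[OF D(1) D(3) \<kappa> this]
  have "d x = 0" using D(2)[OF x] by simp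
  then show ?thesis by (simp add: d_def f_def[abs_def] algebra_simps add_eq_0_iff2)
qed

section \<open>Analytic continuation\<close>

text \<open>Cauchy's estimates bound the second derivative in the parameter uniformly in
  \<open>z\<close>; the difference quotients then converge uniformly and may be integrated.
  Compactness supplies the uniform bound \<open>B\<close>.\<close>

lemma holomorphic_integral:
  fixes F :: "complex => 'a::euclidean_space => complex"
  assumes hol: "\<And>z. z \<in> K \<Longrightarrow> (\<lambda>t. F t z) holomorphic_on ball a r" and K: "compact K"
    and c: "continuous_on (cball a r \<times> K) (\<lambda>(t, z). F t z)" and f: "integrable lborel f" "\<And>z. f z \<noteq> 0 \<Longrightarrow> z \<in> K"
  shows "(\<lambda>t. LBINT z. F t z * f z) holomorphic_on ball a r"
proof (subst holomorphic_on_open[OF open_ball], intro allI ballI)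
  fix t0 assume t0: "t0 \<in> ball a r"
  \<comment> \<open>A third of the distance to the boundary: discs of radius \<rho> centred within
    \<rho> of \<open>t0\<close> stay in the ball.\<close>
  define \<rho> where "\<rho> = (r - dist a t0) / 3"
  have \<rho>: "\<rho> > 0" using t0 by (simp add: \<rho>_def)
  have sub: "t \<in> ball a r" if "dist t0 t \<le> 2 * \<rho>" for t
    using that \<rho> dist_triangle[of a t t0] by (simp add: \<rho>_def)
  define E where "E t z = indicator K z *\<^sub>R F t z" for t z
  have EF: "(LBINT z. F t z * f z) = (LBINT z. E t z * f z)" for t
    by (intro bint_cong refl) (use f(2) in \<open>auto simp: E_def indicator_def\<close>)
  obtain B where "B > 0" and "\<And>t z. t \<in> cball a r \<Longrightarrow> z \<in> K \<Longrightarrow> norm (F t z) \<le> B"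
    using compact_imp_bounded[OF compact_continuous_image[OF c compact_Times[OF compact_cball K]]] unfolding bounded_pos by fastforce
  then have B: "B > 0" "\<And>t z. t \<in> cball a r \<Longrightarrow> norm (E t z) \<le> B" by (auto simp: E_def indicator_def)
  have [measurable]: "E t \<in> borel_measurable borel" if "t \<in> ball a r" for t
  proof -
    have "continuous_on K (Pair t)" by (intro continuous_on_Pair continuous_on_const continuous_on_id)
    then have "continuous_on K (F t)" using continuous_on_compose2[OF c] that by fastforce
    then show ?thesis unfolding E_def using borel_measurable_continuous_on_indicator borel_compact[OF K] by blast
  qed
  have I: "integrable lborel (\<lambda>z. E t z * f z)" if "t \<in> ball a r" for t
    by (rule integrable_mult_bounded(1)[OF f(1), where B = B]) (use that in \<open>auto intro!: B(2)\<close>)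
  have holE: "(\<lambda>t. E t z) holomorphic_on ball a r" for z using hol[of z] by (cases "z \<in> K") (auto simp: E_def)
  define E' where "E' z = deriv (\<lambda>t. E t z) t0" for z
  have ca: "norm ((deriv ^^ n) (\<lambda>t. E t z) t) \<le> fact n * B / \<rho> ^ n" if "t \<in> cball t0 \<rho>" for n t z
  proof (rule Cauchy_inequality)
    have "t' \<in> ball a r" if "t' \<in> cball t \<rho>" for t'
      by (rule sub) (use that \<open>t \<in> cball t0 \<rho>\<close> dist_triangle[of t0 t' t] in auto)
    then have s: "cball t \<rho> \<subseteq> ball a r" by auto
    show "(\<lambda>t. E t z) holomorphic_on ball t \<rho>" by (rule holomorphic_on_subset[OF holE]) (use s in auto)
    show "continuous_on (cball t \<rho>) (\<lambda>t. E t z)" using holomorphic_on_imp_continuous_on[OF holE] s continuous_on_subset by blast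
    show "norm (E x z) \<le> B" if "norm (t - x) = \<rho>" for x using s that by (intro B(2)) (auto simp: dist_norm subset_iff)
  qed (use \<rho> in auto)
  define C where "C = 2 * B / \<rho>\<^sup>2"
  have C: "norm (E u z - E t0 z - E' z * (u - t0)) \<le> C * (norm (u - t0))\<^sup>2" if u: "u \<in> cball t0 \<rho>" for u z
  proof -
    have "norm ((deriv ^^ 0) (\<lambda>t. E t z) u - (\<Sum>i\<le>1. (deriv ^^ i) (\<lambda>t. E t z) t0 * (u - t0) ^ i / fact i)) \<le> C * norm (u - t0) ^ Suc 1 / fact 1"
    proof (rule complex_Taylor[of "cball t0 \<rho>"])
      fix x i assume "x \<in> cball t0 \<rho>"
      then have "x \<in> ball a r" by (intro sub) (use \<rho> in auto)
      then show "((deriv ^^ i) (\<lambda>t. E t z) has_field_derivative (deriv ^^ Suc i) (\<lambda>t. E t z) x) (at x within cball t0 \<rho>)"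
        using holomorphic_derivI[OF holomorphic_higher_deriv[OF holE open_ball] open_ball] has_field_derivative_at_within by simp
    next
      show "norm ((deriv ^^ Suc 1) (\<lambda>t. E t z) x) \<le> C" if "x \<in> cball t0 \<rho>" for x using ca[OF that, where n = 2] by (simp add: C_def numeral_2_eq_2)
    qed (use u \<rho> in auto)
    then show ?thesis by (simp add: E'_def power2_eq_square algebra_simps)
  qed
  have nu: "eventually (\<lambda>u. u \<noteq> t0 \<and> u \<in> cball t0 \<rho>) (at t0)"
    unfolding eventually_at by (intro exI[of _ \<rho>]) (use \<rho> in \<open>auto simp: dist_commute\<close>)
  have q: "norm ((E u z - E t0 z) / (u - t0) - E' z) \<le> C * norm (u - t0)" if "u \<noteq> t0" "u \<in> cball t0 \<rho>" for u z
  proof -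
    have "(E u z - E t0 z) / (u - t0) - E' z = (E u z - E t0 z - E' z * (u - t0)) / (u - t0)" using that by (simp add: field_simps)
    then show ?thesis using C[OF that(2), of z] that(1) by (simp add: norm_divide divide_le_eq power2_eq_square)
  qed
  have u0: "((\<lambda>u. C' * norm (u - t0)) \<longlongrightarrow> 0) (at t0)" for C' by (auto intro!: tendsto_eq_intros)
  have [measurable]: "E' \<in> borel_measurable borel"
  proof (rule borel_measurable_LIMSEQ_metric)
    define u where "u n = t0 + of_real (\<rho> / real (Suc n))" for n
    have u: "u n \<noteq> t0" "u n \<in> cball t0 \<rho>" for n using \<rho> by (auto simp: u_def dist_norm norm_divide divide_le_eq simp flip: of_nat_Suc)
    have "u n \<in> ball a r" for n by (rule sub) (use u(2)[of n] \<rho> in auto)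
    then show "(\<lambda>z. (E (u n) z - E t0 z) / (u n - t0)) \<in> borel_measurable borel" for n using t0 by measurable
    have "(\<lambda>n. \<rho> * inverse (real (Suc n))) \<longlonglongrightarrow> \<rho> * 0" by (intro tendsto_intros LIMSEQ_inverse_real_of_nat)
    then have "(\<lambda>n. t0 + of_real (\<rho> / real (Suc n))) \<longlonglongrightarrow> t0 + of_real 0" by (intro tendsto_intros) (simp add: divide_inverse)
    then have "filterlim u (at t0) sequentially" using u(1) by (auto simp: filterlim_at u_def[abs_def])
    moreover have "((\<lambda>u. (E u z - E t0 z) / (u - t0)) \<longlongrightarrow> E' z) (at t0)" for z
      by (rule LIM_zero_cancel, rule Lim_null_comparison[OF eventually_mono[OF nu] u0]) (use q in blast)
    ultimately show "(\<lambda>n. (E (u n) z - E t0 z) / (u n - t0)) \<longlonglongrightarrow> E' z" for z using filterlim_compose by blast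
  qed
  have I': "integrable lborel (\<lambda>z. E' z * f z)"
    by (rule integrable_mult_bounded(1)[OF f(1), where B = "B / \<rho>"]) (use ca[of t0 1] \<rho> in \<open>auto simp flip: E'_def\<close>)
  have "((\<lambda>u. ((LBINT z. E u z * f z) - (LBINT z. E t0 z * f z)) / (u - t0)) \<longlongrightarrow> (LBINT z. E' z * f z)) (at t0)"
  proof (rule LIM_zero_cancel, rule Lim_null_comparison[OF eventually_mono[OF nu] u0])
    fix u assume u: "u \<noteq> t0 \<and> u \<in> cball t0 \<rho>"
    then have ub: "u \<in> ball a r" by (intro sub) (use \<rho> in auto)
    let ?q = "\<lambda>z. (E u z - E t0 z) / (u - t0) - E' z"
    have "((LBINT z. E u z * f z) - (LBINT z. E t0 z * f z)) / (u - t0) - (LBINT z. E' z * f z) =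
        (LBINT z. (E u z * f z - E t0 z * f z) / (u - t0) - E' z * f z)"
      using I[OF ub] I[OF t0] I' by simp
    also have "\<dots> = (LBINT z. ?q z * f z)" by (simp add: left_diff_distrib)
    also have "norm \<dots> \<le> (LBINT z. norm (?q z * f z))" by (rule integral_norm_bound)
    also have "\<dots> \<le> (LBINT z. C * norm (u - t0) * norm (f z))"
    proof (rule integral_mono)
      show "norm (?q z * f z) \<le> C * norm (u - t0) * norm (f z)" for z
        unfolding norm_mult using q u by (intro mult_right_mono) auto
      show "integrable lborel (\<lambda>z. norm (?q z * f z))"
        using bintegrable_diff[OF integrable_divide_zero[OF bintegrable_diff[OF I[OF ub] I[OF t0]]] I']
        by (intro integrable_norm) (simp add: left_diff_distrib)
    qed (use f(1) in simp)
    also have "\<dots> = (C * (LBINT z. norm (f z))) * norm (u - t0)" by simp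
    finally show "norm (((LBINT z. E u z * f z) - (LBINT z. E t0 z * f z)) / (u - t0) - (LBINT z. E' z * f z)) \<le> (C * (LBINT z. norm (f z))) * norm (u - t0)" .
  qed
  then show "\<exists>f'. ((\<lambda>t. LBINT z. F t z * f z) has_field_derivative f') (at t0)"
    unfolding EF by (auto simp: has_field_derivative_iff)
qed

section \<open>The identity theorem and real analyticity along curves\<close>

lemma connected_propagation:
  fixes S :: "'a::metric_space set"
  assumes S: "connected S" and Z: "Z \<subseteq> S" "Z \<noteq> {}"
    and op: "\<And>x. x \<in> Z \<Longrightarrow> \<exists>T. openin (top_of_set S) T \<and> x \<in> T \<and> T \<subseteq> Z"
    and cl: "\<And>x. x \<in> S \<Longrightarrow> (\<And>V. open V \<Longrightarrow> x \<in> V \<Longrightarrow> V \<inter> Z \<noteq> {}) \<Longrightarrow> x \<in> Z"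
  shows "Z = S"
proof -
  have "openin (top_of_set S) Z" using op by (subst openin_subopen) blast
  moreover have "closedin (top_of_set S) Z"
    unfolding closedin_limpt
  proof (intro conjI allI impI)
    fix x assume x: "x islimpt Z \<and> x \<in> S"
    show "x \<in> Z"
    proof (rule cl)
      fix V assume "open V" "x \<in> V"
      then show "V \<inter> Z \<noteq> {}" using x unfolding islimpt_def by blast
    qed (use x in simp)
  qed (rule Z)
  ultimately show ?thesis using S Z unfolding connected_clopen by blast
qed

text \<open>Real analyticity in one variable, encoded by a holomorphic extension so that the
  theorems of complex analysis apply.\<close>

definition ra_at :: "(real => complex) => real => bool" where
  "ra_at g t \<longleftrightarrow> (\<exists>r>0. \<exists>H. H holomorphic_on ball (of_real t) r \<and> (\<forall>s. \<bar>s - t\<bar> < r \<longrightarrow> g s = H (of_real s)))"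

text \<open>Zeros on an interval pass to the holomorphic extension near an accumulation point and
  from there back to a full real neighbourhood; connectedness of the interval does the rest.\<close>

lemma ra_identity:
  assumes ra: "\<And>t. t \<in> {a<..<b} \<Longrightarrow> ra_at g t" and c: "c \<in> {a<..<b}" and e: "e > 0"
    and z: "\<And>s. \<bar>s - c\<bar> < e \<Longrightarrow> g s = 0" and s: "s \<in> {a<..<b}"
  shows "g s = 0"
proof -
  define Z where "Z = {t \<in> {a<..<b}. \<exists>e>0. \<forall>s. \<bar>s - t\<bar> < e \<longrightarrow> g s = 0}"
  have near: "t \<in> Z" if t: "t \<in> {a<..<b}" and acc: "\<And>V. open V \<Longrightarrow> t \<in> V \<Longrightarrow> V \<inter> Z \<noteq> {}" for t
  proof -
    obtain r H where H: "r > 0" "H holomorphic_on ball (of_real t) r" "\<And>s. \<bar>s - t\<bar> < r \<Longrightarrow> g s = H (of_real s)"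
      using ra[OF t] by (auto simp: ra_at_def)
    obtain t' where t': "t' \<in> Z" "\<bar>t' - t\<bar> < r" using acc[OF open_ball[of t r]] H(1) by (auto simp: dist_real_def abs_minus_commute)
    obtain e where e: "e > 0" "\<And>s. \<bar>s - t'\<bar> < e \<Longrightarrow> g s = 0" using t' by (auto simp: Z_def)
    define e' where "e' = min e (r - \<bar>t' - t\<bar>)"
    have e': "e' > 0" using e t' by (simp add: e'_def)
    define U where "U = complex_of_real ` {t'<..<t' + e'}"
    have "H w = 0" if "w \<in> ball (of_real t) r" for w
    proof (rule analytic_continuation[OF H(2) open_ball _ _ _ _ _ that])
      show "connected (ball (complex_of_real t) r)" by simp
      show "U \<subseteq> ball (of_real t) r" using t' by (auto simp: U_def e'_def dist_real_def dist_of_real)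
      show "complex_of_real t' \<in> ball (of_real t) r" using t' by (simp add: dist_of_real dist_real_def)
      show "complex_of_real t' islimpt U"
        unfolding islimpt_approachable
      proof (intro allI impI)
        fix d :: real assume d: "d > 0"
        define x where "x = t' + min d e' / 2"
        have "t' < x" "x < t' + e'" "\<bar>x - t'\<bar> < d" using d e' by (auto simp: x_def)
        then show "\<exists>x'\<in>U. x' \<noteq> of_real t' \<and> dist x' (of_real t') < d"
          by (intro bexI[of _ "of_real x"]) (auto simp: U_def dist_of_real dist_real_def)
      qed
      fix w assume "w \<in> U"
      then obtain x where x: "w = of_real x" "t' < x" "x < t' + e'" by (auto simp: U_def)
      then have "g x = 0" by (intro e) (auto simp: e'_def)
      moreover have "g x = H (of_real x)" using x t' by (intro H(3)) (auto simp: e'_def)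
      ultimately show "H w = 0" using x by simp
    qed
    then have "g s = 0" if "\<bar>s - t\<bar> < r" for s using H(3)[OF that] that by (auto simp: dist_of_real dist_real_def abs_minus_commute)
    then show ?thesis using t H(1) by (auto simp: Z_def)
  qed
  have "Z = {a<..<b}"
  proof (rule connected_propagation)
    show "Z \<subseteq> {a<..<b}" by (auto simp: Z_def)
    show "Z \<noteq> {}" using c e z by (auto simp: Z_def)
    fix t assume t: "t \<in> Z"
    then obtain e where e: "e > 0" "\<And>s. \<bar>s - t\<bar> < e \<Longrightarrow> g s = 0" by (auto simp: Z_def)
    define T where "T = {a<..<b} \<inter> {t - e / 2<..<t + e / 2}"
    have "T \<subseteq> Z"
    proof
      fix y assume y: "y \<in> T"
      have "g s = 0" if "\<bar>s - y\<bar> < e / 2" for s using that y by (intro e) (auto simp: T_def abs_if split: if_splits)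
      then show "y \<in> Z" using y e(1) by (auto simp: Z_def T_def intro!: exI[of _ "e / 2"])
    qed
    moreover have "openin (top_of_set {a<..<b}) T" unfolding T_def by (rule openin_open_Int) simp
    moreover have "t \<in> T" using t e by (auto simp: T_def Z_def)
    ultimately show "\<exists>T. openin (top_of_set {a<..<b}) T \<and> t \<in> T \<and> T \<subseteq> Z" by blast
  next
    fix x assume "x \<in> {a<..<b}" "\<And>V. open V \<Longrightarrow> x \<in> V \<Longrightarrow> V \<inter> Z \<noteq> {}"
    then show "x \<in> Z" by (rule near)
  qed simp
  then have "s \<in> Z" using s by simp
  then show ?thesis by (auto simp: Z_def)
qed

lemma ra_at_mono:
  assumes "H holomorphic_on ball (of_real t) r" "r > 0" "\<And>s. \<bar>s - t\<bar> < r \<Longrightarrow> g s = H (of_real s)" shows "ra_at g t"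
  using assms by (auto simp: ra_at_def)

text \<open>On the real axis conj (H (conj w)) is the conjugate of H(w), so (H(w) - conj (H (conj
  w))) / (2 i) extends the imaginary part holomorphically.\<close>

lemma ra_at_Im:
  assumes "ra_at g t" shows "ra_at (\<lambda>s. of_real (Im (g s))) t"
proof -
  obtain r H where H: "r > 0" "H holomorphic_on ball (of_real t) r" "\<And>s. \<bar>s - t\<bar> < r \<Longrightarrow> g s = H (of_real s)"
    using assms by (auto simp: ra_at_def)
  have img: "cnj ` ball (complex_of_real t) r = ball (of_real t) r"
  proof -
    have d: "dist (of_real t) (cnj w) = dist (of_real t) w" for w
      by (metis complex_cnj_complex_of_real complex_cnj_diff complex_mod_cnj dist_norm)
    then show ?thesis by (force simp: image_iff intro: bexI[of _ "cnj _"])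
  qed
  have h: "cnj \<circ> H \<circ> cnj holomorphic_on ball (of_real t) r"
    by (rule holomorphic_on_compose_cnj_cnj) (use H img in auto)
  have "(\<lambda>w. (H w - (cnj \<circ> H \<circ> cnj) w) / (2 * \<i>)) holomorphic_on ball (of_real t) r"
    by (intro holomorphic_on_divide holomorphic_on_diff H h holomorphic_on_const) auto
  then show ?thesis
    by (rule ra_at_mono) (use H in \<open>auto simp: complex_eq_iff\<close>)
qed

text \<open>A substitute for real analyticity in several variables. It is inherited by imaginary
  parts and by composition with analytic charts, and it reduces the identity theorem to one complex
  variable.\<close>

definition curve_analytic :: "(real^3 => complex) => (real^3) set => bool" where
  "curve_analytic F U \<longleftrightarrow> (\<forall>\<gamma> t. \<gamma> t \<in> U \<longrightarrow> (\<forall>j. ra_at (\<lambda>s. of_real (\<gamma> s $ j)) t) \<longrightarrow> ra_at (\<lambda>s. F (\<gamma> s)) t)"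

lemma ra_at_line: "ra_at (\<lambda>s. of_real ((x + s *\<^sub>R h) $ j)) t"
  by (rule ra_at_mono[of "\<lambda>w. of_real (x $ j) + w * of_real (h $ j)" _ 1])
     (auto intro!: holomorphic_intros)

lemma ra_at_components:
  fixes \<gamma> :: "real => real^3"
  assumes "\<And>j::3. ra_at (\<lambda>s. of_real (\<gamma> s $ j)) t"
  obtains r H where "r > 0" "\<And>j::3. H j holomorphic_on ball (of_real t) r"
    "\<And>j s. \<bar>s - t\<bar> < r \<Longrightarrow> of_real (\<gamma> s $ j) = H j (of_real s)"
proof -
  have "\<forall>j. \<exists>r H. r > 0 \<and> H holomorphic_on ball (of_real t) r \<and> (\<forall>s. \<bar>s - t\<bar> < r \<longrightarrow> of_real (\<gamma> s $ j) = H (of_real s))"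
    using assms unfolding ra_at_def by blast
  then obtain r H where H: "\<And>j. r j > 0" "\<And>j. H j holomorphic_on ball (of_real t) (r j)"
     "\<And>j s. \<bar>s - t\<bar> < r j \<Longrightarrow> of_real (\<gamma> s $ j) = H j (of_real s)" by metis
  define R where "R = Min (range r)"
  have R: "R \<le> r j" for j by (simp add: R_def)
  have "R \<in> range r" unfolding R_def by (rule Min_in) auto
  then have "R > 0" using H(1) by auto
  moreover have "H j holomorphic_on ball (of_real t) R" for j using holomorphic_on_subset[OF H(2)] subset_ball[OF R] by blast
  moreover have "of_real (\<gamma> s $ j) = H j (of_real s)" if "\<bar>s - t\<bar> < R" for j s using H(3) R[of j] that by force
  ultimately show ?thesis using that by blast
qed

text \<open>The parameters for which some \<open>z\<close> in \<open>K\<close> hits the slit form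
  the projection of a compact set, so the good parameters are open.\<close>

lemma avoid_nonpos_Reals:
  fixes q :: "complex => 'a::euclidean_space => complex"
  assumes c: "continuous_on (cball a r \<times> K) (\<lambda>(t, z). q t z)" and K: "compact K" and r: "r > 0"
    and q: "\<And>z. z \<in> K \<Longrightarrow> q a z \<notin> \<real>\<^sub>\<le>\<^sub>0"
  obtains d where "0 < d" "d \<le> r" "\<And>t z. t \<in> cball a d \<Longrightarrow> z \<in> K \<Longrightarrow> q t z \<notin> \<real>\<^sub>\<le>\<^sub>0"
proof -
  let ?X = "cball a r \<times> K"
  define C where "C = fst ` (?X \<inter> (\<lambda>(t, z). q t z) -` \<real>\<^sub>\<le>\<^sub>0)"
  have "closedin (top_of_set ?X) (?X \<inter> (\<lambda>(t, z). q t z) -` \<real>\<^sub>\<le>\<^sub>0)"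
    by (rule continuous_closedin_preimage[OF c closed_nonpos_Reals_complex])
  then have "compact C" unfolding C_def
    by (intro compact_continuous_image continuous_intros closedin_compact[OF compact_Times[OF compact_cball K]])
  then have "open (- C)" by (simp add: compact_imp_closed open_Compl)
  moreover have "a \<in> - C" using q by (auto simp: C_def)
  ultimately obtain e where "e > 0" "cball a e \<subseteq> - C" by (auto simp: open_contains_cball)
  then show ?thesis using r by (intro that[of "min e r"]) (force simp: C_def image_iff subset_iff)+
qed

text \<open>Along a curve the squared distance extends to the holomorphic function \<open>Q\<close>,
  a sum of complex squares, and the distance to its \<open>csqrt\<close>. At points off the support
  of \<open>f\<close> the squared distance is positive, so \<open>Q\<close> stays off the slit for
  nearby complex parameters.\<close>

lemma pot_curve_analytic:
  assumes f: "dens B A f" and K: "closed K" "\<And>z. z \<notin> K \<Longrightarrow> f z = 0" and U: "U \<inter> K = {}"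
  shows "curve_analytic (pot \<kappa> f) U"
  unfolding curve_analytic_def
proof (intro allI impI)
  fix \<gamma> :: "real => real^3" and t assume t: "\<gamma> t \<in> U" and \<gamma>: "\<forall>j. ra_at (\<lambda>s. complex_of_real (\<gamma> s $ j)) t"
  obtain r' H where H': "r' > 0" "\<And>j::3. H j holomorphic_on ball (of_real t) r'"
    "\<And>j s. \<bar>s - t\<bar> < r' \<Longrightarrow> of_real (\<gamma> s $ j) = H j (of_real s)" using ra_at_components[OF \<gamma>[rule_format]] by metis
  define r where "r = r' / 2"
  have r: "r > 0" "cball (complex_of_real t) r \<subseteq> ball (of_real t) r'" using H'(1) by (auto simp: r_def)
  define Q where "Q w z = (\<Sum>j\<in>UNIV. (H j w - of_real (z $ j))\<^sup>2)" for w and z :: "real^3"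
  have Q: "Q (of_real s) z = of_real ((\<gamma> s - z) \<bullet> (\<gamma> s - z))" if "\<bar>s - t\<bar> < r" for s z
    using that r unfolding Q_def inner_vec_def by (subst H'(3)[symmetric]) (auto simp: power2_eq_square r_def)
  define S where "S = cball 0 A \<inter> K"
  have S: "compact S" unfolding S_def using K(1) by (simp add: compact_Int_closed)
  have Hc: "continuous_on (cball (of_real t) r \<times> S) (\<lambda>p. H j (fst p))" for j
    by (rule continuous_on_compose2[OF holomorphic_on_imp_continuous_on[OF H'(2)]]) (use r in \<open>auto intro!: continuous_intros\<close>)
  have Qc: "continuous_on (cball (of_real t) r \<times> S) (\<lambda>(w, z). Q w z)"
    unfolding Q_def case_prod_unfold by (intro continuous_intros Hc)
  obtain d where d: "0 < d" "d \<le> r" "\<And>w z. w \<in> cball (of_real t) d \<Longrightarrow> z \<in> S \<Longrightarrow> Q w z \<notin> \<real>\<^sub>\<le>\<^sub>0"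
  proof (rule avoid_nonpos_Reals[OF Qc S r(1)])
    fix z assume "z \<in> S"
    then have "\<gamma> t \<noteq> z" using t U by (auto simp: S_def)
    then show "Q (of_real t) z \<notin> \<real>\<^sub>\<le>\<^sub>0" using Q[of t z] r(1) by (simp add: complex_nonpos_Reals_iff not_le)
  qed (rule that)
  define E where "E w z = - exp (\<i> * of_real \<kappa> * csqrt (Q w z)) / (of_real (4 * pi) * csqrt (Q w z))" for w z
  have nz: "csqrt (Q w z) \<noteq> 0" if "w \<in> cball (of_real t) d" "z \<in> S" for w z using d(3)[OF that] by auto
  have "(\<lambda>w. LBINT z. E w z * f z) holomorphic_on ball (of_real t) d"
  proof (rule holomorphic_integral[OF _ S])
    show "(\<lambda>w. E w z) holomorphic_on ball (of_real t) d" if z: "z \<in> S" for z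
    proof -
      have "(\<lambda>w. Q w z) holomorphic_on ball (of_real t) d" unfolding Q_def
        by (intro holomorphic_intros holomorphic_on_subset[OF H'(2)]) (use d r in auto)
      then show ?thesis unfolding E_def
        by (intro holomorphic_intros) (use nz[OF _ z] d(3)[OF _ z] in \<open>auto simp: less_imp_le simp del: csqrt.simps\<close>)
    qed
    have "continuous_on (cball (of_real t) d \<times> S) (\<lambda>(w, z). Q w z)"
      by (rule continuous_on_subset[OF Qc]) (use d in auto)
    then have "continuous_on (cball (of_real t) d \<times> S) (\<lambda>p. csqrt (Q (fst p) (snd p)))"
      unfolding case_prod_unfold by (rule continuous_on_compose2[OF continuous_on_csqrt]) (use d(3) in auto)
    then show "continuous_on (cball (of_real t) d \<times> S) (\<lambda>(w, z). E w z)"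
      unfolding E_def case_prod_unfold using nz by (intro continuous_intros) (auto simp del: csqrt.simps)
    show "z \<in> S" if "f z \<noteq> 0" for z using that densD(4)[OF f that] K(2) by (auto simp: S_def)
  qed (rule dens_integrable[OF f])
  then show "ra_at (\<lambda>s. pot \<kappa> f (\<gamma> s)) t"
  proof (rule ra_at_mono[OF _ d(1)])
    fix s assume "\<bar>s - t\<bar> < d"
    then show "pot \<kappa> f (\<gamma> s) = (LBINT z. E (of_real s) z * f z)"
      using d(2) Q[of s] by (simp add: pot_def E_def Gplus_Gr Gr_def)
  qed
qed

lemma curve_analytic_Im: "curve_analytic F U \<Longrightarrow> curve_analytic (\<lambda>x. of_real (Im (F x))) U"
  unfolding curve_analytic_def using ra_at_Im by blast

text \<open>On a line the multi-index series becomes a series in powers of w - t with exponents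
  |\<alpha>|. Summability at one real radius \<rho> is absolute and so dominates the series on a
  complex disc.\<close>

lemma real_analytic_ra_at:
  fixes X :: "real^'n => real^3" and u h :: "real^'n"
  assumes X: "real_analytic_on W X" and t: "u + t *\<^sub>R h \<in> W"
  shows "ra_at (\<lambda>s. of_real (X (u + s *\<^sub>R h) $ j)) t"
proof -
  define p where "p = u + t *\<^sub>R h"
  obtain r c where r: "r > 0" and c: "\<And>x. x \<in> ball p r \<Longrightarrow> ((\<lambda>\<alpha>. (\<Prod>i\<in>UNIV. (x $ i - p $ i) ^ \<alpha> i) *\<^sub>R c \<alpha>) has_sum X x) UNIV"
    using X t unfolding real_analytic_on_def p_def by blast
  define m where "m \<alpha> = (\<Prod>i\<in>UNIV. (h $ i) ^ \<alpha> i) * (c \<alpha> $ j)" for \<alpha> :: "'n => nat"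
  define N where "N \<alpha> = (\<Sum>i\<in>UNIV. \<alpha> i)" for \<alpha> :: "'n => nat"
  have hs: "((\<lambda>\<alpha>. s ^ N \<alpha> * m \<alpha>) has_sum X (p + s *\<^sub>R h) $ j) UNIV" if "\<bar>s\<bar> * norm h < r" for s
  proof -
    have "p + s *\<^sub>R h \<in> ball p r" using that by (simp add: dist_norm)
    from has_sum_bounded_linear[OF bounded_linear_vec_nth c[OF this], of j]
    have "((\<lambda>\<alpha>. (\<Prod>i\<in>UNIV. (s * h $ i) ^ \<alpha> i) * c \<alpha> $ j) has_sum X (p + s *\<^sub>R h) $ j) UNIV" by simp
    moreover have "(\<Prod>i\<in>UNIV. (s * h $ i) ^ \<alpha> i) * c \<alpha> $ j = s ^ N \<alpha> * m \<alpha>" for \<alpha>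
      by (simp add: power_mult_distrib prod.distrib m_def N_def power_sum)
    ultimately show ?thesis by simp
  qed
  \<comment> \<open>The added 1 covers h = 0 and keeps the segment inside the ball of
    convergence.\<close>
  define \<rho> where "\<rho> = r / (norm h + 1) / 2"
  have h1: "norm h + 1 > 0" by (simp add: add_nonneg_pos)
  have \<rho>: "\<rho> > 0" using r h1 by (simp add: \<rho>_def)
  have \<rho>h: "\<rho> * norm h < r"
  proof -
    have "\<rho> * norm h \<le> \<rho> * (norm h + 1)" using \<rho> by (intro mult_left_mono) auto
    also have "\<dots> = r / 2"
    proof -
      have "r / n / 2 * n = r / 2" if "n > 0" for n :: real using that by simp
      from this[OF h1] show ?thesis by (simp only: \<rho>_def)
    qed
    finally show ?thesis using r by linarith
  qed
  have "\<bar>\<rho>\<bar> * norm h < r" using \<rho> \<rho>h by simp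
  then have "(\<lambda>\<alpha>. \<rho> ^ N \<alpha> * m \<alpha>) summable_on UNIV" by (rule has_sum_imp_summable[OF hs])
  then have sm: "(\<lambda>\<alpha>. norm (\<rho> ^ N \<alpha> * m \<alpha>)) summable_on UNIV" by (rule summable_on_iff_abs_summable_on_real[THEN iffD1])
  define H where "H w = (\<Sum>\<^sub>\<infinity>\<alpha>. (w - of_real t) ^ N \<alpha> * of_real (m \<alpha>))" for w :: complex
  have "uniform_limit (cball (of_real t) \<rho>) (\<lambda>Y w. \<Sum>\<alpha>\<in>Y. (w - of_real t) ^ N \<alpha> * of_real (m \<alpha>)) H (finite_subsets_at_top UNIV)"
    unfolding H_def[abs_def]
  proof (rule Weierstrass_m_test_general[OF _ sm])
    fix \<alpha> and w assume "w \<in> cball (complex_of_real t) \<rho>"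
    then have "norm (w - of_real t) \<le> \<rho>" by (simp add: dist_norm norm_minus_commute)
    then have "norm (w - of_real t) ^ N \<alpha> \<le> \<rho> ^ N \<alpha>" by (intro power_mono) auto
    then show "norm ((w - of_real t) ^ N \<alpha> * of_real (m \<alpha>)) \<le> norm (\<rho> ^ N \<alpha> * m \<alpha>)"
      using \<rho> by (simp add: norm_mult norm_power abs_mult mult_right_mono)
  qed
  then obtain "H holomorphic_on ball (of_real t) \<rho>"
    by (rule holomorphic_uniform_limit[rotated]) (auto intro!: always_eventually continuous_intros holomorphic_intros)
  then show ?thesis
  proof (rule ra_at_mono[OF _ \<rho>])
    fix s assume s: "\<bar>s - t\<bar> < \<rho>"
    have "\<bar>s - t\<bar> * norm h \<le> \<rho> * norm h" using s by (intro mult_right_mono) auto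
    then have "((\<lambda>\<alpha>. (s - t) ^ N \<alpha> * m \<alpha>) has_sum X (p + (s - t) *\<^sub>R h) $ j) UNIV" using \<rho>h by (intro hs) linarith
    from has_sum_of_real[OF this, where 'a = complex]
    have "((\<lambda>\<alpha>. (of_real s - of_real t) ^ N \<alpha> * of_real (m \<alpha>)) has_sum (complex_of_real (X (p + (s - t) *\<^sub>R h) $ j))) UNIV" by simp
    from infsumI[OF this] have "H (of_real s) = complex_of_real (X (p + (s - t) *\<^sub>R h) $ j)" by (simp add: H_def)
    moreover have "p + (s - t) *\<^sub>R h = u + s *\<^sub>R h" by (simp add: p_def algebra_simps)
    ultimately show "complex_of_real (X (u + s *\<^sub>R h) $ j) = H (of_real s)" by simp
  qed
qed

text \<open>Connectedness of \<open>Y\<close> propagates the zero set from chart to chart; within a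
  chart, two parameters in a ball are joined by a segment to which the one-variable identity theorem
  applies. Asking for analyticity of charts along lines covers surfaces and open sets alike.\<close>

lemma curve_analytic_continuation:
  assumes F: "curve_analytic F U" and Y: "connected Y" "Y \<subseteq> U"
    and charts: "\<And>p. p \<in> Y \<Longrightarrow> \<exists>V W (X :: 'a::euclidean_space => real^3) G. open V \<and> p \<in> V \<and> open W \<and> homeomorphism W (Y \<inter> V) X G \<and>
      (\<forall>u h t j. u + t *\<^sub>R h \<in> W \<longrightarrow> ra_at (\<lambda>s. of_real (X (u + s *\<^sub>R h) $ j)) t)"
    and D: "openin (top_of_set Y) D" "D \<noteq> {}" and z: "\<And>x. x \<in> D \<Longrightarrow> F x = 0" and x: "x \<in> Y"
  shows "F x = 0"
proof -
  define Z where "Z = {p \<in> Y. \<exists>T. openin (top_of_set Y) T \<and> p \<in> T \<and> (\<forall>q\<in>T. F q = 0)}"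
  have "Z = Y"
  proof (rule connected_propagation[OF Y(1)])
    show "Z \<subseteq> Y" by (auto simp: Z_def)
    have "D \<subseteq> Z" using D z openin_imp_subset[OF D(1)] by (auto simp: Z_def)
    then show "Z \<noteq> {}" using D by auto
    fix p assume p: "p \<in> Z"
    then obtain T where T: "openin (top_of_set Y) T" "p \<in> T" "\<And>q. q \<in> T \<Longrightarrow> F q = 0" by (auto simp: Z_def)
    have "T \<subseteq> Z" using T openin_imp_subset[OF T(1)] by (auto simp: Z_def)
    then show "\<exists>T. openin (top_of_set Y) T \<and> p \<in> T \<and> T \<subseteq> Z" using T by blast
  next
    fix p assume p: "p \<in> Y" and acc: "\<And>V. open V \<Longrightarrow> p \<in> V \<Longrightarrow> V \<inter> Z \<noteq> {}"
    obtain V W and X :: "'a => real^3" and G where V: "open V" "p \<in> V" and W: "open W" and hom: "homeomorphism W (Y \<inter> V) X G"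
      and X: "\<And>u h t j. u + t *\<^sub>R h \<in> W \<Longrightarrow> ra_at (\<lambda>s. of_real (X (u + s *\<^sub>R h) $ j)) t"
      using charts[OF p] by blast
    have GX: "G (X u) = u" "X u \<in> Y \<inter> V" if "u \<in> W" for u using hom that unfolding homeomorphism_def by auto
    have XG: "X (G q) = q" "G q \<in> W" if "q \<in> Y \<inter> V" for q using hom that unfolding homeomorphism_def by auto
    have cX: "continuous_on W X" and cG: "continuous_on (Y \<inter> V) G" using hom by (auto simp: homeomorphism_def)
    define u0 where "u0 = G p"
    have u0: "u0 \<in> W" "X u0 = p" using XG p V by (auto simp: u0_def)
    obtain r where r: "r > 0" "ball u0 r \<subseteq> W" using W u0 openE by blast
    define O' where "O' = X ` ball u0 r"
    have "O' = (Y \<inter> V) \<inter> G -` ball u0 r"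
    proof
      show "O' \<subseteq> (Y \<inter> V) \<inter> G -` ball u0 r" using GX r by (auto simp: O'_def)
      show "(Y \<inter> V) \<inter> G -` ball u0 r \<subseteq> O'"
      proof
        fix q assume q: "q \<in> (Y \<inter> V) \<inter> G -` ball u0 r"
        then have "q = X (G q)" using XG by simp
        then show "q \<in> O'" using q unfolding O'_def by blast
      qed
    qed
    moreover have "openin (top_of_set (Y \<inter> V)) ((Y \<inter> V) \<inter> G -` ball u0 r)"
      by (rule continuous_openin_preimage_gen[OF cG open_ball])
    moreover have "openin (top_of_set Y) (Y \<inter> V)" by (rule openin_open_Int[OF V(1)])
    ultimately have O: "openin (top_of_set Y) O'" using openin_trans by metis
    then obtain O1 where O1: "open O1" "O' = Y \<inter> O1" by (auto simp: openin_open)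
    have "p \<in> O'" unfolding O'_def using u0 r by force
    then obtain q where q: "q \<in> O1" "q \<in> Z" using acc[OF O1(1)] O1(2) by auto
    then have qO: "q \<in> O'" using O1 by (auto simp: Z_def)
    then obtain u1 where u1: "u1 \<in> ball u0 r" "X u1 = q" by (auto simp: O'_def)
    obtain T where T: "openin (top_of_set Y) T" "q \<in> T" "\<And>q. q \<in> T \<Longrightarrow> F q = 0" using q by (auto simp: Z_def)
    obtain T1 where T1: "open T1" "T = Y \<inter> T1" using T(1) by (auto simp: openin_open)
    have "open (W \<inter> X -` T1)" using continuous_open_preimage[OF cX W T1(1)] .
    moreover have "u1 \<in> W \<inter> X -` T1" using u1 r T T1 by auto
    ultimately obtain e where e: "e > 0" "ball u1 e \<subseteq> W \<inter> X -` T1" by (meson openE)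
    have Fe: "F (X u) = 0" if "u \<in> ball u1 e" for u
      using that e(2) GX(2)[of u] T1(2) by (intro T(3)) auto
    have "F (X w) = 0" if w: "w \<in> ball u0 r" for w
    proof -
      \<comment> \<open>\<open>ra_identity\<close> works on open intervals, so the segment from
        \<open>u1\<close> (parameter 0, near which the composite vanishes) to \<open>w\<close>
        (parameter 1) is prolonged slightly at both ends.\<close>
      define \<gamma> where "\<gamma> s = u1 + s *\<^sub>R (w - u1)" for s
      have "open (\<gamma> -` ball u0 r)" unfolding \<gamma>_def by (intro open_vimage continuous_intros) auto
      moreover have "0 \<in> \<gamma> -` ball u0 r" "1 \<in> \<gamma> -` ball u0 r" using u1 w by (auto simp: \<gamma>_def)
      ultimately obtain d0 d1 where d: "d0 > 0" "ball 0 d0 \<subseteq> \<gamma> -` ball u0 r" "d1 > 0" "ball 1 d1 \<subseteq> \<gamma> -` ball u0 r"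
        by (meson openE)
      have mem: "\<gamma> s \<in> ball u0 r" if "s \<in> {-d0<..<1 + d1}" for s
      proof -
        have "s \<in> {0..1} \<or> s \<in> ball 0 d0 \<or> s \<in> ball 1 d1" using that by (auto simp: dist_real_def abs_if)
        then consider "s \<in> {0..1}" | "s \<in> ball 0 d0" | "s \<in> ball 1 d1" by blast
        then show ?thesis
        proof cases
          case 1
          have "(1 - s) *\<^sub>R u1 + s *\<^sub>R w \<in> ball u0 r" by (rule convexD_alt[OF convex_ball u1(1) w]) (use 1 in auto)
          then show ?thesis by (simp add: \<gamma>_def algebra_simps)
        qed (use d in auto)
      qed
      have "F (X (\<gamma> 1)) = 0"
      proof (rule ra_identity[of "-d0" "1 + d1" "\<lambda>s. F (X (\<gamma> s))" 0 "e / (norm (w - u1) + 1)" 1])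
        show "ra_at (\<lambda>s. F (X (\<gamma> s))) t" if "t \<in> {-d0<..<1 + d1}" for t
        proof (rule F[unfolded curve_analytic_def, rule_format, of "\<lambda>s. X (\<gamma> s)" t])
          have W': "\<gamma> t \<in> W" using mem[OF that] r(2) by blast
          then show "X (\<gamma> t) \<in> U" using GX Y(2) by blast
          show "ra_at (\<lambda>s. of_real (X (\<gamma> s) $ j)) t" for j
            using W' unfolding \<gamma>_def by (rule X)
        qed
        fix s assume s: "\<bar>s - 0\<bar> < e / (norm (w - u1) + 1)"
        have np: "norm (w - u1) + 1 > 0" by (simp add: add_nonneg_pos)
        have "norm (s *\<^sub>R (w - u1)) \<le> \<bar>s\<bar> * (norm (w - u1) + 1)" by (simp add: mult_left_mono)
        also have "\<dots> < e" using s np by (simp add: pos_less_divide_eq)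
        finally show "F (X (\<gamma> s)) = 0" by (intro Fe) (simp add: \<gamma>_def dist_norm)
      qed (use d e in \<open>auto intro!: divide_pos_pos add_nonneg_pos\<close>)
      then show ?thesis by (simp add: \<gamma>_def)
    qed
    then have "\<forall>q\<in>O'. F q = 0" by (auto simp: O'_def)
    then show "p \<in> Z" using p \<open>p \<in> O'\<close> O by (auto simp: Z_def)
  qed
  then show ?thesis using x unfolding Z_def by blast
qed

lemma curve_analytic_unique_continuation:
  assumes F: "curve_analytic F U" and U: "open U" "connected U" and V: "open V" "V \<noteq> {}" "V \<subseteq> U"
    and z: "\<And>x. x \<in> V \<Longrightarrow> F x = 0" and x: "x \<in> U"
  shows "F x = 0"
proof (rule curve_analytic_continuation[OF F U(2) subset_refl _ _ V(2) z x])
  show "\<exists>V W (X :: real^3 => real^3) G. open V \<and> p \<in> V \<and> open W \<and> homeomorphism W (U \<inter> V) X G \<and>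
      (\<forall>u h t j. u + t *\<^sub>R h \<in> W \<longrightarrow> ra_at (\<lambda>s. of_real (X (u + s *\<^sub>R h) $ j)) t)" for p
    using U(1) ra_at_line homeomorphism_ident[of U] by (intro exI[of _ UNIV] exI[of _ U] exI[of _ "\<lambda>x. x"]) auto
  show "openin (top_of_set U) V" using U(1) V by (simp add: openin_open_eq)
qed

lemma curve_analytic_surface:
  assumes F: "curve_analytic F U" and Y: "real_analytic_surface Y" "connected Y" "Y \<subseteq> U"
    and D: "openin (top_of_set Y) D" "D \<noteq> {}" and z: "\<And>x. x \<in> D \<Longrightarrow> F x = 0" and x: "x \<in> Y"
  shows "F x = 0"
proof (rule curve_analytic_continuation[OF F Y(2,3) _ D z x])
  fix p assume p: "p \<in> Y"
  obtain V and W :: "(real^2) set" and X :: "real^2 => real^3" and G where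
    "open V" "p \<in> V" "open W" "homeomorphism W (Y \<inter> V) X G" and X: "real_analytic_on W X"
    using Y(1)[unfolded embedded_surface_def, rule_format, OF p] by auto
  then show "\<exists>V W (X :: real^2 => real^3) G. open V \<and> p \<in> V \<and> open W \<and> homeomorphism W (Y \<inter> V) X G \<and>
      (\<forall>u h t j. u + t *\<^sub>R h \<in> W \<longrightarrow> ra_at (\<lambda>s. of_real (X (u + s *\<^sub>R h) $ j)) t)"
    using real_analytic_ra_at[OF X] by blast
qed

text \<open>Analyticity carries the zero from the piece to the whole boundary, the eigenvalue
  condition carries it from there to the interior, and analyticity again from the open set
  \<open>B\<close> to \<open>U\<close>.\<close>

lemma vanishing_on_surface_piece:
  assumes F: "curve_analytic F U" "continuous_on (closure B) F" "Ck_on 2 B F" "\<And>x. x \<in> B \<Longrightarrow> - laplacian F x = of_real (\<kappa>\<^sup>2) * F x"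
    and U: "open U" "connected U" and B: "open B" "closure B \<subseteq> U" "real_analytic_surface (frontier B)" "connected (frontier B)"
    and nd: "\<not> dirichlet_eigenvalue \<kappa> B" and D: "openin (top_of_set (frontier B)) D" "D \<noteq> {}" "\<And>x. x \<in> D \<Longrightarrow> F x = 0"
    and x: "x \<in> U"
  shows "F x = 0"
proof -
  have fU: "frontier B \<subseteq> U" using B(2) by (auto simp: frontier_def)
  have "F p = 0" if "p \<in> frontier B" for p
    by (rule curve_analytic_surface[OF F(1) B(3,4) fU D that])
  then have "F p = 0" if "p \<in> B" for p
    using nd F that unfolding dirichlet_eigenvalue_def by blast
  moreover have "B \<noteq> {}" using D openin_imp_subset[OF D(1)] by auto
  moreover have "B \<subseteq> U" using B(2) closure_subset by blast
  ultimately show ?thesis using curve_analytic_unique_continuation[OF F(1) U B(1) _ _ _ x] by blast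
qed

text \<open>The second claim treats Im \<open>pot\<close> as a field of its own: since \<kappa>^2 is
  real it solves the same Helmholtz equation, and it is analytic along curves by
  \<open>curve_analytic_Im\<close>.\<close>

lemma pot_vanishing_on_surface_piece:
  assumes f: "dens M A f" and \<kappa>: "\<kappa> > 0" and K: "closed K" "\<And>z. z \<notin> K \<Longrightarrow> f z = 0" "U \<inter> K = {}"
    and U: "open U" "connected U" and B: "open B" "bounded B" "closure B \<subseteq> U" "real_analytic_surface (frontier B)" "connected (frontier B)"
    and nd: "\<not> dirichlet_eigenvalue \<kappa> B" and D: "openin (top_of_set (frontier B)) D" "D \<noteq> {}"
  shows "(\<And>x. x \<in> D \<Longrightarrow> pot \<kappa> f x = 0) \<Longrightarrow> x \<in> U \<Longrightarrow> pot \<kappa> f x = 0"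
    and "(\<And>x. x \<in> D \<Longrightarrow> Im (pot \<kappa> f x) = 0) \<Longrightarrow> x \<in> U \<Longrightarrow> Im (pot \<kappa> f x) = 0"
proof -
  have ca: "curve_analytic (pot \<kappa> f) U" by (rule pot_curve_analytic[OF f K])
  have c: "continuous_on (closure B) (pot \<kappa> f)" using continuous_on_subset[OF pot_dens(3)[OF f]] by auto
  have "compact (closure B)" using B(2) by (simp add: compact_closure)
  then obtain d where d: "d > 0" "\<And>x z. x \<in> closure B \<Longrightarrow> z \<in> K \<Longrightarrow> d \<le> dist x z"
    using separate_compact_closed[of "closure B" K] K B(3) by blast
  have sep: "separated (d / 3) B f"
    unfolding separated_def
  proof (intro ballI allI impI)
    fix x z assume "x \<in> B" "f z \<noteq> 0"
    then have "d \<le> dist x z" using d(2)[of x z] K(2)[of z] closure_subset by blast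
    then show "norm (x - z) > 2 * (d / 3)" using d(1) by (simp add: dist_norm)
  qed
  have d3: "d / 3 > 0" using d by simp
  note P = pot_separated[OF dens_integrable(1,2)[OF f] B(1) d3 sep]
  have lap: "- laplacian (pot \<kappa> f) x = of_real (\<kappa>\<^sup>2) * pot \<kappa> f x" if "x \<in> B" for x
    using P(2)[OF that, of \<kappa>] by (simp only: add_eq_0_iff)
  show "(\<And>x. x \<in> D \<Longrightarrow> pot \<kappa> f x = 0) \<Longrightarrow> x \<in> U \<Longrightarrow> pot \<kappa> f x = 0"
    by (rule vanishing_on_surface_piece[OF ca c P(1) lap U B(1,3,4,5) nd D])
  assume z: "\<And>x. x \<in> D \<Longrightarrow> Im (pot \<kappa> f x) = 0" and x: "x \<in> U"
  define L where "L w = complex_of_real (Im w)" for w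
  have L: "bounded_linear L" unfolding L_def by (intro bounded_linear_compose[OF bounded_linear_of_real bounded_linear_Im])
  have "(\<lambda>x. L (pot \<kappa> f x)) x = 0"
  proof (rule vanishing_on_surface_piece[OF _ _ _ _ U B(1,3,4,5) nd D _ x])
    show "curve_analytic (\<lambda>x. L (pot \<kappa> f x)) U" unfolding L_def by (rule curve_analytic_Im[OF ca])
    show "continuous_on (closure B) (\<lambda>x. L (pot \<kappa> f x))" by (rule bounded_linear.continuous_on[OF L c])
    show "Ck_on 2 B (\<lambda>x. L (pot \<kappa> f x))" by (rule Ck_on_bounded_linear_compose[OF L B(1) P(1)])
    show "- laplacian (\<lambda>x. L (pot \<kappa> f x)) x = of_real (\<kappa>\<^sup>2) * L (pot \<kappa> f x)" if "x \<in> B" for x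
    proof -
      have "- laplacian (\<lambda>x. L (pot \<kappa> f x)) x = L (- laplacian (pot \<kappa> f) x)"
        using laplacian_bounded_linear[OF L B(1) that P(1)] by (simp add: L_def)
      also have "\<dots> = of_real (\<kappa>\<^sup>2) * L (pot \<kappa> f x)" unfolding lap[OF that] L_def by (simp flip: of_real_power)
      finally show ?thesis .
    qed
    show "L (pot \<kappa> f x) = 0" if "x \<in> D" for x using z[OF that] by (simp add: L_def)
  qed
  then show "Im (pot \<kappa> f x) = 0" by (simp add: L_def)
qed

section \<open>Outgoing fields that are real near infinity\<close>

lemma holomorphic_zero_if_zeros_accumulate:
  assumes F: "F holomorphic_on ball 0 \<rho>" and \<rho>: "\<rho> > 0" and s: "\<And>k. s k > 0" "s \<longlonglongrightarrow> 0" and z: "\<And>k. s k < \<rho> \<Longrightarrow> F (of_real (s k)) = 0"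
    and w: "w \<in> ball 0 \<rho>"
  shows "F w = 0"
proof (rule analytic_continuation[OF F open_ball _ _ _ _ _ w])
  define U where "U = {complex_of_real (s k) |k. s k < \<rho>}"
  show "U \<subseteq> ball 0 \<rho>" using s(1) by (auto simp: U_def less_imp_le)
  show "0 islimpt U"
    unfolding islimpt_approachable
  proof (intro allI impI)
    fix e :: real assume "e > 0"
    then have "\<forall>\<^sub>F k in sequentially. s k < min e \<rho>" using order_tendstoD(2)[OF s(2), of "min e \<rho>"] \<rho> by simp
    then obtain k where "s k < min e \<rho>" by (auto simp: eventually_sequentially)
    then show "\<exists>x'\<in>U. x' \<noteq> 0 \<and> dist x' 0 < e"
      using s(1)[of k] by (intro bexI[of _ "of_real (s k)"]) (auto simp: U_def)
  qed
  show "F v = 0" if "v \<in> U" for v using that z by (auto simp: U_def)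
qed (use \<rho> in auto)

text \<open>With \<open>s = 1/r\<close> the field on a ray is \<open>exp (i\<kappa>r)/r\<close> times a function \<open>H\<close> holomorphic in \<open>s\<close> near \<open>0\<close>. Being
  real means \<open>exp (2i\<kappa>r) H = Hs\<close>, and \<open>r\<close> can tend to infinity with \<open>exp (2i\<kappa>r)\<close> equal to \<open>1\<close> or to \<open>-1\<close>.\<close>

lemma pot_ray_zero:
  assumes f: "dens B A f" and A: "A > 0" and \<kappa>: "\<kappa> > 0" and \<theta>: "norm \<theta> = 1" and r0: "\<And>r. r > R \<Longrightarrow> Im (pot \<kappa> f (r *\<^sub>R \<theta>)) = 0"
    and R: "R \<ge> 8 * (A + 1)" and r: "r > R"
  shows "pot \<kappa> f (r *\<^sub>R \<theta>) = 0"
proof -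
  define \<rho> where "\<rho> = 1 / R"
  have R0: "R > 0" "A \<le> R / 8" using R A by auto
  then have \<rho>: "\<rho> > 0" "\<rho> * A \<le> 1 / 8" by (auto simp: \<rho>_def field_simps)
  \<comment> \<open>With s = 1/r this is |r \<theta> - z|^2 / r^2. The exponent of \<open>E\<close>
    is i \<kappa> times |r \<theta> - z| - r, rationalised so that it has no singularity at s =
    0.\<close>
  define q where "q s z = 1 - 2 * s * of_real (\<theta> \<bullet> z) + s\<^sup>2 * of_real (z \<bullet> z)" for s :: complex and z :: "real^3"
  define E where "E s z = exp (\<i> * of_real \<kappa> * ((s * of_real (z \<bullet> z) - 2 * of_real (\<theta> \<bullet> z)) / (csqrt (q s z) + 1))) / csqrt (q s z)" for s z
  \<comment> \<open>From \<rho> A \<le> 1/8, the deviation of \<open>q\<close> from 1 is at most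
    1/64 + 1/4; this is the origin of the constant 8 in the bound for \<open>R\<close>.\<close>
  have qre: "Re (q s z) > 0" if "s \<in> cball 0 \<rho>" "z \<in> cball 0 A" for s z
  proof -
    have "norm (q s z - 1) = norm (s\<^sup>2 * of_real (z \<bullet> z) - 2 * s * of_real (\<theta> \<bullet> z))" by (simp add: q_def)
    also have "\<dots> \<le> (norm s * norm z) * (norm s * norm z) + 2 * (norm s * \<bar>\<theta> \<bullet> z\<bar>)"
      by (rule order_trans[OF norm_triangle_ineq4]) (simp add: norm_mult power2_norm_eq_inner[symmetric] power2_eq_square)
    also have "\<dots> \<le> (\<rho> * A) * (\<rho> * A) + 2 * (\<rho> * A)"
      using that \<theta> Cauchy_Schwarz_ineq2[of \<theta> z] A \<rho>(1) by (intro add_mono mult_mono) auto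
    also have "\<dots> \<le> 1/8 * (1/8) + 2 * (1/8)" using \<rho> A by (intro add_mono mult_mono) auto
    finally show ?thesis using abs_Re_le_cmod[of "q s z - 1"] by simp
  qed
  then have qnz: "q s z \<notin> \<real>\<^sub>\<le>\<^sub>0" if "s \<in> cball 0 \<rho>" "z \<in> cball 0 A" for s z
    using that by (auto simp: complex_nonpos_Reals_iff not_le)
  have nz: "csqrt (q s z) \<noteq> 0" "csqrt (q s z) + 1 \<noteq> 0" if "s \<in> cball 0 \<rho>" "z \<in> cball 0 A" for s z
  proof -
    show "csqrt (q s z) \<noteq> 0" using qnz[OF that] by auto
    have "Re (csqrt (q s z) + 1) > 0" using Re_csqrt[of "q s z"] by (simp del: csqrt.simps)
    then show "csqrt (q s z) + 1 \<noteq> 0" by (metis less_irrefl zero_complex.sel(1))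
  qed
  define H where "H s = (LBINT z. E s z * f z)" for s
  have Hh: "H holomorphic_on ball 0 \<rho>" unfolding H_def[abs_def]
  proof (rule holomorphic_integral[where K = "cball 0 A"])
    show "(\<lambda>s. E s z) holomorphic_on ball 0 \<rho>" if z: "z \<in> cball 0 A" for z
    proof -
      have "(\<lambda>s. q s z) holomorphic_on ball 0 \<rho>" unfolding q_def by (intro holomorphic_intros)
      then show ?thesis unfolding E_def
        by (intro holomorphic_intros) (use nz[OF _ z] qnz[OF _ z] in \<open>auto simp: less_imp_le simp del: csqrt.simps\<close>)
    qed
    have "continuous_on (cball 0 \<rho> \<times> cball 0 A) (\<lambda>p. csqrt (q (fst p) (snd p)))"
      by (rule continuous_on_compose2[OF continuous_on_csqrt, where f = "\<lambda>p. q (fst p) (snd p)"])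
         (use qnz in \<open>auto simp: q_def intro!: continuous_intros\<close>)
    then show "continuous_on (cball 0 \<rho> \<times> cball 0 A) (\<lambda>(s, z). E s z)"
      unfolding E_def case_prod_unfold using nz by (intro continuous_intros) (auto simp del: csqrt.simps)
    show "z \<in> cball 0 A" if "f z \<noteq> 0" for z using densD(4)[OF f that] by simp
  qed (auto intro: dens_integrable[OF f])
  have pot: "pot \<kappa> f (r *\<^sub>R \<theta>) = - exp (\<i> * of_real (\<kappa> * r)) / of_real (4 * pi * r) * H (of_real (1 / r))" if r: "1 / r < \<rho>" "r > 0" for r
  proof -
    have "Gplus (r *\<^sub>R \<theta> - z) \<kappa> * f z = - exp (\<i> * of_real (\<kappa> * r)) / of_real (4 * pi * r) * (E (of_real (1 / r)) z * f z)" for z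
    proof (cases "f z = 0")
      case False
      then have z: "z \<in> cball 0 A" using densD(4)[OF f] by simp
      have sb: "complex_of_real (1 / r) \<in> cball 0 \<rho>" using r by (simp del: of_real_divide)
      define p where "p = 1 - 2 * (1 / r) * (\<theta> \<bullet> z) + (1 / r)\<^sup>2 * (z \<bullet> z)"
      have qp: "q (of_real (1 / r)) z = of_real p" by (simp add: q_def p_def)
      define S where "S = sqrt p"
      have p0: "p > 0" using qre[OF sb z] unfolding qp by simp
      then have S: "S > 0" "S * S = p" by (auto simp: S_def)
      have cs: "csqrt (q (of_real (1 / r)) z) = of_real S" unfolding qp S_def using p0 by simp
      have "\<theta> \<bullet> \<theta> = 1" using \<theta> by (simp add: norm_eq_1)
      then have "(norm (r *\<^sub>R \<theta> - z))\<^sup>2 = r\<^sup>2 - 2 * r * (\<theta> \<bullet> z) + z \<bullet> z"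
        unfolding power2_norm_eq_inner by (simp add: inner_diff_left inner_diff_right inner_commute power2_eq_square)
      also have "\<dots> = r\<^sup>2 * p" using r by (simp add: p_def field_simps power2_eq_square)
      also have "\<dots> = (r * S)\<^sup>2" using S by (simp add: power2_eq_square mult_ac)
      finally have nr: "norm (r *\<^sub>R \<theta> - z) = r * S" using r S by (simp add: power2_eq_iff_nonneg)
      define h where "h = ((1 / r) * (z \<bullet> z) - 2 * (\<theta> \<bullet> z)) / (S + 1)"
      have "r * (S * S - 1) = (1 / r) * (z \<bullet> z) - 2 * (\<theta> \<bullet> z)"
        unfolding S(2) p_def using r by (simp add: field_simps power2_eq_square)
      then have "h = r * (S * S - 1) / (S + 1)" by (simp only: h_def)
      also have "r * (S * S - 1) = r * (S - 1) * (S + 1)" by (simp add: algebra_simps)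
      also have "\<dots> / (S + 1) = r * (S - 1)" using S(1) by simp
      finally have "r * S = r + h" by (simp add: algebra_simps)
      then have "\<i> * of_real \<kappa> * of_real (r * S) = \<i> * of_real (\<kappa> * r) + \<i> * of_real \<kappa> * of_real h" by (simp add: algebra_simps)
      then have "exp (\<i> * of_real \<kappa> * of_real (r * S)) = exp (\<i> * of_real (\<kappa> * r)) * exp (\<i> * of_real \<kappa> * of_real h)"
        by (simp add: exp_add)
      moreover have "E (of_real (1 / r)) z = exp (\<i> * of_real \<kappa> * of_real h) / of_real S" unfolding E_def cs h_def by simp
      ultimately show ?thesis unfolding Gplus_def nr by (simp add: mult.assoc)
    qed simp
    then show ?thesis unfolding pot_def H_def by (simp only: integral_mult_right_zero)
  qed
  have img: "cnj ` ball 0 \<rho> = ball 0 \<rho>" by (auto simp: image_iff intro!: bexI[of _ "cnj _"])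
  define Hs where "Hs = cnj \<circ> H \<circ> cnj"
  have Hsh: "Hs holomorphic_on ball 0 \<rho>" unfolding Hs_def by (rule holomorphic_on_compose_cnj_cnj) (use Hh img in auto)
  have real: "exp (\<i> * of_real (2 * \<kappa> * r)) * H (of_real (1 / r)) = Hs (of_real (1 / r))" if r: "1 / r < \<rho>" "r > 0" for r
  proof -
    define e where "e = exp (\<i> * of_real (\<kappa> * r))"
    let ?H = "H (of_real (1 / r))"
    have e: "e * cnj e = 1" unfolding e_def complex_norm_square[symmetric] norm_exp_i_times by simp
    have "R < r" using r R0 by (simp add: \<rho>_def field_simps)
    then have "Im (e * ?H * of_real (- 1 / (4 * pi * r))) = 0"
      using r0[of r] unfolding pot[OF r] e_def by (simp add: mult_ac)
    moreover have "Im (w * of_real c) = Im w * c" for w c by simp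
    ultimately have "Im (e * ?H) = 0" using r by (metis divide_eq_0_iff mult_eq_0_iff neg_equal_0_iff_equal one_neq_zero pi_neq_zero less_irrefl zero_neq_numeral)
    then have "e * ?H = cnj (e * ?H)" by (simp add: complex_eq_iff)
    then have "e * (e * ?H) = (e * cnj e) * cnj ?H" by (simp only: complex_cnj_mult mult.assoc)
    moreover have "e * e = exp (\<i> * of_real (2 * \<kappa> * r))" unfolding e_def exp_add[symmetric] by (simp add: mult_ac)
    ultimately show ?thesis by (simp add: e Hs_def mult.assoc[symmetric])
  qed
  \<comment> \<open>Radii with 2 \<kappa> r = 2 pi (k + 1 + a): the choices a = 0 and a = 1/2 make
    the phase 1 and -1. Counting from k + 1 keeps them positive.\<close>
  define rr where "rr a k = pi * (real (Suc k) + a) / \<kappa>" for a k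
  have rr: "rr a k > 0" if "a \<ge> 0" for a k using that \<kappa> by (simp add: rr_def add_pos_nonneg)
  have rs: "(\<lambda>k. 1 / rr a k) \<longlonglongrightarrow> 0" for a
  proof -
    have "filterlim (\<lambda>k. a + real (Suc k)) at_top sequentially"
      by (rule filterlim_tendsto_add_at_top[OF tendsto_const filterlim_compose[OF filterlim_real_sequentially filterlim_Suc]])
    from filterlim_tendsto_pos_mult_at_top[OF tendsto_const _ this, of "pi / \<kappa>"] \<kappa>
    have "filterlim (rr a) at_top sequentially" by (simp add: rr_def[abs_def] add.commute)
    then show ?thesis by (auto dest: tendsto_inverse_0_at_top simp: inverse_eq_divide)
  qed
  have e2: "exp (\<i> * of_real (2 * \<kappa> * rr a k)) = cis (2 * pi * a)" for a k
  proof -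
    have "2 * \<kappa> * rr a k = 2 * pi * real (Suc k) + 2 * pi * a" using \<kappa> by (simp add: rr_def field_simps)
    then have "exp (\<i> * of_real (2 * \<kappa> * rr a k)) = cis (2 * pi * real (Suc k)) * cis (2 * pi * a)" by (simp only: cis_mult) (simp only: cis_conv_exp)
    also have "cis (2 * pi * real (Suc k)) = 1" by (rule cis_multiple_2pi) auto
    finally show ?thesis by simp
  qed
  have H0: "H w = 0" if w: "w \<in> ball 0 \<rho>" for w
  proof -
    have "c * H w - Hs w = 0" if a: "a \<ge> 0" "cis (2 * pi * a) = c" for a c
    proof (rule holomorphic_zero_if_zeros_accumulate[OF _ \<rho>(1) _ rs[of a] _ w])
      show "(\<lambda>w. c * H w - Hs w) holomorphic_on ball 0 \<rho>" by (intro holomorphic_intros Hh Hsh)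
      show "c * H (of_real (1 / rr a k)) - Hs (of_real (1 / rr a k)) = 0" if "1 / rr a k < \<rho>" for k
        using real[OF that rr[OF a(1)]] unfolding e2 a(2) by simp
    qed (use rr[OF a(1)] in simp)
    from this[of 0 1] this[of "1/2" "- 1"] have "H w - Hs w = 0" "- H w - Hs w = 0" by simp_all
    then have "(H w - Hs w) - (- H w - Hs w) = 0" by (simp only: diff_self)
    then show ?thesis by simp
  qed
  have r': "1 / r < \<rho>" "r > 0" using r R0 by (auto simp: \<rho>_def intro: divide_strict_left_mono)
  then have "complex_of_real (1 / r) \<in> ball 0 \<rho>" by (simp del: of_real_divide)
  then show ?thesis unfolding pot[OF r'] by (simp add: H0 del: of_real_divide)
qed

text \<open>Every point far out lies on a ray covered by \<open>pot_ray_zero\<close>, and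
  analyticity extends the zero from there to the connected set \<open>U\<close>. The radius
  \<open>A'\<close> is enlarged to be positive.\<close>

lemma pot_zero_if_Im_zero:
  assumes f: "dens B A f" and \<kappa>: "\<kappa> > 0" and K: "closed K" "\<And>z. z \<notin> K \<Longrightarrow> f z = 0" "U \<inter> K = {}"
    and U: "open U" "connected U" "\<And>x. norm x > R \<Longrightarrow> x \<in> U" and z: "\<And>x. x \<in> U \<Longrightarrow> Im (pot \<kappa> f x) = 0"
    and x: "x \<in> U"
  shows "pot \<kappa> f x = 0"
proof -
  define A' where "A' = \<bar>A\<bar> + 1"
  have A': "A' > 0" "dens B A' f" using f by (auto simp: A'_def dens_def)
  define Q where "Q = max \<bar>R\<bar> (8 * (A' + 1))"
  define V where "V = {x::real^3. norm x > Q}"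
  have zV: "pot \<kappa> f v = 0" if v: "v \<in> V" for v
  proof -
    have Q: "norm v > \<bar>R\<bar>" "norm v > Q" using v by (auto simp: V_def Q_def)
    have v0: "norm v > 0" using Q(1) by linarith
    have "pot \<kappa> f (norm v *\<^sub>R sgn v) = 0"
    proof (rule pot_ray_zero[OF A'(2,1) \<kappa>])
      show "norm (sgn v) = 1" using v0 by (simp add: norm_sgn)
      show "Im (pot \<kappa> f (r *\<^sub>R sgn v)) = 0" if "r > Q" for r
        using that[unfolded Q_def] v0 abs_ge_self[of R] abs_ge_self[of r] by (intro z U(3)) (auto simp: norm_sgn)
    qed (use Q in \<open>auto simp: Q_def\<close>)
    then show ?thesis using v0 by (simp add: sgn_div_norm)
  qed
  have oV: "open V" unfolding V_def by (intro open_Collect_less continuous_intros)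
  obtain v :: "real^3" where "norm v = \<bar>Q\<bar> + 1" using vector_choose_size[of "\<bar>Q\<bar> + 1"] by auto
  then have "v \<in> V" by (simp add: V_def)
  then have "V \<noteq> {}" by auto
  moreover have "V \<subseteq> U" using U(3) by (auto simp: V_def Q_def)
  ultimately show ?thesis
    using curve_analytic_unique_continuation[OF pot_curve_analytic[OF f K] U(1,2) oV _ _ zV x] by blast
qed

section \<open>Solvability of the Lippmann--Schwinger equation\<close>

text \<open>Riesz's lemma: normalise z - w for a \<open>w\<close> in \<open>V\<close> whose distance
  from \<open>z\<close> is less than twice the infimum, which gives the constant 1/2.\<close>

lemma riesz_far_unit_vector:
  fixes V :: "'a::real_normed_vector set"
  assumes V: "subspace V" "closed V" and W: "subspace W" "V \<subseteq> W" and z: "z \<in> W" "z \<notin> V"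
  obtains x where "x \<in> W" "norm x = 1" "\<And>v. v \<in> V \<Longrightarrow> norm (x - v) \<ge> 1 / 2"
proof -
  have V0: "0 \<in> V" using V(1) by (rule subspace_0)
  define d where "d = infdist z V"
  have d: "d > 0" unfolding d_def using infdist_pos_not_in_closed[OF V(2) _ z(2)] V0 by blast
  have "\<exists>w\<in>V. dist z w < 2 * d"
  proof (rule ccontr)
    assume "\<not> ?thesis"
    then have "2 * d \<le> infdist z V" unfolding infdist_notempty[OF ex_in_conv[THEN iffD1, OF exI, OF V0]]
      by (intro cINF_greatest) (use V0 in \<open>auto simp: not_less\<close>)
    then show False using d by (simp add: d_def)
  qed
  then obtain w where w: "w \<in> V" "norm (z - w) < 2 * d" by (auto simp: dist_norm)
  define N where "N = norm (z - w)"
  have N: "N > 0" using w z by (auto simp: N_def)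
  show ?thesis
  proof
    show "(z - w) /\<^sub>R N \<in> W" using W w z by (auto intro!: subspace_scale subspace_diff)
    show "norm ((z - w) /\<^sub>R N) = 1" using N by (simp add: N_def)
    fix v assume v: "v \<in> V"
    have "w + N *\<^sub>R v \<in> V" using V(1) w(1) v by (intro subspace_add subspace_scale)
    then have "d \<le> norm (z - (w + N *\<^sub>R v))" unfolding d_def dist_norm[symmetric] by (rule infdist_le)
    also have "z - (w + N *\<^sub>R v) = N *\<^sub>R ((z - w) /\<^sub>R N - v)" using N by (simp add: algebra_simps)
    also have "norm \<dots> = N * norm ((z - w) /\<^sub>R N - v)" using N by simp
    also have "\<dots> \<le> (2 * d) * norm ((z - w) /\<^sub>R N - v)" using w(2) by (intro mult_right_mono) (auto simp: N_def)
    finally show "norm ((z - w) /\<^sub>R N - v) \<ge> 1 / 2" using d by simp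
  qed
qed

text \<open>Riesz theory for a compact operator: if I - T were injective but not onto, the ranges of
  its powers would be a strictly decreasing chain of closed subspaces, and unit vectors far from the
  next range would have images under \<open>T\<close> without convergent subsequence.\<close>

lemma riesz_fredholm:
  fixes T :: "'a::{real_normed_vector,complete_space} => 'a"
  assumes T: "bounded_linear T"
    and comp: "\<And>s :: nat => 'a. bounded (range s) \<Longrightarrow> \<exists>l r. strict_mono r \<and> (\<lambda>n. T (s (r n))) \<longlonglongrightarrow> l"
    and inj: "\<And>x. T x = x \<Longrightarrow> x = 0"
  shows "\<exists>x. x - T x = y"
proof -
  interpret T: bounded_linear T by (rule T)
  define S where "S x = x - T x" for x
  have SL: "bounded_linear S" unfolding S_def[abs_def] by (intro bounded_linear_sub bounded_linear_ident T)
  interpret S: bounded_linear S by (rule SL)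
  \<comment> \<open>Boundedness from below makes the ranges complete and so closed. A unit sequence
    violating it would, by compactness, accumulate at a fixed point of \<open>T\<close> of norm
    1.\<close>
  have "\<exists>c>0. \<forall>x. norm (S x) \<ge> c * norm x"
  proof (rule ccontr)
    assume "\<not> ?thesis"
    then have "\<forall>c>0. \<exists>x. norm (S x) < c * norm x" by (auto simp: not_le)
    then have "\<exists>x. norm (S x) < inverse (real (Suc n)) * norm x" for n by simp
    then obtain X where X: "norm (S (X n)) < inverse (real (Suc n)) * norm (X n)" for n by metis
    define Z where "Z n = X n /\<^sub>R norm (X n)" for n
    have X0: "norm (X n) > 0" for n using X[of n] norm_ge_zero[of "S (X n)"] by (cases "X n = 0") auto
    have Z1: "norm (Z n) = 1" for n using X0[of n] by (simp add: Z_def)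
    have SZ: "norm (S (Z n)) \<le> inverse (real (Suc n))" for n
    proof -
      have "norm (S (Z n)) = norm (S (X n)) / norm (X n)" by (simp add: Z_def S.scaleR divide_inverse mult.commute)
      also have "\<dots> \<le> inverse (real (Suc n))" using X[of n] X0[of n] by (simp add: pos_divide_le_eq)
      finally show ?thesis .
    qed
    have "bounded (range Z)" by (rule boundedI[of _ 1]) (auto simp: Z1)
    from comp[OF this] obtain l r where r: "strict_mono r" and l: "(\<lambda>n. T (Z (r n))) \<longlonglongrightarrow> l" by blast
    have "(\<lambda>n. S (Z n)) \<longlonglongrightarrow> 0"
      by (rule Lim_null_comparison[OF _ LIMSEQ_inverse_real_of_nat]) (use SZ in auto)
    from LIMSEQ_subseq_LIMSEQ[OF this r] have "(\<lambda>n. S (Z (r n))) \<longlonglongrightarrow> 0" by (simp add: o_def)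
    from tendsto_add[OF this l] have Zl: "(\<lambda>n. Z (r n)) \<longlonglongrightarrow> l" by (simp add: S_def)
    from LIMSEQ_unique[OF T.tendsto[OF this] l] have "T l = l" .
    then have "l = 0" by (rule inj)
    moreover have "(\<lambda>n. norm (Z (r n))) \<longlonglongrightarrow> norm l" using Zl by (rule tendsto_norm)
    then have "norm l = 1" unfolding Z1 using LIMSEQ_unique[OF _ tendsto_const] by metis
    ultimately show False by simp
  qed
  then obtain c where c: "c > 0" "\<And>x. norm (S x) \<ge> c * norm x" by blast
  define V where "V n = (S ^^ n) ` UNIV" for n
  have VS: "V (Suc n) = S ` V n" for n by (simp add: V_def image_comp)
  have Vsub: "subspace (V n)" for n
  proof (induction n)
    case (Suc n) then show ?case unfolding VS by (rule linear_subspace_image[OF S.linear_axioms])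
  qed (simp add: V_def)
  have Vcom: "complete (V n)" for n
  proof (induction n)
    case 0 then show ?case using complete_UNIV by (simp add: V_def)
  next
    case (Suc n) show ?case unfolding VS
      by (rule complete_isometric_image[OF c(1) Vsub SL _ Suc]) (use c in auto)
  qed
  have Vdec: "V (Suc n) \<subseteq> V n" for n
  proof
    fix x assume "x \<in> V (Suc n)" then show "x \<in> V n" by (auto simp: V_def funpow_swap1)
  qed
  have Vmono: "V n \<subseteq> V m" if "m \<le> n" for m n using that by (rule lift_Suc_antimono_le[where f = V, OF Vdec])
  have injS: "inj (S ^^ n)" for n
  proof -
    have "inj S" using S.linear_axioms inj by (auto simp: linear_injective_0 S_def)
    then show ?thesis by (rule inj_fn)
  qed
  show ?thesis
  proof (rule ccontr)
    assume "\<not> ?thesis"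
    then have y: "y \<notin> range S" by (auto simp: S_def)
    have "(S ^^ n) y \<in> V n" "(S ^^ n) y \<notin> V (Suc n)" for n
    proof -
      show "(S ^^ n) y \<in> V n" by (auto simp: V_def)
      show "(S ^^ n) y \<notin> V (Suc n)"
      proof
        assume "(S ^^ n) y \<in> V (Suc n)"
        then obtain x where "(S ^^ n) y = (S ^^ n) (S x)" by (auto simp: V_def funpow_swap1)
        then show False using injS[of n] y by (auto dest: injD)
      qed
    qed
    then have "\<exists>x. x \<in> V n \<and> norm x = 1 \<and> (\<forall>v\<in>V (Suc n). norm (x - v) \<ge> 1 / 2)" for n
      using riesz_far_unit_vector[OF Vsub complete_imp_closed[OF Vcom] Vsub Vdec, of "(S ^^ n) y" n] by metis
    then obtain X where X: "X n \<in> V n" "norm (X n) = 1" "\<And>v. v \<in> V (Suc n) \<Longrightarrow> norm (X n - v) \<ge> 1 / 2" for n by metis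
    \<comment> \<open>The difference of the images is X n minus an element of the next range
      \<open>V (Suc n)\<close>.\<close>
    have sep: "norm (T (X n) - T (X m)) \<ge> 1 / 2" if "n < m" for n m
    proof -
      have "X m \<in> V (Suc n)" using X(1)[of m] Vmono[of "Suc n" m] that by auto
      moreover have "S (X m) \<in> V (Suc n)" using X(1)[of m] Vmono[of "Suc n" "Suc m"] that unfolding VS by auto
      moreover have "S (X n) \<in> V (Suc n)" using X(1)[of n] unfolding VS by auto
      ultimately have "S (X n) + X m - S (X m) \<in> V (Suc n)" using Vsub by (intro subspace_diff subspace_add)
      from X(3)[OF this] show ?thesis by (simp add: S_def algebra_simps)
    qed
    have "bounded (range X)" by (rule boundedI[of _ 1]) (auto simp: X)
    from comp[OF this] obtain l r where r: "strict_mono r" and l: "(\<lambda>n. T (X (r n))) \<longlonglongrightarrow> l" by blast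
    from LIMSEQ_imp_Cauchy[OF l] obtain N where "\<And>m n. m \<ge> N \<Longrightarrow> n \<ge> N \<Longrightarrow> norm (T (X (r m)) - T (X (r n))) < 1 / 2"
      unfolding Cauchy_iff by (metis half_gt_zero zero_less_one)
    from this[of N "Suc N"] sep[of "r N" "r (Suc N)"] r show False by (auto simp: strict_mono_Suc_iff)
  qed
qed

lemma pot_add_scaleR:
  assumes "dens B A f" "dens C A' g"
  shows "pot \<kappa> (\<lambda>z. f z + g z) x = pot \<kappa> f x + pot \<kappa> g x" "pot \<kappa> (\<lambda>z. c *\<^sub>R f z) x = c *\<^sub>R pot \<kappa> f x"
    "pot \<kappa> (\<lambda>z. f z - g z) x = pot \<kappa> f x - pot \<kappa> g x"
proof -
  note i = pot_dens(1)[OF assms(1), of x \<kappa>] pot_dens(1)[OF assms(2), of x \<kappa>]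
  show "pot \<kappa> (\<lambda>z. f z + g z) x = pot \<kappa> f x + pot \<kappa> g x"
    unfolding pot_def distrib_left by (rule bint_add[OF i])
  show "pot \<kappa> (\<lambda>z. f z - g z) x = pot \<kappa> f x - pot \<kappa> g x"
    unfolding pot_def right_diff_distrib by (rule bint_diff[OF i])
  show "pot \<kappa> (\<lambda>z. c *\<^sub>R f z) x = c *\<^sub>R pot \<kappa> f x" unfolding pot_def mult_scaleR_right by simp
qed

lemma dens_mult_bcontfun:
  assumes v: "dens M A v" shows "dens (M * norm f) A (\<lambda>z. v z * apply_bcontfun f z)"
proof -
  have "apply_bcontfun f \<in> borel_measurable borel" by (intro borel_measurable_continuous_onI) simp
  then show ?thesis using densD[OF v]
    by (auto simp: dens_def norm_mult intro!: mult_mono norm_bounded)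
qed

text \<open>The unknown is the bounded continuous function f = \<theta>
  \<open>pot \<kappa> g\<close> with g = v f - h. The cut-off \<theta> is 1 wherever
  \<open>v\<close> is non-zero, so the equation is unchanged, and it confines the family to a ball,
  where Arzela-Ascoli gives compactness. The Fredholm alternative turns \<open>inj\<close> into
  existence.\<close>

lemma lippmann_schwinger_solvable:
  assumes v: "dens M A v" and A: "A > 0"
    and inj: "\<forall>B g. dens B A g \<longrightarrow> (\<forall>x. g x = v x * pot \<kappa> g x) \<longrightarrow> (\<forall>z. pot \<kappa> g z = 0)"
    and h: "dens H A h"
  obtains B g where "dens B A g" "\<And>x. g x = v x * pot \<kappa> g x - h x"
proof -
  define \<theta> where "\<theta> = cutoff A"
  have \<theta>1: "\<theta> x = 1" if "norm x \<le> A" for x using that A by (simp add: \<theta>_def cutoff_1)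
  have \<theta>0: "\<theta> x = 0" if "norm x > 2 * A" for x using that A by (simp add: \<theta>_def cutoff_0)
  have \<theta>n: "norm (\<theta> x) \<le> 1" for x using norm_cutoff by (simp add: \<theta>_def)
  have \<theta>c: "continuous_on UNIV \<theta>" using Ck_on_cutoff[of 0 A] by (simp add: \<theta>_def)
  have cp: "(\<lambda>x. \<theta> x * pot \<kappa> g x) \<in> bcontfun" "norm (\<theta> x * pot \<kappa> g x) \<le> B * invnorm (3 * A)" if g: "dens B A g" for B g x
  proof -
    show b: "norm (\<theta> x * pot \<kappa> g x) \<le> B * invnorm (3 * A)" for x
    proof (cases "norm x > 2 * A")
      case False
      have "norm (\<theta> x * pot \<kappa> g x) \<le> 1 * norm (pot \<kappa> g x)" unfolding norm_mult by (intro mult_right_mono \<theta>n) auto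
      \<comment> \<open>The radius in \<open>dens\<close> may be enlarged to 3 A - |x|, here at
        least A, which makes the bound independent of \<open>x\<close>.\<close>
      also have "\<dots> \<le> B * invnorm (3 * A)" using pot_dens(2)[of B "3 * A - norm x" g \<kappa> x] g False by (auto simp: dens_def)
      finally show ?thesis .
    qed (use \<theta>0 densD(5)[OF g] invnorm_nonneg in auto)
    show "(\<lambda>x. \<theta> x * pot \<kappa> g x) \<in> bcontfun" by (rule bcontfun_normI[OF _ b]) (intro continuous_intros \<theta>c pot_dens(3)[OF g])
  qed
  define P where "P g = Bcontfun (\<lambda>x. \<theta> x * pot \<kappa> g x)" for g
  have P: "apply_bcontfun (P g) x = \<theta> x * pot \<kappa> g x" if "dens B A g" for B g x
    unfolding P_def using cp(1)[OF that] by (simp add: Bcontfun_inverse)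
  define T where "T f = P (\<lambda>z. v z * apply_bcontfun f z)" for f :: "(real^3) \<Rightarrow>\<^sub>C complex"
  note vf = dens_mult_bcontfun[OF v]
  have T: "apply_bcontfun (T f) x = \<theta> x * pot \<kappa> (\<lambda>z. v z * apply_bcontfun f z) x" for f x
    unfolding T_def by (rule P[OF vf])
  have M0: "M \<ge> 0" by (rule densD(5)[OF v])
  have TL: "bounded_linear T"
  proof (rule bounded_linear_intro[where K = "M * invnorm (3 * A)"])
    show "T (f + g) = T f + T g" for f g
      by (rule bcontfun_eqI) (simp add: T pot_add_scaleR(1)[OF vf vf] algebra_simps)
    show "T (c *\<^sub>R f) = c *\<^sub>R T f" for c f
      by (rule bcontfun_eqI) (simp add: T pot_add_scaleR(2)[OF vf vf])
    show "norm (T f) \<le> norm f * (M * invnorm (3 * A))" for f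
      by (rule norm_bound) (use cp(2)[OF vf] in \<open>simp add: T mult_ac\<close>)
  qed
  have "\<exists>f. f - T f = - P h"
  proof (rule riesz_fredholm[OF TL])
    fix f assume f: "T f = f"
    define g where "g z = v z * apply_bcontfun f z" for z
    have g: "dens (M * norm f) A g" unfolding g_def[abs_def] by (rule vf)
    have fe: "apply_bcontfun f x = \<theta> x * pot \<kappa> g x" for x using T[of f x] unfolding f g_def[abs_def] .
    have "g x = v x * pot \<kappa> g x" for x
    proof (cases "v x = 0")
      case False then show ?thesis using \<theta>1[of x] densD(4)[OF v] by (simp add: g_def fe[of x] del: mult_cancel_left)
    qed (simp add: g_def)
    from inj[rule_format, OF g this] have "apply_bcontfun f x = 0" for x by (simp add: fe)
    then show "f = 0" by (intro bcontfun_eqI) simp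
  next
    fix s :: "nat => (real^3) \<Rightarrow>\<^sub>C complex" assume "bounded (range s)"
    then obtain N where N: "norm (s n) \<le> N" for n by (auto simp: bounded_iff)
    have N0: "N \<ge> 0" using N[of 0] norm_ge_zero order_trans by blast
    define g where "g n z = v z * apply_bcontfun (s n) z" for n z
    have g: "dens (M * N) A (g n)" for n
    proof -
      have "M * norm (s n) \<le> M * N" using M0 N by (intro mult_left_mono)
      then show ?thesis using vf[of "s n"] by (auto simp: g_def[abs_def] dens_def intro: order_trans)
    qed
    define F where "F n = pot \<kappa> (g n)" for n
    obtain G k where k: "strict_mono (k :: nat => nat)" and G: "continuous_on (cball 0 (2 * A)) G"
      and GF: "\<And>e. 0 < e \<Longrightarrow> \<exists>N. \<forall>n x. n \<ge> N \<and> x \<in> cball (0::real^3) (2 * A) \<longrightarrow> norm (F (k n) x - G x) < e"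
    proof (rule Arzela_Ascoli[of "cball (0::real^3) (2 * A)" F "M * N * invnorm (3 * A)"])
      show "norm (F n x) \<le> M * N * invnorm (3 * A)" if "x \<in> cball 0 (2 * A)" for n x
        unfolding F_def using pot_dens(2)[of "M * N" "3 * A - norm x" "g n" \<kappa> x] g[of n] that by (auto simp: dens_def)
      fix x :: "real^3" and e :: real assume x: "x \<in> cball 0 (2 * A)" and e: "e > 0"
      obtain \<eta> where \<eta>: "\<eta> > 0" and ec: "\<And>f x y. \<lbrakk>dens (M * N) A f; norm x \<le> 2 * A; norm y \<le> 2 * A; norm (x - y) < \<eta>\<rbrakk> \<Longrightarrow> norm (pot \<kappa> f x - pot \<kappa> f y) < e"
        using pot_equicontinuous[of "M * N" e A "2 * A" \<kappa>] e M0 N0 by (metis mult_nonneg_nonneg)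
      show "\<exists>d. 0 < d \<and> (\<forall>n y. y \<in> cball 0 (2 * A) \<and> norm (x - y) < d \<longrightarrow> norm (F n x - F n y) < e)"
        unfolding F_def using \<eta> x g by (intro exI[of _ \<eta>] conjI allI impI ec) auto
    qed auto
    have Tk: "apply_bcontfun (T (s (k n))) x = \<theta> x * F (k n) x" for n x by (simp add: T F_def g_def[abs_def])
    have "uniform_limit UNIV (\<lambda>n. apply_bcontfun (T (s (k n)))) (\<lambda>x. \<theta> x * G x) sequentially"
    proof (rule uniform_limitI)
      fix e :: real assume e: "e > 0"
      obtain N where N: "\<And>n x. n \<ge> N \<Longrightarrow> x \<in> cball 0 (2 * A) \<Longrightarrow> norm (F (k n) x - G x) < e" using GF[OF e] by blast
      have "dist (apply_bcontfun (T (s (k n))) x) (\<theta> x * G x) < e" if n: "n \<ge> N" for n x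
      proof (cases "norm x > 2 * A")
        case False
        have "norm (\<theta> x * (F (k n) x - G x)) \<le> 1 * norm (F (k n) x - G x)" unfolding norm_mult by (intro mult_right_mono \<theta>n) auto
        also have "\<dots> < e" using N[OF n, of x] False by simp
        finally show ?thesis by (simp add: Tk dist_norm algebra_simps)
      qed (use e \<theta>0 in \<open>simp add: Tk\<close>)
      then show "\<forall>\<^sub>F n in sequentially. \<forall>x\<in>UNIV. dist (apply_bcontfun (T (s (k n))) x) (\<theta> x * G x) < e"
        unfolding eventually_sequentially by blast
    qed
    from uniform_limit_bcontfunE[OF this] obtain l where "(\<lambda>n. T (s (k n))) \<longlonglongrightarrow> l" by auto
    with k show "\<exists>l r. strict_mono r \<and> (\<lambda>n. T (s (r n))) \<longlonglongrightarrow> l" by blast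
  qed
  then obtain f where f: "f - T f = - P h" by blast
  define g where "g z = v z * apply_bcontfun f z - h z" for z
  have g: "dens (M * norm f + H) A g"
  proof -
    have "norm (v z * apply_bcontfun f z - h z) \<le> M * norm f + H" for z
      using norm_triangle_ineq4 add_mono[OF densD(2)[OF vf] densD(2)[OF h]] by (rule order_trans)
    then show ?thesis using densD(1,3)[OF vf] densD(1,3)[OF h] unfolding g_def[abs_def] dens_def by auto
  qed
  have fe: "apply_bcontfun f x = \<theta> x * pot \<kappa> g x" for x
  proof -
    have "apply_bcontfun (f - T f) x = apply_bcontfun (- P h) x" unfolding f ..
    then have "apply_bcontfun f x = \<theta> x * (pot \<kappa> (\<lambda>z. v z * apply_bcontfun f z) x - pot \<kappa> h x)"
      by (simp add: T P[OF h] right_diff_distrib diff_eq_eq)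
    then show ?thesis unfolding pot_add_scaleR(3)[OF vf h, symmetric] g_def[abs_def] .
  qed
  have "g x = v x * pot \<kappa> g x - h x" for x
  proof (cases "v x = 0")
    case False then show ?thesis using \<theta>1[of x] densD(4)[OF v] by (simp add: g_def fe[of x] del: mult_cancel_left)
  qed (simp add: g_def)
  with g show ?thesis by (rule that)
qed

text \<open>A homogeneous solution \<open>pot \<kappa> g\<close> can be added to the solution \<psi>
  with source at 0, so uniqueness makes it vanish almost everywhere on \<Omega>. Then g = v'
  \<open>pot \<kappa> g\<close> vanishes almost everywhere, and its potential everywhere.\<close>

lemma unique_solvability_injective:
  assumes us: "unique_solvability \<Omega> v \<kappa>" and \<Omega>: "open \<Omega>" "bounded \<Omega>" "ess_support v \<subseteq> \<Omega>" and v: "v \<in> borel_measurable lebesgue"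
    and v': "dens M A v'" "\<And>x. x \<notin> ess_support v \<Longrightarrow> v' x = 0" "AE x in lebesgue. v x = v' x"
    and g: "dens B A g" "\<And>x. g x = v' x * pot \<kappa> g x"
  shows "pot \<kappa> g z = 0"
proof -
  define N where "N = lebesgue_on \<Omega>"
  have \<Omega>m: "\<Omega> \<inter> space lebesgue \<in> sets lebesgue" using \<Omega>(1) by auto
  have fin: "integrable N (\<lambda>x. c::real)" for c
  proof -
    have "integrable lborel (\<lambda>x. indicator \<Omega> x *\<^sub>R c)"
      using \<Omega> emeasure_bounded_finite[OF \<Omega>(2)] by (intro integrable_scaleR_left integrable_real_indicator) auto
    then show ?thesis unfolding N_def integrable_restrict_space[OF \<Omega>m] using \<Omega>(1) by (subst integrable_completion) auto
  qed
  have bN: "f \<in> borel_measurable N" if "f \<in> borel_measurable borel" for f :: "real^3 => 'b::topological_space"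
    unfolding N_def using that by (intro measurable_restrict_space1 measurable_completion) auto
  have aN: "AE x in N. P x" if "AE x in lebesgue. P x" for P
    unfolding N_def AE_restrict_space_iff[OF \<Omega>m] using that by eventually_elim simp
  obtain \<psi> where \<psi>: "L2_on \<Omega> \<psi>" "green_integral_equation \<Omega> v \<kappa> 0 \<psi>" using us unfolding unique_solvability_def by blast
  have [measurable]: "\<psi> \<in> borel_measurable N" and \<psi>2: "integrable N (\<lambda>x. (norm (\<psi> x))\<^sup>2)" using \<psi>(1) by (auto simp: L2_on_def N_def)
  define \<Phi> where "\<Phi> = pot \<kappa> g"
  have \<Phi>c: "continuous_on UNIV \<Phi>" unfolding \<Phi>_def by (rule pot_dens(3)[OF g(1)])
  then have [measurable]: "\<Phi> \<in> borel_measurable borel" by (rule borel_measurable_continuous_onI)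
  have [measurable]: "\<Phi> \<in> borel_measurable N" by (rule bN) simp
  have [measurable]: "v \<in> borel_measurable N" "v' \<in> borel_measurable N" "g \<in> borel_measurable N" "(\<lambda>z. Gplus (x - z) \<kappa>) \<in> borel_measurable N" for x
    using v densD(1)[OF v'(1)] densD(1)[OF g(1)] by (auto simp: N_def intro: measurable_restrict_space1 bN[unfolded N_def])
  obtain a where a: "\<And>x. x \<in> \<Omega> \<Longrightarrow> norm x \<le> a" using \<Omega>(2) by (auto simp: bounded_iff)
  have "compact (\<Phi> ` cball 0 a)" using \<Phi>c by (intro compact_continuous_image) (auto intro: continuous_on_subset)
  then obtain b where "\<forall>x\<in>cball 0 a. norm (\<Phi> x) \<le> b" by (auto dest!: compact_imp_bounded simp: bounded_iff)
  then have b: "norm (\<Phi> x) \<le> b" if "x \<in> \<Omega>" for x using a[OF that] by simp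
  have sN: "space N = \<Omega>" by (simp add: N_def space_restrict_space)
  have L: "L2_on \<Omega> (\<lambda>x. \<psi> x + \<Phi> x)"
    unfolding L2_on_def N_def[symmetric]
  proof
    show "integrable N (\<lambda>x. (norm (\<psi> x + \<Phi> x))\<^sup>2)"
    proof (rule bintegrable_bound)
      show "integrable N (\<lambda>x. 2 * (norm (\<psi> x))\<^sup>2 + 2 * b\<^sup>2)" by (intro Bochner_Integration.integrable_add integrable_mult_right \<psi>2 fin)
      show "AE x in N. norm ((norm (\<psi> x + \<Phi> x))\<^sup>2) \<le> norm (2 * (norm (\<psi> x))\<^sup>2 + 2 * b\<^sup>2)"
      proof (rule AE_I2)
        fix x assume "x \<in> space N"
        then have "norm (\<Phi> x) \<le> b" using b sN by simp
        then have "norm (\<psi> x + \<Phi> x) \<le> norm (\<psi> x) + b" using norm_triangle_ineq[of "\<psi> x" "\<Phi> x"] by linarith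
        then have "(norm (\<psi> x + \<Phi> x))\<^sup>2 \<le> (norm (\<psi> x) + b)\<^sup>2" by (intro power_mono) auto
        also have "\<dots> \<le> 2 * (norm (\<psi> x))\<^sup>2 + 2 * b\<^sup>2" using zero_le_power2[of "norm (\<psi> x) - b"] by (simp add: power2_eq_square algebra_simps)
        finally show "norm ((norm (\<psi> x + \<Phi> x))\<^sup>2) \<le> norm (2 * (norm (\<psi> x))\<^sup>2 + 2 * b\<^sup>2)" by simp
      qed
    qed measurable
  qed measurable
  have vb: "AE z in N. norm (v z) \<le> M" using aN[OF v'(3)] by eventually_elim (simp add: densD(2)[OF v'(1)])
  \<comment> \<open>Splitting the integral of \<psi> + \<Phi> needs integrability of the part with
    \<psi>, which the integral equation alone does not give, a non-integrable function having
    integral 0 by convention. The product of 1/|x - z| and |\<psi>| is bounded by the sum of their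
    squares.\<close>
  have i1: "integrable N (\<lambda>z. Gplus (x - z) \<kappa> * v z * \<psi> z)" for x
  proof (rule bintegrable_bound)
    have "integrable lborel (\<lambda>z. indicator (cball 0 (norm x + a)) (x - z) / (norm (x - z))\<^sup>2 :: real)"
      using integrable_inverse_norm(2) by (subst lborel_integral_reflect) auto
    then have "integrable N (\<lambda>z. indicator (cball 0 (norm x + a)) (x - z) / (norm (x - z))\<^sup>2 :: real)"
      unfolding N_def by (intro integrable_restrict_space[THEN iffD2, OF \<Omega>m] integrable_mult_indicator)
        (use \<Omega>(1) in \<open>auto simp: integrable_completion\<close>)
    then show "integrable N (\<lambda>z. M * (indicator (cball 0 (norm x + a)) (x - z) / (norm (x - z))\<^sup>2 + (norm (\<psi> z))\<^sup>2))"
      by (intro Bochner_Integration.integrable_add integrable_mult_right \<psi>2)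
    show "AE z in N. norm (Gplus (x - z) \<kappa> * v z * \<psi> z) \<le> norm (M * (indicator (cball 0 (norm x + a)) (x - z) / (norm (x - z))\<^sup>2 + (norm (\<psi> z))\<^sup>2))"
      using vb AE_space
    proof eventually_elim
      fix z assume z: "norm (v z) \<le> M" "z \<in> space N"
      have M: "M \<ge> 0" using z(1) norm_ge_zero order_trans by blast
      have "norm (x - z) \<le> norm x + a" using a z sN norm_triangle_ineq4[of x z] by fastforce
      then have i: "indicator (cball 0 (norm x + a)) (x - z) = (1::real)" by simp
      define q where "q = 1 / norm (x - z)"
      have "norm (Gplus (x - z) \<kappa>) = 1 / (4 * pi) * q" by (simp add: norm_Gplus q_def)
      also have "\<dots> \<le> 1 * q" using pi_ge_two by (intro mult_right_mono) (auto simp: q_def)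
      finally have G: "norm (Gplus (x - z) \<kappa>) \<le> q" by simp
      have "norm (Gplus (x - z) \<kappa> * v z * \<psi> z) \<le> q * M * norm (\<psi> z)" unfolding norm_mult using G z M by (intro mult_right_mono mult_mono) (auto simp: q_def)
      also have "\<dots> = M * (q * norm (\<psi> z))" by simp
      also have "\<dots> \<le> M * (q\<^sup>2 + (norm (\<psi> z))\<^sup>2)"
      proof (rule mult_left_mono[OF _ M])
        have "2 * q * norm (\<psi> z) \<le> q\<^sup>2 + (norm (\<psi> z))\<^sup>2" using zero_le_power2[of "q - norm (\<psi> z)"] by (simp add: power2_diff)
        moreover have "q * norm (\<psi> z) \<ge> 0" by (simp add: q_def)
        ultimately show "q * norm (\<psi> z) \<le> q\<^sup>2 + (norm (\<psi> z))\<^sup>2" by linarith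
      qed
      also have "q\<^sup>2 = indicator (cball 0 (norm x + a)) (x - z) / (norm (x - z))\<^sup>2" by (simp add: i q_def power_divide)
      finally show "norm (Gplus (x - z) \<kappa> * v z * \<psi> z) \<le> norm (M * (indicator (cball 0 (norm x + a)) (x - z) / (norm (x - z))\<^sup>2 + (norm (\<psi> z))\<^sup>2))"
        unfolding real_norm_def by (rule order_trans[OF _ abs_ge_self])
    qed
  qed measurable
  have Gg: "integrable lebesgue (\<lambda>z. Gplus (x - z) \<kappa> * g z)" "(LINT z|lebesgue. Gplus (x - z) \<kappa> * g z) = \<Phi> x" for x
  proof -
    have m: "(\<lambda>z. Gplus (x - z) \<kappa> * g z) \<in> borel_measurable lborel" using densD(1)[OF g(1)] by measurable
    show "integrable lebesgue (\<lambda>z. Gplus (x - z) \<kappa> * g z)" using pot_dens(1)[OF g(1)] by (simp add: integrable_completion[OF m])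
    show "(LINT z|lebesgue. Gplus (x - z) \<kappa> * g z) = \<Phi> x" by (simp add: integral_completion[OF m] \<Phi>_def pot_def)
  qed
  have g0: "indicator \<Omega> z *\<^sub>R (Gplus (x - z) \<kappa> * g z) = Gplus (x - z) \<kappa> * g z" for x z
  proof (cases "z \<in> \<Omega>")
    case False then have "g z = 0" using v'(2) \<Omega>(3) g(2)[of z] by auto
    then show ?thesis by simp
  qed simp
  have GN: "integrable N (\<lambda>z. Gplus (x - z) \<kappa> * g z)" "(LINT z|N. Gplus (x - z) \<kappa> * g z) = \<Phi> x" for x
    unfolding N_def integrable_restrict_space[OF \<Omega>m] integral_restrict_space[OF \<Omega>m] g0 by (fact Gg)+
  have eqg: "AE z in N. Gplus (x - z) \<kappa> * v z * \<Phi> z = Gplus (x - z) \<kappa> * g z" for x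
    using aN[OF v'(3)] by eventually_elim (simp only: g(2) \<Phi>_def mult.assoc)
  have i2: "integrable N (\<lambda>z. Gplus (x - z) \<kappa> * v z * \<Phi> z)" for x
    using GN(1)[of x] by (subst integrable_cong_AE[OF _ _ eqg]) auto
  have I2: "(LINT z|N. Gplus (x - z) \<kappa> * v z * \<Phi> z) = \<Phi> x" for x
    by (rule trans[OF integral_cong_AE[OF _ _ eqg] GN(2)]) auto
  have "green_integral_equation \<Omega> v \<kappa> 0 (\<lambda>x. \<psi> x + \<Phi> x)"
    using \<psi>(2) unfolding green_integral_equation_def N_def[symmetric] distrib_left bint_add[OF i1 i2] I2
    by eventually_elim simp
  with us L \<psi> have "AE x in N. \<psi> x = \<psi> x + \<Phi> x" unfolding unique_solvability_def N_def by blast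
  then have "AE x in lebesgue. x \<in> \<Omega> \<longrightarrow> \<psi> x = \<psi> x + \<Phi> x" unfolding N_def by (simp add: AE_restrict_space_iff[OF \<Omega>m])
  then have "AE x in lebesgue. g x = 0"
  proof eventually_elim
    fix x assume "x \<in> \<Omega> \<longrightarrow> \<psi> x = \<psi> x + \<Phi> x"
    then show "g x = 0" using v'(2)[of x] \<Omega>(3) g(2)[of x] by (cases "x \<in> \<Omega>") (auto simp: \<Phi>_def)
  qed
  then have "AE x in lborel. g x = 0" using densD(1)[OF g(1)] by (subst (asm) AE_completion_iff) auto
  then have "AE x in lborel. Gplus (z - x) \<kappa> * g x = 0" by eventually_elim simp
  then show ?thesis unfolding pot_def by (rule integral_eq_zero_AE)
qed

section \<open>Complex geometrical optics\<close>

text \<open>Fourier series of unimodular functions, separated from the geometry of the cube. Bounded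
  Borel functions are used as such, not as L^2 classes. \<open>complete\<close> pairs with e n
  itself and not with its conjugate, as do the exponential moments to which it is applied.\<close>

locale ortho_system = finite_measure M for M :: "'a::topological_space measure" +
  fixes e :: "nat => 'a => complex"
  assumes borel_id: "(\<lambda>x. x) \<in> M \<rightarrow>\<^sub>M borel"
    and e_borel [measurable]: "e n \<in> borel_measurable borel"
    and e_norm [simp]: "norm (e n x) = 1"
    and e_orth: "n \<noteq> m \<Longrightarrow> (LINT x|M. e n x * cnj (e m x)) = 0"
    and mu_pos: "measure M (space M) > 0"
    and complete: "\<And>h B. h \<in> borel_measurable borel \<Longrightarrow> (\<And>x. norm (h x) \<le> B) \<Longrightarrow> (\<And>n. (LINT x|M. h x * e n x) = 0) \<Longrightarrow> AE x in M. h x = 0"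
begin

definition "\<mu> = measure M (space M)"

definition bm :: "('a => complex) => bool" where
  "bm g \<longleftrightarrow> g \<in> borel_measurable borel \<and> (\<exists>B. \<forall>x. norm (g x) \<le> B)"

definition coef :: "('a => complex) => nat => complex" where
  "coef g n = (LINT x|M. g x * cnj (e n x)) / of_real \<mu>"

definition energy :: "('a => complex) => real" where
  "energy g = (LINT x|M. (norm (g x))\<^sup>2)"

text \<open>A Fourier multiplier as a pointwise series: for square summable \<open>m\<close>,
  Bessel's inequality makes it absolutely convergent, so the result is again a bounded
  function.\<close>

definition mult_op :: "(nat => complex) => ('a => complex) => 'a => complex" where
  "mult_op m g x = (\<Sum>n. m n * coef g n * e n x)"

lemma mu: "\<mu> > 0" using mu_pos by (simp add: \<mu>_def)

lemma borelM: "f \<in> borel_measurable borel \<Longrightarrow> f \<in> borel_measurable M"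
  using measurable_compose[OF borel_id, of f borel] by blast

lemma bmD: assumes "bm g" shows "g \<in> borel_measurable borel" "g \<in> borel_measurable M"
  using assms borelM by (auto simp: bm_def)

lemma bm_e: "bm (e n)" by (auto simp: bm_def intro!: exI[of _ 1])

lemma bm_const: "bm (\<lambda>x. c)" by (auto simp: bm_def)

lemma borel_cnj: "g \<in> borel_measurable borel \<Longrightarrow> (\<lambda>x. cnj (g x)) \<in> borel_measurable borel"
  by (rule measurable_compose[OF _ borel_measurable_continuous_onI[where f = cnj]]) (auto intro: continuous_intros)

lemma bm_cnj: "bm g \<Longrightarrow> bm (\<lambda>x. cnj (g x))" by (auto simp: bm_def borel_cnj)

lemma bm_add: assumes "bm f" "bm g" shows "bm (\<lambda>x. f x + g x)"
proof -
  obtain B C where "\<And>x. norm (f x) \<le> B" "\<And>x. norm (g x) \<le> C" using assms by (auto simp: bm_def)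
  then have "norm (f x + g x) \<le> B + C" for x using norm_triangle_ineq add_mono order_trans by blast
  then show ?thesis using assms by (auto simp: bm_def)
qed

lemma bm_mult: assumes "bm f" "bm g" shows "bm (\<lambda>x. f x * g x)"
proof -
  obtain B C where *: "\<And>x. norm (f x) \<le> B" "\<And>x. norm (g x) \<le> C" using assms by (auto simp: bm_def)
  have "B \<ge> 0" using *(1) norm_ge_zero order_trans by blast
  then have "norm (f x * g x) \<le> B * C" for x unfolding norm_mult using * by (intro mult_mono) auto
  then show ?thesis using assms by (auto simp: bm_def)
qed

lemma bm_diff: "bm f \<Longrightarrow> bm g \<Longrightarrow> bm (\<lambda>x. f x - g x)"
  using bm_add[of f "\<lambda>x. (-1) * g x"] bm_mult[OF bm_const[of "-1"], of g] by simp

lemma bm_sum: "(\<And>i. i \<in> I \<Longrightarrow> bm (f i)) \<Longrightarrow> bm (\<lambda>x. \<Sum>i\<in>I. f i x)"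
  by (induction I rule: infinite_finite_induct) (auto intro: bm_add bm_const)

lemma bm_integrable: assumes "bm g" shows "integrable M g"
proof -
  obtain B where "\<forall>x. norm (g x) \<le> B" using assms by (auto simp: bm_def)
  then show ?thesis using bmD(2)[OF assms] by (intro integrable_const_bound[of _ B]) auto
qed

lemma bm_integrable_square: assumes "bm g" shows "integrable M (\<lambda>x. (norm (g x))\<^sup>2)"
proof -
  have "integrable M (\<lambda>x. norm (g x * cnj (g x)))" by (intro integrable_norm bm_integrable bm_mult bm_cnj assms)
  then show ?thesis by (simp add: norm_mult power2_eq_square)
qed

lemma energy_nonneg: "energy g \<ge> 0" unfolding energy_def by (rule Bochner_Integration.integral_nonneg) simp

lemma of_real_energy: "complex_of_real (energy g) = (LINT x|M. g x * cnj (g x))"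
  unfolding energy_def by (simp only: integral_complex_of_real[symmetric] complex_norm_square)

lemma e_self: "(LINT x|M. e n x * cnj (e n x)) = of_real \<mu>"
  unfolding of_real_energy[symmetric] by (simp add: energy_def \<mu>_def)

lemma coef_sum: "(LINT x|M. (\<Sum>n<N. a n * e n x) * cnj (e k x)) = (if k < N then a k * of_real \<mu> else 0)"
proof -
  have "(LINT x|M. (\<Sum>n<N. a n * e n x) * cnj (e k x)) = (LINT x|M. (\<Sum>n<N. a n * (e n x * cnj (e k x))))"
    by (simp add: sum_distrib_right mult.assoc)
  also have "\<dots> = (\<Sum>n<N. a n * (LINT x|M. e n x * cnj (e k x)))"
    by (subst Bochner_Integration.integral_sum) (auto intro!: bm_integrable bm_mult bm_e bm_cnj bm_const)
  also have "\<dots> = (\<Sum>n<N. if n = k then a k * of_real \<mu> else 0)"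
    using e_orth e_self by (intro sum.cong) auto
  finally show ?thesis by simp
qed

lemma energy_sum: "energy (\<lambda>x. \<Sum>n<N. a n * e n x) = \<mu> * (\<Sum>n<N. (norm (a n))\<^sup>2)"
proof -
  have "complex_of_real (energy (\<lambda>x. \<Sum>n<N. a n * e n x)) = (LINT x|M. (\<Sum>k<N. cnj (a k) * ((\<Sum>n<N. a n * e n x) * cnj (e k x))))"
    unfolding of_real_energy by (simp add: cnj_sum sum_distrib_left mult_ac)
  also have "\<dots> = (\<Sum>k<N. cnj (a k) * (LINT x|M. (\<Sum>n<N. a n * e n x) * cnj (e k x)))"
    by (subst Bochner_Integration.integral_sum) (auto intro!: bm_integrable bm_mult bm_sum bm_const bm_e bm_cnj)
  also have "\<dots> = (\<Sum>k<N. of_real \<mu> * (a k * cnj (a k)))" unfolding coef_sum by (intro sum.cong) auto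
  also have "\<dots> = of_real (\<mu> * (\<Sum>n<N. (norm (a n))\<^sup>2))" by (simp only: complex_norm_square[symmetric] sum_distrib_left of_real_sum of_real_mult)
  finally show ?thesis by (simp only: of_real_eq_iff)
qed

lemma bessel: assumes g: "bm g" shows "(\<Sum>n<N. (norm (coef g n))\<^sup>2) \<le> energy g / \<mu>"
proof -
  define S where "S x = (\<Sum>n<N. coef g n * e n x)" for x
  have S: "bm S" unfolding S_def[abs_def] by (intro bm_sum bm_mult bm_const bm_e)
  define s where "s = (\<Sum>n<N. (norm (coef g n))\<^sup>2)"
  have gS: "(LINT x|M. g x * cnj (S x)) = of_real (\<mu> * s)"
  proof -
    have "(LINT x|M. g x * cnj (S x)) = (LINT x|M. (\<Sum>n<N. cnj (coef g n) * (g x * cnj (e n x))))"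
      by (simp add: S_def cnj_sum sum_distrib_left mult_ac)
    also have "\<dots> = (\<Sum>n<N. cnj (coef g n) * (LINT x|M. g x * cnj (e n x)))"
      by (subst Bochner_Integration.integral_sum) (auto intro!: bm_integrable bm_mult bm_const bm_e bm_cnj g)
    also have "\<dots> = (\<Sum>n<N. of_real \<mu> * (coef g n * cnj (coef g n)))" using mu by (intro sum.cong) (auto simp: coef_def)
    finally show ?thesis by (simp only: complex_norm_square[symmetric] sum_distrib_left[symmetric] of_real_sum[symmetric] of_real_mult s_def)
  qed
  have Sg: "(LINT x|M. S x * cnj (g x)) = of_real (\<mu> * s)"
  proof -
    have "(LINT x|M. cnj (g x * cnj (S x))) = cnj (of_real (\<mu> * s))" by (subst Bochner_Integration.integral_cnj) (simp only: gS)
    then show ?thesis by (simp add: mult.commute)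
  qed
  have SS: "(LINT x|M. S x * cnj (S x)) = of_real (\<mu> * s)" unfolding of_real_energy[symmetric] S_def[abs_def] energy_sum s_def ..
  have "complex_of_real (energy (\<lambda>x. g x - S x)) = (LINT x|M. (g x * cnj (g x) - g x * cnj (S x)) - (S x * cnj (g x) - S x * cnj (S x)))"
    unfolding of_real_energy by (simp add: algebra_simps)
  also have "\<dots> = (of_real (energy g) - of_real (\<mu> * s)) - (of_real (\<mu> * s) - of_real (\<mu> * s))"
    by (simp only: bint_diff bintegrable_diff bm_integrable bm_mult bm_cnj bm_diff g S gS Sg SS of_real_energy)
  also have "\<dots> = of_real (energy g - \<mu> * s)" by simp
  finally have "energy g - \<mu> * s \<ge> 0" using energy_nonneg by (metis of_real_eq_iff)
  then show ?thesis using mu by (simp add: s_def field_simps)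
qed

lemma bessel_summable: assumes "bm g" shows "summable (\<lambda>n. (norm (coef g n))\<^sup>2)"
  by (rule summableI_nonneg_bounded[OF _ bessel[OF assms]]) simp

lemma summable_prod_square:
  assumes "summable (\<lambda>n. (norm (a n :: complex))\<^sup>2)" "summable (\<lambda>n. (norm (b n :: complex))\<^sup>2)"
  shows "summable (\<lambda>n. norm (a n * b n))"
proof (rule summable_comparison_test'[OF summable_add[OF assms]])
  fix n show "norm (norm (a n * b n)) \<le> (norm (a n))\<^sup>2 + (norm (b n))\<^sup>2"
    using zero_le_power2[of "norm (a n) - norm (b n)"] mult_nonneg_nonneg[OF norm_ge_zero norm_ge_zero, of "a n" "b n"]
    unfolding power2_diff norm_mult real_norm_def mult.assoc by (simp only: abs_of_nonneg)
qed

lemma series_bm: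
  assumes a: "summable (\<lambda>n. norm (a n))" and f: "\<And>n. f n \<in> borel_measurable borel" "\<And>n x. norm (f n x) \<le> 1"
  shows "summable (\<lambda>n. norm (a n * f n x))" "bm (\<lambda>x. \<Sum>n. a n * f n x)"
    "\<And>x. norm (\<Sum>n. a n * f n x) \<le> (\<Sum>n. norm (a n))"
    "bm F \<Longrightarrow> (\<lambda>n. a n * (LINT x|M. F x * f n x)) sums (LINT x|M. F x * (\<Sum>n. a n * f n x))"
proof -
  have le: "norm (a n * f n x) \<le> norm (a n)" for n x using mult_left_mono[OF f(2)[of n x], of "norm (a n)"] by (simp add: norm_mult)
  show s: "summable (\<lambda>n. norm (a n * f n x))" for x by (rule summable_comparison_test'[OF a]) (use le in simp)
  show n: "norm (\<Sum>n. a n * f n x) \<le> (\<Sum>n. norm (a n))" for x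
    using summable_norm[OF s] suminf_le[OF le s a] order_trans by blast
  show "bm (\<lambda>x. \<Sum>n. a n * f n x)" unfolding bm_def using f(1) n by (intro conjI borel_measurable_suminf) auto
  assume F: "bm F"
  have bf: "bm (f n)" for n using f by (auto simp: bm_def)
  have i: "integrable M (\<lambda>x. a n * (F x * f n x))" for n by (intro bm_integrable bm_mult bm_const F bf)
  obtain B where B: "\<And>x. norm (F x) \<le> B" using F by (auto simp: bm_def)
  have B0: "B \<ge> 0" using B norm_ge_zero order_trans by blast
  have b: "norm (a n * (F x * f n x)) \<le> B * norm (a n)" for n x
    using mult_mono[OF B[of x] le[of n x]] B0 by (simp add: norm_mult mult_ac)
  have s1: "AE x in M. summable (\<lambda>n. norm (a n * (F x * f n x)))"
    by (intro AE_I2 summable_comparison_test'[OF summable_mult[OF a, of B]]) (use b in simp)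
  have s2: "summable (\<lambda>n. LINT x|M. norm (a n * (F x * f n x)))"
  proof (rule summable_comparison_test'[OF summable_mult[OF a, of "\<mu> * B"]])
    fix n
    have "(LINT x|M. norm (a n * (F x * f n x))) \<le> (LINT x|M. B * norm (a n))"
      by (intro integral_mono integrable_norm i b) simp
    also have "\<dots> = \<mu> * B * norm (a n)" by (simp add: \<mu>_def)
    finally show "norm (LINT x|M. norm (a n * (F x * f n x))) \<le> \<mu> * B * norm (a n)" by simp
  qed
  have "(LINT x|M. F x * (\<Sum>n. a n * f n x)) = (LINT x|M. (\<Sum>n. a n * (F x * f n x)))"
  proof (rule bint_cong)
    fix x show "F x * (\<Sum>n. a n * f n x) = (\<Sum>n. a n * (F x * f n x))"
      by (subst suminf_mult[OF summable_norm_cancel[OF s], symmetric]) (simp add: mult_ac)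
  qed simp
  moreover have "(\<lambda>n. LINT x|M. a n * (F x * f n x)) sums (LINT x|M. (\<Sum>n. a n * (F x * f n x)))"
    by (rule sums_integral[OF i s1 s2])
  ultimately show "(\<lambda>n. a n * (LINT x|M. F x * f n x)) sums (LINT x|M. F x * (\<Sum>n. a n * f n x))" by simp
qed

lemma energy_tendsto:
  assumes f: "\<And>n. bm (f n)" "\<And>n x. norm (f n x) \<le> B" "\<And>x. (\<lambda>n. f n x) \<longlonglongrightarrow> g x" and g: "bm g"
  shows "(\<lambda>n. energy (f n)) \<longlonglongrightarrow> energy g"
  unfolding energy_def
proof (rule integral_dominated_convergence[where w = "\<lambda>x. B\<^sup>2"])
  show "AE x in M. (\<lambda>n. (norm (f n x))\<^sup>2) \<longlonglongrightarrow> (norm (g x))\<^sup>2" by (intro AE_I2 tendsto_intros f)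
  show "AE x in M. norm ((norm (f n x))\<^sup>2) \<le> B\<^sup>2" for n using f(2) by (intro AE_I2) (simp add: power_mono)
qed (use bmD(2)[OF f(1)] bmD(2)[OF g] in measurable)

text \<open>Two norms of \<open>m\<close> enter: its l^2 norm bounds the supremum of the result, its
  supremum bounds the energy. The Neumann series takes smallness from the latter and boundedness of
  its terms from the former.\<close>

lemma mult_op_properties:
  assumes m: "summable (\<lambda>n. (norm (m n))\<^sup>2)" "\<And>n. norm (m n) \<le> c" and g: "bm g"
  shows "summable (\<lambda>n. norm (m n * coef g n))" "bm (mult_op m g)"
    "norm (mult_op m g x) \<le> sqrt (\<Sum>n. (norm (m n))\<^sup>2) * sqrt (energy g / \<mu>)"
    "energy (mult_op m g) \<le> c\<^sup>2 * energy g"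
proof -
  show s: "summable (\<lambda>n. norm (m n * coef g n))" by (rule summable_prod_square[OF m(1) bessel_summable[OF g]])
  note S = series_bm[where f = e, OF s e_borel eq_refl[OF e_norm]]
  show b: "bm (mult_op m g)" using S(2) by (simp add: mult_op_def[abs_def])
  have "(\<Sum>n. norm (m n * coef g n)) \<le> sqrt (\<Sum>n. (norm (m n))\<^sup>2) * sqrt (energy g / \<mu>)"
  proof (rule suminf_le_const[OF s])
    fix N
    have "(\<Sum>n<N. norm (m n * coef g n))\<^sup>2 \<le> (\<Sum>n<N. (norm (m n))\<^sup>2) * (\<Sum>n<N. (norm (coef g n))\<^sup>2)"
      unfolding norm_mult by (rule Cauchy_Schwarz_ineq_sum)
    also have "\<dots> \<le> (\<Sum>n. (norm (m n))\<^sup>2) * (energy g / \<mu>)"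
      by (intro mult_mono sum_le_suminf[OF m(1)] bessel[OF g] sum_nonneg suminf_nonneg[OF m(1)]) auto
    finally have "(\<Sum>n<N. norm (m n * coef g n)) \<le> sqrt ((\<Sum>n. (norm (m n))\<^sup>2) * (energy g / \<mu>))" by (rule real_le_rsqrt)
    then show "(\<Sum>n<N. norm (m n * coef g n)) \<le> sqrt (\<Sum>n. (norm (m n))\<^sup>2) * sqrt (energy g / \<mu>)" by (simp only: real_sqrt_mult)
  qed
  then show "norm (mult_op m g x) \<le> sqrt (\<Sum>n. (norm (m n))\<^sup>2) * sqrt (energy g / \<mu>)"
    unfolding mult_op_def by (rule order_trans[OF S(3)])
  have "(\<lambda>N. energy (\<lambda>x. \<Sum>n<N. m n * coef g n * e n x)) \<longlonglongrightarrow> energy (mult_op m g)"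
  proof (rule energy_tendsto[OF _ _ _ b])
    show "bm (\<lambda>x. \<Sum>n<N. m n * coef g n * e n x)" for N by (intro bm_sum bm_mult bm_const bm_e)
    show "norm (\<Sum>n<N. m n * coef g n * e n x) \<le> (\<Sum>n. norm (m n * coef g n))" for N x
      using norm_sum[of "\<lambda>n. m n * coef g n * e n x" "{..<N}"] sum_le_suminf[OF s, of "{..<N}"] by (simp add: norm_mult)
    show "(\<lambda>N. \<Sum>n<N. m n * coef g n * e n x) \<longlonglongrightarrow> mult_op m g x" for x
      unfolding mult_op_def by (rule summable_LIMSEQ[OF summable_norm_cancel[OF S(1)]])
  qed
  then show "energy (mult_op m g) \<le> c\<^sup>2 * energy g"
  proof (rule LIMSEQ_le_const2, intro exI allI impI)
    fix N
    have "(\<Sum>n<N. (norm (m n * coef g n))\<^sup>2) \<le> (\<Sum>n<N. c\<^sup>2 * (norm (coef g n))\<^sup>2)"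
      unfolding norm_mult power_mult_distrib using m(2) by (intro sum_mono mult_right_mono power_mono) auto
    also have "\<dots> \<le> c\<^sup>2 * (energy g / \<mu>)" unfolding sum_distrib_left[symmetric] by (intro mult_left_mono bessel[OF g]) simp
    finally show "energy (\<lambda>x. \<Sum>n<N. m n * coef g n * e n x) \<le> c\<^sup>2 * energy g"
      unfolding energy_sum using mu by (simp add: field_simps)
  qed
qed

text \<open>The multiplier is moved to the other factor without conjugation. The Fourier data
  \<open>w\<close> of \<open>G\<close> are absolutely summable, so by completeness \<mu> G equals
  the sum \<open>S\<close> of its series almost everywhere, and both integrals become the same
  series.\<close>

lemma mult_op_adjoint:
  assumes m: "summable (\<lambda>n. (norm (m n))\<^sup>2)" and F: "bm F" and G: "bm G" and g: "bm g"
    and FG: "\<And>n. (LINT x|M. G x * e n x) = m n * (LINT x|M. F x * e n x)"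
  shows "(LINT x|M. F x * mult_op m g x) = (LINT x|M. G x * g x)"
proof -
  define w where "w n = (LINT x|M. G x * e n x)" for n
  have wc: "w n = of_real \<mu> * (m n * cnj (coef (\<lambda>x. cnj (F x)) n))" for n
  proof -
    have "cnj (coef (\<lambda>x. cnj (F x)) n) = (LINT x|M. cnj (cnj (F x) * cnj (e n x))) / of_real \<mu>"
      unfolding coef_def by (simp only: complex_cnj_divide complex_cnj_complex_of_real Bochner_Integration.integral_cnj)
    then show ?thesis using mu by (simp add: w_def FG)
  qed
  have "summable (\<lambda>n. norm (m n * cnj (coef (\<lambda>x. cnj (F x)) n)))"
    using summable_prod_square[OF m bessel_summable[OF bm_cnj[OF F]]] by (simp add: norm_mult)
  then have sw: "summable (\<lambda>n. norm (w n))" unfolding wc norm_mult[of "of_real \<mu>"] by (rule summable_mult)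
  define S where "S x = (\<Sum>n. w n * cnj (e n x))" for x
  have ce: "(\<lambda>x. cnj (e n x)) \<in> borel_measurable borel" "norm (cnj (e n x)) \<le> 1" for n x by (auto intro: borel_cnj)
  note Ss = series_bm[where f = "\<lambda>n x. cnj (e n x)", OF sw ce, folded S_def]
  have S: "bm S" using Ss(2) by (simp add: S_def[abs_def])
  have Se: "(LINT x|M. S x * e k x) = w k * of_real \<mu>" for k
  proof -
    have "(\<lambda>n. w n * (LINT x|M. e k x * cnj (e n x))) sums (LINT x|M. e k x * S x)" by (rule Ss(4)[OF bm_e])
    moreover have "(\<lambda>n. w n * (LINT x|M. e k x * cnj (e n x))) = (\<lambda>n. if n = k then w k * of_real \<mu> else 0)"
    proof
      fix n show "w n * (LINT x|M. e k x * cnj (e n x)) = (if n = k then w k * of_real \<mu> else 0)"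
        using e_orth[of k n] by (cases "n = k") (simp_all add: e_self)
    qed
    ultimately have "(\<lambda>n. if n = k then w k * of_real \<mu> else 0) sums (LINT x|M. e k x * S x)" by (simp only:)
    from sums_unique2[OF this sums_single] have "(LINT x|M. e k x * S x) = w k * of_real \<mu>" .
    then show ?thesis by (simp add: mult.commute)
  qed
  define h where "h x = of_real \<mu> * G x - S x" for x
  have h: "bm h" unfolding h_def[abs_def] by (intro bm_diff bm_mult bm_const G S)
  have "(LINT x|M. h x * e n x) = 0" for n
  proof -
    have "(LINT x|M. h x * e n x) = (LINT x|M. of_real \<mu> * (G x * e n x) - S x * e n x)" by (simp add: h_def algebra_simps)
    also have "\<dots> = of_real \<mu> * w n - w n * of_real \<mu>"
      unfolding w_def Se[unfolded w_def, symmetric]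
      by (subst bint_diff) (auto intro!: bm_integrable bm_mult bm_const bm_e G S)
    finally show ?thesis by simp
  qed
  moreover obtain B where "\<And>x. norm (h x) \<le> B" using h by (auto simp: bm_def)
  ultimately have h0: "AE x in M. h x = 0" using complete[OF bmD(1)[OF h]] by blast
  have "of_real \<mu> * (LINT x|M. G x * g x) = (LINT x|M. of_real \<mu> * G x * g x)" by (simp add: mult.assoc)
  also have "\<dots> = (LINT x|M. g x * S x)"
  proof (rule integral_cong_AE)
    show "AE x in M. of_real \<mu> * G x * g x = g x * S x" using h0 by eventually_elim (simp add: h_def)
  qed (auto intro!: bmD(2) bm_mult bm_const G S g)
  finally have A: "of_real \<mu> * (LINT x|M. G x * g x) = (LINT x|M. g x * S x)" .
  have "(\<lambda>n. w n * (LINT x|M. g x * cnj (e n x))) sums (LINT x|M. g x * S x)" by (rule Ss(4)[OF g])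
  then have "(\<lambda>n. of_real \<mu> * (w n * coef g n)) sums (of_real \<mu> * (LINT x|M. G x * g x))"
    unfolding A coef_def using mu by simp
  then have B: "(\<lambda>n. w n * coef g n) sums (LINT x|M. G x * g x)" using mu by (subst (asm) sums_mult_iff) auto
  have s: "summable (\<lambda>n. norm (m n * coef g n))" by (rule summable_prod_square[OF m bessel_summable[OF g]])
  have "(\<lambda>n. m n * coef g n * (LINT x|M. F x * e n x)) sums (LINT x|M. F x * mult_op m g x)"
    unfolding mult_op_def by (rule series_bm(4)[where f = e, OF s e_borel eq_refl[OF e_norm] F])
  then have "(\<lambda>n. w n * coef g n) sums (LINT x|M. F x * mult_op m g x)" unfolding w_def FG by (simp add: mult_ac)
  then show ?thesis using B by (rule sums_unique2)
qed

text \<open>\<rho> is the Neumann series of \<rho> = 1 + m(v \<rho>), with m acting as a multiplier.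
  The equation is recorded in transposed form, tested with pairs \<open>F\<close>, \<open>G\<close>;
  that \<open>F\<close> has integral 0 removes the leading 1.\<close>

lemma neumann_solution:
  assumes m: "summable (\<lambda>n. (norm (m n))\<^sup>2)" "\<And>n. norm (m n) * V \<le> q" and q: "0 < q" "q \<le> 1 / 2"
    and v: "v \<in> borel_measurable borel" "\<And>x. norm (v x) \<le> V" "V > 0"
  obtains \<rho> where "bm \<rho>" "energy (\<lambda>x. \<rho> x - 1) \<le> 4 * q\<^sup>2 * \<mu>"
    "\<forall>F G. bm F \<longrightarrow> bm G \<longrightarrow> (\<forall>n. (LINT x|M. G x * e n x) = m n * (LINT x|M. F x * e n x)) \<longrightarrow> (LINT x|M. F x) = 0
      \<longrightarrow> (LINT x|M. F x * \<rho> x) = (LINT x|M. G x * (v x * \<rho> x))"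
proof -
  have bv: "bm v" using v by (auto simp: bm_def)
  define r where "r = rec_nat (\<lambda>_. 1) (\<lambda>k s. mult_op m (\<lambda>x. v x * s x))"
  have r0: "r 0 x = 1" and rS: "r (Suc k) = mult_op m (\<lambda>x. v x * r k x)" for k x by (simp_all add: r_def)
  have mc: "norm (m n) \<le> q / V" for n using m(2)[of n] v(3) by (simp add: field_simps)
  note mop = mult_op_properties[OF m(1) mc]
  have br: "bm (r k)" for k
  proof (induction k)
    case 0 show ?case using bm_const[of 1] by (simp add: r_def)
  next
    case (Suc k) show ?case unfolding rS by (intro mop bm_mult bv Suc)
  qed
  have ev: "energy (\<lambda>x. v x * r k x) \<le> V\<^sup>2 * energy (r k)" for k
  proof -
    have "energy (\<lambda>x. v x * r k x) \<le> (LINT x|M. V\<^sup>2 * (norm (r k x))\<^sup>2)"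
      unfolding energy_def norm_mult power_mult_distrib
    proof (rule integral_mono)
      show "integrable M (\<lambda>x. (norm (v x))\<^sup>2 * (norm (r k x))\<^sup>2)"
        using bm_integrable_square[OF bm_mult[OF bv br[of k]]] by (simp add: norm_mult power_mult_distrib)
      show "integrable M (\<lambda>x. V\<^sup>2 * (norm (r k x))\<^sup>2)" by (intro integrable_mult_right bm_integrable_square br)
      show "(norm (v x))\<^sup>2 * (norm (r k x))\<^sup>2 \<le> V\<^sup>2 * (norm (r k x))\<^sup>2" for x using v(2) by (intro mult_right_mono power_mono) auto
    qed
    then show ?thesis by (simp add: energy_def)
  qed
  have E: "energy (r k) \<le> q ^ (2 * k) * \<mu>" for k
  proof (induction k)
    case 0 show ?case by (simp add: energy_def r0 \<mu>_def)
  next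
    case (Suc k)
    have "energy (r (Suc k)) \<le> (q / V)\<^sup>2 * (V\<^sup>2 * energy (r k))"
      unfolding rS using mop(4)[OF bm_mult[OF bv br]] mult_left_mono[OF ev, of "(q / V)\<^sup>2"] order_trans zero_le_power2 by blast
    also have "\<dots> = q\<^sup>2 * energy (r k)" using v(3) by (simp add: field_simps)
    also have "\<dots> \<le> q\<^sup>2 * (q ^ (2 * k) * \<mu>)" using Suc by (intro mult_left_mono) auto
    finally show ?case by (simp add: power2_eq_square mult_ac)
  qed
  define C where "C = sqrt (\<Sum>n. (norm (m n))\<^sup>2) * V"
  have C0: "C \<ge> 0" using v(3) suminf_nonneg[OF m(1)] by (simp add: C_def)
  have sup: "norm (r (Suc k) x) \<le> C * q ^ k" for k x
  proof -
    have "energy (\<lambda>x. v x * r k x) / \<mu> \<le> (V * q ^ k)\<^sup>2"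
    proof -
      have "energy (\<lambda>x. v x * r k x) \<le> V\<^sup>2 * (q ^ (2 * k) * \<mu>)" using ev[of k] mult_left_mono[OF E[of k], of "V\<^sup>2"] by simp
      then show ?thesis using mu by (simp add: pos_divide_le_eq power_mult_distrib power_mult[symmetric] mult_ac)
    qed
    then have "sqrt (energy (\<lambda>x. v x * r k x) / \<mu>) \<le> V * q ^ k" using v(3) q by (intro real_le_lsqrt) auto
    then have "sqrt (\<Sum>n. (norm (m n))\<^sup>2) * sqrt (energy (\<lambda>x. v x * r k x) / \<mu>) \<le> sqrt (\<Sum>n. (norm (m n))\<^sup>2) * (V * q ^ k)"
      using suminf_nonneg[OF m(1)] by (intro mult_left_mono) auto
    then show ?thesis unfolding rS C_def using mop(3)[OF bm_mult[OF bv br[of k]], of x] by (simp add: mult_ac)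
  qed
  \<comment> \<open>A majorant of the terms. The added 1/2^k keeps it positive even for C = 0, so
    that the terms can be normalised for \<open>series_bm\<close>.\<close>
  define a where "a k = (if k = 0 then 1 else C * q ^ (k - 1) + 1 / 2 ^ k)" for k
  have a0: "a k > 0" for k using C0 q by (auto simp: a_def intro!: add_nonneg_pos)
  have ra: "norm (r k x) \<le> a k" for k x using sup[of "k - 1" x] by (cases k) (auto simp: a_def r0 intro: order_trans)
  have sa: "summable a"
  proof (subst summable_Suc_iff[symmetric])
    have "summable (\<lambda>k. C * q ^ k + 1 / 2 * (1 / 2) ^ k)" using q by (intro summable_add summable_mult summable_geometric) auto
    then show "summable (\<lambda>k. a (Suc k))" by (simp add: a_def power_one_over)
  qed
  define f where "f k x = r k x / of_real (a k)" for k x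
  have fa: "of_real (a k) * f k x = r k x" for k x using a0[of k] by (simp add: f_def)
  have fb: "f k \<in> borel_measurable borel" "norm (f k x) \<le> 1" for k x
    using bmD(1)[OF br] ra[of k x] a0[of k] by (auto simp: f_def[abs_def] norm_divide)
  have sa': "summable (\<lambda>k. norm (complex_of_real (a k)))" using sa a0 by (simp add: less_imp_le abs_of_pos)
  note Ss = series_bm[where f = f, OF sa' fb, unfolded fa]
  define \<rho> where "\<rho> x = (\<Sum>k. r k x)" for x
  have \<rho>: "bm \<rho>" using Ss(2) by (simp add: \<rho>_def[abs_def])
  have sr: "summable (\<lambda>k. norm (r k x))" for x by (rule Ss(1))
  have int_sums: "(\<lambda>k. LINT x|M. F x * r k x) sums (LINT x|M. F x * \<rho> x)" if "bm F" for F
  proof -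
    have "of_real (a k) * (LINT x|M. F x * f k x) = (LINT x|M. F x * r k x)" for k
      unfolding fa[symmetric] integral_mult_right_zero[symmetric] by (simp add: mult_ac)
    then show ?thesis using Ss(4)[OF that] by (simp add: \<rho>_def)
  qed
  show ?thesis
  proof
    show "bm \<rho>" by (rule \<rho>)
    have "(LINT x|M. F x * \<rho> x) = (LINT x|M. G x * (v x * \<rho> x))"
      if F: "bm F" and G: "bm G" and FG: "\<And>n. (LINT x|M. G x * e n x) = m n * (LINT x|M. F x * e n x)" and z: "(LINT x|M. F x) = 0" for F G
    proof -
    have "(LINT x|M. F x * r (Suc k) x) = (LINT x|M. (G x * v x) * r k x)" for k
      unfolding rS mult_op_adjoint[OF m(1) F G bm_mult[OF bv br] FG] by (simp add: mult_ac)
    moreover have "(\<lambda>k. LINT x|M. F x * r (Suc k) x) sums (LINT x|M. F x * \<rho> x)"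
      using int_sums[OF F] z by (subst sums_Suc_iff) (simp add: r0)
    ultimately have "(LINT x|M. F x * \<rho> x) = (LINT x|M. (G x * v x) * \<rho> x)"
      using int_sums[OF bm_mult[OF G bv]] sums_unique2 by (simp only:) blast
    then show ?thesis by (simp add: mult_ac)
    qed
    then show "\<forall>F G. bm F \<longrightarrow> bm G \<longrightarrow> (\<forall>n. (LINT x|M. G x * e n x) = m n * (LINT x|M. F x * e n x)) \<longrightarrow> (LINT x|M. F x) = 0
      \<longrightarrow> (LINT x|M. F x * \<rho> x) = (LINT x|M. G x * (v x * \<rho> x))" by blast
  next
    have lim: "(\<lambda>K. energy (\<lambda>x. \<Sum>k<K. r (Suc k) x)) \<longlonglongrightarrow> energy (\<lambda>x. \<rho> x - 1)"
    proof (rule energy_tendsto)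
      show "bm (\<lambda>x. \<Sum>k<K. r (Suc k) x)" for K by (intro bm_sum br)
      show "bm (\<lambda>x. \<rho> x - 1)" by (intro bm_diff bm_const \<rho>)
      show "norm (\<Sum>k<K. r (Suc k) x) \<le> (\<Sum>k. a (Suc k))" for K x
      proof -
        have "norm (\<Sum>k<K. r (Suc k) x) \<le> (\<Sum>k<K. a (Suc k))" by (intro sum_norm_le ra)
        also have "\<dots> \<le> (\<Sum>k. a (Suc k))" using sa a0 by (intro sum_le_suminf) (auto simp: summable_Suc_iff less_imp_le)
        finally show ?thesis .
      qed
      show "(\<lambda>K. \<Sum>k<K. r (Suc k) x) \<longlonglongrightarrow> \<rho> x - 1" for x
        using summable_norm_cancel[OF sr[of x]] unfolding sums_def[symmetric] \<rho>_def
        by (subst sums_Suc_iff) (simp add: r0 summable_sums)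
    qed
    then show "energy (\<lambda>x. \<rho> x - 1) \<le> 4 * q\<^sup>2 * \<mu>"
    proof (rule LIMSEQ_le_const2, intro exI allI impI)
      fix K
      define g where "g = (\<Sum>k<K. q ^ Suc k)"
      have g: "0 \<le> g" "g \<le> 2 * q"
      proof -
        show "0 \<le> g" using q by (auto simp: g_def intro!: sum_nonneg)
        have "g = q * (\<Sum>k<K. q ^ k)" by (simp add: g_def sum_distrib_left)
        also have "(\<Sum>k<K. q ^ k) \<le> (\<Sum>k. (1/2) ^ k)"
          using q by (intro order_trans[OF sum_mono[of _ _ "\<lambda>k. (1/2)^k"] sum_le_suminf] power_mono) (auto intro: summable_geometric)
        also have "(\<Sum>k. (1/2::real) ^ k) = 2" by (subst suminf_geometric) auto
        finally show "g \<le> 2 * q" using q by (simp add: mult.commute)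
      qed
      \<comment> \<open>Cauchy-Schwarz with weights q^(k+1) takes the place of the triangle
        inequality in L^2. The weights sum to at most 2 q, which gives the factor 4 q^2.\<close>
      have pw: "(norm (\<Sum>k<K. r (Suc k) x))\<^sup>2 \<le> g * (\<Sum>k<K. (norm (r (Suc k) x))\<^sup>2 / q ^ Suc k)" for x
      proof -
        have "(\<Sum>k<K. norm (r (Suc k) x)) = (\<Sum>k<K. sqrt (q ^ Suc k) * (norm (r (Suc k) x) / sqrt (q ^ Suc k)))" using q by (intro sum.cong) auto
        then have "(norm (\<Sum>k<K. r (Suc k) x))\<^sup>2 \<le> (\<Sum>k<K. sqrt (q ^ Suc k) * (norm (r (Suc k) x) / sqrt (q ^ Suc k)))\<^sup>2"
          by (intro power_mono) (auto intro: norm_sum order_trans)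
        also have "\<dots> \<le> (\<Sum>k<K. (sqrt (q ^ Suc k))\<^sup>2) * (\<Sum>k<K. (norm (r (Suc k) x) / sqrt (q ^ Suc k))\<^sup>2)" by (rule Cauchy_Schwarz_ineq_sum)
        also have "\<dots> = g * (\<Sum>k<K. (norm (r (Suc k) x))\<^sup>2 / q ^ Suc k)"
          using q zero_le_power[of q] by (simp add: g_def power_divide real_sqrt_pow2 del: power_Suc)
        finally show ?thesis .
      qed
      have "energy (\<lambda>x. \<Sum>k<K. r (Suc k) x) \<le> (LINT x|M. g * (\<Sum>k<K. (norm (r (Suc k) x))\<^sup>2 / q ^ Suc k))"
        unfolding energy_def
        by (intro integral_mono pw integrable_mult_right Bochner_Integration.integrable_sum integrable_divide bm_integrable_square bm_sum br)
      also have "\<dots> = g * (\<Sum>k<K. energy (r (Suc k)) / q ^ Suc k)"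
        unfolding energy_def by (subst integral_mult_right_zero, subst Bochner_Integration.integral_sum) (auto intro!: integrable_divide bm_integrable_square br simp del: power_Suc)
      also have "\<dots> \<le> g * (\<Sum>k<K. q ^ Suc k * \<mu>)"
      proof (intro mult_left_mono sum_mono)
        fix k
        show "energy (r (Suc k)) / q ^ Suc k \<le> q ^ Suc k * \<mu>"
          using E[of "Suc k", unfolded mult_2 power_add] q zero_less_power[OF q(1), of "Suc k"]
          by (simp only: pos_divide_le_eq mult_ac)
      qed (rule g)
      also have "\<dots> = g * g * \<mu>" unfolding g_def sum_distrib_right[symmetric] by simp
      also have "\<dots> \<le> (2 * q) * (2 * q) * \<mu>" using g mu by (intro mult_right_mono mult_mono) auto
      finally show "energy (\<lambda>x. \<Sum>k<K. r (Suc k) x) \<le> 4 * q\<^sup>2 * \<mu>" by (simp add: power2_eq_square)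
    qed
  qed
qed

end

section \<open>Characters of a cube and uniqueness of Fourier coefficients\<close>

definition lat :: "int^3 => real^3" where "lat k = (\<chi> i. of_int (k $ i))"

lemma lat_nth [simp]: "lat k $ i = of_int (k $ i)" by (simp add: lat_def)

lemma lat_diff: "lat (k - l) = lat k - lat l" and lat_add: "lat (k + l) = lat k + lat l"
  by (simp_all add: vec_eq_iff)

lemma lat_axis: "lat (axis i 1) \<bullet> x = x $ i"
proof -
  have "lat (axis i 1) = axis i 1" by (simp add: vec_eq_iff axis_def)
  then show ?thesis by (simp add: inner_axis inner_commute)
qed

text \<open>A half-open period cell, of side 2 pi L, for the characters with frequencies
  \<open>lat k\<close> / L.\<close>

definition cube :: "real => (real^3) set" where
  "cube L = {x. \<forall>i. - (pi * L) \<le> x $ i \<and> x $ i < pi * L}"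

lemma cube_borel [measurable]: "cube L \<in> sets borel"
proof -
  have "cube L = (\<Inter>i. {x. - (pi * L) \<le> x $ i} \<inter> {x. x $ i < pi * L})" by (auto simp: cube_def)
  also have "\<dots> \<in> sets borel"
    by (intro sets.countable_INT' sets.Int borel_closed borel_open closed_Collect_le open_Collect_less continuous_intros) auto
  finally show ?thesis .
qed

lemma bounded_cube: "bounded (cube L)"
proof (rule boundedI)
  fix x assume "x \<in> cube L"
  then have x: "\<bar>x $ i\<bar> \<le> \<bar>pi * L\<bar>" for i unfolding cube_def by (smt (verit) mem_Collect_eq)
  have "norm x \<le> (\<Sum>i\<in>UNIV. \<bar>x $ i\<bar>)" by (rule norm_le_l1_cart)
  also have "\<dots> \<le> (\<Sum>i\<in>(UNIV::3 set). \<bar>pi * L\<bar>)" by (intro sum_mono x)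
  finally show "norm x \<le> (\<Sum>i\<in>(UNIV::3 set). \<bar>pi * L\<bar>)" .
qed

lemma ball_subset_cube: "ball 0 (pi * L) \<subseteq> cube L"
proof
  fix x :: "real^3" assume "x \<in> ball 0 (pi * L)"
  then have "\<bar>x $ i\<bar> < pi * L" for i using component_le_norm_cart[of x i] by simp
  then show "x \<in> cube L" unfolding cube_def by (smt (verit) mem_Collect_eq)
qed

lemma integrable_on_cube:
  fixes f :: "real^3 => complex"
  assumes "f \<in> borel_measurable borel" "\<And>x. norm (f x) \<le> B"
  shows "integrable lborel (\<lambda>x. indicator (cube L) x *\<^sub>R f x)"
proof (rule bintegrable_bound)
  have B: "B \<ge> 0" using assms(2) norm_ge_zero order_trans by blast
  show "integrable lborel (\<lambda>x. indicator (cube L) x *\<^sub>R B)"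
    using emeasure_bounded_finite[OF bounded_cube[of L]] by (intro integrable_scaleR_left integrable_real_indicator) auto
  show "AE x in lborel. norm (indicator (cube L) x *\<^sub>R f x) \<le> norm (indicator (cube L) x *\<^sub>R B)"
    using assms(2) B by (intro AE_I2) (simp add: mult_left_mono)
qed (use assms(1) in measurable)

text \<open>Translation takes the place of iterated integrals. Moving by half a wavelength
  \<open>h\<close>, in a direction where \<open>k\<close> does not vanish, reverses the sign of the
  character, while the moved cube is the old one with a slab displaced by a full period. So the
  integral equals its negative.\<close>

lemma character_cube_integral:
  fixes k :: "int^3"
  assumes L: "L > 0" and k: "k \<noteq> 0"
  shows "(LBINT x. indicator (cube L) x *\<^sub>R cis ((1 / L) * (lat k \<bullet> x))) = 0"
proof -
  obtain i where i: "k $ i \<noteq> 0" using k by (auto simp: vec_eq_iff)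
  define z where "z = k $ i"
  define T where "T = 2 * pi * L"
  define h where "h = pi * L / \<bar>real_of_int z\<bar>"
  have z1: "\<bar>real_of_int z\<bar> \<ge> 1" using i by (simp add: z_def abs_if)
  have h: "h > 0" "2 * h \<le> T"
  proof -
    show "h > 0" using L z1 by (auto simp: h_def)
    have "h \<le> pi * L / 1" unfolding h_def using L z1 by (intro divide_left_mono) auto
    then show "2 * h \<le> T" by (simp add: T_def)
  qed
  define f where "f x = cis ((1 / L) * (lat k \<bullet> x))" for x
  define u where "u c = c *\<^sub>R axis i (1::real)" for c
  have u: "u c $ j = (if j = i then c else 0)" for c j by (simp add: u_def axis_def)
  have ku: "(1 / L) * (lat k \<bullet> (x - u c)) = (1 / L) * (lat k \<bullet> x) - z * c / L" for x and c :: real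
    by (simp add: u_def inner_diff_right inner_axis z_def diff_divide_distrib mult.commute)
  have fm [measurable]: "f \<in> borel_measurable borel" unfolding f_def[abs_def] cis_conv_exp by measurable
  have fT: "f (x - u T) = f x" for x
  proof -
    have "z * T / L = 2 * pi * of_int z" using L by (simp add: T_def)
    moreover have "cis (2 * pi * of_int z) = 1" by (rule cis_multiple_2pi) simp
    ultimately show ?thesis by (simp only: f_def ku cis_divide[symmetric] div_by_1)
  qed
  have fh: "f (x - u h) = - f x" for x
  proof -
    have "z * h / L = pi * sgn (real_of_int z)" using L i by (simp add: h_def z_def sgn_if abs_if)
    moreover have "cis (pi * sgn (real_of_int z)) = -1" using i by (simp add: z_def sgn_if complex_eq_iff)
    ultimately show ?thesis by (simp only: f_def ku cis_divide[symmetric]) simp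
  qed
  define A where "A = {x \<in> cube L. x $ i < - (pi * L) + h}"
  define C where "C = {x \<in> cube L. - (pi * L) + h \<le> x $ i}"
  define A' where "A' = {x. x - u T \<in> A}"
  have [measurable]: "A \<in> sets borel" "C \<in> sets borel" unfolding A_def C_def by measurable
  have [measurable]: "A' \<in> sets borel" unfolding A'_def by measurable
  have I: "integrable lborel (\<lambda>x. indicator B x *\<^sub>R f x)" if "B \<in> sets borel" "bounded B" for B
  proof (rule bintegrable_bound)
    show "integrable lborel (\<lambda>x. indicator B x :: real)"
      using emeasure_bounded_finite[OF that(2)] that(1) by (intro integrable_real_indicator) auto
    show "(\<lambda>x. indicator B x *\<^sub>R f x) \<in> borel_measurable lborel" using that(1) by measurable
    show "AE x in lborel. norm (indicator B x *\<^sub>R f x) \<le> norm (indicator B x :: real)" by (intro AE_I2) (simp add: f_def)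
  qed
  have bd: "bounded A" "bounded C" using bounded_cube by (auto intro: bounded_subset simp: A_def C_def)
  have bA': "bounded A'"
  proof -
    have "A' \<subseteq> (\<lambda>x. u T + x) ` A"
    proof
      fix x assume "x \<in> A'"
      then show "x \<in> (\<lambda>x. u T + x) ` A" by (intro image_eqI[of _ _ "x - u T"]) (auto simp: A'_def)
    qed
    then show ?thesis using bounded_translation[OF bd(1)] by (rule bounded_subset[rotated])
  qed
  have dec: "indicator (cube L) x = (indicator A x + indicator C x :: real)" for x by (auto simp: A_def C_def indicator_def)
  have dech: "indicator (cube L) (x - u h) = (indicator C x + indicator A' x :: real)" for x
  proof -
    let ?O = "\<forall>j. j \<noteq> i \<longrightarrow> - (pi * L) \<le> x $ j \<and> x $ j < pi * L"
    have 1: "x - u h \<in> cube L \<longleftrightarrow> ?O \<and> - (pi * L) \<le> x $ i - h \<and> x $ i - h < pi * L"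
      unfolding cube_def mem_Collect_eq vector_minus_component u by (auto split: if_splits)
    have 2: "x \<in> C \<longleftrightarrow> ?O \<and> - (pi * L) + h \<le> x $ i \<and> x $ i < pi * L"
      unfolding C_def cube_def mem_Collect_eq using h by (smt (verit))
    have 3: "x \<in> A' \<longleftrightarrow> ?O \<and> pi * L \<le> x $ i \<and> x $ i < pi * L + h"
    proof -
      have "(\<forall>j. - (pi * L) \<le> x $ j - (if j = i then T else 0) \<and> x $ j - (if j = i then T else 0) < pi * L)
        \<longleftrightarrow> ?O \<and> - (pi * L) \<le> x $ i - T \<and> x $ i - T < pi * L"
        by (auto split: if_splits)
      moreover have "T = 2 * (pi * L)" by (simp add: T_def)
      moreover have "((P \<and> - a \<le> t - 2 * a \<and> t - 2 * a < a) \<and> t - 2 * a < - a + h) \<longleftrightarrow> (P \<and> a \<le> t \<and> t < a + h)" if "0 < h" "2 * h \<le> 2 * a" for P and a t h :: real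
        using that by auto
      ultimately show ?thesis unfolding A'_def A_def cube_def mem_Collect_eq vector_minus_component u using h by (simp only: if_True refl)
    qed
    show ?thesis unfolding indicator_def of_bool_def 1 2 3 using h unfolding T_def by auto
  qed
  have "(LBINT x. indicator A x *\<^sub>R f x) = (LBINT x. indicator A (x - u T) *\<^sub>R f (x - u T))"
    by (subst lborel_integral_translate(1)[where f = "\<lambda>x. indicator A x *\<^sub>R f x"]) auto
  also have "\<dots> = (LBINT x. indicator A' x *\<^sub>R f x)" unfolding fT by (simp add: A'_def indicator_def)
  finally have AA: "(LBINT x. indicator A x *\<^sub>R f x) = (LBINT x. indicator A' x *\<^sub>R f x)" .
  define J where "J = (LBINT x. indicator (cube L) x *\<^sub>R f x)"
  have "J = (LBINT x. indicator (cube L) (x - u h) *\<^sub>R f (x - u h))"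
    unfolding J_def by (subst lborel_integral_translate(1)[where f = "\<lambda>x. indicator (cube L) x *\<^sub>R f x"]) auto
  also have "\<dots> = - (LBINT x. indicator C x *\<^sub>R f x + indicator A' x *\<^sub>R f x)"
    unfolding fh dech by (simp add: scaleR_add_left flip: integral_minus)
  also have "\<dots> = - ((LBINT x. indicator C x *\<^sub>R f x) + (LBINT x. indicator A x *\<^sub>R f x))"
    unfolding AA by (subst bint_add[OF I I]) (use bd bA' in auto)
  also have "(LBINT x. indicator C x *\<^sub>R f x) + (LBINT x. indicator A x *\<^sub>R f x) = J"
    unfolding J_def dec scaleR_add_left by (subst bint_add[OF I I]) (use bd in auto)
  finally have "J = - J" .
  then show ?thesis unfolding J_def f_def by simp
qed

text \<open>Ramps of slope n that start at \<open>c\<close> converge boundedly to the step, and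
  Weierstrass polynomials follow them within 1/(n+1).\<close>

lemma threshold_polynomials:
  obtains p :: "nat => real => real" where "\<And>n. real_polynomial_function (p n)" "\<And>n u. \<bar>u\<bar> \<le> 1 \<Longrightarrow> \<bar>p n u\<bar> \<le> 2"
    "\<And>u. \<bar>u\<bar> \<le> 1 \<Longrightarrow> (\<lambda>n. p n u) \<longlonglongrightarrow> (if c < u then 1 else 0)"
proof -
  define g where "g n u = min 1 (max 0 (real n * (u - c)))" for n u
  have "\<exists>p. real_polynomial_function p \<and> (\<forall>u\<in>{-1..1}. \<bar>g n u - p u\<bar> < inverse (real (Suc n)))" for n
  proof (rule Stone_Weierstrass_real_polynomial_function[of "{-1..1}" "g n" "inverse (real (Suc n))"])
    show "continuous_on {-1..1} (g n)" unfolding g_def by (intro continuous_intros)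
  qed auto
  then obtain p where p: "\<And>n. real_polynomial_function (p n)" "\<And>n u. u \<in> {-1..1} \<Longrightarrow> \<bar>g n u - p n u\<bar> < inverse (real (Suc n))" by metis
  have u: "u \<in> {-1..1}" if "\<bar>u\<bar> \<le> 1" for u :: real using that by auto
  show ?thesis
  proof (rule that[OF p(1)])
    fix u :: real assume u1: "\<bar>u\<bar> \<le> 1"
    note gp = p(2)[OF u[OF u1]]
    show "\<bar>p n u\<bar> \<le> 2" for n
    proof -
      have "inverse (real (Suc n)) \<le> 1" by (simp add: inverse_eq_divide)
      moreover have "0 \<le> g n u" "g n u \<le> 1" by (auto simp: g_def)
      ultimately show ?thesis using gp[of n] by linarith
    qed
    have d: "(\<lambda>n. g n u - p n u) \<longlonglongrightarrow> 0"
      by (rule Lim_null_comparison[OF _ LIMSEQ_inverse_real_of_nat]) (use gp in \<open>simp add: less_imp_le del: of_nat_Suc\<close>)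
    have "(\<lambda>n. g n u) \<longlonglongrightarrow> (if c < u then 1 else 0)"
    proof (cases "c < u")
      case True
      obtain N :: nat where N: "real N > 1 / (u - c)" using reals_Archimedean2 by blast
      have "g n u = 1" if "n \<ge> N" for n
      proof -
        have "1 \<le> real N * (u - c)" using N True by (simp add: pos_divide_less_eq)
        also have "\<dots> \<le> real n * (u - c)" using that True by (intro mult_right_mono) auto
        finally show ?thesis by (simp add: g_def)
      qed
      then show ?thesis using True by (simp add: tendsto_eventually eventually_sequentiallyI[of N])
    next
      case False
      then have "g n u = 0" for n by (simp add: g_def mult_nonneg_nonpos)
      then show ?thesis using False by simp
    qed
    from tendsto_diff[OF this d] show "(\<lambda>n. p n u) \<longlonglongrightarrow> (if c < u then 1 else 0)" by simp
  qed
qed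

text \<open>Past pi the cosine rises again and reaches cos w at 2 pi - w, which is why |t| is
  limited by that value.\<close>

lemma cos_threshold:
  assumes w: "0 < w" "w \<le> pi" and t: "\<bar>t\<bar> \<le> 2 * pi - w"
  shows "cos w < cos t \<longleftrightarrow> \<bar>t\<bar> < w"
proof (cases "\<bar>t\<bar> \<le> pi")
  case True
  have "cos t = cos \<bar>t\<bar>" by simp
  then show ?thesis using cos_mono_less_eq[of w "\<bar>t\<bar>"] w True by simp
next
  case False
  have "cos t = cos \<bar>t\<bar>" by simp
  also have "\<dots> = cos (2 * pi - \<bar>t\<bar>)" by (simp add: cos_diff)
  also have "\<dots> \<le> cos w" by (rule cos_monotone_0_pi_le) (use False w t in linarith)+
  finally have "cos t \<le> cos w" .
  then show ?thesis using False w by auto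
qed

lemma AE_lborel_off_hyperplanes: "AE x in lborel. \<forall>i. (x::real^3) $ i \<noteq> c"
  unfolding AE_all_countable
proof -
  show "\<forall>i. AE x in lborel. (x::real^3) $ i \<noteq> c"
  proof
    fix i :: 3
    have "{x::real^3. x $ i = c} \<in> null_sets (completion lborel)"
      using negligible_standard_hyperplane[of "axis i (1::real)" c] by (simp add: negligible_iff_null_sets inner_axis axis_in_Basis_iff)
    then have "{x::real^3. x $ i = c} \<in> null_sets lborel" by (subst (asm) null_sets_completion_iff) measurable
    from AE_not_in[OF this] show "AE x in lborel. (x::real^3) $ i \<noteq> c" by simp
  qed
qed

text \<open>\<open>V\<close> collects the bounded factors that keep \<open>b\<close> orthogonal to
  all characters. It is a vector space stable under multiplication by characters, hence by
  polynomials in cosines of single coordinates. Threshold polynomials of such cosines converge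
  boundedly to box indicators, and the box integrals determine \<open>b\<close>.\<close>

lemma torus_uniqueness:
  fixes b :: "real^3 => complex"
  assumes L: "L > 0" and b: "integrable lborel b" "\<And>x. x \<notin> cube L \<Longrightarrow> b x = 0"
    and z: "\<And>k. (LBINT x. b x * cis ((1 / L) * (lat k \<bullet> x))) = 0"
  shows "AE x in lborel. b x = 0"
proof (rule AE_zero_if_box_integrals_zero[OF b(1)])
  fix lo hi :: "real^3"
  define E where "E k x = cis ((1 / L) * (lat k \<bullet> x))" for k x
  have [measurable]: "b \<in> borel_measurable borel" using borel_measurable_integrable[OF b(1)] by simp
  have [measurable]: "E k \<in> borel_measurable borel" for k unfolding E_def[abs_def] cis_conv_exp by measurable
  have En: "norm (E k x) = 1" for k x by (simp add: E_def)
  have EE: "E k x * E l x = E (k + l) x" for k l x by (simp add: E_def cis_mult lat_add inner_add_left algebra_simps)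
  define V where "V = {G :: real^3 => complex. G \<in> borel_measurable borel \<and> (\<exists>B. \<forall>x. norm (G x) \<le> B) \<and> (\<forall>k. (LBINT x. b x * (G x * E k x)) = 0)}"
  have bi: "integrable lborel (\<lambda>x. b x * G x)" if "G \<in> borel_measurable borel" "\<And>x. norm (G x) \<le> B" for G B
  proof (rule bintegrable_bound)
    show "integrable lborel (\<lambda>x. B * norm (b x))" by (intro integrable_mult_right integrable_norm b(1))
    have "B \<ge> 0" using that(2) norm_ge_zero order_trans by blast
    then show "AE x in lborel. norm (b x * G x) \<le> norm (B * norm (b x))"
      using that(2) by (intro AE_I2) (simp add: norm_mult mult.commute[of "norm (b _)"] mult_right_mono)
  qed (use that(1) in measurable)
  have biE: "integrable lborel (\<lambda>x. b x * (G x * E k x))" if "G \<in> V" for G k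
  proof -
    obtain B where "\<And>x. norm (G x) \<le> B" "G \<in> borel_measurable borel" using \<open>G \<in> V\<close> by (auto simp: V_def)
    then show ?thesis by (intro bi[of _ B]) (auto simp: norm_mult En)
  qed
  have V1: "(\<lambda>x. 1) \<in> V" using z by (auto simp: V_def E_def)
  have Vadd: "(\<lambda>x. F x + G x) \<in> V" if FG: "F \<in> V" "G \<in> V" for F G
  proof -
    obtain B C where "\<And>x. norm (F x) \<le> B" "\<And>x. norm (G x) \<le> C" using FG by (auto simp: V_def)
    then have "norm (F x + G x) \<le> B + C" for x using norm_triangle_ineq add_mono order_trans by blast
    moreover have "(LBINT x. b x * ((F x + G x) * E k x)) = 0" for k
      unfolding distrib_left distrib_right bint_add[OF biE[OF FG(1)] biE[OF FG(2)]] using FG by (simp add: V_def)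
    ultimately show ?thesis using FG by (auto simp: V_def)
  qed
  have Vscale: "(\<lambda>x. c * G x) \<in> V" if G: "G \<in> V" for G c
  proof -
    obtain B where "\<And>x. norm (G x) \<le> B" using G by (auto simp: V_def)
    then have "norm (c * G x) \<le> norm c * B" for x by (simp add: norm_mult mult_left_mono)
    moreover have "(LBINT x. b x * ((c * G x) * E k x)) = 0" for k
    proof -
      have "(LBINT x. b x * ((c * G x) * E k x)) = c * (LBINT x. b x * (G x * E k x))"
        unfolding integral_mult_right_zero[symmetric] by (simp add: mult_ac)
      then show ?thesis using G by (simp add: V_def)
    qed
    ultimately show ?thesis using G by (auto simp: V_def)
  qed
  have VE: "(\<lambda>x. E l x * G x) \<in> V" if G: "G \<in> V" for G l
  proof -
    have "b x * ((E l x * G x) * E k x) = b x * (G x * E (k + l) x)" for x k unfolding EE[symmetric] by (simp add: mult_ac)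
    moreover obtain B where "\<And>x. norm (E l x * G x) \<le> B" using G by (auto simp: V_def norm_mult En)
    moreover have "(\<lambda>x. E l x * G x) \<in> borel_measurable borel" using G by (auto simp: V_def)
    ultimately show ?thesis using G unfolding V_def mem_Collect_eq by (auto simp only:)
  qed
  have Vcos: "(\<lambda>x. of_real (cos ((x $ i - c) / L)) * G x) \<in> V" if G: "G \<in> V" for G i c
  proof -
    have "(\<lambda>x. (cis (- c / L) / 2) * (E (axis i 1) x * G x) + (cis (c / L) / 2) * (E (- axis i 1) x * G x)) \<in> V"
      by (intro Vadd Vscale VE G)
    moreover have "(cis (- c / L) / 2) * (E (axis i 1) x * G x) + (cis (c / L) / 2) * (E (- axis i 1) x * G x) = of_real (cos ((x $ i - c) / L)) * G x" for x
    proof -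
      have "lat (- axis i 1) = - lat (axis i 1)" by (simp add: vec_eq_iff)
      then have "lat (- axis i 1) \<bullet> x = - (x $ i)" by (simp add: lat_axis)
      then have "cis (- c / L) * E (axis i 1) x = cis ((x $ i - c) / L)" "cis (c / L) * E (- axis i 1) x = cis (- ((x $ i - c) / L))"
        unfolding E_def cis_mult lat_axis by (simp_all add: diff_divide_distrib)
      moreover have "cis t + cis (- t) = 2 * of_real (cos t)" for t by (simp add: complex_eq_iff)
      moreover have "(a / 2) * (u * g) + (b / 2) * (v * g) = (a * u + b * v) * g / 2" for a b u v g :: complex
        by (simp add: distrib_right add_divide_distrib mult.assoc)
      ultimately show ?thesis by (simp only:) simp
    qed
    ultimately show ?thesis by simp
  qed
  have Vpoly: "\<forall>G\<in>V. (\<lambda>x. of_real (p (cos ((x $ i - c) / L))) * G x) \<in> V" if "real_polynomial_function p" for p i c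
    using that
  proof induction
    case (linear f)
    have f: "f u = f 1 * u" for u using linear_cmul[OF bounded_linear.linear[OF linear], of u 1] by simp
    show ?case
    proof
      fix G assume "G \<in> V"
      then have "(\<lambda>x. of_real (f 1) * (of_real (cos ((x $ i - c) / L)) * G x)) \<in> V" by (intro Vscale Vcos)
      then show "(\<lambda>x. of_real (f (cos ((x $ i - c) / L))) * G x) \<in> V" by (subst f) (simp add: mult.assoc)
    qed
  next
    case (const c) then show ?case by (auto intro: Vscale)
  next
    case (add f g) then show ?case by (auto simp: distrib_right intro: Vadd)
  next
    case (mult f g) then show ?case by (auto simp: mult.assoc)
  qed
  define l where "l i = max (lo $ i) (- (pi * L))" for i
  define h where "h i = min (hi $ i) (pi * L)" for i
  show "(LBINT x. indicator (box lo hi) x *\<^sub>R b x) = 0"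
  proof (cases "\<forall>i. l i < h i")
    case False
    then obtain i where i: "h i \<le> l i" by (auto simp: not_less)
    have "indicator (box lo hi) x *\<^sub>R b x = 0" for x
    proof (cases "x \<in> box lo hi \<and> x \<in> cube L")
      case True
      then have "lo $ i < x $ i" "x $ i < hi $ i" "- (pi * L) \<le> x $ i" "x $ i < pi * L" by (auto simp: mem_box_cart cube_def)
      then show ?thesis using i by (simp add: l_def h_def)
    qed (use b(2) in auto)
    then show ?thesis by (simp only:) simp
  next
    case lh: True
    \<comment> \<open>Centre of the clipped interval; \<open>w i\<close> is its half-width as an
      angle, so that the threshold cos (w i) singles out the interval within the cube.\<close>
    define c where "c i = (l i + h i) / 2" for i
    define w where "w i = (h i - l i) / (2 * L)" for i
    define th where "th i x = (x $ i - c i) / L" for i and x :: "real^3"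
    have lb: "- (pi * L) \<le> l i" "h i \<le> pi * L" for i by (auto simp: l_def h_def)
    have w: "0 < w i" "w i \<le> pi" for i
    proof -
      show "0 < w i" using lh L by (simp add: w_def)
      have "h i - l i \<le> pi * (2 * L)" using lb[of i] by simp
      then show "w i \<le> pi" using L by (simp add: w_def pos_divide_le_eq)
    qed
    have iv: "cos (w i) < cos (th i x) \<longleftrightarrow> l i < x $ i \<and> x $ i < h i" if "x \<in> cube L" for x i
    proof -
      have x: "- (pi * L) \<le> x $ i" "x $ i < pi * L" using that by (auto simp: cube_def)
      have wL: "w i * L = (h i - l i) / 2" using L by (simp add: w_def)
      have "\<bar>x $ i - c i\<bar> \<le> 2 * (pi * L) - w i * L" unfolding wL c_def abs_le_iff using x lb[of i] by (simp add: field_simps)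
      then have "\<bar>x $ i - c i\<bar> \<le> (2 * pi - w i) * L" by (simp add: left_diff_distrib)
      then have "\<bar>th i x\<bar> \<le> 2 * pi - w i" using L by (simp add: th_def pos_divide_le_eq)
      then have "cos (w i) < cos (th i x) \<longleftrightarrow> \<bar>th i x\<bar> < w i" by (rule cos_threshold[OF w])
      also have "\<dots> \<longleftrightarrow> \<bar>x $ i - c i\<bar> < w i * L" using L by (simp add: th_def pos_divide_less_eq)
      also note wL
      also have "\<bar>x $ i - c i\<bar> < (h i - l i) / 2 \<longleftrightarrow> l i < x $ i \<and> x $ i < h i" by (auto simp: c_def abs_less_iff field_simps)
      finally show ?thesis .
    qed
    have "\<exists>p :: nat => real => real. \<forall>n. real_polynomial_function (p n) \<and> (\<forall>u. \<bar>u\<bar> \<le> 1 \<longrightarrow> \<bar>p n u\<bar> \<le> 2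
       \<and> (\<lambda>n. p n u) \<longlonglongrightarrow> (if cos (w i) < u then 1 else 0))" for i
      by (rule threshold_polynomials[of "cos (w i)"]) blast
    then obtain p :: "3 => nat => real => real" where p: "\<And>i n. real_polynomial_function (p i n)" "\<And>i n u. \<bar>u\<bar> \<le> 1 \<Longrightarrow> \<bar>p i n u\<bar> \<le> 2"
      "\<And>i u. \<bar>u\<bar> \<le> 1 \<Longrightarrow> (\<lambda>n. p i n u) \<longlonglongrightarrow> (if cos (w i) < u then 1 else 0)" by metis
    define P where "P n x = complex_of_real (p 1 n (cos (th 1 x))) * (of_real (p 2 n (cos (th 2 x))) * (of_real (p 3 n (cos (th 3 x))) * 1))" for n x
    have PV: "P n \<in> V" for n
      unfolding P_def[abs_def] th_def by (intro bspec[OF Vpoly[OF p(1)]] V1)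
    then have P0: "(LBINT x. b x * P n x) = 0" for n
    proof -
      have "(LBINT x. b x * (P n x * E 0 x)) = 0" using PV by (auto simp: V_def)
      moreover have "E 0 x = 1" for x by (simp add: E_def lat_def inner_vec_def)
      ultimately show ?thesis by simp
    qed
    have "(\<lambda>n. LBINT x. b x * P n x) \<longlonglongrightarrow> (LBINT x. indicator (box lo hi) x *\<^sub>R b x)"
    proof (rule integral_dominated_convergence[where w = "\<lambda>x. 8 * norm (b x)"])
      show "integrable lborel (\<lambda>x. 8 * norm (b x))" by (intro integrable_mult_right integrable_norm b(1))
      show "(\<lambda>x. b x * P n x) \<in> borel_measurable lborel" for n using PV[of n] by (auto simp: V_def)
      show "AE x in lborel. norm (b x * P n x) \<le> 8 * norm (b x)" for n
      proof (rule AE_I2)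
        fix x
        have "\<bar>p 1 n (cos (th 1 x))\<bar> * (\<bar>p 2 n (cos (th 2 x))\<bar> * \<bar>p 3 n (cos (th 3 x))\<bar>) \<le> 2 * (2 * 2)"
          by (intro mult_mono p(2)) auto
        then have "norm (P n x) \<le> 8" by (simp add: P_def norm_mult)
        from mult_left_mono[OF this norm_ge_zero[of "b x"]] show "norm (b x * P n x) \<le> 8 * norm (b x)" by (simp add: norm_mult mult.commute)
      qed
      \<comment> \<open>On the lower faces, which belong to the half-open cube, the clipped bound l
        i can equal x $ i although x lies in the box; these faces are null sets.\<close>
      show "AE x in lborel. (\<lambda>n. b x * P n x) \<longlonglongrightarrow> indicator (box lo hi) x *\<^sub>R b x"
        using AE_lborel_off_hyperplanes[of "- (pi * L)"]
      proof eventually_elim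
        fix x :: "real^3" assume off: "\<forall>i. x $ i \<noteq> - (pi * L)"
        show "(\<lambda>n. b x * P n x) \<longlonglongrightarrow> indicator (box lo hi) x *\<^sub>R b x"
        proof (cases "x \<in> cube L")
          case True
          define q where "q i = (if cos (w i) < cos (th i x) then 1 else 0 :: real)" for i
          have "(\<lambda>n. p i n (cos (th i x))) \<longlonglongrightarrow> q i" for i unfolding q_def by (rule p(3)) simp
          then have "(\<lambda>n. b x * P n x) \<longlonglongrightarrow> b x * (of_real (q 1) * (of_real (q 2) * (of_real (q 3) * 1)))"
            unfolding P_def by (intro tendsto_intros)
          moreover have "x \<in> box lo hi \<longleftrightarrow> (\<forall>i. l i < x $ i \<and> x $ i < h i)"
          proof -
            have "- (pi * L) < x $ i" "x $ i < pi * L" for i using True off by (auto simp: cube_def less_le)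
            then show ?thesis by (auto simp: mem_box_cart l_def h_def)
          qed
          then have "of_real (q 1) * (of_real (q 2) * (of_real (q 3) * 1)) = (indicator (box lo hi) x :: complex)"
            unfolding iv[OF True, symmetric] forall_3 by (simp add: q_def indicator_def)
          moreover have "indicator (box lo hi) x *\<^sub>R b x = b x * indicator (box lo hi) x" by (simp add: indicator_def)
          ultimately show ?thesis by (simp only:)
        qed (use b(2) in simp)
      qed
    qed auto
    then show ?thesis unfolding P0 using LIMSEQ_unique[OF tendsto_const] by metis
  qed
qed

section \<open>Complex exponentials, the shifted lattice and the symbol\<close>

definition lform :: "real^3 => real^3 => real^3 => complex" where
  "lform a w x = \<i> * of_real (a \<bullet> x) - of_real (w \<bullet> x)"

text \<open>The exponential e^(i \<zeta> . x) for the complex frequency \<zeta> = a + i w; \<zeta> .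
  \<zeta> has real part a . a - w . w and imaginary part 2 a . w.\<close>

definition cexp :: "real^3 => real^3 => real^3 => complex" where
  "cexp a w x = exp (lform a w x)"

lemma bounded_linear_lform: "bounded_linear (lform a w)"
  unfolding lform_def[abs_def]
  by (intro bounded_linear_sub bounded_linear_compose[OF bounded_linear_mult_right]
    bounded_linear_compose[OF bounded_linear_of_real] bounded_linear_inner_right)

lemma cexp_has_derivative: "(cexp a w has_derivative (\<lambda>h. cexp a w x * lform a w h)) (at x)"
proof -
  have "(lform a w has_derivative lform a w) (at x)" by (rule bounded_linear_imp_has_derivative[OF bounded_linear_lform])
  from has_derivative_compose[OF this, of exp "\<lambda>h. exp (lform a w x) * h"]
  show ?thesis using DERIV_exp[of "lform a w x"] by (simp add: has_field_derivative_def cexp_def[abs_def])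
qed

lemma Ck_on_cexp: "Ck_on k UNIV (cexp a w)"
proof (induction k)
  case 0 show ?case using cexp_has_derivative has_derivative_continuous by (simp add: continuous_on_eq_continuous_at) blast
next
  case (Suc k) show ?case
    by (rule Ck_on_SucI[OF open_UNIV cexp_has_derivative]) (intro Ck_on_mult Ck_on_const Suc open_UNIV)
qed

lemma laplacian_cexp: "laplacian (cexp a w) x = - (of_real (a \<bullet> a - w \<bullet> w) + 2 * \<i> * of_real (a \<bullet> w)) * cexp a w x"
proof -
  have "laplacian (cexp a w) x = (\<Sum>b\<in>Basis. (cexp a w x * lform a w b) * lform a w b)"
    by (rule laplacian_eqI[OF open_UNIV UNIV_I cexp_has_derivative]) (intro has_derivative_mult_left cexp_has_derivative)
  also have "\<dots> = cexp a w x * (\<Sum>b\<in>Basis. - of_real ((a \<bullet> b) * (a \<bullet> b)) + of_real ((w \<bullet> b) * (w \<bullet> b)) - 2 * \<i> * of_real ((a \<bullet> b) * (w \<bullet> b)))"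
    unfolding sum_distrib_left
  proof (intro sum.cong refl)
    fix b :: "real^3"
    have "lform a w b * lform a w b = - of_real ((a \<bullet> b) * (a \<bullet> b)) + of_real ((w \<bullet> b) * (w \<bullet> b)) - 2 * \<i> * of_real ((a \<bullet> b) * (w \<bullet> b))"
      by (simp add: lform_def complex_eq_iff algebra_simps)
    then show "(cexp a w x * lform a w b) * lform a w b = cexp a w x * (- of_real ((a \<bullet> b) * (a \<bullet> b)) + of_real ((w \<bullet> b) * (w \<bullet> b)) - 2 * \<i> * of_real ((a \<bullet> b) * (w \<bullet> b)))"
      by (simp only: mult.assoc)
  qed
  also have "\<dots> = cexp a w x * (- of_real (a \<bullet> a) + of_real (w \<bullet> w) - 2 * \<i> * of_real (a \<bullet> w))"
    unfolding sum_subtractf sum.distrib sum_negf sum_distrib_left[symmetric] of_real_sum[symmetric] euclidean_inner[of a a, symmetric]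
      euclidean_inner[of w w, symmetric] euclidean_inner[of a w, symmetric] ..
  finally show ?thesis by (simp add: algebra_simps)
qed

lemma cexp_add: "cexp a w x * cexp a' w' x = cexp (a + a') (w + w') x"
  by (simp add: cexp_def lform_def inner_add_left algebra_simps flip: exp_add)

lemma cexp_cis: "cexp a w x * cis (b \<bullet> x) = cexp (a + b) w x"
  using cexp_add[of a w x b 0] by (simp add: cexp_def lform_def cis_conv_exp)

lemma norm_cexp: "norm (cexp a w x) \<le> exp (norm w * norm x)"
proof -
  have "- (w \<bullet> x) \<le> norm w * norm x" using Cauchy_Schwarz_ineq2[of w x] by linarith
  then show ?thesis by (simp add: cexp_def lform_def)
qed

lemma cexp_borel [measurable]: "cexp a w \<in> borel_measurable borel"
  using Ck_on_cexp[of 0 a w] by (auto intro: borel_measurable_continuous_onI)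

text \<open>As \<open>f\<close> is (\<Delta> + \<kappa>^2) of its potential, which here has bounded
  support, integration by parts against e^(i \<zeta> . x) produces the factor \<kappa>^2 - \<zeta> .
  \<zeta>. The cut-off turns the exponential into an admissible function without changing it on the
  supports.\<close>

lemma exponential_moment:
  assumes f: "dens B A f" and A: "A > 0" and \<kappa>: "\<kappa> > 0" and W: "\<And>x. norm x > A \<Longrightarrow> pot \<kappa> f x = 0"
  shows "(LBINT x. f x * cexp a w x) = (of_real (\<kappa>\<^sup>2 - (a \<bullet> a - w \<bullet> w)) - 2 * \<i> * of_real (a \<bullet> w)) * (LBINT x. pot \<kappa> f x * cexp a w x)"
proof -
  define \<phi> where "\<phi> x = cutoff (A + 1) x * cexp a w x" for x
  have A1: "A + 1 > 0" using A by simp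
  have \<phi>: "Ck_on 2 UNIV \<phi>" "bsupp \<phi>"
    unfolding \<phi>_def[abs_def] by (intro Ck_on_mult Ck_on_cutoff Ck_on_cexp open_UNIV) (intro bsupp_mult_left bsupp_cutoff A1)
  define c :: complex where "c = of_real (\<kappa>\<^sup>2 - (a \<bullet> a - w \<bullet> w)) - 2 * \<i> * of_real (a \<bullet> w)"
  have \<phi>1: "\<phi> x = cexp a w x" if "norm x < A + 1" for x using cutoff_1[OF A1, of x] that by (simp add: \<phi>_def)
  have "(LBINT x. f x * cexp a w x) = (LBINT x. f x * \<phi> x)"
  proof (rule bint_cong)
    fix x show "f x * cexp a w x = f x * \<phi> x"
      using \<phi>1[of x] densD(4)[OF f, of x] by (cases "f x = 0") auto
  qed simp
  also have "\<dots> = (LBINT x. pot \<kappa> f x * helm \<kappa> \<phi> x)" by (rule pot_dens(4)[OF f \<phi> \<kappa>, symmetric])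
  also have "\<dots> = (LBINT x. c * (pot \<kappa> f x * cexp a w x))"
  proof (rule bint_cong)
    fix x
    show "pot \<kappa> f x * helm \<kappa> \<phi> x = c * (pot \<kappa> f x * cexp a w x)"
    proof (cases "norm x > A")
      case False
      then have x: "x \<in> ball 0 (A + 1)" by simp
      have "laplacian \<phi> x = laplacian (cexp a w) x" by (rule laplacian_cong_open[OF open_ball x]) (simp add: \<phi>1)
      then have "helm \<kappa> \<phi> x = c * cexp a w x"
        using \<phi>1[of x] x unfolding laplacian_cexp c_def by (simp add: algebra_simps)
      then show ?thesis by simp
    qed (use W in simp)
  qed simp
  also have "\<dots> = c * (LBINT x. pot \<kappa> f x * cexp a w x)" by (rule integral_mult_right_zero)
  finally show ?thesis unfolding c_def .
qed

definition lattice_point :: "nat => int^3" where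
  "lattice_point = from_nat_into UNIV"

lemma bij_lattice_point: "bij lattice_point"
proof -
  have "inj (\<lambda>z::int. (\<chi> i. z) :: int^3)" by (auto simp: inj_def vec_eq_iff)
  then have "infinite (UNIV :: (int^3) set)" using finite_imageD[of "\<lambda>z::int. (\<chi> i. z) :: int^3" UNIV] infinite_UNIV_int
    by (metis finite_subset subset_UNIV)
  then show ?thesis unfolding lattice_point_def by (intro bij_betw_from_nat_into) auto
qed

text \<open>The shift \<open>s\<close> makes the characters quasi-periodic and serves to move the
  frequencies off the zeros of the symbol.\<close>

definition freq :: "real => real^3 => nat => real^3" where
  "freq L s n = (1 / L) *\<^sub>R (lat (lattice_point n) + s)"

text \<open>The shift cancels in the product of one function with the conjugate of another; for
  completeness, the factor cis (s . x / L) is absorbed into \<open>h\<close>.\<close>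

lemma cube_ortho_system:
  assumes L: "L > 0"
  shows "ortho_system (restrict_space lborel (cube L)) (\<lambda>n x. cis (freq L s n \<bullet> x))"
proof -
  define M where "M = restrict_space lborel (cube L)"
  have Q: "cube L \<inter> space lborel \<in> sets lborel" by simp
  have fin: "emeasure lborel (cube L) < \<infinity>" by (rule emeasure_bounded_finite[OF bounded_cube])
  have sM: "space M = cube L" by (simp add: M_def space_restrict_space)
  have I: "(LINT x|M. f x) = (LBINT x. indicator (cube L) x *\<^sub>R f x)" for f :: "real^3 => complex"
    unfolding M_def by (rule integral_restrict_space[OF Q])
  have cm: "(\<lambda>x. cis (b \<bullet> x)) \<in> borel_measurable borel" for b :: "real^3" unfolding cis_conv_exp by measurable
  interpret finite_measure M
    by (rule finite_measureI) (use fin in \<open>simp add: sM, simp add: M_def emeasure_restrict_space\<close>)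
  have "ortho_system M (\<lambda>n x. cis (freq L s n \<bullet> x))"
  proof
    show "(\<lambda>x. x) \<in> M \<rightarrow>\<^sub>M borel" unfolding M_def by (rule measurable_restrict_space1) simp
    show "(\<lambda>x. cis (freq L s n \<bullet> x)) \<in> borel_measurable borel" for n by (rule cm)
    show "norm (cis (freq L s n \<bullet> x)) = 1" for n x by simp
    show "(LINT x|M. cis (freq L s n \<bullet> x) * cnj (cis (freq L s m \<bullet> x))) = 0" if "n \<noteq> m" for n m
    proof -
      have "lattice_point n \<noteq> lattice_point m" using that bij_lattice_point by (auto dest: bij_is_inj injD)
      then have k: "lattice_point n - lattice_point m \<noteq> 0" by simp
      have "cis (freq L s n \<bullet> x) * cnj (cis (freq L s m \<bullet> x)) = cis ((1 / L) * (lat (lattice_point n - lattice_point m) \<bullet> x))" for x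
        unfolding cis_cnj cis_mult freq_def by (simp add: lat_diff inner_diff_left inner_add_left algebra_simps)
      then show ?thesis unfolding I by (simp only: character_cube_integral[OF L k])
    qed
    have "0 < measure lborel (ball (0::real^3) (pi * L))" using content_ball_pos[of "pi * L" "0::real^3"] L by simp
    also have "\<dots> \<le> measure lborel (cube L)" using fin by (intro measure_mono_fmeasurable ball_subset_cube) (auto simp: fmeasurable_def)
    finally show "measure M (space M) > 0" unfolding sM by (simp add: M_def measure_restrict_space)
    fix h :: "real^3 => complex" and B assume h: "h \<in> borel_measurable borel" "\<And>x. norm (h x) \<le> B" "\<And>n. (LINT x|M. h x * cis (freq L s n \<bullet> x)) = 0"
    define b where "b x = indicator (cube L) x *\<^sub>R (h x * cis ((1 / L) * (s \<bullet> x)))" for x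
    have "AE x in lborel. b x = 0"
    proof (rule torus_uniqueness[OF L])
      show "integrable lborel b" unfolding b_def[abs_def] using h(1) cm[of "(1 / L) *\<^sub>R s"] h(2)
        by (intro integrable_on_cube[where B = B]) (auto simp: norm_mult)
      show "b x = 0" if "x \<notin> cube L" for x using that by (simp add: b_def)
      fix k
      obtain n where n: "lattice_point n = k" using bij_lattice_point by (metis bij_pointE)
      have "b x * cis ((1 / L) * (lat k \<bullet> x)) = indicator (cube L) x *\<^sub>R (h x * cis (freq L s n \<bullet> x))" for x
      proof -
        have "cis ((1 / L) * (s \<bullet> x)) * cis ((1 / L) * (lat k \<bullet> x)) = cis (freq L s n \<bullet> x)"
          unfolding cis_mult freq_def n by (simp add: inner_add_left algebra_simps)
        then show ?thesis by (simp add: b_def mult.assoc)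
      qed
      then show "(LBINT x. b x * cis ((1 / L) * (lat k \<bullet> x))) = 0" using h(3)[of n] unfolding I by (simp only:)
    qed
    then show "AE x in M. h x = 0" unfolding M_def AE_restrict_space_iff[OF Q]
      by eventually_elim (simp add: b_def indicator_eq_0_iff)
  qed
  then show ?thesis by (simp add: M_def)
qed

text \<open>Three factors with exponent -2/3, one per coordinate, bound the power -2 needed in
  dimension 3; each is summable since it decays like |z|^(-4/3).\<close>

lemma sum_int_bounded:
  obtains C where "\<And>K :: int set. finite K \<Longrightarrow> (\<Sum>z\<in>K. (1 + (real_of_int z)\<^sup>2) powr (-2/3)) \<le> C"
proof -
  define \<phi> where "\<phi> t = (1 + t\<^sup>2) powr (-2/3)" for t :: real
  have \<phi>0: "\<phi> t \<ge> 0" for t by (simp add: \<phi>_def)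
  have s: "summable (\<lambda>n. \<phi> (real n))"
  proof (rule summable_comparison_test)
    show "summable (\<lambda>n. real n powr (-4/3))" by (subst summable_real_powr_iff) simp
    show "\<exists>N. \<forall>n\<ge>N. norm (\<phi> (real n)) \<le> real n powr (-4/3)"
    proof (intro exI[of _ 1] allI impI)
      fix n :: nat assume n: "n \<ge> 1"
      have "\<phi> (real n) \<le> ((real n) powr 2) powr (-2/3)" unfolding \<phi>_def using n by (intro powr_mono2') (auto simp: powr_numeral)
      also have "\<dots> = real n powr (-4/3)" unfolding powr_powr by simp
      finally show "norm (\<phi> (real n)) \<le> real n powr (-4/3)" using \<phi>0 by simp
    qed
  qed
  have "(\<Sum>z\<in>K. \<phi> (real_of_int z)) \<le> (\<Sum>n. \<phi> (real n)) + (\<Sum>n. \<phi> (real n))" if K: "finite K" for K :: "int set"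
  proof -
    have half: "(\<Sum>z\<in>J. \<phi> (real_of_int z)) \<le> (\<Sum>n. \<phi> (real n))" if J: "finite J" "inj_on (\<lambda>z. nat \<bar>z\<bar>) J" for J :: "int set"
    proof -
      have "(\<Sum>z\<in>J. \<phi> (real_of_int z)) = (\<Sum>z\<in>J. \<phi> (real (nat \<bar>z\<bar>)))" by (simp add: \<phi>_def)
      also have "\<dots> = (\<Sum>n\<in>(\<lambda>z. nat \<bar>z\<bar>) ` J. \<phi> (real n))" by (subst sum.reindex[OF J(2)]) simp
      also have "\<dots> \<le> (\<Sum>n. \<phi> (real n))" using J(1) by (intro sum_le_suminf s \<phi>0) auto
      finally show ?thesis .
    qed
    have "(\<Sum>z\<in>K. \<phi> (real_of_int z)) = (\<Sum>z\<in>{z\<in>K. z \<ge> 0}. \<phi> (real_of_int z)) + (\<Sum>z\<in>{z\<in>K. z < 0}. \<phi> (real_of_int z))"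
      using K by (subst sum.union_disjoint[symmetric]) (auto intro!: sum.cong)
    also have "\<dots> \<le> (\<Sum>n. \<phi> (real n)) + (\<Sum>n. \<phi> (real n))" using K by (intro add_mono half) (auto simp: inj_on_def)
    finally show ?thesis .
  qed
  then show ?thesis unfolding \<phi>_def by (rule that)
qed

text \<open>Beyond |freq| = 4 |a| the quadratic term dominates, below it the gap \<tau> does, so |p
  n| is at least a multiple of 1 + |freq|^2. The reciprocal squares have order |freq|^-4, which is
  summable over a lattice of dimension 3.\<close>

lemma lattice_sum_summable:
  assumes L: "L > 0" and \<tau>: "\<tau> > 0" and p: "\<And>n. p n = of_real (freq L s n \<bullet> freq L s n + 2 * (a \<bullet> freq L s n)) + 2 * \<i> * of_real (w \<bullet> freq L s n)"
    and gap: "\<And>n. norm (p n) \<ge> \<tau>"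
  shows "summable (\<lambda>n. (norm (1 / p n))\<^sup>2)"
proof -
  obtain S where S: "\<And>K :: int set. finite K \<Longrightarrow> (\<Sum>z\<in>K. (1 + (real_of_int z)\<^sup>2) powr (-2/3)) \<le> S" using sum_int_bounded by blast
  define \<phi> where "\<phi> z = (1 + (real_of_int z)\<^sup>2) powr (-2/3)" for z
  define N where "N n = 1 + freq L s n \<bullet> freq L s n" for n
  have N1: "N n \<ge> 1" for n by (simp add: N_def)
  define D where "D = 1 + 2 * L\<^sup>2 + 2 * (s \<bullet> s)"
  have D: "D > 0" using L unfolding D_def by (intro add_pos_nonneg) auto
  define C where "C = 2 + (1 + 16 * (a \<bullet> a)) / \<tau>"
  have C: "C > 0" using \<tau> by (auto simp: C_def intro!: add_pos_nonneg)
  have NC: "N n \<le> C * norm (p n)" for n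
  proof -
    define r where "r = norm (freq L s n)"
    have r2: "freq L s n \<bullet> freq L s n = r\<^sup>2" by (simp add: r_def power2_norm_eq_inner)
    have t: "1 + 16 * (a \<bullet> a) \<le> (1 + 16 * (a \<bullet> a)) / \<tau> * norm (p n)"
      using mult_left_mono[OF gap[of n], of "(1 + 16 * (a \<bullet> a)) / \<tau>"] \<tau> by simp
    show ?thesis
    proof (cases "r \<le> 4 * norm a")
      case True
      have "r\<^sup>2 \<le> (4 * norm a)\<^sup>2" using True by (intro power_mono) (auto simp: r_def)
      then have "N n \<le> 1 + 16 * (a \<bullet> a)" unfolding N_def r2 by (simp add: power2_norm_eq_inner power_mult_distrib)
      also note t
      also have "(1 + 16 * (a \<bullet> a)) / \<tau> * norm (p n) \<le> C * norm (p n)" by (intro mult_right_mono) (auto simp: C_def)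
      finally show ?thesis .
    next
      case False
      have "\<bar>a \<bullet> freq L s n\<bar> \<le> norm a * r" unfolding r_def by (rule Cauchy_Schwarz_ineq2)
      also have "\<dots> \<le> r / 4 * r" using False by (intro mult_right_mono) (auto simp: r_def)
      finally have "r\<^sup>2 / 2 \<le> Re (p n)" unfolding p r2 by (simp add: power2_eq_square)
      then have "r\<^sup>2 \<le> 2 * norm (p n)" using complex_Re_le_cmod[of "p n"] by simp
      moreover have "1 \<le> 1 + 16 * (a \<bullet> a)" by simp
      ultimately show ?thesis unfolding N_def r2 C_def distrib_right using t by linarith
    qed
  qed
  have kD: "1 + (real_of_int (lattice_point n $ i))\<^sup>2 \<le> D * N n" for n i
  proof -
    define x where "x = freq L s n $ i"
    have k: "lattice_point n $ i = L * x - s $ i" using L by (simp add: x_def freq_def)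
    have "(L * x - t)\<^sup>2 \<le> 2 * L\<^sup>2 * x\<^sup>2 + 2 * t\<^sup>2" for t :: real
      using zero_le_power2[of "L * x + t"] by (simp add: power2_eq_square algebra_simps)
    then have "(real_of_int (lattice_point n $ i))\<^sup>2 \<le> 2 * L\<^sup>2 * x\<^sup>2 + 2 * (s $ i)\<^sup>2" unfolding k .
    moreover have "x\<^sup>2 \<le> freq L s n \<bullet> freq L s n" "(s $ i)\<^sup>2 \<le> s \<bullet> s"
      using component_le_norm_cart[of "freq L s n" i] component_le_norm_cart[of s i]
      unfolding power2_norm_eq_inner[symmetric] x_def by (simp_all add: abs_le_square_iff[symmetric])
    then have "2 * L\<^sup>2 * x\<^sup>2 + 2 * (s $ i)\<^sup>2 \<le> 2 * L\<^sup>2 * (N n - 1) + 2 * (s \<bullet> s)"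
      unfolding N_def by (intro add_mono mult_left_mono) auto
    moreover have "1 + (2 * L\<^sup>2 * (N n - 1) + 2 * (s \<bullet> s)) \<le> D * N n"
    proof -
      have "(2 * (s \<bullet> s) + 1) * 1 \<le> (2 * (s \<bullet> s) + 1) * N n" using N1 by (intro mult_left_mono) auto
      then have "2 * L\<^sup>2 * (N n - 1) + (2 * (s \<bullet> s) + 1) * 1 \<le> (2 * L\<^sup>2 * (N n - 1) + 2 * L\<^sup>2) + (2 * (s \<bullet> s) + 1) * N n"
        by (intro add_mono) auto
      also have "\<dots> = D * N n" by (simp add: D_def algebra_simps)
      finally show ?thesis by simp
    qed
    ultimately show ?thesis by linarith
  qed
  let ?p = "\<lambda>n. \<phi> (lattice_point n $ 1) * (\<phi> (lattice_point n $ 2) * \<phi> (lattice_point n $ 3))"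
  have bound: "(norm (1 / p n))\<^sup>2 \<le> (C * D)\<^sup>2 * ?p n" for n
  proof -
    define X where "X = D * N n"
    have X: "X > 0" unfolding X_def using D N1[of n] by (intro mult_pos_pos) auto
    have f: "X powr (-2/3) \<le> \<phi> (lattice_point n $ i)" for i
      unfolding \<phi>_def X_def using kD by (intro powr_mono2') (auto intro: add_pos_nonneg)
    have pos: "norm (p n) > 0" using gap[of n] \<tau> by linarith
    have "X powr (-2/3) * (X powr (-2/3) * X powr (-2/3)) = X powr (-2)" by (simp flip: powr_add)
    also have "\<dots> = 1 / X\<^sup>2" using X by (simp add: powr_minus powr_numeral divide_inverse)
    finally have P: "1 / X\<^sup>2 \<le> ?p n"
      using mult_mono[OF f[of 1] mult_mono[OF f[of 2] f[of 3]]] by (simp add: \<phi>_def)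
    have "X \<le> (C * D) * norm (p n)" using mult_left_mono[OF NC[of n], of D] D by (simp add: X_def mult_ac)
    then have "X\<^sup>2 \<le> ((C * D) * norm (p n))\<^sup>2" using X by (intro power_mono) auto
    then have "(norm (1 / p n))\<^sup>2 \<le> (C * D)\<^sup>2 * (1 / X\<^sup>2)" using pos X by (simp add: norm_divide power_divide power_mult_distrib divide_simps mult_ac)
    also have "\<dots> \<le> (C * D)\<^sup>2 * ?p n" by (intro mult_left_mono P) simp
    finally show ?thesis .
  qed
  have S0: "S \<ge> 0" using S[of "{}"] by simp
  show ?thesis
  proof (rule summableI_nonneg_bounded)
    fix m
    define K where "K = (\<Union>i. (\<lambda>n. lattice_point n $ i) ` {..<m})"
    have K: "finite K" "(\<Sum>z\<in>K. \<phi> z) \<le> S" using S[of K] by (auto simp: K_def \<phi>_def)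
    define T where "T n = (lattice_point n $ 1, lattice_point n $ 2, lattice_point n $ 3)" for n
    have inj: "inj_on T {..<m}"
      using bij_lattice_point by (auto simp: inj_on_def T_def bij_def vec_eq_iff forall_3)
    have "(\<Sum>n<m. ?p n) = (\<Sum>(x, y, z)\<in>T ` {..<m}. \<phi> x * (\<phi> y * \<phi> z))"
      by (subst sum.reindex[OF inj]) (simp add: T_def)
    also have "\<dots> \<le> (\<Sum>(x, y, z)\<in>K \<times> K \<times> K. \<phi> x * (\<phi> y * \<phi> z))"
      using K(1) by (intro sum_mono2) (auto simp: T_def K_def \<phi>_def)
    also have "\<dots> = (\<Sum>x\<in>K. \<phi> x) * ((\<Sum>x\<in>K. \<phi> x) * (\<Sum>x\<in>K. \<phi> x))"
      unfolding sum_product[of \<phi> K \<phi> K] sum.cartesian_product sum_product[of \<phi> K "\<lambda>(y, z). \<phi> y * \<phi> z"]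
      by (intro sum.cong) auto
    also have "\<dots> \<le> S * (S * S)" using K(2) S0 by (intro mult_mono) (auto simp: \<phi>_def intro!: sum_nonneg)
    finally have "(\<Sum>n<m. ?p n) \<le> S * (S * S)" .
    then have "(C * D)\<^sup>2 * (\<Sum>n<m. ?p n) \<le> (C * D)\<^sup>2 * (S * (S * S))"
      by (intro mult_left_mono) auto
    with sum_mono[of "{..<m}", OF bound] show "(\<Sum>n<m. (norm (1 / p n))\<^sup>2) \<le> (C * D)\<^sup>2 * (S * (S * S))"
      unfolding sum_distrib_left[symmetric] by (meson order_trans)
  qed simp
qed

text \<open>The equation (\<Delta> + \<kappa>^2) u = v u tested with potentials that vanish outside
  the ball of radius \<open>A\<close>. Since f is (\<Delta> + \<kappa>^2) of
  \<open>pot \<kappa> f\<close>, both sides integrate \<open>u\<close> itself and no derivative of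
  \<open>u\<close> occurs.\<close>

definition adjoint_solution :: "real => real => (real^3 => complex) => (real^3 => complex) => bool" where
  "adjoint_solution \<kappa> A v u \<longleftrightarrow> (\<forall>B f. dens B A f \<longrightarrow> (\<forall>x. norm x > A \<longrightarrow> pot \<kappa> f x = 0) \<longrightarrow>
     (LBINT x. f x * u x) = (LBINT x. pot \<kappa> f x * (v x * u x)))"

text \<open>For \<open>w\<close> parallel to an integer vector \<open>m\<close> and a shift with \<open>m \<bullet> s = 1/2\<close>, the numbers
  \<open>w \<bullet> freq L s n\<close> stay away from \<open>0\<close>; this is how the assumption \<open>gap\<close> is met.\<close>

lemma cgo_solution:
  assumes L: "L > 0" and A: "A > 0" "A < pi * L" and \<kappa>: "\<kappa> > 0"
    and v: "v \<in> borel_measurable borel" "\<And>x. norm (v x) \<le> V" "V > 0"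
    and zeta: "a \<bullet> a - w \<bullet> w = \<kappa>\<^sup>2" "a \<bullet> w = 0" and q: "0 < q" "q \<le> 1 / 2"
    and gap: "\<And>n. V \<le> q * \<bar>2 * (w \<bullet> freq L s n)\<bar>"
  obtains \<rho> C where "\<rho> \<in> borel_measurable borel" "\<And>x. norm (\<rho> x) \<le> C"
    "(LBINT x. indicator (cube L) x * (norm (\<rho> x - 1))\<^sup>2) \<le> 4 * q\<^sup>2 * measure lborel (cube L)"
    "adjoint_solution \<kappa> A v (\<lambda>x. cexp a w x * \<rho> x)"
proof -
  define M where "M = restrict_space lborel (cube L)"
  define e where "e n x = cis (freq L s n \<bullet> x)" for n and x :: "real^3"
  interpret ortho_system M e unfolding M_def e_def[abs_def] by (rule cube_ortho_system[OF L])
  \<comment> \<open>For \<zeta> = a + i w with \<zeta> . \<zeta> = \<kappa>^2 and \<alpha> =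
    \<open>freq L s n\<close> this is (\<zeta> + \<alpha>) . (\<zeta> + \<alpha>) - \<kappa>^2. By
    \<open>exponential_moment\<close> the multiplier -1 / p n takes the moments of \<open>F\<close>
    to those of \<open>G\<close>.\<close>
  define p :: "nat => complex" where "p n = of_real (freq L s n \<bullet> freq L s n + 2 * (a \<bullet> freq L s n)) + 2 * \<i> * of_real (w \<bullet> freq L s n)" for n
  have pV: "V \<le> q * norm (p n)" for n
  proof -
    have "\<bar>2 * (w \<bullet> freq L s n)\<bar> \<le> norm (p n)" using abs_Im_le_cmod[of "p n"] by (simp add: p_def)
    then have "q * \<bar>2 * (w \<bullet> freq L s n)\<bar> \<le> q * norm (p n)" using q by (intro mult_left_mono) auto
    then show ?thesis using gap[of n] by linarith
  qed
  have pg: "norm (p n) \<ge> V / q" for n using pV[of n] q by (simp add: pos_divide_le_eq mult.commute)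
  have p0: "norm (p n) > 0" for n using pg[of n] divide_pos_pos[OF v(3) q(1)] by linarith
  define m where "m n = - 1 / p n" for n
  have m: "summable (\<lambda>n. (norm (m n))\<^sup>2)"
    using lattice_sum_summable[OF L divide_pos_pos[OF v(3) q(1)] p_def pg] by (simp add: m_def norm_divide)
  have mV: "norm (m n) * V \<le> q" for n using pV[of n] p0[of n] by (simp add: m_def norm_divide pos_divide_le_eq)
  obtain \<rho> where \<rho>: "bm \<rho>" "energy (\<lambda>x. \<rho> x - 1) \<le> 4 * q\<^sup>2 * \<mu>"
    and adj: "\<forall>F G. bm F \<longrightarrow> bm G \<longrightarrow> (\<forall>n. (LINT x|M. G x * e n x) = m n * (LINT x|M. F x * e n x)) \<longrightarrow> (LINT x|M. F x) = 0
      \<longrightarrow> (LINT x|M. F x * \<rho> x) = (LINT x|M. G x * (v x * \<rho> x))"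
    by (rule neumann_solution[OF m mV q v]) (rule that)
  have Q: "cube L \<inter> space lborel \<in> sets lborel" by simp
  obtain C where C: "\<And>x. norm (\<rho> x) \<le> C" using \<rho>(1) by (auto simp: bm_def)
  show ?thesis
  proof
    show "\<rho> \<in> borel_measurable borel" by (rule bmD(1)[OF \<rho>(1)])
    show "norm (\<rho> x) \<le> C" for x by (rule C)
    have "\<mu> = measure lborel (cube L)" unfolding \<mu>_def unfolding M_def by (simp add: measure_restrict_space space_restrict_space)
    moreover have "energy (\<lambda>x. \<rho> x - 1) = (LBINT x. indicator (cube L) x * (norm (\<rho> x - 1))\<^sup>2)"
      unfolding energy_def unfolding M_def by (simp add: integral_restrict_space[OF Q])
    ultimately show "(LBINT x. indicator (cube L) x * (norm (\<rho> x - 1))\<^sup>2) \<le> 4 * q\<^sup>2 * measure lborel (cube L)" using \<rho>(2) by simp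
    show "adjoint_solution \<kappa> A v (\<lambda>x. cexp a w x * \<rho> x)"
      unfolding adjoint_solution_def
    proof (intro allI impI)
    fix B f assume f: "dens B A f" and W': "\<forall>x. norm x > A \<longrightarrow> pot \<kappa> f x = 0"
    have W: "pot \<kappa> f x = 0" if "norm x > A" for x using W' that by blast
    define F where "F x = f x * cexp a w x" for x
    define G where "G x = pot \<kappa> f x * cexp a w x" for x
    have z: "F x = 0" "G x = 0" if "norm x > A" for x using that W densD(3)[OF f] by (auto simp: F_def G_def)
    have MI: "(LINT x|M. g x) = (LBINT x. g x)" if "\<And>x. norm x > A \<Longrightarrow> g x = 0" for g :: "real^3 => complex"
    proof -
      have "indicator (cube L) x *\<^sub>R g x = g x" for x
      proof (cases "norm x > A")
        case False then have "x \<in> cube L" using ball_subset_cube[of L] A by auto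
        then show ?thesis by simp
      qed (use that in simp)
      then show ?thesis unfolding M_def integral_restrict_space[OF Q] by (simp only:)
    qed
    have eb: "norm (cexp a w x) \<le> exp (norm w * A)" if "norm x \<le> A" for x
      by (rule order_trans[OF norm_cexp]) (use that in \<open>simp add: mult_left_mono\<close>)
    have B0: "B \<ge> 0" by (rule densD(5)[OF f])
    have bF: "bm F"
    proof -
      have "norm (F x) \<le> B * exp (norm w * A)" for x
      proof (cases "norm x > A")
        case False then show ?thesis unfolding F_def norm_mult using eb[of x] densD(2)[OF f] B0 by (intro mult_mono) auto
      qed (use z B0 in simp)
      then show ?thesis unfolding bm_def F_def[abs_def] using densD(1)[OF f] by auto
    qed
    have [measurable]: "pot \<kappa> f \<in> borel_measurable borel" by (rule borel_measurable_continuous_onI[OF pot_dens(3)[OF f]])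
    have bG: "bm G"
    proof -
      have "norm (G x) \<le> (B * invnorm (A + A)) * exp (norm w * A)" for x
      proof (cases "norm x > A")
        case False
        have "dens B (2 * A - norm x) f" using f False by (auto simp: dens_def)
        from pot_dens(2)[OF this, of \<kappa> x] have "norm (pot \<kappa> f x) \<le> B * invnorm (A + A)" by simp
        then show ?thesis unfolding G_def norm_mult using eb[of x] False B0 invnorm_nonneg by (intro mult_mono) auto
      qed (use z B0 invnorm_nonneg in simp)
      then show ?thesis unfolding bm_def G_def[abs_def] by auto
    qed
    have mom: "(LBINT x. f x * cexp a w x) = (of_real (\<kappa>\<^sup>2 - (a \<bullet> a - w \<bullet> w)) - 2 * \<i> * of_real (a \<bullet> w)) * (LBINT x. pot \<kappa> f x * cexp a w x)" for a w
      by (rule exponential_moment[OF f A(1) \<kappa> W])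
    \<comment> \<open>The moment at the frequency \<zeta> itself, where the factor \<kappa>^2 -
      \<zeta> . \<zeta> is 0.\<close>
    have "(LBINT x. F x) = 0"
      unfolding F_def mom zeta by simp
    then have F0: "(LINT x|M. F x) = 0" using MI z by simp
    have FG: "(LINT x|M. G x * e n x) = m n * (LINT x|M. F x * e n x)" for n
    proof -
      define \<alpha> where "\<alpha> = freq L s n"
      have c: "of_real (\<kappa>\<^sup>2 - ((a + \<alpha>) \<bullet> (a + \<alpha>) - w \<bullet> w)) - 2 * \<i> * of_real ((a + \<alpha>) \<bullet> w) = - p n"
        unfolding zeta(1)[symmetric] p_def \<alpha>_def[symmetric] using zeta(2) by (simp add: inner_add_left inner_add_right inner_commute complex_eq_iff)
      have "(LINT x|M. F x * e n x) = (LBINT x. f x * cexp (a + \<alpha>) w x)"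
        unfolding cexp_cis[symmetric] using MI[of "\<lambda>x. F x * e n x"] z by (simp add: F_def e_def \<alpha>_def mult.assoc)
      also have "\<dots> = - p n * (LBINT x. pot \<kappa> f x * cexp (a + \<alpha>) w x)" unfolding mom c ..
      also have "(LBINT x. pot \<kappa> f x * cexp (a + \<alpha>) w x) = (LINT x|M. G x * e n x)"
        unfolding cexp_cis[symmetric] using MI[of "\<lambda>x. G x * e n x"] z by (simp add: G_def e_def \<alpha>_def mult.assoc)
      finally show ?thesis using p0[of n] by (simp add: m_def)
    qed
    have "(LBINT x. F x * \<rho> x) = (LBINT x. G x * (v x * \<rho> x))"
      using adj[rule_format, OF bF bG FG F0] MI[of "\<lambda>x. F x * \<rho> x"] MI[of "\<lambda>x. G x * (v x * \<rho> x)"] z by simp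
    then show "(LBINT x. f x * (cexp a w x * \<rho> x)) = (LBINT x. pot \<kappa> f x * (v x * (cexp a w x * \<rho> x)))"
      by (simp add: F_def G_def mult_ac)
    qed
  qed
qed

section \<open>The orthogonality relation\<close>

lemma dens_mult:
  assumes v: "dens M A v" and u: "u \<in> borel_measurable borel" "\<And>x. norm x \<le> A \<Longrightarrow> norm (u x) \<le> C"
  shows "dens (M * \<bar>C\<bar>) A (\<lambda>x. v x * u x)"
proof -
  have "norm (v x * u x) \<le> M * \<bar>C\<bar>" for x
  proof (cases "v x = 0")
    case False
    then have "norm (u x) \<le> \<bar>C\<bar>" using u(2)[of x] densD(4)[OF v, of x] by linarith
    then show ?thesis unfolding norm_mult using densD(2,5)[OF v] by (intro mult_mono) auto
  qed (use densD(5)[OF v] in simp)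
  then show ?thesis using densD(1,3)[OF v] u(1) by (auto simp: dens_def)
qed

lemma dens_diff:
  assumes f: "dens B A f" and g: "dens C A g" shows "dens (B + C) A (\<lambda>x. f x - g x)"
proof -
  have "norm (f x - g x) \<le> B + C" for x
    using norm_triangle_ineq4 add_mono[OF densD(2)[OF f] densD(2)[OF g]] by (rule order_trans)
  then show ?thesis using densD(1,3)[OF f] densD(1,3)[OF g] by (auto simp: dens_def)
qed

text \<open>For fixed \<open>y\<close> the data are compared only off the diagonal, that is on D -
  {y}. This is non-empty because charts are defined on open sets of the plane, so a surface has no
  isolated points.\<close>

lemma surface_piece_minus_point:
  assumes S: "embedded_surface reg S" and D: "openin (top_of_set S) D" "y \<in> D"
  shows "openin (top_of_set S) (D - {y})" "D - {y} \<noteq> {}"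
proof -
  have y: "y \<in> S" using D openin_imp_subset by blast
  then have c: "closedin (top_of_set S) {y}" by (intro closed_subset) auto
  show "openin (top_of_set S) (D - {y})" by (rule openin_diff[OF D(1) c])
  show "D - {y} \<noteq> {}"
  proof
    assume "D - {y} = {}"
    then have Dy: "D = {y}" using D(2) by auto
    obtain V :: "(real^3) set" and W :: "(real^2) set" and X Z
      where V: "open V" "y \<in> V" and W: "open W" and h: "homeomorphism W (S \<inter> V) X Z"
      using bspec[OF S[unfolded embedded_surface_def] y] by (elim exE conjE) blast
    obtain T where T: "open T" "D = S \<inter> T" using D(1) by (auto simp: openin_open)
    have Zy: "Z y \<in> W" "X (Z y) = y" using h V(2) y by (auto simp: homeomorphism_def)
    have "continuous_on W X" using h by (simp add: homeomorphism_def)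
    then obtain O' where O': "open O'" "O' \<inter> W = X -` T \<inter> W"
      using T(1) unfolding continuous_on_open_invariant by blast
    have "O' \<inter> W = {Z y}"
    proof
      have "X u = y \<and> u = Z (X u)" if "u \<in> O' \<inter> W" for u
      proof -
        have "X u \<in> S \<inter> V" "Z (X u) = u" using h that by (auto simp: homeomorphism_def)
        moreover have "X u \<in> T" using that O'(2) by blast
        ultimately show ?thesis using T(2) Dy by auto
      qed
      then show "O' \<inter> W \<subseteq> {Z y}" by auto
      have "y \<in> T" using T(2) D(2) by auto
      then show "{Z y} \<subseteq> O' \<inter> W" using O'(2) Zy by auto
    qed
    moreover have "open (O' \<inter> W)" using O'(1) W by auto
    ultimately show False using not_open_singleton[of "Z y"] by simp
  qed
qed

definition bounded_borel_on :: "real => (real^3 => complex) => bool" where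
  "bounded_borel_on A u \<longleftrightarrow> u \<in> borel_measurable borel \<and> (\<exists>C. \<forall>x. norm x \<le> A \<longrightarrow> norm (u x) \<le> C)"

lemma bounded_borel_on_pot: "dens B A f \<Longrightarrow> bounded_borel_on A' (pot \<kappa> f)"
  using pot_dens(3)[of B A f \<kappa>] continuous_bounded_cball[of "pot \<kappa> f" A']
  by (auto simp: bounded_borel_on_def intro: borel_measurable_continuous_onI)

lemma dens_bounded_borel:
  assumes "dens M A v" "bounded_borel_on A u" obtains B where "dens B A (\<lambda>x. v x * u x)"
  using assms dens_mult unfolding bounded_borel_on_def by metis

text \<open>For \<open>y\<close> in the observed piece of the surface, \<open>R\<^sub>1(\<cdot>,y) - R\<^sub>2(\<cdot>,y)\<close> is a potential whose
  imaginary part vanishes on \<open>U\<close>, hence it vanishes on \<open>U\<close>. Testing with \<open>u\<^sub>1\<close> turns this into the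
  vanishing on the surface of the solution \<open>\<Phi>\<close> of an equation with right-hand side \<open>(v\<^sub>1 - v\<^sub>2) u\<^sub>1\<close>, and
  testing \<open>\<Phi>\<close> with \<open>u\<^sub>2\<close> gives the orthogonality relation.\<close>

lemma products_orthogonal:
  assumes \<kappa>: "\<kappa> > 0" and U: "open U" "connected U" "\<And>x. norm x > A \<Longrightarrow> x \<in> U" and A: "A > 0"
    and K: "compact K" "U \<inter> K = {}"
    and v1: "dens M A v1" "\<And>x. x \<notin> K \<Longrightarrow> v1 x = 0" and v2: "dens M A v2" "\<And>x. x \<notin> K \<Longrightarrow> v2 x = 0"
    and inj: "\<forall>B g. dens B A g \<longrightarrow> (\<forall>x. g x = v2 x * pot \<kappa> g x) \<longrightarrow> (\<forall>z. pot \<kappa> g z = 0)"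
    and \<psi>c: "\<And>y. continuous_on (- {y}) (\<psi>1 y)" "\<And>y. continuous_on (- {y}) (\<psi>2 y)"
    and ls1: "\<And>x y. y \<in> U \<Longrightarrow> x \<noteq> y \<Longrightarrow> \<psi>1 y x = - Gplus (x - y) \<kappa> + pot \<kappa> (\<lambda>z. v1 z * \<psi>1 y z) x"
    and ls2: "\<And>x y. y \<in> U \<Longrightarrow> x \<noteq> y \<Longrightarrow> \<psi>2 y x = - Gplus (x - y) \<kappa> + pot \<kappa> (\<lambda>z. v2 z * \<psi>2 y z) x"
    and B: "open B" "bounded B" "closure B \<subseteq> U" "real_analytic_surface (frontier B)" "connected (frontier B)"
    and nd: "\<not> dirichlet_eigenvalue \<kappa> B" and D: "openin (top_of_set (frontier B)) D" "D \<noteq> {}"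
    and im: "\<And>x y. x \<in> D \<Longrightarrow> y \<in> D \<Longrightarrow> x \<noteq> y \<Longrightarrow> Im (\<psi>1 y x) = Im (\<psi>2 y x)"
    and u1: "adjoint_solution \<kappa> A v1 u1" "bounded_borel_on A u1" and u2: "adjoint_solution \<kappa> A v2 u2" "bounded_borel_on A u2"
  shows "(LBINT x. (v1 x - v2 x) * u1 x * u2 x) = 0"
proof -
  have clK: "closed K" using K(1) by (rule compact_imp_closed)
  have DU: "y \<in> U" if "y \<in> D" for y using that openin_imp_subset[OF D(1)] B(3) by (auto simp: frontier_def)
  obtain Bh where h': "dens Bh A (\<lambda>x. (v1 x - v2 x) * u1 x)" using dens_bounded_borel[OF dens_diff[OF v1(1) v2(1)] u1(2)] .
  define h where "h x = (v1 x - v2 x) * u1 x" for x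
  have h: "dens Bh A h" using h' by (simp add: h_def[abs_def])
  \<comment> \<open>The outgoing solution of (\<Delta> + \<kappa>^2 - v2) \<Phi> = - h, written as
    \<Phi> = \<open>pot \<kappa> g\<close>.\<close>
  obtain Bg g where g: "dens Bg A g" and gh: "\<And>x. g x = v2 x * pot \<kappa> g x - h x"
    by (rule lippmann_schwinger_solvable[OF v2(1) A inj h]) (rule that, assumption, blast)
  define \<Phi> where "\<Phi> = pot \<kappa> g"
  have g0: "g x = 0" if "x \<notin> K" for x using gh[of x] v1(2)[OF that] v2(2)[OF that] by (simp add: h_def)
  have \<Phi>D: "\<Phi> y = 0" if y: "y \<in> D" for y
  proof -
    have yU: "y \<in> U" and yK: "y \<notin> K" using DU[OF y] K(2) by auto
    obtain C1 where F1: "dens C1 A (\<lambda>x. v1 x * \<psi>1 y x)" using dens_mult_off_point[OF v1 K(1) yK \<psi>c(1)] .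
    obtain C2 where F2: "dens C2 A (\<lambda>x. v2 x * \<psi>2 y x)" using dens_mult_off_point[OF v2 K(1) yK \<psi>c(2)] .
    define f where "f x = v1 x * \<psi>1 y x - v2 x * \<psi>2 y x" for x
    have f: "dens (C1 + C2) A f" unfolding f_def[abs_def] by (rule dens_diff[OF F1 F2])
    have f0: "f x = 0" if "x \<notin> K" for x using v1(2)[OF that] v2(2)[OF that] by (simp add: f_def)
    have W: "pot \<kappa> f x = \<psi>1 y x - \<psi>2 y x" if "x \<noteq> y" for x
      unfolding f_def[abs_def] pot_add_scaleR(3)[OF F1 F2] using ls1[OF yU that] ls2[OF yU that] by simp
    have "Im (pot \<kappa> f x) = 0" if "x \<in> D - {y}" for x using im[OF _ y, of x] W[of x] that by simp
    then have "Im (pot \<kappa> f x) = 0" if "x \<in> U" for x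
      using pot_vanishing_on_surface_piece(2)[OF f \<kappa> clK f0 K(2) U(1,2) B nd surface_piece_minus_point[OF B(4) D(1) y]] that by blast
    then have "pot \<kappa> f x = 0" if "x \<in> U" for x
      using pot_zero_if_Im_zero[OF f \<kappa> clK f0 K(2) U] that by blast
    then have adj: "(LBINT x. f x * u1 x) = (LBINT x. pot \<kappa> f x * (v1 x * u1 x))"
      using u1(1) f U(3) unfolding adjoint_solution_def by blast
    obtain c1 where d1: "dens c1 A (\<lambda>x. f x * u1 x)" using dens_bounded_borel[OF f u1(2)] .
    obtain c2 where d2: "dens c2 A (\<lambda>x. v1 x * u1 x)" using dens_bounded_borel[OF v1(1) u1(2)] .
    obtain c3 where d3: "dens c3 A (\<lambda>x. v1 x * u1 x * pot \<kappa> f x)" using dens_bounded_borel[OF d2 bounded_borel_on_pot[OF f]] .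
    \<comment> \<open>Off \<open>y\<close> this is algebra with \<open>pot \<kappa> f\<close> =
      \<psi>1 - \<psi>2. At \<open>y\<close> both \<open>v1\<close> and \<open>v2\<close> vanish, so
      the unconstrained diagonal values do not enter.\<close>
    have p: "\<psi>2 y x * h x = f x * u1 x - v1 x * u1 x * pot \<kappa> f x" for x
    proof (cases "x = y")
      case True then show ?thesis using v1(2)[OF yK] v2(2)[OF yK] by (simp add: h_def f_def)
    qed (simp add: h_def f_def W algebra_simps)
    have z: "(LBINT x. \<psi>2 y x * h x) = 0"
      unfolding p bint_diff[OF dens_integrable(1)[OF d1] dens_integrable(1)[OF d3]] adj by (simp add: mult_ac)
    define F where "F x = v2 x * \<psi>2 y x" for x
    have F: "dens C2 A F" using F2 by (simp add: F_def[abs_def])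
    \<comment> \<open>The integral equation of \<psi>2 is inserted. The bracket integrates to 0 by
      symmetry of the kernel and the last term to \<Phi>(y), so \<Phi>(y) is the pairing of \<psi>2
      with h, already known to vanish.\<close>
    have q: "\<psi>2 y x * h x = (F x * \<Phi> x - g x * pot \<kappa> F x) + Gplus (y - x) \<kappa> * g x" for x
    proof (cases "x = y")
      case True then show ?thesis using v1(2)[OF yK] v2(2)[OF yK] g0[OF yK] by (simp add: h_def F_def)
    next
      case False
      have "h x = v2 x * \<Phi> x - g x" using gh[of x] by (simp add: \<Phi>_def)
      moreover have "Gplus (x - y) \<kappa> = Gplus (y - x) \<kappa>" by (simp add: Gplus_def norm_minus_commute)
      moreover have "\<psi>2 y x = - Gplus (x - y) \<kappa> + pot \<kappa> F x" using ls2[OF yU False] by (simp add: F_def[abs_def])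
      ultimately have "\<psi>2 y x * h x = \<psi>2 y x * (v2 x * \<Phi> x) - (- Gplus (y - x) \<kappa> + pot \<kappa> F x) * g x" by (simp add: right_diff_distrib)
      then show ?thesis by (simp add: F_def algebra_simps)
    qed
    obtain c4 where d4: "dens c4 A (\<lambda>x. F x * \<Phi> x)" unfolding \<Phi>_def using dens_bounded_borel[OF F bounded_borel_on_pot[OF g]] .
    obtain c5 where d5: "dens c5 A (\<lambda>x. g x * pot \<kappa> F x)" using dens_bounded_borel[OF g bounded_borel_on_pot[OF F]] .
    have "(LBINT x. \<psi>2 y x * h x) = ((LBINT x. F x * \<Phi> x) - (LBINT x. g x * pot \<kappa> F x)) + pot \<kappa> g y"
      unfolding q pot_def[of \<kappa> g y]
      using dens_integrable(1)[OF d4] dens_integrable(1)[OF d5] pot_dens(1)[OF g]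
      by (subst bint_add) (auto simp: bint_diff)
    moreover have "(LBINT x. F x * \<Phi> x) = (LBINT x. g x * pot \<kappa> F x)"
      unfolding \<Phi>_def mult.commute[of "g _"]
      by (rule pot_symmetric[OF F g, symmetric])
    ultimately show ?thesis using z by (simp add: \<Phi>_def)
  qed
  have "pot \<kappa> g x = 0" if "x \<in> U" for x
    using pot_vanishing_on_surface_piece(1)[OF g \<kappa> clK g0 K(2) U(1,2) B nd D] \<Phi>D that unfolding \<Phi>_def by blast
  then have adj: "(LBINT x. g x * u2 x) = (LBINT x. pot \<kappa> g x * (v2 x * u2 x))"
    using u2(1) g U(3) unfolding adjoint_solution_def by blast
  obtain c1 where d1: "dens c1 A (\<lambda>x. g x * u2 x)" using dens_bounded_borel[OF g u2(2)] .
  obtain c2 where d2: "dens c2 A (\<lambda>x. v2 x * u2 x)" using dens_bounded_borel[OF v2(1) u2(2)] .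
  obtain c3 where d3: "dens c3 A (\<lambda>x. v2 x * u2 x * pot \<kappa> g x)" using dens_bounded_borel[OF d2 bounded_borel_on_pot[OF g]] .
  have "(v1 x - v2 x) * u1 x * u2 x = v2 x * u2 x * pot \<kappa> g x - g x * u2 x" for x
  proof -
    have "h x = v2 x * pot \<kappa> g x - g x" using gh[of x] by simp
    then show ?thesis unfolding h_def[symmetric] by (simp add: left_diff_distrib)
  qed
  then have "(LBINT x. (v1 x - v2 x) * u1 x * u2 x) = (LBINT x. v2 x * u2 x * pot \<kappa> g x - g x * u2 x)" by (simp only:)
  then show ?thesis
    unfolding bint_diff[OF dens_integrable(1)[OF d3] dens_integrable(1)[OF d1]] adj by (simp add: mult_ac)
qed

text \<open>The frequencies are \<xi>/2 + d \<eta> + i w and \<xi>/2 - d \<eta> - i w with \<xi>,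
  \<eta>, w pairwise orthogonal, which takes three dimensions. One \<open>w\<close> is returned for
  both; the second solution uses -w.\<close>

lemma cgo_parameters:
  fixes k :: "int^3"
  assumes L: "L > 0" and \<kappa>: "\<kappa> > 0" and V: "V > 0" and q: "q > 0"
  obtains a1 a2 w s :: "real^3" where "a1 \<bullet> a1 - w \<bullet> w = \<kappa>\<^sup>2" "a1 \<bullet> w = 0" "a2 \<bullet> a2 - w \<bullet> w = \<kappa>\<^sup>2" "a2 \<bullet> w = 0"
    "a1 + a2 = (1 / L) *\<^sub>R lat k" "\<forall>n. V \<le> q * \<bar>2 * (w \<bullet> freq L s n)\<bar>"
proof -
  define \<xi> where "\<xi> = (1 / L) *\<^sub>R lat k"
  \<comment> \<open>An integer direction for \<open>w\<close>: its products with lattice points are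
    then integer multiples of one number.\<close>
  obtain m :: "int^3" where m: "m \<noteq> 0" "lat m \<bullet> lat k = 0"
  proof (cases "k $ 1 = 0 \<and> k $ 2 = 0")
    case True
    show ?thesis by (rule that[of "axis 1 1"]) (use True in \<open>auto simp: lat_axis\<close>)
  next
    case False
    show ?thesis by (rule that[of "vector [k $ 2, - (k $ 1), 0]"]) (use False in \<open>auto simp: vec_eq_iff forall_3 inner_vec_def sum_3\<close>)
  qed
  define \<omega> where "\<omega> = lat m"
  obtain i where i: "m $ i \<noteq> 0" using m(1) by (auto simp: vec_eq_iff)
  have "1 \<le> \<bar>real_of_int (m $ i)\<bar>" using i by linarith
  also have "\<dots> \<le> norm \<omega>" using component_le_norm_cart[of \<omega> i] by (simp add: \<omega>_def)
  finally have \<omega>1: "1 \<le> norm \<omega>" .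
  then have \<omega>2: "\<omega> \<bullet> \<omega> \<ge> 1" by (simp add: power2_norm_eq_inner[symmetric] power2_eq_square mult_ge1_I)
  have \<xi>\<omega>: "\<xi> \<bullet> \<omega> = 0" using m(2) by (simp add: \<xi>_def \<omega>_def inner_commute)
  have "dim {\<xi>, \<omega>} \<le> card {\<xi>, \<omega>}" by (rule dim_le_card') simp
  also have "\<dots> \<le> 2" by (simp add: card_insert_if)
  finally have "dim {\<xi>, \<omega>} < DIM(real^3)" by simp
  from orthogonal_to_subspace_exists[OF this] obtain e where e: "e \<noteq> 0" "\<And>y. y \<in> span {\<xi>, \<omega>} \<Longrightarrow> orthogonal e y" by blast
  define \<eta> where "\<eta> = e /\<^sub>R norm e"
  have \<eta>: "\<eta> \<bullet> \<eta> = 1" "\<eta> \<bullet> \<xi> = 0" "\<eta> \<bullet> \<omega> = 0"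
    using e by (auto simp: \<eta>_def orthogonal_def span_base power2_norm_eq_inner[symmetric] power2_eq_square)
  \<comment> \<open>The first summand provides the gap. The second makes w at least as long as
    \<xi>, so that the number under the root in \<open>d\<close> is nonnegative.\<close>
  define c where "c = V * L / q + norm \<xi>"
  define w where "w = c *\<^sub>R \<omega>"
  \<comment> \<open>Then \<omega> . s = 1/2, and 2 w . freq is c/L times an odd integer, hence at
    least c/L in absolute value.\<close>
  define s where "s = (1 / (2 * (\<omega> \<bullet> \<omega>))) *\<^sub>R \<omega>"
  have cp: "c > 0" using V L q by (auto simp: c_def intro!: add_pos_nonneg)
  define d where "d = sqrt (\<kappa>\<^sup>2 + w \<bullet> w - \<xi> \<bullet> \<xi> / 4)"
  have "\<xi> \<bullet> \<xi> \<le> w \<bullet> w"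
  proof -
    have "norm \<xi> \<le> c * 1" using V L q by (simp add: c_def)
    also have "\<dots> \<le> c * norm \<omega>" using \<omega>1 cp by (intro mult_left_mono) auto
    finally have "norm \<xi> \<le> norm w" using cp by (simp add: w_def)
    then show ?thesis by (simp add: norm_le)
  qed
  then have "\<kappa>\<^sup>2 + w \<bullet> w - \<xi> \<bullet> \<xi> / 4 \<ge> 0" using inner_ge_zero[of \<xi>] zero_le_power2[of \<kappa>] by linarith
  then have d: "d * d = \<kappa>\<^sup>2 + w \<bullet> w - \<xi> \<bullet> \<xi> / 4" by (simp add: d_def)
  have w\<xi>: "\<xi> \<bullet> w = 0" "\<eta> \<bullet> w = 0" using \<xi>\<omega> \<eta> by (simp_all add: w_def)
  show ?thesis
  proof (rule that[of "(1/2) *\<^sub>R \<xi> + d *\<^sub>R \<eta>" w "(1/2) *\<^sub>R \<xi> - d *\<^sub>R \<eta>" s])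
    show "((1/2) *\<^sub>R \<xi> + d *\<^sub>R \<eta>) \<bullet> ((1/2) *\<^sub>R \<xi> + d *\<^sub>R \<eta>) - w \<bullet> w = \<kappa>\<^sup>2"
      using \<eta> d by (simp add: inner_add_left inner_add_right inner_commute)
    show "((1/2) *\<^sub>R \<xi> - d *\<^sub>R \<eta>) \<bullet> ((1/2) *\<^sub>R \<xi> - d *\<^sub>R \<eta>) - w \<bullet> w = \<kappa>\<^sup>2"
      using \<eta> d by (simp add: inner_diff_left inner_diff_right inner_commute)
    show "((1/2) *\<^sub>R \<xi> + d *\<^sub>R \<eta>) \<bullet> w = 0" "((1/2) *\<^sub>R \<xi> - d *\<^sub>R \<eta>) \<bullet> w = 0"
      using w\<xi> by (simp_all add: inner_add_left inner_diff_left)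
    show "(1/2) *\<^sub>R \<xi> + d *\<^sub>R \<eta> + ((1/2) *\<^sub>R \<xi> - d *\<^sub>R \<eta>) = (1 / L) *\<^sub>R lat k"
      by (simp add: \<xi>_def[symmetric] scaleR_left_distrib[symmetric])
    have "V \<le> q * \<bar>2 * (w \<bullet> freq L s n)\<bar>" for n
    proof -
    define N where "N = (\<Sum>i\<in>UNIV. m $ i * lattice_point n $ i)"
    have "\<omega> \<bullet> lat (lattice_point n) = of_int N" by (simp add: \<omega>_def N_def inner_vec_def)
    moreover have "\<omega> \<bullet> s = 1 / 2" using \<omega>1 by (auto simp: s_def)
    moreover have "2 * (w \<bullet> freq L s n) = (c / L) * (2 * (\<omega> \<bullet> lat (lattice_point n) + \<omega> \<bullet> s))"
      by (simp add: w_def freq_def inner_add_right distrib_left mult.left_commute)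
    ultimately have "2 * (w \<bullet> freq L s n) = (c / L) * (2 * (of_int N + 1 / 2))" by (simp only:)
    also have "2 * (of_int N + 1 / 2) = 2 * of_int N + (1::real)" by simp
    finally have "2 * (w \<bullet> freq L s n) = (c / L) * (2 * of_int N + 1)" .
    then have "\<bar>2 * (w \<bullet> freq L s n)\<bar> = (c / L) * \<bar>real_of_int (2 * N + 1)\<bar>" using cp L by (simp add: abs_mult)
    moreover have "1 \<le> \<bar>2 * N + 1\<bar>" by presburger
    then have "1 \<le> \<bar>real_of_int (2 * N + 1)\<bar>" by (metis of_int_1_le_iff of_int_abs)
    then have "(c / L) * 1 \<le> (c / L) * \<bar>real_of_int (2 * N + 1)\<bar>" using cp L by (intro mult_left_mono) auto
    ultimately have "c / L \<le> \<bar>2 * (w \<bullet> freq L s n)\<bar>" by simp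
    then have "q * (c / L) \<le> q * \<bar>2 * (w \<bullet> freq L s n)\<bar>" using q by (intro mult_left_mono) auto
    moreover have "V \<le> q * (c / L)" using q L by (simp add: c_def field_simps)
    ultimately show ?thesis by linarith
    qed
    then show "\<forall>n. V \<le> q * \<bar>2 * (w \<bullet> freq L s n)\<bar>" by blast
  qed
qed

text \<open>The remainders \<rho>1 - 1 and \<rho>2 - 1 have L^2 norms of order q, so replacing both
  amplitudes by 1 costs O(q), with q arbitrarily small.\<close>

lemma cgo_limit:
  assumes b: "dens V A b" and A: "A < pi * L"
    and ap: "\<And>q. 0 < q \<Longrightarrow> q \<le> 1 / 2 \<Longrightarrow> \<exists>\<rho>1 \<rho>2 C1 C2. \<rho>1 \<in> borel_measurable borel \<and> (\<forall>x. norm (\<rho>1 x) \<le> C1)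
      \<and> \<rho>2 \<in> borel_measurable borel \<and> (\<forall>x. norm (\<rho>2 x) \<le> C2)
      \<and> (LBINT x. indicator (cube L) x * (norm (\<rho>1 x - 1))\<^sup>2) \<le> 4 * q\<^sup>2 * measure lborel (cube L)
      \<and> (LBINT x. indicator (cube L) x * (norm (\<rho>2 x - 1))\<^sup>2) \<le> 4 * q\<^sup>2 * measure lborel (cube L)
      \<and> (LBINT x. b x * (cis (\<xi> \<bullet> x) * \<rho>1 x * \<rho>2 x)) = 0"
  shows "(LBINT x. b x * cis (\<xi> \<bullet> x)) = 0"
proof -
  define \<mu> where "\<mu> = measure lborel (cube L)"
  have V0: "V \<ge> 0" by (rule densD(5)[OF b])
  have cm [measurable]: "(\<lambda>x. cis (\<xi> \<bullet> x)) \<in> borel_measurable borel" unfolding cis_conv_exp by measurable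
  note [measurable] = densD(1)[OF b]
  have fin: "emeasure lborel (cube L) < \<infinity>" by (rule emeasure_bounded_finite[OF bounded_cube])
  have indi: "integrable lborel (indicator (cube L) :: real^3 => real)" using fin by (intro integrable_real_indicator) auto
  \<comment> \<open>The factor 7 bounds 5 + 4 q for q \<le> 1/2.\<close>
  have bd: "norm (LBINT x. b x * cis (\<xi> \<bullet> x)) \<le> V * \<mu> * 7 * q" if q: "0 < q" "q \<le> 1 / 2" for q
  proof -
    obtain \<rho>1 \<rho>2 C1 C2 where [measurable]: "\<rho>1 \<in> borel_measurable borel" "\<rho>2 \<in> borel_measurable borel"
      and C: "\<And>x. norm (\<rho>1 x) \<le> C1" "\<And>x. norm (\<rho>2 x) \<le> C2"
      and e1: "(LBINT x. indicator (cube L) x * (norm (\<rho>1 x - 1))\<^sup>2) \<le> 4 * q\<^sup>2 * \<mu>"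
      and e2: "(LBINT x. indicator (cube L) x * (norm (\<rho>2 x - 1))\<^sup>2) \<le> 4 * q\<^sup>2 * \<mu>"
      and z: "(LBINT x. b x * (cis (\<xi> \<bullet> x) * \<rho>1 x * \<rho>2 x)) = 0"
      using ap[OF q] unfolding \<mu>_def by blast
    define r1 where "r1 x = norm (\<rho>1 x - 1)" for x
    define r2 where "r2 x = norm (\<rho>2 x - 1)" for x
    have sq: "integrable lborel (\<lambda>x. indicator (cube L) x * (norm (\<rho> x - 1))\<^sup>2)"
      if "\<rho> \<in> borel_measurable borel" "\<And>x. norm (\<rho> x) \<le> C" for \<rho> :: "real^3 => complex" and C
    proof (rule bintegrable_bound[OF integrable_mult_left[OF indi, of "(C + 1)\<^sup>2"]])
      show "AE x in lborel. norm (indicator (cube L) x * (norm (\<rho> x - 1))\<^sup>2) \<le> norm (indicator (cube L) x * (C + 1)\<^sup>2)"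
      proof (rule AE_I2)
        fix x
        have "norm (\<rho> x - 1) \<le> C + 1" using norm_triangle_ineq4[of "\<rho> x" 1] that(2)[of x] by simp
        then have "(norm (\<rho> x - 1))\<^sup>2 \<le> (C + 1)\<^sup>2" by (intro power_mono) auto
        then show "norm (indicator (cube L) x * (norm (\<rho> x - 1))\<^sup>2) \<le> norm (indicator (cube L) x * (C + 1)\<^sup>2)" by (simp add: indicator_def)
      qed
    qed (use that(1) in measurable)
    note s1 = sq[OF _ C(1), folded r1_def] and s2 = sq[OF _ C(2), folded r2_def]
    let ?p = "\<lambda>x. cis (\<xi> \<bullet> x) * \<rho>1 x * \<rho>2 x" and ?b = "\<lambda>x. b x * cis (\<xi> \<bullet> x)"
    let ?t = "\<lambda>x. (\<rho>1 x - 1) + (\<rho>2 x - 1) + (\<rho>1 x - 1) * (\<rho>2 x - 1)"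
    \<comment> \<open>Linear terms are bounded by t \<le> q/2 + t^2/(2 q) and the product by half
      the sum of squares; what remains are integrals known to be at most 4 q^2 \<mu>.\<close>
    define H where "H x = V * (q * indicator (cube L) x + (1 / (2 * q) + 1 / 2) * (indicator (cube L) x * (r1 x)\<^sup>2 + indicator (cube L) x * (r2 x)\<^sup>2))" for x
    have iH: "integrable lborel H" unfolding H_def[abs_def]
      by (intro integrable_mult_right Bochner_Integration.integrable_add indi s1 s2) measurable
    have "C1 * C2 \<ge> norm (\<rho>1 x * \<rho>2 x)" for x unfolding norm_mult using C norm_ge_zero order_trans by (intro mult_mono) blast+
    then have i2: "integrable lborel (\<lambda>x. b x * ?p x)"
      using dens_integrable(1)[OF dens_mult[OF b, of "\<lambda>x. cis (\<xi> \<bullet> x) * \<rho>1 x * \<rho>2 x" "C1 * C2"]] by (simp add: norm_mult)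
    have i1: "integrable lborel (\<lambda>x. ?b x)"
      using dens_integrable(1)[OF dens_mult[OF b cm, of 1]] by simp
    have "(LBINT x. ?b x) = (LBINT x. ?b x - b x * ?p x)"
      unfolding bint_diff[OF i1 i2] z by simp
    also have "norm \<dots> \<le> (LBINT x. norm (?b x - b x * ?p x))"
      by (rule integral_norm_bound)
    also have "\<dots> \<le> (LBINT x. H x)"
    proof (rule integral_mono[OF integrable_norm[OF bintegrable_diff[OF i1 i2]] iH])
      fix x
      show "norm (?b x - b x * ?p x) \<le> H x"
      proof (cases "norm x > A")
        case True
        then show ?thesis using densD(3)[OF b] V0 q by (simp add: H_def)
      next
        case False
        then have xQ: "x \<in> cube L" using A ball_subset_cube[of L] by auto
        have "?b x - b x * ?p x = - ?b x * ?t x"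
          by (simp add: algebra_simps)
        then have "norm (?b x - b x * ?p x) = norm (b x) * norm (?t x)"
          by (simp add: norm_mult)
        also have "\<dots> \<le> V * (r1 x + r2 x + r1 x * r2 x)"
        proof (intro mult_mono densD(2)[OF b] V0 norm_ge_zero)
          show "norm (?t x) \<le> r1 x + r2 x + r1 x * r2 x"
            unfolding r1_def r2_def norm_mult[symmetric] by (intro norm_triangle_le add_mono norm_triangle_ineq) (auto intro: norm_triangle_ineq)
        qed
        also have "\<dots> \<le> V * (q + (1 / (2 * q) + 1 / 2) * ((r1 x)\<^sup>2 + (r2 x)\<^sup>2))"
        proof (rule mult_left_mono[OF _ V0])
          have yo: "t \<le> q / 2 + t\<^sup>2 / (2 * q)" for t
          proof -
            have "2 * q * t \<le> q\<^sup>2 + t\<^sup>2" using zero_le_power2[of "q - t"] by (simp add: power2_diff)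
            then have "(2 * q * t) / (2 * q) \<le> (q\<^sup>2 + t\<^sup>2) / (2 * q)" using q by (intro divide_right_mono) auto
            then show ?thesis using q by (simp add: add_divide_distrib power2_eq_square)
          qed
          have "2 * (r1 x * r2 x) \<le> (r1 x)\<^sup>2 + (r2 x)\<^sup>2" using zero_le_power2[of "r1 x - r2 x"] by (simp add: power2_diff)
          moreover have "(1 / (2 * q) + 1 / 2) * ((r1 x)\<^sup>2 + (r2 x)\<^sup>2) = (r1 x)\<^sup>2 / (2 * q) + (r2 x)\<^sup>2 / (2 * q) + ((r1 x)\<^sup>2 + (r2 x)\<^sup>2) / 2"
            by (simp add: distrib_left distrib_right)
          moreover have "a + b + c \<le> q + e" if "2 * c \<le> s + t" "e = u + w + (s + t) / 2" "a \<le> q / 2 + u" "b \<le> q / 2 + w"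
            for a b c e s t u w :: real using that by argo
          ultimately show "r1 x + r2 x + r1 x * r2 x \<le> q + (1 / (2 * q) + 1 / 2) * ((r1 x)\<^sup>2 + (r2 x)\<^sup>2)"
            using yo[of "r1 x"] yo[of "r2 x"] by blast
        qed
        finally show ?thesis using xQ by (simp add: H_def)
      qed
    qed
    also have "(LBINT x. H x) = V * (q * \<mu> + (1 / (2 * q) + 1 / 2) * ((LBINT x. indicator (cube L) x * (r1 x)\<^sup>2) + (LBINT x. indicator (cube L) x * (r2 x)\<^sup>2)))"
      unfolding H_def \<mu>_def using indi s1 s2 by (simp add: bint_add)
    also have "\<dots> \<le> V * (q * \<mu> + (1 / (2 * q) + 1 / 2) * (4 * q\<^sup>2 * \<mu> + 4 * q\<^sup>2 * \<mu>))"
      using q V0 e1 e2 unfolding r1_def r2_def by (intro mult_left_mono add_mono) auto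
    also have "\<dots> = V * \<mu> * (5 + 4 * q) * q" using q by (simp add: field_simps power2_eq_square)
    also have "\<dots> \<le> V * \<mu> * 7 * q" using q V0 by (intro mult_right_mono mult_left_mono) (auto simp: \<mu>_def)
    finally show ?thesis .
  qed
  have "norm (LBINT x. b x * cis (\<xi> \<bullet> x)) \<le> 0"
  proof (rule field_le_epsilon)
    fix \<epsilon> :: real assume \<epsilon>: "\<epsilon> > 0"
    define P where "P = V * \<mu> * 7"
    have P: "P \<ge> 0" using V0 by (simp add: P_def \<mu>_def)
    define q where "q = min (1 / 2) (\<epsilon> / (P + 1))"
    have "0 < q" using \<epsilon> P by (simp add: q_def)
    moreover have "q \<le> 1 / 2" unfolding q_def by (rule min.cobounded1)
    ultimately have q: "0 < q" "q \<le> 1 / 2" .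
    have "P * q \<le> (P + 1) * (\<epsilon> / (P + 1))" using P q(1) by (intro mult_mono) (auto simp: q_def)
    also have "\<dots> = \<epsilon>" using P by simp
    finally show "norm (LBINT x. b x * cis (\<xi> \<bullet> x)) \<le> 0 + \<epsilon>" using bd[OF q] unfolding P_def by linarith
  qed
  then show ?thesis by simp
qed

section \<open>Assembly of the uniqueness proof\<close>

lemma green_function_lippmann_schwinger:
  assumes v: "Linfty v" and v': "v' \<in> borel_measurable borel" "\<And>x. norm (v' x) \<le> M" "\<And>x. x \<notin> K \<Longrightarrow> v' x = 0" "AE x in lebesgue. v x = v' x"
    and K: "compact K" "y \<notin> K" and \<kappa>: "\<kappa> > 0" and R: "outgoing_green_function v \<kappa> R" and x: "x \<noteq> y"
  shows "R x y = - Gplus (x - y) \<kappa> + pot \<kappa> (\<lambda>z. v' z * R z y) x"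
proof -
  have R': "distributional_green_solution v \<kappa> y (\<lambda>x. R x y)" "continuous_on (- {y}) (\<lambda>x. R x y)" "sommerfeld \<kappa> (\<lambda>x. R x y)"
    using R by (auto simp: outgoing_green_function_def)
  have vm: "v \<in> borel_measurable lebesgue" using v by (simp add: Linfty_def)
  note g = green_solution_lborel[OF R'(1,2) vm v'(1,4)]
  show ?thesis
    by (rule lippmann_schwinger[OF v'(1-3) K \<kappa> R'(2) g(1) g(2) R'(3) x])
qed

theorem theorem5:
  fixes U B D \<Omega>1 \<Omega>2 :: "(real^3) set"
    and v1 v2 :: "real^3 => complex"
    and R1 R2 :: "real^3 => real^3 => complex"
    and \<kappa> :: real
  assumes "exterior_region U"
    and "\<kappa> > 0"
    and "Linfty v1" and "ess_support v1 \<subseteq> - closure U"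
    and "Linfty v2" and "ess_support v2 \<subseteq> - closure U"
    and "open \<Omega>1" and "bounded \<Omega>1" and "connected \<Omega>1" and "ess_support v1 \<subseteq> \<Omega>1"
    and "open \<Omega>2" and "bounded \<Omega>2" and "connected \<Omega>2" and "ess_support v2 \<subseteq> \<Omega>2"
    and "unique_solvability \<Omega>1 v1 \<kappa>"
    and "unique_solvability \<Omega>2 v2 \<kappa>"
    and "outgoing_green_function v1 \<kappa> R1"
    and "outgoing_green_function v2 \<kappa> R2"
    and "open B" and "bounded B" and "connected B"
    and "real_analytic_surface (frontier B)" and "connected (frontier B)"
    and "closure B \<subseteq> U"
    and "\<not> dirichlet_eigenvalue \<kappa> B"
    and "openin (top_of_set (frontier B)) D" and "D \<noteq> {}"
    and "\<forall>x\<in>D. \<forall>y\<in>D. Im_green R1 x y = Im_green R2 x y"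
  shows "AE x in lebesgue. v1 x = v2 x"
proof -
  note \<kappa> = assms(2)
  obtain S where S: "compact S" "U = outside S" using assms(1) unfolding exterior_region_def by blast
  have oU: "open U" unfolding S(2) by (rule open_outside[OF compact_imp_closed[OF S(1)]])
  have cU: "connected U" unfolding S(2) by (rule connected_outside[OF compact_imp_bounded[OF S(1)]]) simp
  obtain A where A: "A > 0" "S \<subseteq> cball 0 A"
    using compact_imp_bounded[OF S(1)] unfolding bounded_pos by (auto simp: subset_iff)
  have far: "x \<in> U" if "norm x > A" for x
    using outside_subset_convex[OF convex_cball A(2)] that unfolding S(2) by auto
  obtain w1 M1 where w1: "w1 \<in> borel_measurable borel" "M1 > 0" "\<And>x. norm (w1 x) \<le> M1"
    "\<And>x. x \<notin> ess_support v1 \<Longrightarrow> w1 x = 0" "AE x in lebesgue. v1 x = w1 x" using Linfty_borel_version[OF assms(3)] by blast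
  obtain w2 M2 where w2: "w2 \<in> borel_measurable borel" "M2 > 0" "\<And>x. norm (w2 x) \<le> M2"
    "\<And>x. x \<notin> ess_support v2 \<Longrightarrow> w2 x = 0" "AE x in lebesgue. v2 x = w2 x" using Linfty_borel_version[OF assms(5)] by blast
  define M where "M = M1 + M2"
  have M: "M > 0" "\<And>x. norm (w1 x) \<le> M" "\<And>x. norm (w2 x) \<le> M"
    using w1(2) w2(2) by (auto simp: M_def intro: order_trans[OF w1(3)] order_trans[OF w2(3)])
  define K where "K = ess_support v1 \<union> ess_support v2"
  have K: "compact K" "U \<inter> K = {}"
  proof -
    have "bounded K" unfolding K_def using assms(8,10,12,14) by (auto intro: bounded_subset)
    moreover have "closed K" unfolding K_def by (intro closed_Un closed_ess_support)
    ultimately show "compact K" by (simp add: compact_eq_bounded_closed)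
    show "U \<inter> K = {}" using assms(4,6) closure_subset[of U] unfolding K_def by blast
  qed
  have wK: "w1 x = 0" "w2 x = 0" if "x \<notin> K" for x using that w1(4) w2(4) by (auto simp: K_def)
  have d1: "dens M A w1" and d2: "dens M A w2"
    using w1(1) w2(1) M wK far K(2) unfolding dens_def by blast+
  \<comment> \<open>Here unique solvability becomes the injectivity hypothesis of the Fredholm
    alternative.\<close>
  have inj: "\<forall>B g. dens B A g \<longrightarrow> (\<forall>x. g x = w2 x * pot \<kappa> g x) \<longrightarrow> (\<forall>z. pot \<kappa> g z = 0)"
  proof (intro allI impI)
    fix B g z assume g: "dens B A g" "\<forall>x. g x = w2 x * pot \<kappa> g x"
    have m: "v2 \<in> borel_measurable lebesgue" using assms(5) by (simp add: Linfty_def)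
    show "pot \<kappa> g z = 0"
      by (rule unique_solvability_injective[OF assms(16,11,12,14) m d2 w2(4,5) g(1) g(2)[rule_format]])
  qed
  have \<psi>c: "continuous_on (- {y}) (\<lambda>x. R1 x y)" "continuous_on (- {y}) (\<lambda>x. R2 x y)" for y
    using assms(17,18) by (auto simp: outgoing_green_function_def)
  have ls1: "R1 x y = - Gplus (x - y) \<kappa> + pot \<kappa> (\<lambda>z. w1 z * R1 z y) x" if "y \<in> U" "x \<noteq> y" for x y
    using K(2) that by (intro green_function_lippmann_schwinger[OF assms(3) w1(1,3) wK(1) w1(5) K(1) _ \<kappa> assms(17)]) auto
  have ls2: "R2 x y = - Gplus (x - y) \<kappa> + pot \<kappa> (\<lambda>z. w2 z * R2 z y) x" if "y \<in> U" "x \<noteq> y" for x y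
    using K(2) that by (intro green_function_lippmann_schwinger[OF assms(5) w2(1,3) wK(2) w2(5) K(1) _ \<kappa> assms(18)]) auto
  \<comment> \<open>Off the diagonal \<open>Im_green\<close> is the plain imaginary part, and these
    values carry the whole argument.\<close>
  have im: "Im (R1 x y) = Im (R2 x y)" if "x \<in> D" "y \<in> D" "x \<noteq> y" for x y
  proof -
    have "Im_green R1 x y = Im_green R2 x y" using assms(28) that(1,2) by blast
    then show ?thesis using that(3) by (simp add: Im_green_def)
  qed
  have orth: "(LBINT x. (w1 x - w2 x) * u1 x * u2 x) = 0"
    if "adjoint_solution \<kappa> A w1 u1" "bounded_borel_on A u1" "adjoint_solution \<kappa> A w2 u2" "bounded_borel_on A u2" for u1 u2
    by (rule products_orthogonal[where ?\<psi>1.0 = "\<lambda>y x. R1 x y" and ?\<psi>2.0 = "\<lambda>y x. R2 x y", OF \<kappa> oU cU far A(1) K d1 wK(1) d2 wK(2) inj \<psi>c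
      ls1 ls2 assms(19,20,24,22,23,25,26,27) im that])
  \<comment> \<open>The cube of half-side pi A contains the ball of radius \<open>A\<close>, so the
    scale L of the Fourier series can be taken to be \<open>A\<close> itself.\<close>
  have AL: "A < pi * A" using A(1) pi_gt3 by simp
  define b where "b x = w1 x - w2 x" for x
  have b: "dens (M + M) A b" unfolding b_def[abs_def] by (rule dens_diff[OF d1 d2])
  have bb: "bounded_borel_on A (\<lambda>x. cexp a w x * \<rho> x)" if "\<rho> \<in> borel_measurable borel" "\<And>x. norm (\<rho> x) \<le> C" for \<rho> C a w
  proof -
    have "norm (cexp a w x * \<rho> x) \<le> exp (norm w * A) * C" if "norm x \<le> A" for x
      unfolding norm_mult
      by (intro mult_mono order_trans[OF norm_cexp]) (use that \<open>\<And>x. norm (\<rho> x) \<le> C\<close> in \<open>auto intro: mult_left_mono\<close>)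
    then show ?thesis using that(1) by (auto simp: bounded_borel_on_def)
  qed
  have "AE x in lborel. b x = 0"
  proof (rule torus_uniqueness[OF A(1) dens_integrable(1)[OF b]])
    show "b x = 0" if "x \<notin> cube A" for x
    proof (rule densD(3)[OF b], rule ccontr)
      assume "\<not> norm x > A"
      then have "x \<in> ball 0 (pi * A)" using AL by simp
      then show False using that ball_subset_cube by blast
    qed
    fix k :: "int^3"
    define \<xi> where "\<xi> = (1 / A) *\<^sub>R lat k"
    have "(LBINT x. b x * cis (\<xi> \<bullet> x)) = 0"
    proof (rule cgo_limit[OF b AL])
      fix q :: real assume q: "0 < q" "q \<le> 1 / 2"
      obtain a1 a2 w s :: "real^3" where z1: "a1 \<bullet> a1 - w \<bullet> w = \<kappa>\<^sup>2" "a1 \<bullet> w = 0" and z2: "a2 \<bullet> a2 - w \<bullet> w = \<kappa>\<^sup>2" "a2 \<bullet> w = 0"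
        and sum: "a1 + a2 = (1 / A) *\<^sub>R lat k" and gap: "\<forall>n. M \<le> q * \<bar>2 * (w \<bullet> freq A s n)\<bar>"
        by (rule cgo_parameters[OF A(1) \<kappa> M(1) q(1), of k]) (rule that, assumption+)
      \<comment> \<open>With -w in the second exponential, growth and decay cancel and the product
        is the bounded character cis (\<xi> . x).\<close>
      have z2': "a2 \<bullet> a2 - (- w) \<bullet> (- w) = \<kappa>\<^sup>2" "a2 \<bullet> (- w) = 0" and gap': "M \<le> q * \<bar>2 * ((- w) \<bullet> freq A s n)\<bar>" for n
        using z2 gap by simp_all
      obtain \<rho>1 C1 where r1: "\<rho>1 \<in> borel_measurable borel" "\<And>x. norm (\<rho>1 x) \<le> C1"
        "(LBINT x. indicator (cube A) x * (norm (\<rho>1 x - 1))\<^sup>2) \<le> 4 * q\<^sup>2 * measure lborel (cube A)"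
        "adjoint_solution \<kappa> A w1 (\<lambda>x. cexp a1 w x * \<rho>1 x)"
        by (rule cgo_solution[OF A(1) A(1) AL \<kappa> w1(1) M(2,1) z1 q gap[rule_format]]) (rule that, assumption, blast, assumption+)
      obtain \<rho>2 C2 where r2: "\<rho>2 \<in> borel_measurable borel" "\<And>x. norm (\<rho>2 x) \<le> C2"
        "(LBINT x. indicator (cube A) x * (norm (\<rho>2 x - 1))\<^sup>2) \<le> 4 * q\<^sup>2 * measure lborel (cube A)"
        "adjoint_solution \<kappa> A w2 (\<lambda>x. cexp a2 (- w) x * \<rho>2 x)"
        by (rule cgo_solution[OF A(1) A(1) AL \<kappa> w2(1) M(3,1) z2' q gap']) (rule that, assumption, blast, assumption+)
      have "cexp a1 w x * cexp a2 (- w) x = cis (\<xi> \<bullet> x)" for x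
        unfolding cexp_add sum \<xi>_def by (simp add: cexp_def lform_def cis_conv_exp)
      moreover have "d * (p * r) * (p' * r') = d * (p * p' * r * r')" for d p r p' r' :: complex by (simp add: mult_ac)
      ultimately have "(w1 x - w2 x) * (cexp a1 w x * \<rho>1 x) * (cexp a2 (- w) x * \<rho>2 x) = b x * (cis (\<xi> \<bullet> x) * \<rho>1 x * \<rho>2 x)" for x
        by (simp only: b_def)
      then have z: "(LBINT x. b x * (cis (\<xi> \<bullet> x) * \<rho>1 x * \<rho>2 x)) = 0"
        using orth[OF r1(4) bb[OF r1(1,2)] r2(4) bb[OF r2(1,2)]] by (simp only:)
      show "\<exists>\<rho>1 \<rho>2 C1 C2. \<rho>1 \<in> borel_measurable borel \<and> (\<forall>x. norm (\<rho>1 x) \<le> C1)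
        \<and> \<rho>2 \<in> borel_measurable borel \<and> (\<forall>x. norm (\<rho>2 x) \<le> C2)
        \<and> (LBINT x. indicator (cube A) x * (norm (\<rho>1 x - 1))\<^sup>2) \<le> 4 * q\<^sup>2 * measure lborel (cube A)
        \<and> (LBINT x. indicator (cube A) x * (norm (\<rho>2 x - 1))\<^sup>2) \<le> 4 * q\<^sup>2 * measure lborel (cube A)
        \<and> (LBINT x. b x * (cis (\<xi> \<bullet> x) * \<rho>1 x * \<rho>2 x)) = 0"
        by (rule exI[of _ \<rho>1], rule exI[of _ \<rho>2], rule exI[of _ C1], rule exI[of _ C2]) (intro conjI allI r1(1-3) r2(1-3) z)
    qed
    then show "(LBINT x. b x * cis ((1 / A) * (lat k \<bullet> x))) = 0" by (simp add: \<xi>_def)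
  qed
  then have "AE x in lebesgue. b x = 0" by (rule AE_completion)
  with w1(5) w2(5) show ?thesis by eventually_elim (simp add: b_def)
qed

end
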